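(* Let $\mathfrak g=\mathfrak l\oplus\mathfrak m$ be a reductive decomposition of a Lie algebra $\mathfrak g$, and let $\mathcal G=(\mathfrak g,[\,,\,],\varpi,\varphi)$ be a Lie quasi-bialgebra compatible with this reductive decomposition. Then the (well-defined, injective) map $$\mathcal M(\mathcal G,\mathfrak l)\longrightarrow\mathcal M_{\mathcal G,\mathfrak l,\mathfrak m}=\{t\in(\wedge^2\mathfrak m)^{\mathfrak l}:\ \varphi^t\equiv0\bmod\mathfrak l\},$$ which sends a gauge class $\mathcal C$ of formal dynamical $\ell$-matrices to $l_0$, where $l\in\mathcal C$ is any representative with $l_0\mathfrak m^\perp=0$ and $l_0\mathfrak l^\perp\subset\mathfrak m$, is an isomorphism (i.e. a bijection).
   Context: Conventions: vector spaces are finite-dimensional over $\mathbb K=\mathbb R$ or $\mathbb C$; $f^*$ is the transpose of $f$; $\mathcal A(\mathfrak g^*,\mathfrak g)$ is the set of linear maps $t:\mathfrak g^*\to\mathfrak g$ with $t^*=-t$; $\mathrm{ad}^*_x$ is the transpose of $\mathrm{ad}_x$; $A^\perp$ is the annihilator of $A$; $\sum_{\mathrm{cyc}}$ is the sum over cyclic permutations. Lie quasi-bialgebra: a quadruple $\mathcal G=(\mathfrak g,[\,,\,],\varpi,\varphi)$ with $(\mathfrak g,[\,,\,])$ a Lie algebra, $\varpi:\mathfrak g\to\mathcal A(\mathfrak g^*,\mathfrak g)$ linear with $\varpi_{[x,y]}=\mathrm{ad}_x\varpi_y+\varpi_y\mathrm{ad}^*_x-\mathrm{ad}_y\varpi_x-\varpi_x\mathrm{ad}^*_y$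 (a $1$-cocycle), $\varphi\in\wedge^3\mathfrak g$, such that $\mathfrak d=\mathfrak g\oplus\mathfrak g^*$ with bracket $[x,y]_{\mathfrak d}=[x,y]$, $[x,\xi]_{\mathfrak d}=\varpi_x\xi-\mathrm{ad}^*_x\xi$, $[\xi,\eta]_{\mathfrak d}=\langle\eta,\varpi_\bullet\xi\rangle+\langle\xi\otimes\eta\otimes1,\varphi\rangle$ is a Lie algebra. For $t\in\mathcal A(\mathfrak g^*,\mathfrak g)$: $\langle\xi\otimes\eta\otimes\zeta,\varphi^t\rangle=\langle\xi\otimes\eta\otimes\zeta,\varphi\rangle+\sum_{\mathrm{cyc}(\xi,\eta,\zeta)}\langle\zeta,[t\xi,t\eta]+\varpi_{t\xi}\eta\rangle$. "$\equiv0\bmod\mathfrak l$" means vanishing on $\mathfrak l^\perp\times\mathfrak l^\perp\times\mathfrak l^\perp$. Reductive decomposition: $\mathfrak g=\mathfrak l\oplus\mathfrak m$, $\mathfrak l$ a subalgebra, $[\mathfrak l,\mathfrak m]\subset\mathfrak m$; $i:\mathfrak l\to\mathfrak g$ is the inclusion. $(\wedge^2\mathfrak m)^{\mathfrak l}$ is the set of $t\in\mathcal A(\mathfrak g^*,\mathfrak g)$ with $t\mathfrak m^\perp=0$, $t\mathfrak l^\perp\subset\mathfrak m$ and $\mathrm{ad}_zt+t\,\mathrm{ad}^*_z=0$ for $z\in\mathfrak l$. $\mathcal G$ is compatible with $\mathfrak g=\mathfrak l\oplus\mathfrak m$ if $\varpi_z=0$ for $z\in\mathfrak l$; $\langle\xi,\varpi_x\eta\rangle=0$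 for $x\in\mathfrak g$, $\xi,\eta\in\mathfrak m^\perp$; and $\varphi\in\mathrm{Alt}(\mathfrak l\otimes\mathfrak l\otimes\mathfrak l\oplus\mathfrak l\otimes\mathfrak m\otimes\mathfrak m\oplus\mathfrak m\otimes\mathfrak m\otimes\mathfrak m)$. $\mathbb D$ is the formal neighbourhood of $0\in\mathfrak l^*$ (maps from $\mathbb D$ are formal power series at $0$). A formal dynamical $\ell$-matrix is a formal map $l:\mathbb D\to\mathcal A(\mathfrak g^*,\mathfrak g)$ satisfying, formally in $p$, for all $\xi,\eta,\zeta\in\mathfrak g^*$, $z\in\mathfrak l$: $$\sum_{\mathrm{cyc}(\xi,\eta,\zeta)}\big(\langle\zeta,d_pl(i^*\xi)\eta\rangle-\langle\zeta,[l_p\xi,l_p\eta]\rangle-\langle\zeta,\varpi_{l_p\xi}\eta\rangle\big)=\langle\xi\otimes\eta\otimes\zeta,\varphi\rangle,\qquad d_pl(\mathrm{ad}^*_zp)+\varpi_{iz}+\mathrm{ad}_{iz}l_p+l_p\mathrm{ad}^*_{iz}=0.$$ The set of these is $\mathrm{Dynl}(\mathbb D,\mathcal G)$. Gauge group: let $G$ be a Lie group with Lie algebra $\mathfrak g$. $\mathrm{Map}_0(\mathbb D,G)^{\mathfrak l}$ is the group (pointwise product) of formal maps $\sigma:\mathbb D\to G$ with $\sigma_0=1$ that are $\mathfrak l$-equivariant; writing $\sigma=e^{\Sigma}$ with $\Sigma:\mathbb D\to\mathfrak g$ formal, $\Sigma_0=0$, equivariance means $d_p\Sigma(\mathrm{ad}^*_zp)=-[z,\Sigma_p]$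 for $z\in\mathfrak l$. It acts on $\mathrm{Dynl}(\mathbb D,\mathcal G)$ by $l^\sigma_p=\mathrm{Ad}_{\sigma_p}l_p\mathrm{Ad}^*_{\sigma_p}+\theta^\sigma_p+\pi_{\sigma_p}$, where $\theta^\sigma_p=S_pi^*\mathrm{Ad}^*_{\sigma_p}-iS_p^*$ with $S_p=\frac{e^{\mathrm{ad}_{\Sigma_p}}-1}{\mathrm{ad}_{\Sigma_p}}\circ d_p\Sigma:\mathfrak l^*\to\mathfrak g$ (the right-translated differential of $\sigma$), and $\pi$ is the group $1$-cocycle integrating $\varpi$, i.e. $\pi_{e^x}=\int_0^1\mathrm{Ad}_{e^{\tau x}}\varpi_x\mathrm{Ad}^*_{e^{\tau x}}\,d\tau$. The moduli space is the orbit space $\mathcal M(\mathcal G,\mathfrak l)=\mathrm{Dynl}(\mathbb D,\mathcal G)/\mathrm{Map}_0(\mathbb D,G)^{\mathfrak l}$. *)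

theory Defs
  imports
    "HOL-Analysis.Analysis"
    "HOL-Library.Multiset"
    "HOL-Library.Function_Algebras"
begin

text \<open>
  The ground field is a type of class real_normed_field and euclidean_space, that is, a
  finite-dimensional field extension of the reals with a multiplicative norm: up to
  isomorphism exactly \<open>\<real>\<close> and \<open>\<complex>\<close>.
  The vector space \<open>\<gg>\<close> is the whole type \<open>'g\<close>. Its dual is a second type \<open>'h\<close> together
  with a pairing which identifies \<open>'h\<close> with the space of all linear functionals on \<open>\<gg>\<close>
  (see \<open>dual_spaces\<close>); so a linear map from \<open>\<gg>\<^sup>*\<close> to \<open>\<gg>\<close> is a function \<open>'h \<Rightarrow> 'g\<close>.
  An element \<open>T\<close> of \<open>\<gg> \<otimes> \<gg> \<otimes> \<gg>\<close> is given by the trilinear form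
  \<open>(\<xi>, \<eta>, \<zeta>) \<mapsto> \<langle>\<xi> \<otimes> \<eta> \<otimes> \<zeta>, T\<rangle>\<close> on \<open>\<gg>\<^sup>*\<close>.
\<close>

record ('k, 'g, 'h) quasi_bialgebra =
  scl :: "'k \<Rightarrow> 'g \<Rightarrow> 'g"
  dscl :: "'k \<Rightarrow> 'h \<Rightarrow> 'h"
  pairing :: "'h \<Rightarrow> 'g \<Rightarrow> 'k"  ("\<langle>_, _\<rangle>\<index>")
  lbr :: "'g \<Rightarrow> 'g \<Rightarrow> 'g"  ("[_; _]\<index>")
  cobr :: "'g \<Rightarrow> 'h \<Rightarrow> 'g"
  phi :: "'h \<Rightarrow> 'h \<Rightarrow> 'h \<Rightarrow> 'k"

definition lie_algebra ::
    "('k::field \<Rightarrow> 'v::ab_group_add \<Rightarrow> 'v) \<Rightarrow> ('v \<Rightarrow> 'v \<Rightarrow> 'v) \<Rightarrow> bool" where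
  "lie_algebra s b \<longleftrightarrow>
     vector_space s \<and>
     (\<forall>x. Vector_Spaces.linear s s (\<lambda>y. b x y)) \<and>
     (\<forall>y. Vector_Spaces.linear s s (\<lambda>x. b x y)) \<and>
     (\<forall>x. b x x = 0) \<and>
     (\<forall>x y z. b x (b y z) + b y (b z x) + b z (b x y) = 0)"

context
  fixes G :: "('k::{real_normed_field, euclidean_space},
               'g::ab_group_add, 'h::ab_group_add) quasi_bialgebra" (structure)
begin

definition dual_spaces :: bool where
  "dual_spaces \<longleftrightarrow>
     (\<exists>Bas. finite_dimensional_vector_space (scl G) Bas) \<and>
     vector_space (dscl G) \<and>
     (\<forall>x. Vector_Spaces.linear (dscl G) (*) (\<lambda>\<xi>. \<langle>\<xi>, x\<rangle>)) \<and>
     bij_betw (pairing G) UNIV {f. Vector_Spaces.linear (scl G) (*) f}"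

definition annihilator :: "'g set \<Rightarrow> 'h set" where
  "annihilator A = {\<xi>. \<forall>x\<in>A. \<langle>\<xi>, x\<rangle> = 0}"

text \<open>The inverses of the identifications of \<open>'h\<close> with \<open>\<gg>\<^sup>*\<close> and of \<open>'g\<close> with \<open>\<gg>\<^sup>*\<^sup>*\<close>.\<close>

definition functional :: "('g \<Rightarrow> 'k) \<Rightarrow> 'h" where
  "functional f = (THE \<xi>. \<forall>x. \<langle>\<xi>, x\<rangle> = f x)"

definition bidual_vector :: "('h \<Rightarrow> 'k) \<Rightarrow> 'g" where
  "bidual_vector u = (THE x. \<forall>\<xi>. \<langle>\<xi>, x\<rangle> = u \<xi>)"

definition transp :: "('g \<Rightarrow> 'g) \<Rightarrow> 'h \<Rightarrow> 'h" where
  "transp f \<xi> = functional (\<lambda>x. \<langle>\<xi>, f x\<rangle>)"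

definition coad :: "'g \<Rightarrow> 'h \<Rightarrow> 'h" where
  "coad x = transp (lbr G x)"

definition skew_maps :: "('h \<Rightarrow> 'g) set" where
  "skew_maps = {t. Vector_Spaces.linear (dscl G) (scl G) t \<and>
                   (\<forall>\<xi> \<eta>. \<langle>\<xi>, t \<eta>\<rangle> = - \<langle>\<eta>, t \<xi>\<rangle>)}"

definition pure_tensor :: "'g \<times> 'g \<times> 'g \<Rightarrow> 'h \<Rightarrow> 'h \<Rightarrow> 'h \<Rightarrow> 'k" where
  "pure_tensor = (\<lambda>(x, y, z) \<xi> \<eta> \<zeta>. \<langle>\<xi>, x\<rangle> * \<langle>\<eta>, y\<rangle> * \<langle>\<zeta>, z\<rangle>)"

definition tensor_span :: "('g \<times> 'g \<times> 'g) set \<Rightarrow> ('h \<Rightarrow> 'h \<Rightarrow> 'h \<Rightarrow> 'k) set" where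
  "tensor_span W = module.span (\<lambda>c T \<xi> \<eta> \<zeta>. c * T \<xi> \<eta> \<zeta>) (pure_tensor ` W)"

definition Alt :: "('h \<Rightarrow> 'h \<Rightarrow> 'h \<Rightarrow> 'k) \<Rightarrow> 'h \<Rightarrow> 'h \<Rightarrow> 'h \<Rightarrow> 'k" where
  "Alt T \<xi> \<eta> \<zeta> = T \<xi> \<eta> \<zeta> + T \<eta> \<zeta> \<xi> + T \<zeta> \<xi> \<eta> - T \<eta> \<xi> \<zeta> - T \<xi> \<zeta> \<eta> - T \<zeta> \<eta> \<xi>"

definition double_scl :: "'k \<Rightarrow> 'g \<times> 'h \<Rightarrow> 'g \<times> 'h" where
  "double_scl c = (\<lambda>(x, \<xi>). (scl G c x, dscl G c \<xi>))"

definition double_bracket :: "'g \<times> 'h \<Rightarrow> 'g \<times> 'h \<Rightarrow> 'g \<times> 'h" where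
  "double_bracket = (\<lambda>(x, \<xi>) (y, \<eta>).
     ([x; y] + cobr G x \<eta> - cobr G y \<xi> + bidual_vector (phi G \<xi> \<eta>),
      coad y \<xi> - coad x \<eta> + functional (\<lambda>z. \<langle>\<eta>, cobr G z \<xi>\<rangle>)))"

definition lie_quasi_bialgebra :: bool where
  "lie_quasi_bialgebra \<longleftrightarrow>
     dual_spaces \<and>
     lie_algebra (scl G) (lbr G) \<and>
     (\<forall>x. cobr G x \<in> skew_maps) \<and>
     (\<forall>\<xi>. Vector_Spaces.linear (scl G) (scl G) (\<lambda>x. cobr G x \<xi>)) \<and>
     (\<forall>x y \<xi>. cobr G [x; y] \<xi> =
        [x; cobr G y \<xi>] + cobr G y (coad x \<xi>) - [y; cobr G x \<xi>] - cobr G x (coad y \<xi>)) \<and>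
     phi G \<in> Alt ` tensor_span UNIV \<and>
     lie_algebra double_scl double_bracket"

definition cyc :: "('h \<Rightarrow> 'h \<Rightarrow> 'h \<Rightarrow> 'k) \<Rightarrow> 'h \<Rightarrow> 'h \<Rightarrow> 'h \<Rightarrow> 'k" where
  "cyc T \<xi> \<eta> \<zeta> = T \<xi> \<eta> \<zeta> + T \<eta> \<zeta> \<xi> + T \<zeta> \<xi> \<eta>"

definition twisted_phi :: "('h \<Rightarrow> 'g) \<Rightarrow> 'h \<Rightarrow> 'h \<Rightarrow> 'h \<Rightarrow> 'k" where
  "twisted_phi t \<xi> \<eta> \<zeta> =
     phi G \<xi> \<eta> \<zeta> + cyc (\<lambda>\<xi> \<eta> \<zeta>. \<langle>\<zeta>, [t \<xi>; t \<eta>] + cobr G (t \<xi>) \<eta>\<rangle>) \<xi> \<eta> \<zeta>"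

definition reductive_decomposition :: "'g set \<Rightarrow> 'g set \<Rightarrow> bool" where
  "reductive_decomposition L M \<longleftrightarrow>
     module.subspace (scl G) L \<and> module.subspace (scl G) M \<and>
     L \<inter> M = {0} \<and> (\<forall>x. \<exists>a\<in>L. \<exists>b\<in>M. x = a + b) \<and>
     (\<forall>x\<in>L. \<forall>y\<in>L. [x; y] \<in> L) \<and> (\<forall>x\<in>L. \<forall>y\<in>M. [x; y] \<in> M)"

definition compatible :: "'g set \<Rightarrow> 'g set \<Rightarrow> bool" where
  "compatible L M \<longleftrightarrow>
     (\<forall>z\<in>L. \<forall>\<xi>. cobr G z \<xi> = 0) \<and>
     (\<forall>x. \<forall>\<xi>\<in>annihilator M. \<forall>\<eta>\<in>annihilator M. \<langle>\<xi>, cobr G x \<eta>\<rangle> = 0) \<and>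
     phi G \<in> Alt ` tensor_span (L \<times> L \<times> L \<union> L \<times> M \<times> M \<union> M \<times> M \<times> M)"

definition invariant_bivectors :: "'g set \<Rightarrow> 'g set \<Rightarrow> ('h \<Rightarrow> 'g) set" where
  "invariant_bivectors L M =
     {t \<in> skew_maps. (\<forall>\<xi>\<in>annihilator M. t \<xi> = 0) \<and> (\<forall>\<xi>\<in>annihilator L. t \<xi> \<in> M) \<and>
                     (\<forall>z\<in>L. \<forall>\<xi>. [z; t \<xi>] + t (coad z \<xi>) = 0)}"

definition reduced_moduli :: "'g set \<Rightarrow> 'g set \<Rightarrow> ('h \<Rightarrow> 'g) set" where
  "reduced_moduli L M =
     {t \<in> invariant_bivectors L M.
        \<forall>\<xi>\<in>annihilator L. \<forall>\<eta>\<in>annihilator L. \<forall>\<zeta>\<in>annihilator L. twisted_phi t \<xi> \<eta> \<zeta> = 0}"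

end

text \<open>
  Let \<open>B\<close> be a basis of the subspace \<open>L\<close>. The elements \<open>b\<close> of \<open>B\<close> are linear coordinates
  \<open>p \<mapsto> \<langle>p, b\<rangle>\<close> on the dual of \<open>L\<close>, and finite multisets over \<open>B\<close> are the monomials in them.
  A formal map is a family of coefficients indexed by multisets \<open>\<alpha>\<close>, the coefficient at
  \<open>\<alpha>\<close> belonging to the monomial \<open>\<Prod>b\<in>#\<alpha>. \<langle>p, b\<rangle>\<close>; its value at 0 is the coefficient at
  \<open>{#}\<close>. A formal map with values in the dual of \<open>L\<close> is given by its coordinates, a function
  from \<open>B\<close> to scalar formal maps.
\<close>

type_synonym ('g, 'v) formal_map = "'g multiset \<Rightarrow> 'v"

definition formal_on :: "'g set \<Rightarrow> ('g, 'v::zero) formal_map \<Rightarrow> bool" where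
  "formal_on B f \<longleftrightarrow> (\<forall>\<alpha>. \<not> set_mset \<alpha> \<subseteq> B \<longrightarrow> f \<alpha> = 0)"

definition const :: "'v::zero \<Rightarrow> ('g, 'v) formal_map" where
  "const v \<alpha> = (if \<alpha> = {#} then v else 0)"

text \<open>The formal map \<open>p \<mapsto> m (f p) (g p)\<close>, for a biadditive \<open>m\<close>.\<close>

definition fprod ::
    "('u \<Rightarrow> 'v \<Rightarrow> 'w::comm_monoid_add) \<Rightarrow> ('g, 'u) formal_map \<Rightarrow> ('g, 'v) formal_map
       \<Rightarrow> ('g, 'w) formal_map" where
  "fprod m f g \<alpha> = (\<Sum>\<beta> | \<beta> \<subseteq># \<alpha>. m (f \<beta>) (g (\<alpha> - \<beta>)))"

abbreviation fapply ::
    "('g, 'u \<Rightarrow> 'w::comm_monoid_add) formal_map \<Rightarrow> ('g, 'u) formal_map \<Rightarrow> ('g, 'w) formal_map" where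
  "fapply \<equiv> fprod (\<lambda>F x. F x)"

context
  fixes G :: "('k::{real_normed_field, euclidean_space},
               'g::ab_group_add, 'h::ab_group_add) quasi_bialgebra" (structure)
begin

definition basis_of :: "'g set \<Rightarrow> 'g set \<Rightarrow> bool" where
  "basis_of L B \<longleftrightarrow> \<not> module.dependent (scl G) B \<and> module.span (scl G) B = L"

definition fpartial :: "'g \<Rightarrow> ('g, 'g) formal_map \<Rightarrow> ('g, 'g) formal_map" where
  "fpartial b f \<alpha> = scl G (of_nat (Suc (count \<alpha> b))) (f (add_mset b \<alpha>))"

text \<open>The formal map \<open>p \<mapsto> d\<^sub>p f (v p)\<close>, for \<open>v\<close> with values in the dual of \<open>L\<close>.\<close>

definition fdiff ::
    "'g set \<Rightarrow> ('g, 'g) formal_map \<Rightarrow> ('g \<Rightarrow> ('g, 'k) formal_map) \<Rightarrow> ('g, 'g) formal_map" where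
  "fdiff B f v \<alpha> = (\<Sum>b\<in>B. fprod (scl G) (v b) (fpartial b f) \<alpha>)"

text \<open>The formal map \<open>p \<mapsto> \<langle>p, x\<rangle>\<close>, for \<open>x \<in> L\<close>.\<close>

definition eval_at :: "'g set \<Rightarrow> 'g \<Rightarrow> ('g, 'k) formal_map" where
  "eval_at B x \<alpha> = (\<Sum>c\<in>B. if \<alpha> = {#c#} then module.representation (scl G) B x c else 0)"

text \<open>The formal map \<open>p \<mapsto> ad\<^sub>z\<^sup>* p\<close>, for \<open>z \<in> L\<close>; its coordinate \<open>b\<close> is \<open>\<langle>p, [z, b]\<rangle>\<close>.\<close>

definition coad_field :: "'g set \<Rightarrow> 'g \<Rightarrow> 'g \<Rightarrow> ('g, 'k) formal_map" where
  "coad_field B z b = eval_at B [z; b]"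

text \<open>\<open>i\<^sup>* w\<close> for a formal map \<open>w\<close> with values in \<open>\<gg>\<^sup>*\<close>, \<open>i\<close> being the inclusion of \<open>L\<close>.\<close>

definition restr :: "('g, 'h) formal_map \<Rightarrow> 'g \<Rightarrow> ('g, 'k) formal_map" where
  "restr w b = (\<lambda>\<alpha>. \<langle>w \<alpha>, b\<rangle>)"

definition Dynl :: "'g set \<Rightarrow> 'g set \<Rightarrow> ('g, 'h \<Rightarrow> 'g) formal_map set" where
  "Dynl L B = {l. formal_on B l \<and> (\<forall>\<alpha>. l \<alpha> \<in> skew_maps G) \<and>
     (\<forall>\<alpha> \<xi> \<eta> \<zeta>.
        cyc (\<lambda>\<xi> \<eta> \<zeta>. \<langle>\<zeta>, fdiff B (\<lambda>\<beta>. l \<beta> \<eta>) (restr (const \<xi>)) \<alpha>\<rangle>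
                    - \<langle>\<zeta>, fprod (lbr G) (\<lambda>\<beta>. l \<beta> \<xi>) (\<lambda>\<beta>. l \<beta> \<eta>) \<alpha>\<rangle>
                    - \<langle>\<zeta>, cobr G (l \<alpha> \<xi>) \<eta>\<rangle>) \<xi> \<eta> \<zeta>
        = const (phi G \<xi> \<eta> \<zeta>) \<alpha>) \<and>
     (\<forall>z\<in>L. \<forall>\<alpha> \<xi>.
        fdiff B (\<lambda>\<beta>. l \<beta> \<xi>) (coad_field B z) \<alpha> + const (cobr G z \<xi>) \<alpha>
        + [z; l \<alpha> \<xi>] + l \<alpha> (coad G z \<xi>) = 0)}"

text \<open>
  A formal map \<open>\<sigma>\<close> to the Lie group with \<open>\<sigma>\<^sub>0 = 1\<close> is given by its logarithm \<open>S\<close>, a formal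
  map to \<open>\<gg>\<close> with \<open>S\<^sub>0 = 0\<close>.
\<close>

definition gauge_maps :: "'g set \<Rightarrow> 'g set \<Rightarrow> ('g, 'g) formal_map set" where
  "gauge_maps L B = {S. formal_on B S \<and> S {#} = 0 \<and>
     (\<forall>z\<in>L. \<forall>\<alpha>. fdiff B S (coad_field B z) \<alpha> = - [z; S \<alpha>])}"

text \<open>
  The power series \<open>\<Sum>n. c n * X^n\<close> evaluated at \<open>X = ad S\<close> and applied to a formal map \<open>v\<close>.
  As \<open>S\<close> has no constant term, the terms with \<open>n > size \<alpha>\<close> do not contribute at \<open>\<alpha>\<close>.
\<close>

definition ad_series ::
    "(nat \<Rightarrow> 'k) \<Rightarrow> ('g, 'g) formal_map \<Rightarrow> ('g, 'g) formal_map \<Rightarrow> ('g, 'g) formal_map" where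
  "ad_series c S v \<alpha> = (\<Sum>n\<le>size \<alpha>. scl G (c n) ((fprod (lbr G) S ^^ n) v \<alpha>))"

text \<open>\<open>Ad\<close> of \<open>\<sigma> = exp S\<close>, and its transpose.\<close>

definition Ad :: "('g, 'g) formal_map \<Rightarrow> ('g, 'g \<Rightarrow> 'g) formal_map" where
  "Ad S \<alpha> x = ad_series (\<lambda>n. 1 / fact n) S (const x) \<alpha>"

definition coAd :: "('g, 'g) formal_map \<Rightarrow> ('g, 'h \<Rightarrow> 'h) formal_map" where
  "coAd S \<alpha> = transp G (Ad S \<alpha>)"

text \<open>\<open>(e\<^bsup>ad S\<^esup> - 1) / ad S\<close> composed with the differential of \<open>S\<close>, applied to \<open>v\<close>.\<close>

definition right_diff ::
    "'g set \<Rightarrow> ('g, 'g) formal_map \<Rightarrow> ('g \<Rightarrow> ('g, 'k) formal_map) \<Rightarrow> ('g, 'g) formal_map" where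
  "right_diff B S v = ad_series (\<lambda>n. 1 / fact (Suc n)) S (fdiff B S v)"

text \<open>
  The transpose of \<open>right_diff\<close> applied to \<open>\<xi>\<close>, an element of \<open>L\<close> included in \<open>\<gg>\<close>: its
  coordinate in the basis \<open>B\<close> at \<open>b\<close> is obtained by pairing \<open>\<xi>\<close> with the image of the element
  \<open>b\<close> of the dual basis.
\<close>

definition right_diff_transp :: "'g set \<Rightarrow> ('g, 'g) formal_map \<Rightarrow> 'h \<Rightarrow> ('g, 'g) formal_map" where
  "right_diff_transp B S \<xi> \<alpha> =
     (\<Sum>b\<in>B. scl G \<langle>\<xi>, right_diff B S (\<lambda>b'. const (if b' = b then 1 else 0)) \<alpha>\<rangle> b)"

definition theta :: "'g set \<Rightarrow> ('g, 'g) formal_map \<Rightarrow> ('g, 'h \<Rightarrow> 'g) formal_map" where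
  "theta B S \<alpha> \<xi> =
     right_diff B S (restr (\<lambda>\<beta>. coAd S \<beta> \<xi>)) \<alpha> - right_diff_transp B S \<xi> \<alpha>"

text \<open>
  The integral of \<open>Ad(e\<^bsup>\<tau>S\<^esup>) \<circ> cobr S \<circ> Ad\<^sup>*(e\<^bsup>\<tau>S\<^esup>)\<close> over \<open>0 \<le> \<tau> \<le> 1\<close>, taken coefficient by
  coefficient and weakly, i.e. after pairing with elements of \<open>\<gg>\<^sup>*\<close>.
\<close>

definition group_cocycle :: "('g, 'g) formal_map \<Rightarrow> ('g, 'h \<Rightarrow> 'g) formal_map" where
  "group_cocycle S \<alpha> \<xi> = bidual_vector G (\<lambda>\<zeta>. integral {0..1} (\<lambda>\<tau>::real.
     let \<tau>S = (\<lambda>\<beta>. scl G (of_real \<tau>) (S \<beta>))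
     in \<langle>\<zeta>, fapply (Ad \<tau>S) (fprod (cobr G) S (\<lambda>\<beta>. coAd \<tau>S \<beta> \<xi>)) \<alpha>\<rangle>))"

definition gauge_action ::
    "'g set \<Rightarrow> ('g, 'h \<Rightarrow> 'g) formal_map \<Rightarrow> ('g, 'g) formal_map \<Rightarrow> ('g, 'h \<Rightarrow> 'g) formal_map" where
  "gauge_action B l S \<alpha> \<xi> =
     fapply (Ad S) (fapply l (\<lambda>\<beta>. coAd S \<beta> \<xi>)) \<alpha> + theta B S \<alpha> \<xi> + group_cocycle S \<alpha> \<xi>"

definition moduli :: "'g set \<Rightarrow> 'g set \<Rightarrow> ('g, 'h \<Rightarrow> 'g) formal_map set set" where
  "moduli L B = Dynl L B //
     {(l, l'). l \<in> Dynl L B \<and> (\<exists>S\<in>gauge_maps L B. l' = gauge_action B l S)}"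

definition normalized :: "'g set \<Rightarrow> 'g set \<Rightarrow> ('g, 'h \<Rightarrow> 'g) formal_map \<Rightarrow> bool" where
  "normalized L M l \<longleftrightarrow>
     (\<forall>\<xi>\<in>annihilator G M. l {#} \<xi> = 0) \<and> (\<forall>\<xi>\<in>annihilator G L. l {#} \<xi> \<in> M)"

definition base_value :: "'g set \<Rightarrow> 'g set \<Rightarrow> ('g, 'h \<Rightarrow> 'g) formal_map set \<Rightarrow> 'h \<Rightarrow> 'g" where
  "base_value L M C = (THE t. \<exists>l\<in>C. normalized L M l \<and> t = l {#})"

end

end

theory Submission
  imports Defs
begin

text \<open>
  In the double \<open>\<dd> = \<gg> \<oplus> \<gg>\<^sup>*\<close>, with its invariant pairing, put \<open>e \<xi> = l \<xi> + \<xi>\<close>. The dynamical equation says that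
  \<open>F \<xi> \<eta> \<zeta> = 0\<close>, where \<open>F\<close> is the cyclic sum of \<open>(\<partial>\<^sub>\<xi> e \<eta>, e \<zeta>)\<close> minus \<open>([e \<xi>, e \<eta>], e \<zeta>)\<close>. The gauge
  transform by \<open>S\<close> is the value at time 1 of the flow \<open>\<tau> \<mapsto> l\<^sup>\<tau>\<^sup>S\<close>. Along it \<open>F\<close>, the failure of equivariance
  and the symmetric part of \<open>l\<close> satisfy linear differential equations that are nilpotent for the
  degree filtration, so if they vanish at time 0 they vanish identically: the gauge group preserves
  the solutions.

  The Jacobi identity in the double gives a Bianchi identity for \<open>F\<close>, so the lowest order term of
  \<open>F\<close> is closed; the lowest order term of the difference of two solutions is closed because the
  quadratic terms do not contribute to it. A Koszul homotopy, normalised by the inverse of the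
  polynomial degree plus the form degree and commuting with \<open>\<ll>\<close>, provides equivariant primitives.
  Degree by degree this yields a solution with any prescribed admissible value at 0, and a gauge
  transformation between two solutions whose values at 0 have the same component in \<open>\<And>\<^sup>2\<mm>\<close>;
  that component is a gauge invariant.
\<close>

section \<open>Formal maps\<close>

text \<open>Along S itself the action is built from series in ad S that are hard to compare with the
  equation; along \<tau>S it becomes a differential equation in \<tau>, nilpotent because S vanishes
  at 0. As \<gg> carries no topology, derivatives in \<tau> are taken coefficientwise after linear
  functionals.

  The obstacle in both the flow and the Bianchi identity are terms quadratic in first derivatives.
  Equivariance turns a bracket with an element of L into a derivative along a coadjoint field, so
  these terms become contractions with the linear Poisson tensor \<langle>p, [b, c]\<rangle> of the
  dual of L, whose skew-symmetry cancels them.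

  The homotopy differentiates only along the dual of L, so the form degree that counts is the number
  of arguments in ann M, the annihilator of M. Components with all arguments in ann L are out of its
  reach: for closed forms they vanish in positive polynomial degree, but in degree 0 they are the
  obstruction, namely the twisted phi for existence and the component in
  \<open>\<And>\<^sup>2\<mm>\<close> for uniqueness. The latter is gauge invariant because covectors
  in ann L restrict to zero on L.\<close>

definition nsc :: "nat \<Rightarrow> 'v::comm_monoid_add \<Rightarrow> 'v" where
  "nsc n x = (\<Sum>i<n. x)"

lemma nsc_0 [simp]: "nsc 0 x = 0" and nsc_Suc: "nsc (Suc n) x = x + nsc n x"
  by (simp_all add: nsc_def add.commute)

lemma nsc_add: "nsc (m + n) x = nsc m x + nsc n x"
  by (induction m) (simp_all add: nsc_Suc add.assoc)

lemma nsc_zero [simp]: "nsc n 0 = 0"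
  by (simp add: nsc_def)

lemma nsc_plus: "nsc n (x + y) = nsc n x + nsc n y"
  by (simp add: nsc_def sum.distrib)

lemma nsc_hom: "T 0 = 0 \<Longrightarrow> (\<And>x y. T (x + y) = T x + T y) \<Longrightarrow> T (nsc n x) = nsc n (T x)"
  by (induction n) (simp_all add: nsc_Suc)

text \<open>Derivatives are written with iterated sums instead of scalars, so that one product rule
  serves every biadditive product; this is the bridge back to \<open>fpartial\<close>, which uses
  the scalar multiplication.\<close>

lemma nsc_scale: "vector_space s \<Longrightarrow> s (of_nat n) x = nsc n x"
proof (induction n)
  case 0 then show ?case by (simp add: module.scale_zero_left module_iff_vector_space)
next
  case (Suc n) then show ?case
    by (simp add: module.scale_left_distrib module.scale_one module_iff_vector_space nsc_Suc)
qed

lemma nsc_mult: "nsc n (x::'k::comm_ring_1) = of_nat n * x"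
  by (simp add: nsc_def)

lemma nsc_nsc: "nsc m (nsc n x) = nsc n (nsc m x)"
  by (rule nsc_hom) (simp_all add: nsc_plus)

text \<open>Additivity in each argument is what Cauchy products and partial derivatives use.
  Brackets, pairings, cobrackets and scalar multiplications are thus covered by the same lemmas, and
  scalars enter only when they have to be moved across a product.\<close>

definition biadd :: "('u::ab_group_add \<Rightarrow> 'v::ab_group_add \<Rightarrow> 'w::ab_group_add) \<Rightarrow> bool" where
  "biadd m \<longleftrightarrow> (\<forall>x. Modules.additive (m x)) \<and> (\<forall>y. Modules.additive (\<lambda>x. m x y))"

lemma biaddI:
  assumes "\<And>x y z. m (x + y) z = m x z + m y z" "\<And>x y z. m x (y + z) = m x y + m x z"
  shows "biadd m"
  using assms by (simp add: biadd_def Modules.additive_def)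

lemma biadd_simps:
  assumes "biadd m"
  shows "m (x + x') y = m x y + m x' y" "m x (y + y') = m x y + m x y'"
    "m 0 y = 0" "m x 0 = 0" "m (- x) y = - m x y" "m x (- y) = - m x y"
    "m (x - x') y = m x y - m x' y" "m x (y - y') = m x y - m x y'"
    "m (sum f A) y = (\<Sum>i\<in>A. m (f i) y)" "m x (sum h A) = (\<Sum>i\<in>A. m x (h i))"
    "m (nsc n x) y = nsc n (m x y)" "m x (nsc n y) = nsc n (m x y)"
proof -
  have l': "Modules.additive (\<lambda>x. m x y)" for y using assms by (simp add: biadd_def)
  have r': "Modules.additive (m x)" for x using assms by (simp add: biadd_def)
  interpret l: Modules.additive "\<lambda>x. m x y" for y by (rule l')
  interpret r: Modules.additive "m x" for x by (rule r')
  show "m (x + x') y = m x y + m x' y" by (rule l.add)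
  show "m x (y + y') = m x y + m x y'" by (rule r.add)
  show "m 0 y = 0" by (rule l.zero)
  show "m x 0 = 0" by (rule r.zero)
  show "m (- x) y = - m x y" by (rule l.minus)
  show "m x (- y) = - m x y" by (rule r.minus)
  show "m (x - x') y = m x y - m x' y" by (rule l.diff)
  show "m x (y - y') = m x y - m x y'" by (rule r.diff)
  show "m (sum f A) y = (\<Sum>i\<in>A. m (f i) y)" by (rule l.sum)
  show "m x (sum h A) = (\<Sum>i\<in>A. m x (h i))" by (rule r.sum)
  show "m (nsc n x) y = nsc n (m x y)"
    by (rule nsc_hom) (simp_all add: l.add l.zero)
  show "m x (nsc n y) = nsc n (m x y)"
    by (rule nsc_hom) (simp_all add: r.add r.zero)
qed

section \<open>Cauchy products of formal maps\<close>

lemma sum_fun_apply: "(\<Sum>i\<in>A. f i) x = (\<Sum>i\<in>A. f i x)"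
  by (induction A rule: infinite_finite_induct) auto

lemma finite_submultisets: "finite {\<beta>. \<beta> \<subseteq># (\<alpha>::'a multiset)}"
proof (induction \<alpha>)
  case (add x \<alpha>)
  have "{\<beta>. \<beta> \<subseteq># add_mset x \<alpha>} \<subseteq> {\<beta>. \<beta> \<subseteq># \<alpha>} \<union> add_mset x ` {\<beta>. \<beta> \<subseteq># \<alpha>}"
  proof
    fix \<beta> assume b: "\<beta> \<in> {\<beta>. \<beta> \<subseteq># add_mset x \<alpha>}"
    show "\<beta> \<in> {\<beta>. \<beta> \<subseteq># \<alpha>} \<union> add_mset x ` {\<beta>. \<beta> \<subseteq># \<alpha>}"
    proof (cases "x \<in># \<beta>")
      case True
      then obtain \<gamma> where "\<beta> = add_mset x \<gamma>" by (blast dest: multi_member_split)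
      with b show ?thesis by auto
    next
      case False
      with b show ?thesis by (metis CollectI UnI1 diff_single_trivial mem_Collect_eq subset_eq_diff_conv add_mset_add_single)
    qed
  qed
  then show ?case by (rule finite_subset) (simp add: add)
qed simp

lemma finite_splits [simp]: "finite {(\<beta>,\<gamma>). \<beta> + \<gamma> = (\<alpha>::'a multiset)}"
proof -
  have "{(\<beta>,\<gamma>). \<beta> + \<gamma> = \<alpha>} \<subseteq> (\<lambda>\<beta>. (\<beta>, \<alpha> - \<beta>)) ` {\<beta>. \<beta> \<subseteq># \<alpha>}" by auto
  then show ?thesis by (rule finite_subset) (simp add: finite_submultisets)
qed

text \<open>Splitting the multi-index into an ordered pair makes the sum symmetric in the two
  factors, and commutation and reassociation become bijections of index sets.\<close>

lemma fprod_splits: "fprod m f g \<alpha> = (\<Sum>(\<beta>,\<gamma>) | \<beta> + \<gamma> = \<alpha>. m (f \<beta>) (g \<gamma>))"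
  unfolding fprod_def
  by (rule sum.reindex_bij_witness[of _ fst "\<lambda>\<beta>. (\<beta>, \<alpha> - \<beta>)"]) auto

lemma fprod_cong:
  assumes "\<And>\<beta> \<gamma>. \<beta> + \<gamma> = \<alpha> \<Longrightarrow> m (f \<beta>) (g \<gamma>) = m' (f' \<beta>) (g' \<gamma>)"
  shows "fprod m f g \<alpha> = fprod m' f' g' \<alpha>"
  unfolding fprod_splits by (rule sum.cong) (auto simp: assms)

lemma fprod_0:
  assumes "\<And>\<beta> \<gamma>. \<beta> + \<gamma> = \<alpha> \<Longrightarrow> m (f \<beta>) (g \<gamma>) = 0"
  shows "fprod m f g \<alpha> = 0"
  unfolding fprod_splits by (rule sum.neutral) (auto simp: assms)

lemma fprod_commute: "fprod m f g = fprod (\<lambda>x y. m y x) g f"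
  unfolding fprod_splits fun_eq_iff
  by (auto intro!: sum.reindex_bij_witness[of _ prod.swap prod.swap] simp: add.commute)

lemma fprod_simps:
  assumes "biadd m"
  shows "fprod m (f + f') g = fprod m f g + fprod m f' g"
    "fprod m f (g + g') = fprod m f g + fprod m f g'"
    "fprod m (f - f') g = fprod m f g - fprod m f' g"
    "fprod m f (g - g') = fprod m f g - fprod m f g'"
    "fprod m (- f) g = - fprod m f g"
    "fprod m f (- g) = - fprod m f g"
    "fprod m 0 g = 0" "fprod m f 0 = 0"
    "fprod m (sum F A) g = (\<Sum>i\<in>A. fprod m (F i) g)"
    "fprod m f (sum H A) = (\<Sum>i\<in>A. fprod m f (H i))"
  by (simp_all add: fun_eq_iff fprod_splits biadd_simps[OF assms] sum.distrib sum_subtractf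
      sum_negf split_def sum_fun_apply sum.swap[of _ A])

lemma sum_splits_delta1:
  "(\<Sum>(\<beta>,\<gamma>) | \<beta> + \<gamma> = (\<alpha>::'a multiset). if \<beta> = {#} then f \<gamma> else 0) = (f \<alpha> :: 'w::comm_monoid_add)"
proof -
  have "(\<Sum>(\<beta>,\<gamma>) | \<beta> + \<gamma> = \<alpha>. if \<beta> = {#} then f \<gamma> else 0) =
        (\<Sum>(\<beta>,\<gamma>)\<in>{({#}::'a multiset,\<alpha>)}. if \<beta> = {#} then f \<gamma> else 0)"
  proof (rule sum.mono_neutral_right)
    show "finite {(\<beta>,\<gamma>). \<beta> + \<gamma> = \<alpha>}" by (rule finite_splits)
  qed (auto split: if_splits)
  then show ?thesis by simp
qed

lemma fprod_const_left: "(\<And>y. m 0 y = 0) \<Longrightarrow> fprod m (const x) g = (\<lambda>\<alpha>. m x (g \<alpha>))"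
proof
  fix \<alpha> assume "\<And>y. m 0 y = 0"
  then have "fprod m (const x) g \<alpha> = (\<Sum>(\<beta>,\<gamma>) | \<beta> + \<gamma> = \<alpha>. if \<beta> = {#} then m x (g \<gamma>) else 0)"
    unfolding fprod_splits const_def by (intro sum.cong) auto
  then show "fprod m (const x) g \<alpha> = m x (g \<alpha>)" by (simp add: sum_splits_delta1)
qed

lemma fprod_const_right: "(\<And>y. m y 0 = 0) \<Longrightarrow> fprod m f (const x) = (\<lambda>\<alpha>. m (f \<alpha>) x)"
  by (subst fprod_commute, subst fprod_const_left) auto

text \<open>Common normal form of both nestings of two Cauchy products. A trilinear identity between
  values passes to formal maps through it; invariance of the pairing and the Jacobi identity are
  obtained in this way.\<close>

definition lift3 :: "('u \<Rightarrow> 'v \<Rightarrow> 'w \<Rightarrow> 'z::comm_monoid_add) \<Rightarrow> ('a,'u) formal_map \<Rightarrow> ('a,'v) formal_map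
    \<Rightarrow> ('a,'w) formal_map \<Rightarrow> ('a,'z) formal_map" where
  "lift3 \<Phi> f g h \<alpha> = (\<Sum>(\<beta>,\<gamma>,\<delta>) | \<beta> + \<gamma> + \<delta> = \<alpha>. \<Phi> (f \<beta>) (g \<gamma>) (h \<delta>))"

lemma finite_splits3 [simp]: "finite {(\<beta>,\<gamma>,\<delta>). \<beta> + \<gamma> + \<delta> = (\<alpha>::'a multiset)}"
proof -
  have "{(\<beta>,\<gamma>,\<delta>). \<beta> + \<gamma> + \<delta> = \<alpha>} \<subseteq>
     (\<lambda>(\<beta>,\<gamma>). (\<beta>, \<gamma>, \<alpha> - \<beta> - \<gamma>)) ` ({\<beta>. \<beta> \<subseteq># \<alpha>} \<times> {\<beta>. \<beta> \<subseteq># \<alpha>})"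
  proof clarify
    fix \<beta> \<gamma> \<delta> assume a: "\<alpha> = \<beta> + \<gamma> + \<delta>"
    show "(\<beta>, \<gamma>, \<delta>) \<in> (\<lambda>(\<beta>', \<gamma>'). (\<beta>', \<gamma>', \<beta> + \<gamma> + \<delta> - \<beta>' - \<gamma>')) `
           ({\<beta>'. \<beta>' \<subseteq># \<beta> + \<gamma> + \<delta>} \<times> {\<beta>'. \<beta>' \<subseteq># \<beta> + \<gamma> + \<delta>})"
      by (rule image_eqI[of _ _ "(\<beta>,\<gamma>)"]) (auto intro: mset_subset_eq_add_right)
  qed
  then show ?thesis by (rule finite_subset) (simp add: finite_submultisets)
qed

lemma fprod_fprod_left:
  assumes "\<And>z. Modules.additive (\<lambda>x. m1 x z)"
  shows "fprod m1 (fprod m2 f g) h = lift3 (\<lambda>x y z. m1 (m2 x y) z) f g h"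
proof
  fix \<alpha>
  interpret Modules.additive "\<lambda>x. m1 x z" for z by (rule assms)
  have "fprod m1 (fprod m2 f g) h \<alpha> =
     (\<Sum>p\<in>{(\<beta>,\<gamma>). \<beta> + \<gamma> = \<alpha>}. \<Sum>q\<in>{(\<beta>,\<gamma>). \<beta> + \<gamma> = fst p}. m1 (m2 (f (fst q)) (g (snd q))) (h (snd p)))"
    by (simp add: fprod_splits split_def sum)
  also have "\<dots> = (\<Sum>(p,q)\<in>(SIGMA p:{(\<beta>,\<gamma>). \<beta> + \<gamma> = \<alpha>}. {(\<beta>,\<gamma>). \<beta> + \<gamma> = fst p}). m1 (m2 (f (fst q)) (g (snd q))) (h (snd p)))"
    by (rule sum.Sigma) auto
  also have "\<dots> = lift3 (\<lambda>x y z. m1 (m2 x y) z) f g h \<alpha>" unfolding lift3_def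
    by (rule sum.reindex_bij_witness[of _ "\<lambda>(b,c,d). ((b+c,d),(b,c))" "\<lambda>(p,q). (fst q, snd q, snd p)"]) auto
  finally show "fprod m1 (fprod m2 f g) h \<alpha> = lift3 (\<lambda>x y z. m1 (m2 x y) z) f g h \<alpha>" .
qed

lemma lift3_swap12: "lift3 \<Phi> f g h = lift3 (\<lambda>y x z. \<Phi> x y z) g f h"
  unfolding lift3_def fun_eq_iff
  by (auto intro!: sum.reindex_bij_witness[of _ "\<lambda>(b,c,d). (c,b,d)" "\<lambda>(b,c,d). (c,b,d)"] simp: add_ac)

lemma lift3_rot: "lift3 \<Phi> f g h = lift3 (\<lambda>y z x. \<Phi> x y z) g h f"
  unfolding lift3_def fun_eq_iff
  by (auto intro!: sum.reindex_bij_witness[of _ "\<lambda>(c,d,b). (b,c,d)" "\<lambda>(b,c,d). (c,d,b)"] simp: add_ac)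

lemma fprod_fprod_right:
  assumes "\<And>x. Modules.additive (m1 x)"
  shows "fprod m1 f (fprod m2 g h) = lift3 (\<lambda>x y z. m1 x (m2 y z)) f g h"
  by (subst fprod_commute, subst fprod_fprod_left) (auto simp: assms intro: lift3_rot[symmetric])

lemma lift3_add: "lift3 \<Phi> f g h + lift3 \<Psi> f g h = lift3 (\<lambda>x y z. \<Phi> x y z + \<Psi> x y z) f g h"
  by (simp add: lift3_def fun_eq_iff sum.distrib[symmetric] split_def)

lemma fprod_assoc:
  assumes "biadd m1" "biadd m3" "\<And>x y z. m1 (m2 x y) z = m3 x (m4 y z)"
  shows "fprod m1 (fprod m2 f g) h = fprod m3 f (fprod m4 g h)"
proof -
  have "(\<lambda>x y z. m1 (m2 x y) z) = (\<lambda>x y z. m3 x (m4 y z))"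
    using assms(3) by (simp add: fun_eq_iff)
  moreover have "Modules.additive (\<lambda>x. m1 x z)" "Modules.additive (m3 y)" for y z
    using assms(1,2) by (simp_all add: biadd_def)
  ultimately show ?thesis by (simp only: fprod_fprod_left fprod_fprod_right)
qed

lemma fprod_left_commute:
  assumes "biadd m1" "biadd m3" "\<And>x y z. m1 x (m2 y z) = m3 y (m4 x z)"
  shows "fprod m1 f (fprod m2 g h) = fprod m3 g (fprod m4 f h)"
proof -
  have "(\<lambda>x y z. m1 y (m2 x z)) = (\<lambda>x y z. m3 x (m4 y z))"
    using assms(3) by (simp add: fun_eq_iff)
  moreover have "Modules.additive (m1 z)" "Modules.additive (m3 y)" for y z
    using assms(1,2) by (simp_all add: biadd_def)
  ultimately show ?thesis by (simp only: fprod_fprod_right lift3_swap12[of _ f])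
qed

text \<open>
  A family \<open>X\<close> depending linearly on a vector \<open>x\<close> is extended to formal maps in place of \<open>x\<close>.
\<close>

definition ext :: "('u \<Rightarrow> ('a, 'w::comm_monoid_add) formal_map) \<Rightarrow> ('a, 'u) formal_map \<Rightarrow> ('a, 'w) formal_map" where
  "ext X \<mu> \<alpha> = (\<Sum>(\<beta>,\<gamma>) | \<beta> + \<gamma> = \<alpha>. X (\<mu> \<beta>) \<gamma>)"

definition linfam :: "('u::ab_group_add \<Rightarrow> ('a, 'w::ab_group_add) formal_map) \<Rightarrow> bool" where
  "linfam X \<longleftrightarrow> (\<forall>x y. X (x + y) = X x + X y)"

lemma linfam_simps:
  assumes "linfam X"
  shows "X (x + y) = X x + X y" "X 0 = 0" "X (- x) = - X x" "X (x - y) = X x - X y"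
    "X (nsc n x) \<gamma> = nsc n (X x \<gamma>)"
proof -
  interpret Modules.additive X using assms by (simp add: linfam_def Modules.additive_def)
  show "X (x + y) = X x + X y" "X 0 = 0" "X (- x) = - X x" "X (x - y) = X x - X y"
    by (rule add zero minus diff)+
  show "X (nsc n x) \<gamma> = nsc n (X x \<gamma>)"
    by (rule nsc_hom) (simp_all add: add zero)
qed

lemma linfam_sum:
  assumes "linfam X"
  shows "X (sum f A) = (\<Sum>i\<in>A. X (f i))"
proof -
  interpret Modules.additive X using assms by (simp add: linfam_def Modules.additive_def)
  show ?thesis by (rule sum)
qed

lemma ext_fprod: "ext X \<mu> = fprod (\<lambda>x Z. Z x) \<mu> (\<lambda>\<gamma> x. X x \<gamma>)"
  by (simp add: ext_def fun_eq_iff fprod_splits)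

lemma fapply_ext: "fapply l \<mu> = ext (\<lambda>x \<alpha>. l \<alpha> x) \<mu>"
  by (subst fprod_commute) (simp add: ext_fprod)

lemma fprod_ext: "fprod m f g = ext (\<lambda>x \<gamma>. m x (g \<gamma>)) f"
  by (simp add: ext_def fun_eq_iff fprod_splits)

lemma ext_const: "linfam X \<Longrightarrow> ext X (const x) = X x"
proof
  fix \<alpha> assume "linfam X"
  then have "ext X (const x) \<alpha> = (\<Sum>(\<beta>,\<gamma>) | \<beta> + \<gamma> = \<alpha>. if \<beta> = {#} then X x \<gamma> else 0)"
    unfolding ext_def const_def by (intro sum.cong) (auto simp: linfam_simps)
  then show "ext X (const x) \<alpha> = X x \<alpha>" by (simp add: sum_splits_delta1)
qed

lemma ext_0:
  "(\<And>\<beta> \<gamma>. \<beta> + \<gamma> = \<alpha> \<Longrightarrow> X (\<mu> \<beta>) \<gamma> = 0) \<Longrightarrow> ext X \<mu> \<alpha> = 0"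
  unfolding ext_def by (rule sum.neutral) auto

lemma ext_fam_zero [simp]: "ext (\<lambda>x. 0) \<mu> = (0 :: ('a, 'w::ab_group_add) formal_map)"
  by (simp add: fun_eq_iff ext_def)

lemma ext_fam:
  fixes X :: "'u \<Rightarrow> ('a, 'w::ab_group_add) formal_map"
  shows "ext (\<lambda>x. X x + Y x) \<mu> = ext X \<mu> + ext Y \<mu>"
    "ext (\<lambda>x. X x - Y x) \<mu> = ext X \<mu> - ext Y \<mu>"
    "ext (\<lambda>x. - X x) \<mu> = - ext X \<mu>"
    "ext (\<lambda>x. \<Sum>i\<in>A. Z i x) \<mu> = (\<Sum>i\<in>A. ext (Z i) \<mu> :: ('a, 'w::ab_group_add) formal_map)"
  by (simp_all add: fun_eq_iff ext_def sum.distrib sum_subtractf sum_negf split_def sum_fun_apply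
      sum.swap[of _ A])

lemma ext_arg:
  assumes "linfam X"
  shows "ext X (\<mu> + \<psi>) = ext X \<mu> + ext X \<psi>" "ext X (\<mu> - \<psi>) = ext X \<mu> - ext X \<psi>"
    "ext X (- \<mu>) = - ext X \<mu>" "ext X 0 = 0"
  by (simp_all add: fun_eq_iff ext_def linfam_simps[OF assms] sum.distrib sum_subtractf sum_negf split_def)

lemma fprod_ext_right:
  assumes "biadd m"
  shows "fprod m u (ext X \<mu>) = ext (\<lambda>x. fprod m u (X x)) \<mu>"
proof -
  have "(\<lambda>\<gamma> x. fprod m u (X x) \<gamma>) = fprod (\<lambda>u Z x. m u (Z x)) u (\<lambda>\<gamma> x. X x \<gamma>)"
    by (simp add: fun_eq_iff fprod_splits sum_fun_apply split_def)
  then show ?thesis unfolding ext_fprod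
    apply (simp add:)
    apply (subst fprod_fprod_right) subgoal using assms by (simp add: biadd_def)
    apply (subst fprod_fprod_right) subgoal by (simp add: Modules.additive_def)
    apply (rule lift3_swap12)
    done
qed

lemma fprod_ext_left:
  assumes "biadd m"
  shows "fprod m (ext X \<mu>) u = ext (\<lambda>x. fprod m (X x) u) \<mu>"
proof -
  have "biadd (\<lambda>x y. m y x)" using assms by (simp add: biadd_def)
  from fprod_ext_right[OF this, of u X \<mu>] show ?thesis
    by (simp add: fprod_commute[of m])
qed

text \<open>Since \<open>X\<close> is additive it passes through the inner Cauchy sum, and both
  sides become sums over triples of multi-indices.\<close>

lemma ext_ext: 
  assumes "linfam X"
  shows "ext X (ext Y \<mu>) = ext (\<lambda>x. ext X (Y x)) \<mu>"
proof -
  have "(\<lambda>\<gamma> x. ext X (Y x) \<gamma>) = fprod (\<lambda>Z W x. W (Z x)) (\<lambda>\<gamma> x. Y x \<gamma>) (\<lambda>\<gamma> x. X x \<gamma>)"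
    by (simp add: fun_eq_iff fprod_splits ext_def sum_fun_apply split_def)
  then have "ext (\<lambda>x. ext X (Y x)) \<mu> = lift3 (\<lambda>x Z W. W (Z x)) \<mu> (\<lambda>\<gamma> x. Y x \<gamma>) (\<lambda>\<gamma> x. X x \<gamma>)"
    by (subst ext_fprod, simp add:) (subst fprod_fprod_right, simp_all add: Modules.additive_def)
  also have "\<dots> = ext X (ext Y \<mu>)"
  proof
    fix \<alpha>
    have "ext X (ext Y \<mu>) \<alpha> = (\<Sum>p\<in>{(\<beta>,\<gamma>). \<beta> + \<gamma> = \<alpha>}. \<Sum>q\<in>{(\<beta>,\<gamma>). \<beta> + \<gamma> = fst p}. X (Y (\<mu> (fst q)) (snd q)) (snd p))"
      by (simp add: ext_def split_def linfam_sum[OF assms] sum_fun_apply)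
    also have "\<dots> = (\<Sum>(p,q)\<in>(SIGMA p:{(\<beta>,\<gamma>). \<beta> + \<gamma> = \<alpha>}. {(\<beta>,\<gamma>). \<beta> + \<gamma> = fst p}). X (Y (\<mu> (fst q)) (snd q)) (snd p))"
      by (rule sum.Sigma) auto
    also have "\<dots> = lift3 (\<lambda>x Z W. W (Z x)) \<mu> (\<lambda>\<gamma> x. Y x \<gamma>) (\<lambda>\<gamma> x. X x \<gamma>) \<alpha>" unfolding lift3_def
      by (rule sum.reindex_bij_witness[of _ "\<lambda>(b,c,d). ((b+c,d),(b,c))" "\<lambda>(p,q). (fst q, snd q, snd p)"]) auto
    finally show "lift3 (\<lambda>x Z W. W (Z x)) \<mu> (\<lambda>\<gamma> x. Y x \<gamma>) (\<lambda>\<gamma> x. X x \<gamma>) \<alpha> = ext X (ext Y \<mu>) \<alpha>" by simp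
  qed
  finally show ?thesis by simp
qed

section \<open>Partial derivatives and derivatives along vector fields\<close>

definition pd :: "'a \<Rightarrow> ('a, 'v::comm_monoid_add) formal_map \<Rightarrow> ('a, 'v) formal_map" where
  "pd b f \<alpha> = nsc (Suc (count \<alpha> b)) (f (add_mset b \<alpha>))"

text \<open>Only splittings with b in the left part contribute, and removing one b from that part is
  a bijection onto the splittings of \<alpha>; the factor \<open>count \<beta> b\<close> becomes
  \<open>Suc (count \<beta> b)\<close>.\<close>

lemma sum_splits_pd:
  fixes P :: "'a multiset \<Rightarrow> 'a multiset \<Rightarrow> 'v::comm_monoid_add"
  shows "(\<Sum>(\<beta>,\<gamma>) | \<beta> + \<gamma> = add_mset b \<alpha>. nsc (count \<beta> b) (P \<beta> \<gamma>)) =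
         (\<Sum>(\<beta>,\<gamma>) | \<beta> + \<gamma> = \<alpha>. nsc (Suc (count \<beta> b)) (P (add_mset b \<beta>) \<gamma>))"
proof -
  have "(\<Sum>(\<beta>,\<gamma>) | \<beta> + \<gamma> = add_mset b \<alpha>. nsc (count \<beta> b) (P \<beta> \<gamma>)) =
        (\<Sum>(\<beta>,\<gamma>) | \<beta> + \<gamma> = add_mset b \<alpha> \<and> b \<in># \<beta>. nsc (count \<beta> b) (P \<beta> \<gamma>))"
    by (rule sum.mono_neutral_right) (auto, metis nsc_0 not_in_iff)
  also have "\<dots> = (\<Sum>(\<beta>,\<gamma>) | \<beta> + \<gamma> = \<alpha>. nsc (Suc (count \<beta> b)) (P (add_mset b \<beta>) \<gamma>))"
    by (rule sum.reindex_bij_witness[of _ "\<lambda>(\<beta>,\<gamma>). (add_mset b \<beta>, \<gamma>)" "\<lambda>(\<beta>,\<gamma>). (\<beta> - {#b#}, \<gamma>)"])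
      (auto dest: arg_cong[where f = "\<lambda>x. x - {#b#}"])
  finally show ?thesis .
qed

lemma sum_splits_swap:
  "(\<Sum>(\<beta>,\<gamma>) | \<beta> + \<gamma> = \<alpha>. P \<beta> \<gamma>) = (\<Sum>(\<beta>,\<gamma>) | \<beta> + \<gamma> = (\<alpha>::'a multiset). P \<gamma> \<beta>)"
  by (rule sum.reindex_bij_witness[of _ prod.swap prod.swap]) (auto simp: add.commute)

text \<open>Product rule on coefficients: the multiplicity of b in
  \<open>add_mset b \<alpha>\<close> is the sum of its multiplicities in the two parts, which
  distributes the factor over the two differentiations.\<close>

lemma pd_splits:
  fixes P :: "'a multiset \<Rightarrow> 'a multiset \<Rightarrow> 'v::comm_monoid_add"
  shows "nsc (Suc (count \<alpha> b)) (\<Sum>(\<beta>,\<gamma>) | \<beta> + \<gamma> = add_mset b \<alpha>. P \<beta> \<gamma>) =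
     (\<Sum>(\<beta>,\<gamma>) | \<beta> + \<gamma> = \<alpha>. nsc (Suc (count \<beta> b)) (P (add_mset b \<beta>) \<gamma>)) +
     (\<Sum>(\<beta>,\<gamma>) | \<beta> + \<gamma> = \<alpha>. nsc (Suc (count \<gamma> b)) (P \<beta> (add_mset b \<gamma>)))"
proof -
  have "nsc (Suc (count \<alpha> b)) (\<Sum>(\<beta>,\<gamma>) | \<beta> + \<gamma> = add_mset b \<alpha>. P \<beta> \<gamma>) =
    (\<Sum>(\<beta>,\<gamma>) | \<beta> + \<gamma> = add_mset b \<alpha>. nsc (count \<beta> b + count \<gamma> b) (P \<beta> \<gamma>))"
  proof -
    have "nsc n (sum f A) = (\<Sum>i\<in>A. nsc n (f i))" for n A and f :: "'a multiset \<times> 'a multiset \<Rightarrow> 'v"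
      by (induction A rule: infinite_finite_induct) (simp_all add: nsc_plus)
    moreover have "count \<beta> b + count \<gamma> b = Suc (count \<alpha> b)" if "\<beta> + \<gamma> = add_mset b \<alpha>" for \<beta> \<gamma>
      using arg_cong[OF that, of "\<lambda>x. count x b"] by simp
    ultimately show ?thesis by (auto intro!: sum.cong)
  qed
  also have "\<dots> = (\<Sum>(\<beta>,\<gamma>) | \<beta> + \<gamma> = add_mset b \<alpha>. nsc (count \<beta> b) (P \<beta> \<gamma>)) +
     (\<Sum>(\<beta>,\<gamma>) | \<beta> + \<gamma> = add_mset b \<alpha>. nsc (count \<gamma> b) (P \<beta> \<gamma>))"
    by (simp add: nsc_add sum.distrib[symmetric] split_def)
  also have "(\<Sum>(\<beta>,\<gamma>) | \<beta> + \<gamma> = add_mset b \<alpha>. nsc (count \<gamma> b) (P \<beta> \<gamma>)) =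
      (\<Sum>(\<beta>,\<gamma>) | \<beta> + \<gamma> = \<alpha>. nsc (Suc (count \<gamma> b)) (P \<beta> (add_mset b \<gamma>)))"
    by (subst sum_splits_swap, subst sum_splits_pd, subst sum_splits_swap) simp
  finally show ?thesis by (simp add: sum_splits_pd)
qed

lemma pd_fprod:
  assumes "biadd m"
  shows "pd b (fprod m f g) = fprod m (pd b f) g + fprod m f (pd b g)"
  by (simp add: fun_eq_iff fprod_splits pd_def pd_splits biadd_simps[OF assms])

lemma pd_ext:
  assumes "linfam X"
  shows "pd b (ext X \<mu>) = ext (\<lambda>x. pd b (X x)) \<mu> + ext X (pd b \<mu>)"
  by (simp add: fun_eq_iff ext_def pd_def pd_splits linfam_simps(5)[OF assms] add.commute)

lemma pd_simps:
  fixes f g :: "('a, 'v::ab_group_add) formal_map"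
  shows "pd b (f + g) = pd b f + pd b g" "pd b (f - g) = pd b f - pd b g" "pd b (- f) = - pd b f"
    "pd b 0 = (0 :: ('a, 'v::ab_group_add) formal_map)" "pd b (sum F A) = (\<Sum>i\<in>A. pd b (F i) :: ('a, 'v) formal_map)"
proof -
  interpret Modules.additive "pd b :: ('a, 'v) formal_map \<Rightarrow> _"
    by (simp add: Modules.additive_def pd_def fun_eq_iff nsc_plus)
  show "pd b (f + g) = pd b f + pd b g" "pd b (f - g) = pd b f - pd b g" "pd b (- f) = - pd b f"
    "pd b 0 = (0 :: ('a, 'v) formal_map)" "pd b (sum F A) = (\<Sum>i\<in>A. pd b (F i) :: ('a, 'v) formal_map)"
    by (rule add diff minus zero sum)+
qed

lemma pd_const [simp]: "pd b (const x) = 0"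
  by (simp add: pd_def fun_eq_iff const_def)

lemma pd_commute: "pd b (pd c f) = pd c (pd b f)"
proof (cases "b = c")
  case False
  then show ?thesis
    by (simp add: pd_def fun_eq_iff add_mset_commute nsc_nsc)
qed simp

lemma pd_hom: "Modules.additive T \<Longrightarrow> pd b (\<lambda>\<alpha>. T (f \<alpha>)) = (\<lambda>\<alpha>. T (pd b f \<alpha>))"
proof -
  assume "Modules.additive T"
  then interpret Modules.additive T .
  show ?thesis unfolding pd_def using nsc_hom[of T, OF zero add] by simp
qed

text \<open>Derivative along the vector field on the dual of L with components \<open>v b\<close>.
  It agrees with \<open>fdiff\<close> on \<gg>-valued maps and also serves scalar maps and maps into
  the double.\<close>

definition dv :: "('k::ab_group_add \<Rightarrow> 'v::ab_group_add \<Rightarrow> 'v) \<Rightarrow> 'a set \<Rightarrow> ('a \<Rightarrow> ('a,'k) formal_map) \<Rightarrow> ('a, 'v) formal_map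
    \<Rightarrow> ('a, 'v) formal_map" where
  "dv s B v f = (\<Sum>b\<in>B. fprod s (v b) (pd b f))"

lemma dv_simps:
  assumes "biadd s"
  shows "dv s B v (f + g) = dv s B v f + dv s B v g" "dv s B v (f - g) = dv s B v f - dv s B v g"
    "dv s B v (- f) = - dv s B v f" "dv s B v 0 = 0" "dv s B v (sum F A) = (\<Sum>i\<in>A. dv s B v (F i))"
    "dv s B v (const x) = 0"
  by (simp_all add: dv_def pd_simps fprod_simps[OF assms] sum.distrib sum_subtractf sum_negf sum.swap[of _ A])

lemma dv_fprod:
  assumes "biadd m" "biadd s1" "biadd s2" "biadd s3"
    "\<And>a x y. m (s1 a x) y = s3 a (m x y)" "\<And>a x y. m x (s2 a y) = s3 a (m x y)"
  shows "dv s3 B v (fprod m f g) = fprod m (dv s1 B v f) g + fprod m f (dv s2 B v g)"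
proof -
  have 1: "fprod m (fprod s1 a f') g = fprod s3 a (fprod m f' g)" for a f'
    by (rule fprod_assoc) (auto simp: assms)
  have 2: "fprod m f (fprod s2 a g') = fprod s3 a (fprod m f g')" for a g'
    by (rule fprod_left_commute) (auto simp: assms)
  show ?thesis
    by (simp add: dv_def pd_fprod assms fprod_simps sum.distrib 1 2)
qed

lemma fprod_scalar_ext: "biadd s \<Longrightarrow> fprod s a (ext X \<mu>) = ext (\<lambda>x. fprod s a (X x)) \<mu>"
  by (rule fprod_ext_right)

lemma ext_fprod_scalar:
  assumes "\<And>a x \<gamma>. X (t a x) \<gamma> = s a (X x \<gamma>)" "linfam X" "biadd s"
  shows "ext X (fprod t a \<mu>) = fprod s a (ext X \<mu>)"
proof -
  have "ext X (fprod t a \<mu>) = ext (\<lambda>c. ext X (\<lambda>\<gamma>. t c (\<mu> \<gamma>))) a"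
    by (simp add: fprod_ext[of t] ext_ext assms)
  also have "(\<lambda>c. ext X (\<lambda>\<gamma>. t c (\<mu> \<gamma>))) = (\<lambda>c \<gamma>. s c (ext X \<mu> \<gamma>))"
    by (simp add: fun_eq_iff ext_def assms(1) biadd_simps(10)[OF assms(3)] split_def)
  finally show ?thesis by (simp add: fprod_ext[of s])
qed

lemma dv_ext:
  assumes "linfam X" "biadd s" "biadd t" "\<And>a x \<gamma>. X (t a x) \<gamma> = s a (X x \<gamma>)"
  shows "dv s B v (ext X \<mu>) = ext (\<lambda>x. dv s B v (X x)) \<mu> + ext X (dv t B v \<mu>)"
proof -
  have s: "ext X (sum f A) = (\<Sum>i\<in>A. ext X (f i))" for f :: "_ \<Rightarrow> ('b, 'a) formal_map" and A
    by (induction A rule: infinite_finite_induct)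
      (simp_all only: sum.infinite sum.empty sum.insert ext_arg[OF assms(1)] not_False_eq_True)
  show ?thesis
  by (simp add: dv_def pd_ext[OF assms(1)] fprod_simps[OF assms(2)] sum.distrib ext_fam s
      fprod_scalar_ext[OF assms(2)] ext_fprod_scalar[OF assms(4,1,2)])
qed

text \<open>The right-hand field is the Lie bracket of the two fields. The second-order terms cancel
  because partial derivatives commute, so only derivatives of the components remain.\<close>

lemma dv_dv:
  assumes "biadd s" "biadd m" "\<And>a b x. s a (s b x) = s (m a b) x" "\<And>a b. m a b = m b a"
  shows "dv s B v (dv s B w f) - dv s B w (dv s B v f) =
         dv s B (\<lambda>b. dv m B v (w b) - dv m B w (v b)) f"
proof -
  have *: "dv s B v (dv s B w f) = dv s B (\<lambda>b. dv m B v (w b)) f +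
     (\<Sum>b\<in>B. \<Sum>c\<in>B. fprod s (v b) (fprod s (w c) (pd b (pd c f))))" for v w
  proof -
    have 1: "fprod s a (fprod s b x) = fprod s (fprod m a b) x" for a b x
      by (rule fprod_assoc[symmetric]) (auto simp: assms)
    have "dv s B v (dv s B w f) = (\<Sum>b\<in>B. \<Sum>c\<in>B. fprod s (v b) (fprod s (pd b (w c)) (pd c f)) + 
           fprod s (v b) (fprod s (w c) (pd b (pd c f))))"
      by (simp add: dv_def pd_simps pd_fprod assms fprod_simps sum.distrib)
    also have "\<dots> = (\<Sum>b\<in>B. \<Sum>c\<in>B. fprod s (v b) (fprod s (pd b (w c)) (pd c f))) +
        (\<Sum>b\<in>B. \<Sum>c\<in>B. fprod s (v b) (fprod s (w c) (pd b (pd c f))))"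
      by (simp add: sum.distrib)
    also have "(\<Sum>b\<in>B. \<Sum>c\<in>B. fprod s (v b) (fprod s (pd b (w c)) (pd c f))) =
          dv s B (\<lambda>b. dv m B v (w b)) f"
      by (subst sum.swap) (simp add: dv_def 1 fprod_simps assms)
    finally show ?thesis .
  qed
  have "(\<Sum>b\<in>B. \<Sum>c\<in>B. fprod s (v b) (fprod s (w c) (pd b (pd c f)))) =
        (\<Sum>b\<in>B. \<Sum>c\<in>B. fprod s (w b) (fprod s (v c) (pd b (pd c f))))"
  proof -
    have "fprod s a (fprod s b x) = fprod s b (fprod s a x)" for a b x
      by (rule fprod_left_commute) (auto simp: assms)
    from this[of "v c" "w b" "pd b (pd c f)" for b c] show ?thesis
      by (subst sum.swap) (auto intro!: sum.cong simp: pd_commute)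
  qed
  then show ?thesis unfolding *[of v w] *[of w v]
    by (simp add: dv_def fprod_simps assms sum_subtractf)
qed

lemma linear_add: "Vector_Spaces.linear s t f \<Longrightarrow> f (x + y) = f x + f y"
  and linear_scl: "Vector_Spaces.linear s t f \<Longrightarrow> f (s c x) = t c (f x)"
  by (simp_all add: module_hom_iff_linear[symmetric] module_hom.add module_hom.scale)

lemma linear_additive: "Vector_Spaces.linear s t f \<Longrightarrow> Modules.additive f"
  by (simp add: Modules.additive_def linear_add)

lemma linearI:
  assumes "vector_space s" "vector_space t" "\<And>x y. f (x + y) = f x + f y" "\<And>c x. f (s c x) = t c (f x)"
  shows "Vector_Spaces.linear s t f"
  using assms by (simp add: Vector_Spaces.linear_iff)

lemma linear_sum': "Vector_Spaces.linear s t f \<Longrightarrow> f (sum h A) = (\<Sum>i\<in>A. f (h i))"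
  by (rule Modules.additive.sum[OF linear_additive])

lemma linear_simps:
  assumes "Vector_Spaces.linear s t f"
  shows "f 0 = 0" "f (- x) = - f x" "f (x - y) = f x - f y"
  using assms by (simp_all add: Modules.additive.zero Modules.additive.minus Modules.additive.diff linear_additive)

section \<open>The double\<close>

lemma vector_space_mult: "vector_space ((*) :: 'k::field \<Rightarrow> 'k \<Rightarrow> 'k)"
  by unfold_locales (simp_all add: algebra_simps)

lemma biadd_mult: "biadd ((*) :: 'k::comm_ring_1 \<Rightarrow> 'k \<Rightarrow> 'k)"
  by (rule biaddI) (simp_all add: algebra_simps)

lemma biadd_scale: "vector_space s \<Longrightarrow> biadd s"
  by (rule biaddI) (simp_all add: vector_space_def)

locale lie_qb =
  fixes G :: "('k::{real_normed_field, euclidean_space},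
               'g::ab_group_add, 'h::ab_group_add) quasi_bialgebra" (structure)
  assumes lqb: "lie_quasi_bialgebra G"
begin

abbreviation sg where "sg \<equiv> scl G"
abbreviation sh where "sh \<equiv> dscl G"
abbreviation sd where "sd \<equiv> double_scl G"
abbreviation br where "br \<equiv> double_bracket G"

lemma dual: "dual_spaces G"
  and lie: "lie_algebra sg (lbr G)"
  and cobr_skew: "cobr G x \<in> skew_maps G"
  and cobr_linear: "Vector_Spaces.linear sg sg (\<lambda>x. cobr G x \<xi>)"
  and phi_Alt: "phi G \<in> Alt ` tensor_span G UNIV"
  and lie_double: "lie_algebra sd br"
  using lqb by (auto simp: lie_quasi_bialgebra_def)

lemma vs_h: "vector_space sh" and vs_g: "vector_space sg" and vs_d: "vector_space sd"
  and pair_linear_left: "Vector_Spaces.linear sh (*) (\<lambda>\<xi>. \<langle>\<xi>, x\<rangle>)"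
  using dual lie lie_double by (simp_all add: dual_spaces_def lie_algebra_def)

lemma pair_linear_right: "Vector_Spaces.linear sg (*) (pairing G \<xi>)"
  using dual by (auto simp: dual_spaces_def bij_betw_def)

lemma ex_functional: "Vector_Spaces.linear sg (*) f \<Longrightarrow> \<exists>\<xi>. \<forall>x. \<langle>\<xi>, x\<rangle> = f x"
proof -
  assume "Vector_Spaces.linear sg (*) f"
  then have "f \<in> range (pairing G)" using dual by (simp add: dual_spaces_def bij_betw_def)
  then show ?thesis by auto
qed

lemma h_eqI: "(\<And>x. \<langle>\<xi>, x\<rangle> = \<langle>\<eta>, x\<rangle>) \<Longrightarrow> \<xi> = \<eta>"
proof -
  assume "\<And>x. \<langle>\<xi>, x\<rangle> = \<langle>\<eta>, x\<rangle>"
  then have "pairing G \<xi> = pairing G \<eta>" by (intro HOL.ext)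
  moreover have "inj (pairing G)" using dual by (simp add: dual_spaces_def bij_betw_def)
  ultimately show ?thesis by (rule injD[rotated])
qed

lemma functional: "Vector_Spaces.linear sg (*) f \<Longrightarrow> \<langle>functional G f, x\<rangle> = f x"
proof -
  assume "Vector_Spaces.linear sg (*) f"
  then obtain \<xi> where \<xi>: "\<forall>x. \<langle>\<xi>, x\<rangle> = f x" using ex_functional by blast
  have "functional G f = \<xi>" unfolding functional_def
  proof (rule the_equality)
    show "\<And>\<eta>. \<forall>x. \<langle>\<eta>, x\<rangle> = f x \<Longrightarrow> \<eta> = \<xi>" by (rule h_eqI) (simp add: \<xi>)
  qed (rule \<xi>)
  then show ?thesis using \<xi> by simp
qed

lemma biadd_pair: "biadd (pairing G)"
  by (rule biaddI) (simp_all add: linear_add[OF pair_linear_left] linear_add[OF pair_linear_right])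

lemmas pair_simps = biadd_simps[OF biadd_pair]

lemma pair_scale: "\<langle>sh c \<xi>, x\<rangle> = c * \<langle>\<xi>, x\<rangle>" "\<langle>\<xi>, sg c x\<rangle> = c * \<langle>\<xi>, x\<rangle>"
  by (simp_all add: linear_scl[OF pair_linear_left] linear_scl[OF pair_linear_right])

text \<open>Finite dimension enters the algebra here: the coordinates of a basis are represented by
  covectors, which gives a dual basis, reflexivity, and the separation of vectors by
  covectors.\<close>

lemma dual_bases:
  obtains E :: "'g set" and D :: "'g \<Rightarrow> 'h" where "finite E"
    "\<And>x. x = (\<Sum>e\<in>E. sg \<langle>D e, x\<rangle> e)" "\<And>\<xi>. \<xi> = (\<Sum>e\<in>E. sh \<langle>\<xi>, e\<rangle> (D e))"
    "\<And>u \<xi>. Vector_Spaces.linear sh (*) u \<Longrightarrow> u \<xi> = \<langle>\<xi>, \<Sum>e\<in>E. sg (u (D e)) e\<rangle>"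
proof -
  from dual obtain E where "finite_dimensional_vector_space sg E" by (auto simp: dual_spaces_def)
  then interpret g: finite_dimensional_vector_space sg E .
  have "\<exists>\<xi>. \<forall>x. \<langle>\<xi>, x\<rangle> = g.representation E x e" for e
    by (rule ex_functional, rule g.linear_representation)
       (simp_all add: g.independent_Basis g.span_Basis)
  then obtain D where D: "\<And>e x. \<langle>D e, x\<rangle> = g.representation E x e" by metis
  have 1: "x = (\<Sum>e\<in>E. sg \<langle>D e, x\<rangle> e)" for x
    unfolding D by (rule g.sum_representation_eq[symmetric]) 
      (simp_all add: g.independent_Basis g.span_Basis g.finite_Basis)
  have 2: "\<xi> = (\<Sum>e\<in>E. sh \<langle>\<xi>, e\<rangle> (D e))" for \<xi>
  proof (rule h_eqI)
    fix x
    have "\<langle>\<xi>, x\<rangle> = \<langle>\<xi>, \<Sum>e\<in>E. sg \<langle>D e, x\<rangle> e\<rangle>" using 1[of x] by (rule arg_cong)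
    then show "\<langle>\<xi>, x\<rangle> = \<langle>\<Sum>e\<in>E. sh \<langle>\<xi>, e\<rangle> (D e), x\<rangle>"
      by (simp add: pair_simps pair_scale mult.commute)
  qed
  show ?thesis
  proof (rule that[of E D])
    fix u \<xi> assume u: "Vector_Spaces.linear sh (*) u"
    have "u \<xi> = u (\<Sum>e\<in>E. sh \<langle>\<xi>, e\<rangle> (D e))" using 2[of \<xi>] by (rule arg_cong)
    then show "u \<xi> = \<langle>\<xi>, \<Sum>e\<in>E. sg (u (D e)) e\<rangle>"
      by (simp add: linear_sum'[OF u] linear_scl[OF u] pair_simps pair_scale mult.commute)
  qed (rule g.finite_Basis 1 2)+
qed

lemma g_eqI: "(\<And>\<xi>. \<langle>\<xi>, x\<rangle> = \<langle>\<xi>, y\<rangle>) \<Longrightarrow> x = y"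
proof -
  obtain E D where D: "\<And>x. x = (\<Sum>e\<in>E. sg \<langle>D e, x\<rangle> e)" using dual_bases by metis
  assume "\<And>\<xi>. \<langle>\<xi>, x\<rangle> = \<langle>\<xi>, y\<rangle>"
  then have "(\<Sum>e\<in>E. sg \<langle>D e, x\<rangle> e) = (\<Sum>e\<in>E. sg \<langle>D e, y\<rangle> e)" by simp
  then show ?thesis by (rule trans[OF D[of x] trans[OF _ D[of y, symmetric]]])
qed

lemma ex_bidual: "Vector_Spaces.linear sh (*) u \<Longrightarrow> \<exists>x. \<forall>\<xi>. \<langle>\<xi>, x\<rangle> = u \<xi>"
  by (rule dual_bases) metis

lemma bidual: "Vector_Spaces.linear sh (*) u \<Longrightarrow> \<langle>\<xi>, bidual_vector G u\<rangle> = u \<xi>"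
proof -
  assume "Vector_Spaces.linear sh (*) u"
  then obtain x where x: "\<forall>\<xi>. \<langle>\<xi>, x\<rangle> = u \<xi>" using ex_bidual by blast
  have "bidual_vector G u = x" unfolding bidual_vector_def
  proof (rule the_equality)
    show "\<And>y. \<forall>\<xi>. \<langle>\<xi>, y\<rangle> = u \<xi> \<Longrightarrow> y = x" by (rule g_eqI) (simp add: x)
  qed (rule x)
  then show ?thesis using x by simp
qed

lemma lbr_linear: "Vector_Spaces.linear sg sg (\<lambda>y. [x; y])" "Vector_Spaces.linear sg sg (\<lambda>x. [x; y])"
  and lbr_self: "[x; x] = 0"
  using lie by (simp_all add: lie_algebra_def)

lemma biadd_lbr: "biadd (lbr G)"
  by (rule biaddI) (simp_all add: linear_add[OF lbr_linear(1)] linear_add[OF lbr_linear(2)])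

lemmas lbr_simps = biadd_simps[OF biadd_lbr]

lemma lbr_scale: "[sg c x; y] = sg c [x; y]" "[x; sg c y] = sg c [x; y]"
  by (simp_all add: linear_scl[OF lbr_linear(1)] linear_scl[OF lbr_linear(2)])

lemma lbr_skew: "[x; y] = - [y; x]"
proof -
  have "0 = [x + y; x + y]" by (simp only: lbr_self)
  also have "\<dots> = [x; y] + [y; x]" by (simp only: lbr_simps(1,2)) (simp add: lbr_self)
  finally have "[x; y] + [y; x] = 0" by (rule sym)
  then show ?thesis by (simp only: eq_neg_iff_add_eq_0)
qed

lemma transp: "Vector_Spaces.linear sg sg f \<Longrightarrow> \<langle>transp G f \<xi>, x\<rangle> = \<langle>\<xi>, f x\<rangle>"
  unfolding transp_def
  by (rule functional) (simp add: linearI vs_g vector_space_mult linear_add linear_scl pair_simps pair_scale)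

lemma coad: "\<langle>coad G x \<xi>, y\<rangle> = \<langle>\<xi>, [x; y]\<rangle>"
  unfolding coad_def by (rule transp) (rule lbr_linear)

lemma coad_simps:
  "coad G (x + y) \<xi> = coad G x \<xi> + coad G y \<xi>" "coad G x (\<xi> + \<eta>) = coad G x \<xi> + coad G x \<eta>"
  "coad G (sg c x) \<xi> = sh c (coad G x \<xi>)" "coad G x (sh c \<xi>) = sh c (coad G x \<xi>)"
  by (rule h_eqI, simp add: coad lbr_simps lbr_scale pair_simps pair_scale)+

lemma biadd_coad: "biadd (coad G)"
  by (rule biaddI) (simp_all add: coad_simps)

lemma cobr_simps:
  "cobr G (x + y) \<xi> = cobr G x \<xi> + cobr G y \<xi>" "cobr G x (\<xi> + \<eta>) = cobr G x \<xi> + cobr G x \<eta>"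
  "cobr G (sg c x) \<xi> = sg c (cobr G x \<xi>)" "cobr G x (sh c \<xi>) = sg c (cobr G x \<xi>)"
  using linear_add[OF cobr_linear] linear_scl[OF cobr_linear] cobr_skew[of x]
  by (auto simp: skew_maps_def linear_add linear_scl)

lemma cobr_swap: "\<langle>\<xi>, cobr G x \<eta>\<rangle> = - \<langle>\<eta>, cobr G x \<xi>\<rangle>"
  using cobr_skew[of x] unfolding skew_maps_def by blast

lemma biadd_cobr: "biadd (cobr G)"
  by (rule biaddI) (simp_all add: cobr_simps)

text \<open>Trilinearity passes from pure tensors to their span. Antisymmetrising a trilinear T then
  makes both the trilinearity and the cyclic symmetry of \<open>phi\<close> a matter of
  expansion.\<close>

lemma phi_form:
  obtains T where "phi G = Alt T"
    "\<And>\<xi> \<xi>' \<eta> \<zeta>. T (\<xi> + \<xi>') \<eta> \<zeta> = T \<xi> \<eta> \<zeta> + T \<xi>' \<eta> \<zeta>"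
    "\<And>\<xi> \<eta>' \<eta> \<zeta>. T \<xi> (\<eta> + \<eta>') \<zeta> = T \<xi> \<eta> \<zeta> + T \<xi> \<eta>' \<zeta>"
    "\<And>\<xi> \<eta> \<zeta> \<zeta>'. T \<xi> \<eta> (\<zeta> + \<zeta>') = T \<xi> \<eta> \<zeta> + T \<xi> \<eta> \<zeta>'"
    "\<And>c \<xi> \<eta> \<zeta>. T (sh c \<xi>) \<eta> \<zeta> = c * T \<xi> \<eta> \<zeta>" "\<And>c \<xi> \<eta> \<zeta>. T \<xi> (sh c \<eta>) \<zeta> = c * T \<xi> \<eta> \<zeta>"
    "\<And>c \<xi> \<eta> \<zeta>. T \<xi> \<eta> (sh c \<zeta>) = c * T \<xi> \<eta> \<zeta>"
proof -
  let ?s = "\<lambda>c (T :: 'h \<Rightarrow> 'h \<Rightarrow> 'h \<Rightarrow> 'k) \<xi> \<eta> \<zeta>. c * T \<xi> \<eta> \<zeta>"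
  let ?P = "\<lambda>T :: 'h \<Rightarrow> 'h \<Rightarrow> 'h \<Rightarrow> 'k. (\<forall>\<xi> \<xi>' \<eta> \<zeta>. T (\<xi> + \<xi>') \<eta> \<zeta> = T \<xi> \<eta> \<zeta> + T \<xi>' \<eta> \<zeta>) \<and>
    (\<forall>\<xi> \<eta>' \<eta> \<zeta>. T \<xi> (\<eta> + \<eta>') \<zeta> = T \<xi> \<eta> \<zeta> + T \<xi> \<eta>' \<zeta>) \<and> (\<forall>\<xi> \<eta> \<zeta> \<zeta>'. T \<xi> \<eta> (\<zeta> + \<zeta>') = T \<xi> \<eta> \<zeta> + T \<xi> \<eta> \<zeta>') \<and>
    (\<forall>c \<xi> \<eta> \<zeta>. T (sh c \<xi>) \<eta> \<zeta> = c * T \<xi> \<eta> \<zeta>) \<and> (\<forall>c \<xi> \<eta> \<zeta>. T \<xi> (sh c \<eta>) \<zeta> = c * T \<xi> \<eta> \<zeta>) \<and>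
    (\<forall>c \<xi> \<eta> \<zeta>. T \<xi> \<eta> (sh c \<zeta>) = c * T \<xi> \<eta> \<zeta>)"
  interpret t: module ?s by unfold_locales (simp_all add: fun_eq_iff algebra_simps)
  from phi_Alt obtain T where T: "T \<in> t.span (pure_tensor G ` UNIV)" and phi: "phi G = Alt T"
    by (auto simp: tensor_span_def)
  have "?P T" using T
  proof (rule t.span_induct)
    show "t.subspace (Collect ?P)"
      by (rule t.subspaceI) (simp_all add: algebra_simps)
    show "?P x" if "x \<in> pure_tensor G ` UNIV" for x
      using that by (auto simp: pure_tensor_def pair_simps pair_scale algebra_simps)
  qed
  then show ?thesis by (intro that[OF phi]) auto
qed

lemma phi_trilinear:
  "phi G (\<xi> + \<xi>') \<eta> \<zeta> = phi G \<xi> \<eta> \<zeta> + phi G \<xi>' \<eta> \<zeta>"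
  "phi G \<xi> (\<eta> + \<eta>') \<zeta> = phi G \<xi> \<eta> \<zeta> + phi G \<xi> \<eta>' \<zeta>"
  "phi G \<xi> \<eta> (\<zeta> + \<zeta>') = phi G \<xi> \<eta> \<zeta> + phi G \<xi> \<eta> \<zeta>'"
  "phi G (sh c \<xi>) \<eta> \<zeta> = c * phi G \<xi> \<eta> \<zeta>"
  "phi G \<xi> (sh c \<eta>) \<zeta> = c * phi G \<xi> \<eta> \<zeta>"
  "phi G \<xi> \<eta> (sh c \<zeta>) = c * phi G \<xi> \<eta> \<zeta>"
  by (rule phi_form, simp add: Alt_def algebra_simps)+

lemma phi_rot: "phi G \<eta> \<zeta> \<xi> = phi G \<xi> \<eta> \<zeta>"
  by (rule phi_form) (simp add: Alt_def algebra_simps)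

section \<open>The invariant pairing of the double and brackets of formal maps\<close>

definition pr :: "'g \<times> 'h \<Rightarrow> 'g \<times> 'h \<Rightarrow> 'k" where
  "pr u w = \<langle>snd u, fst w\<rangle> + \<langle>snd w, fst u\<rangle>"

lemma biadd_pr: "biadd pr"
  by (rule biaddI) (simp_all add: pr_def pair_simps)

lemma pr_commute: "pr u w = pr w u"
  by (simp add: pr_def add.commute)

lemma sd_simps: "fst (sd c u) = sg c (fst u)" "snd (sd c u) = sh c (snd u)"
  by (simp_all add: double_scl_def split_def)

lemma pr_scale: "pr (sd c u) w = c * pr u w" "pr u (sd c w) = c * pr u w"
  by (simp_all add: pr_def sd_simps pair_scale algebra_simps)

lemma br_linear: "Vector_Spaces.linear sd sd (\<lambda>y. br x y)" "Vector_Spaces.linear sd sd (\<lambda>x. br x y)"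
  and br_self: "br x x = 0" and br_jac: "br x (br y z) + br y (br z x) + br z (br x y) = 0"
  using lie_double unfolding lie_algebra_def by blast+

lemma biadd_br: "biadd br"
  by (rule biaddI) (simp_all add: linear_add[OF br_linear(1)] linear_add[OF br_linear(2)])

lemmas br_simps = biadd_simps[OF biadd_br]

lemma br_scale: "br (sd c x) y = sd c (br x y)" "br x (sd c y) = sd c (br x y)"
  by (simp_all add: linear_scl[OF br_linear(1)] linear_scl[OF br_linear(2)])

lemma br_skew: "br x y = - br y x"
proof -
  have "0 = br (x + y) (x + y)" by (simp only: br_self)
  also have "\<dots> = br x y + br y x" by (simp only: br_simps(1,2)) (simp add: br_self)
  finally have "br x y + br y x = 0" by (rule sym)
  then show ?thesis by (simp only: eq_neg_iff_add_eq_0)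
qed

lemma br_jacobi: "br x (br y z) = br (br x y) z + br y (br x z)"
proof -
  have "br y (br z x) = - br y (br x z)" by (subst br_skew[of z]) (simp add: br_simps)
  moreover have "br z (br x y) = - br (br x y) z" by (rule br_skew)
  ultimately show ?thesis using br_jac[of x y z] by (simp add: algebra_simps)
qed

text \<open>Lowering the last index removes the inverse identifications with the duals from the
  bracket and exhibits a cyclically symmetric trilinear form; the invariance of the pairing is
  exactly this symmetry.\<close>

lemma pr_br: "pr (br u v) w = 
  \<langle>snd w, [fst u; fst v]\<rangle> + \<langle>snd u, [fst v; fst w]\<rangle> + \<langle>snd v, [fst w; fst u]\<rangle>
  + \<langle>snd w, cobr G (fst u) (snd v)\<rangle> + \<langle>snd u, cobr G (fst v) (snd w)\<rangle> + \<langle>snd v, cobr G (fst w) (snd u)\<rangle>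
  + phi G (snd u) (snd v) (snd w)"
proof -
  have 1: "\<langle>\<zeta>, bidual_vector G (phi G \<xi> \<eta>)\<rangle> = phi G \<xi> \<eta> \<zeta>" for \<xi> \<eta> \<zeta>
    by (rule bidual) (simp add: linearI vs_h vector_space_mult phi_trilinear)
  have 2: "\<langle>functional G (\<lambda>z. \<langle>\<eta>, cobr G z \<xi>\<rangle>), x\<rangle> = \<langle>\<eta>, cobr G x \<xi>\<rangle>" for \<xi> \<eta> x
    by (rule functional) (simp add: linearI vs_g vector_space_mult cobr_simps pair_simps pair_scale)
  have 3: "\<langle>snd w, cobr G (fst v) (snd u)\<rangle> = - \<langle>snd u, cobr G (fst v) (snd w)\<rangle>" by (rule cobr_swap)
  have 4: "[fst u; fst w] = - [fst w; fst u]" by (rule lbr_skew)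
  show ?thesis
    by (simp add: pr_def double_bracket_def split_def pair_simps 1 2 3 4 coad algebra_simps)
qed

lemma pr_invariant: "pr (br u v) w = pr u (br v w)"
  unfolding pr_commute[of u] pr_br by (simp add: phi_rot algebra_simps)

lemma snd_br_fst: "snd u = 0 \<Longrightarrow> snd (br u w) = - coad G (fst u) (snd w)"
proof -
  assume u: "snd u = 0"
  have "Modules.additive (coad G y)" for y using biadd_coad by (simp add: biadd_def)
  then have "coad G y 0 = 0" for y by (rule Modules.additive.zero)
  moreover have "functional G (\<lambda>z. \<langle>\<eta>, cobr G z 0\<rangle>) = 0" for \<eta>
  proof -
    have "Modules.additive (cobr G y)" for y using biadd_cobr by (simp add: biadd_def)
    then have "cobr G y 0 = 0" for y by (rule Modules.additive.zero)
    then show ?thesis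
      by (intro h_eqI) (simp add: functional pair_simps linearI vs_g vector_space_mult)
  qed
  ultimately show ?thesis using u by (simp add: double_bracket_def split_def)
qed

lemma fst_br_fst: "snd u = 0 \<Longrightarrow> snd w = 0 \<Longrightarrow> br u w = ([fst u; fst w], 0)"
proof -
  assume u: "snd u = 0" and w: "snd w = 0"
  have "snd (br u w) = 0" using u w by (simp add: snd_br_fst biadd_simps[OF biadd_coad])
  moreover have "fst (br u w) = [fst u; fst w]"
  proof -
    have "bidual_vector G (phi G 0 0) = 0"
    proof (rule g_eqI)
      have "phi G 0 0 \<xi> = 0" for \<xi> using phi_trilinear(4)[of 0 0 0 \<xi>] vs_h
        by (simp add: module.scale_zero_left module_iff_vector_space)
      moreover have "Vector_Spaces.linear sh (*) (phi G 0 0)"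
         by (simp add: linearI vs_h vector_space_mult phi_trilinear)
      ultimately show "\<langle>\<xi>, bidual_vector G (phi G 0 0)\<rangle> = \<langle>\<xi>, 0\<rangle>" for \<xi>
        by (simp add: bidual pair_simps)
    qed
    then show ?thesis using u w by (simp add: double_bracket_def split_def biadd_simps[OF biadd_cobr])
  qed
  ultimately show ?thesis by (simp add: prod_eq_iff)
qed

abbreviation fmul (infixl "\<odot>" 70) where "a \<odot> b \<equiv> fprod (*) a b"
abbreviation Pr where "Pr \<equiv> fprod pr"
abbreviation Br where "Br \<equiv> fprod br"

lemmas Pr_simps = fprod_simps[OF biadd_pr]
lemmas Br_simps = fprod_simps[OF biadd_br]
lemmas fmul_simps = fprod_simps[OF biadd_mult]

lemma fmul_commute: "a \<odot> b = b \<odot> (a :: ('a, 'k) formal_map)"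
  by (subst fprod_commute) (simp add: mult.commute)

lemma fmul_assoc: "a \<odot> b \<odot> c = a \<odot> (b \<odot> (c :: ('a, 'k) formal_map))"
  by (rule fprod_assoc) (simp_all add: biadd_mult mult.assoc)

lemma fmul_left_commute: "a \<odot> (b \<odot> c) = b \<odot> (a \<odot> (c :: ('a, 'k) formal_map))"
  by (rule fprod_left_commute) (simp_all add: biadd_mult)

lemma Pr_commute: "Pr f g = Pr g f"
  by (subst fprod_commute) (simp add: pr_commute)

lemma Br_skew: "Br f g = - Br g f"
proof -
  have "Br f g = fprod (\<lambda>x y. - br x y) g f"
    by (subst fprod_commute, subst (2) br_skew) simp
  then show ?thesis by (simp add: fun_eq_iff fprod_splits sum_negf split_def)
qed

lemma Pr_invariant: "Pr (Br f g) h = Pr f (Br g h)"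
  by (rule fprod_assoc) (simp_all add: biadd_pr pr_invariant)

lemma Pr_Br_rot: "Pr (Br x y) z = Pr (Br y z) x"
  by (simp add: Pr_invariant Pr_commute[of x])

lemma Br_jacobi: "Br f (Br g h) = Br (Br f g) h + Br g (Br f h)"
proof -
  have a: "Modules.additive (br x)" "Modules.additive (\<lambda>x. br x y)" for x y
    using biadd_br unfolding biadd_def by blast+
  show ?thesis
    by (simp add: fprod_fprod_left fprod_fprod_right a lift3_swap12[of _ g] lift3_add br_jacobi[symmetric])
qed

lemma Pr_scale: "Pr (fprod sd a f) g = a \<odot> Pr f g" "Pr f (fprod sd a g) = a \<odot> Pr f g"
  by (rule fprod_assoc fprod_left_commute; simp add: biadd_pr biadd_mult pr_scale)+

lemma Br_scale: "Br (fprod sd a f) g = fprod sd a (Br f g)" "Br f (fprod sd a g) = fprod sd a (Br f g)"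
  by (rule fprod_assoc fprod_left_commute; simp add: biadd_br biadd_scale vs_d br_scale)+

text \<open>Values in \<gg>, an isotropic subalgebra of the double. Most terms of the later
  computations vanish because two such maps are paired.\<close>

definition gval :: "('a, 'g \<times> 'h) formal_map \<Rightarrow> bool" where
  "gval f \<longleftrightarrow> (\<forall>\<alpha>. snd (f \<alpha>) = 0)"

lemma Pr_gval: "gval f \<Longrightarrow> gval g \<Longrightarrow> Pr f g = 0"
  by (simp add: gval_def fun_eq_iff fprod_splits pr_def pair_simps)

end

lemma dv_cong: "(\<And>b. b \<in> B \<Longrightarrow> v b = w b) \<Longrightarrow> dv s B v f = dv s B w f"
  by (simp add: dv_def)

lemma dv_map:
  assumes "Vector_Spaces.linear s t T"
  shows "dv t B v (\<lambda>\<alpha>. T (f \<alpha>)) = (\<lambda>\<alpha>. T (dv s B v f \<alpha>))"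
  unfolding dv_def pd_hom[OF linear_additive[OF assms]] fun_eq_iff
  by (simp add: sum_fun_apply fprod_splits linear_sum'[OF assms] linear_scl[OF assms, symmetric] split_def)

context lie_qb
begin

lemma restr_const: "restr G (const \<xi>) b = const \<langle>\<xi>, b\<rangle>"
  by (simp add: restr_def const_def fun_eq_iff pair_simps)

text \<open>A directional derivative is linear over formal functions in its direction, so inserting
  a formal covector \<mu> for x means differentiating along the field
  \<open>restr G \<mu>\<close>.\<close>

lemma ext_dv_restr:
  assumes "biadd s"
  shows "ext (\<lambda>x. dv s B (restr G (const x)) f) \<mu> = dv s B (restr G \<mu>) f"
proof -
  have "dv s B (restr G (const x)) f = (\<Sum>b\<in>B. (\<lambda>\<gamma>. s \<langle>x, b\<rangle> (pd b f \<gamma>)))" for x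
    by (simp add: dv_def restr_const fprod_const_left biadd_simps[OF assms])
  then show ?thesis
    by (simp add: ext_fam dv_def) (simp add: ext_def fprod_splits fun_eq_iff restr_def sum_fun_apply)
qed

lemma Pr_dv: "Pr (dv sd B v f) g = (\<Sum>b\<in>B. v b \<odot> Pr (pd b f) g)"
  by (simp add: dv_def Pr_simps Pr_scale)

text \<open>Together with \<open>K\<close>, these are the test elements of the double: pairing with
  \<open>K \<xi>\<close> reads off the \<gg>-component of a formal map, pairing with
  \<open>J x\<close> its dual component.\<close>

definition J :: "'g \<Rightarrow> ('a, 'g \<times> 'h) formal_map" where "J x = const (x, 0)"

definition K :: "'h \<Rightarrow> ('a, 'g \<times> 'h) formal_map" where "K \<xi> = const (0, \<xi>)"

lemma gval_J: "gval (J x)"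
  by (simp add: gval_def J_def const_def)

lemma Pr_K: "Pr (K \<xi>) f = (\<lambda>\<alpha>. \<langle>\<xi>, fst (f \<alpha>)\<rangle>)"
  unfolding K_def by (subst fprod_const_left) (simp_all add: pr_def pair_simps zero_prod_def)

lemma Pr_J: "Pr f (J x) = (\<lambda>\<alpha>. \<langle>snd (f \<alpha>), x\<rangle>)"
  unfolding J_def by (subst fprod_const_right) (simp_all add: pr_def pair_simps zero_prod_def)

lemma gval_eqI: "gval f \<Longrightarrow> (\<And>\<xi>. Pr (K \<xi>) f = 0) \<Longrightarrow> f = 0"
proof
  fix \<alpha> assume f: "gval f" and "\<And>\<xi>. Pr (K \<xi>) f = 0"
  then have "Pr (K \<xi>) f \<alpha> = 0" for \<xi> by simp
  then have "\<langle>\<xi>, fst (f \<alpha>)\<rangle> = \<langle>\<xi>, 0\<rangle>" for \<xi> unfolding Pr_K by (simp add: pair_simps)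
  then have "fst (f \<alpha>) = 0" by (rule g_eqI)
  then show "f \<alpha> = 0 \<alpha>" using f by (simp add: gval_def prod_eq_iff)
qed

lemma gval_simps:
  "gval f \<Longrightarrow> gval g \<Longrightarrow> gval (f + g)" "gval f \<Longrightarrow> gval g \<Longrightarrow> gval (f - g)" "gval f \<Longrightarrow> gval (- f)"
  "(\<And>i. i \<in> A \<Longrightarrow> gval (F i)) \<Longrightarrow> gval (sum F A)"
  by (auto simp: gval_def sum_fun_apply snd_sum)

lemma linear_snd: "Vector_Spaces.linear sd sh snd"
  by (auto simp: linearI vs_d vs_h vs_g sd_simps)

lemma gval_pd: "gval f \<Longrightarrow> gval (pd b f)"
proof -
  assume "gval f"
  moreover have "snd (nsc n x) = nsc n (snd x)" for n and x :: "'g \<times> 'h"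
    by (rule nsc_hom) simp_all
  ultimately show ?thesis by (simp add: gval_def pd_def)
qed

lemma gval_fprod: "gval f \<Longrightarrow> gval (fprod sd a f)"
  using linear_simps(1)[OF linear_snd]
  by (simp add: gval_def fprod_splits snd_sum split_def sd_simps
      module.scale_zero_right[OF vs_h[folded module_iff_vector_space]])

lemma gval_dv: "gval f \<Longrightarrow> gval (dv sd B v f)"
  by (simp add: dv_def gval_simps gval_fprod gval_pd)

lemma gval_Br: "gval f \<Longrightarrow> gval g \<Longrightarrow> gval (Br f g)"
  by (simp add: gval_def fprod_splits snd_sum split_def fst_br_fst)

end

section \<open>Derivations on the dual of L and the infinitesimal action of L\<close>

locale red_qb = lie_qb G
  for G :: "('k::{real_normed_field, euclidean_space},
               'g::ab_group_add, 'h::ab_group_add) quasi_bialgebra" (structure) +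
  fixes L M B :: "'g set"
  assumes red: "reductive_decomposition G L M"
    and comp: "compatible G L M"
    and basis: "basis_of G L B"
begin

abbreviation rep where "rep \<equiv> module.representation sg B"

interpretation g: vector_space sg by (rule vs_g)

lemma L_subspace: "g.subspace L" and M_subspace: "g.subspace M" and L_Int_M: "L \<inter> M = {0}"
  and L_plus_M: "\<exists>a\<in>L. \<exists>b\<in>M. x = a + b"
  and lbr_LL: "x \<in> L \<Longrightarrow> y \<in> L \<Longrightarrow> [x; y] \<in> L" and lbr_LM: "x \<in> L \<Longrightarrow> y \<in> M \<Longrightarrow> [x; y] \<in> M"
  using red by (auto simp: reductive_decomposition_def)

lemma cobr_L: "z \<in> L \<Longrightarrow> cobr G z \<xi> = 0"
  using comp by (simp add: compatible_def)

lemma indep_B: "g.independent B" and span_B: "g.span B = L"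
  using basis by (simp_all add: basis_of_def)

lemma finite_B: "finite B"
proof -
  from dual obtain E where "finite_dimensional_vector_space sg E" by (auto simp: dual_spaces_def)
  then interpret f: finite_dimensional_vector_space sg E .
  show ?thesis using indep_B by (rule f.finiteI_independent)
qed

lemma B_L: "b \<in> B \<Longrightarrow> b \<in> L"
  using g.span_base[of b B] by (simp add: span_B)

lemma sum_rep: "x \<in> L \<Longrightarrow> (\<Sum>b\<in>B. sg (rep x b) b) = x"
  by (rule g.sum_representation_eq) (simp_all add: indep_B span_B finite_B)

lemma rep_basis: "b \<in> B \<Longrightarrow> rep b c = (if b = c then 1 else 0)"
  by (simp add: g.representation_basis indep_B)

lemma rep_add: "x \<in> L \<Longrightarrow> y \<in> L \<Longrightarrow> rep (x + y) b = rep x b + rep y b"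
  and rep_neg: "x \<in> L \<Longrightarrow> rep (- x) b = - rep x b"
  by (simp_all add: g.representation_add g.representation_neg indep_B span_B)

lemma pd_eval_at: "b \<in> B \<Longrightarrow> pd b (eval_at G B x) = const (rep x b)"
proof
  fix \<alpha> assume b: "b \<in> B"
  show "pd b (eval_at G B x) \<alpha> = const (rep x b) \<alpha>"
  proof (cases "\<alpha> = {#}")
    case True
    have "(\<Sum>c\<in>B. if b = c then rep x c else 0) = rep x b" using b finite_B by (simp add: sum.delta)
    then show ?thesis using True by (simp add: pd_def eval_at_def const_def nsc_Suc)
  next
    case False
    then show ?thesis by (simp add: pd_def eval_at_def const_def)
  qed
qed

abbreviation vf where "vf \<equiv> coad_field G B"
abbreviation Dd where "Dd \<equiv> dv sd B"
abbreviation Dk where "Dk \<equiv> dv ((*) :: 'k \<Rightarrow> 'k \<Rightarrow> 'k) B"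
abbreviation dd where "dd \<xi> \<equiv> Dd (restr G (const \<xi>))"
abbreviation dk where "dk \<xi> \<equiv> Dk (restr G (const \<xi>))"

lemma biadd_sd: "biadd sd" and biadd_sg: "biadd sg" and biadd_sh: "biadd sh"
  by (simp_all add: biadd_scale vs_d vs_g vs_h)

lemmas Dd_simps = dv_simps[OF biadd_sd]
lemmas Dk_simps = dv_simps[OF biadd_mult]

lemma Dk_Pr: "Dk v (Pr f g) = Pr (Dd v f) g + Pr f (Dd v g)"
  by (rule dv_fprod) (simp_all add: biadd_pr biadd_sd biadd_mult pr_scale)

lemma Dd_Br: "Dd v (Br f g) = Br (Dd v f) g + Br f (Dd v g)"
  by (rule dv_fprod) (simp_all add: biadd_br biadd_sd br_scale)

lemma dk_eval_at: "x \<in> L \<Longrightarrow> dk \<xi> (eval_at G B x) = const \<langle>\<xi>, x\<rangle>"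
proof -
  assume "x \<in> L"
  then have "\<langle>\<xi>, x\<rangle> = (\<Sum>b\<in>B. \<langle>\<xi>, b\<rangle> * rep x b)"
    by (subst sum_rep[symmetric]) (simp_all add: pair_simps pair_scale mult.commute)
  then show ?thesis
    by (simp add: dv_def pd_eval_at restr_const fprod_const_left fun_eq_iff sum_fun_apply)
       (simp add: const_def)
qed

text \<open>One field is linear and the other constant, so their bracket is constant; its component
  at b is \<langle>\<xi>, [z; b]\<rangle>, that is, the covector \<open>coad G z \<xi>\<close>
  evaluated at b.\<close>

lemma dv_vf_commute:
  assumes "vector_space s" "z \<in> L"
  shows "dv s B (vf z) (dv s B (restr G (const \<xi>)) f) =
    dv s B (restr G (const \<xi>)) (dv s B (vf z) f) - dv s B (restr G (const (coad G z \<xi>))) f"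
proof -
  have "dv s B (restr G (const \<xi>)) (dv s B (vf z) f) - dv s B (vf z) (dv s B (restr G (const \<xi>)) f) =
     dv s B (\<lambda>b. dk \<xi> (vf z b) - Dk (vf z) (restr G (const \<xi>) b)) f"
    by (rule dv_dv) (simp_all add: biadd_scale assms biadd_mult 
      module.scale_scale[OF assms(1)[folded module_iff_vector_space]])
  also have "\<dots> = dv s B (restr G (const (coad G z \<xi>))) f"
    by (rule dv_cong) (simp add: coad_field_def dk_eval_at lbr_LL assms B_L restr_const Dk_simps coad)
  finally show ?thesis by (simp add: algebra_simps)
qed

lemma dv_dir_commute:
  assumes "vector_space s"
  shows "dv s B (restr G (const \<eta>)) (dv s B (restr G (const \<xi>)) f) =
    dv s B (restr G (const \<xi>)) (dv s B (restr G (const \<eta>)) f)"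
proof -
  have "dv s B (restr G (const \<xi>)) (dv s B (restr G (const \<eta>)) f) - dv s B (restr G (const \<eta>)) (dv s B (restr G (const \<xi>)) f) =
     dv s B (\<lambda>b. dk \<xi> (restr G (const \<eta>) b) - dk \<eta> (restr G (const \<xi>) b)) f"
    by (rule dv_dv) (simp_all add: biadd_scale assms biadd_mult 
      module.scale_scale[OF assms(1)[folded module_iff_vector_space]])
  also have "\<dots> = dv s B (\<lambda>b. 0) f"
    by (rule dv_cong) (simp add: restr_const Dk_simps)
  also have "\<dots> = 0" by (simp add: dv_def fprod_simps biadd_scale assms)
  finally show ?thesis by simp
qed

text \<open>The components \<open>vf b c\<close> form the linear Poisson tensor \<langle>p,
  [b; c]\<rangle> of the dual of L. Its skew-symmetry cancels the quadratic terms in the Bianchi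
  identity and in the gauge flow.\<close>

lemma vf_skew: "b \<in> B \<Longrightarrow> c \<in> B \<Longrightarrow> vf b c = - vf c b"
proof -
  assume "b \<in> B" "c \<in> B"
  then have "rep [b; c] a = - rep [c; b] a" for a
    by (subst lbr_skew) (simp add: rep_neg lbr_LL B_L)
  then show ?thesis by (auto simp: coad_field_def eval_at_def fun_eq_iff sum_negf[symmetric] intro!: sum.cong)
qed

text \<open>The infinitesimal action of \<open>z \<in> L\<close> on formal maps into the double.\<close>

definition DL :: "'g \<Rightarrow> ('g, 'g \<times> 'h) formal_map \<Rightarrow> ('g, 'g \<times> 'h) formal_map" where
  "DL z f = Dd (vf z) f + Br (J z) f"

lemma DL_simps: "DL z (f + g) = DL z f + DL z g" "DL z (f - g) = DL z f - DL z g" "DL z (- f) = - DL z f"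
  by (simp_all add: DL_def Dd_simps Br_simps)

lemma DL_Br: "DL z (Br f g) = Br (DL z f) g + Br f (DL z g)"
  by (simp add: DL_def Dd_Br Br_jacobi[of "J z"] Br_simps)

text \<open>The bracket with \<open>J z\<close> is skew for the pairing and drops out, so on scalars
  the action of z is the derivative along the coadjoint field alone.\<close>

lemma Dk_Pr_DL: "Dk (vf z) (Pr f g) = Pr (DL z f) g + Pr f (DL z g)"
proof -
  have "Pr (Br (J z) f) g = - Pr f (Br (J z) g)"
    by (subst Br_skew) (simp add: Pr_simps Pr_invariant)
  then show ?thesis by (simp add: Dk_Pr DL_def Pr_simps)
qed

lemma DL_dd: "z \<in> L \<Longrightarrow> DL z (dd \<xi> f) = dd \<xi> (DL z f) - dd (coad G z \<xi>) f"
  by (simp add: DL_def Dd_simps Dd_Br J_def dv_vf_commute vs_d Br_simps)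

lemma DL_K: "DL z (K \<xi>) = const (cobr G z \<xi>, - coad G z \<xi>)"
proof -
  have "Br (J z) (K \<xi>) = const (br (z, 0) (0, \<xi>))"
    unfolding J_def K_def by (subst fprod_const_left) (auto simp: const_def br_simps zero_prod_def[symmetric])
  moreover have "snd (br (z, 0) (0, \<xi>)) = - coad G z \<xi>" by (simp add: snd_br_fst)
  moreover have "fst (br (z, 0) (0, \<xi>)) = cobr G z \<xi>"
  proof (rule g_eqI)
    fix \<zeta>
    have "\<langle>\<zeta>, fst (br (z, 0) (0, \<xi>))\<rangle> = pr (br (z, 0) (0, \<xi>)) (0, \<zeta>)"
      by (simp add: pr_def pair_simps)
    also have "\<dots> = \<langle>\<zeta>, cobr G z \<xi>\<rangle>"
      unfolding pr_br using phi_trilinear(4)[of 0 0 \<xi> \<zeta>] vs_h 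
      by (simp add: pair_simps lbr_simps biadd_simps[OF biadd_cobr] module.scale_zero_left module_iff_vector_space)
    finally show "\<langle>\<zeta>, fst (br (z, 0) (0, \<xi>))\<rangle> = \<langle>\<zeta>, cobr G z \<xi>\<rangle>" .
  qed
  ultimately have "Br (J z) (K \<xi>) = const (cobr G z \<xi>, - coad G z \<xi>)" by (metis prod.collapse)
  then show ?thesis by (simp add: DL_def K_def Dd_simps)
qed

text \<open>The cobracket part of \<open>DL z (K \<xi>)\<close> lies in \<gg> and pairs to zero with
  \<gg>-valued maps, which leaves the coadjoint term.\<close>

lemma Pr_DL_K: "gval f \<Longrightarrow> Pr (DL z (K \<xi>)) f = - Pr (K (coad G z \<xi>)) f"
  unfolding DL_K by (subst fprod_const_left)
    (simp_all add: Pr_K pr_def pair_simps zero_prod_def fun_eq_iff gval_def)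

end

section \<open>Infinitesimal gauge transformations\<close>

locale gauge_field = red_qb G L M B
  for G :: "('k::{real_normed_field, euclidean_space},
               'g::ab_group_add, 'h::ab_group_add) quasi_bialgebra" (structure) and L M B +
  fixes s :: "('g, 'g \<times> 'h) formal_map"
  assumes s_gval: "gval s" and s_eqv: "z \<in> L \<Longrightarrow> DL z s = 0"
begin

definition cS :: "'h \<Rightarrow> ('g, 'h) formal_map" where "cS \<xi> = (\<lambda>\<alpha>. coad G (fst (s \<alpha>)) \<xi>)"

definition rS :: "'g \<Rightarrow> 'h \<Rightarrow> ('g, 'k) formal_map" where "rS b \<xi> = Pr (K \<xi>) (pd b s)"

text \<open>The transpose of the differential of s, included in \<gg>. Subtracting it from
  \<open>dd \<xi> s\<close> gives \<open>uS\<close>, the first-order part of \<open>theta\<close> in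
  s, whose bilinear form is skew.\<close>

definition dst :: "'h \<Rightarrow> ('g, 'g \<times> 'h) formal_map" where "dst \<xi> = (\<Sum>b\<in>B. fprod sd (rS b \<xi>) (J b))"

definition uS :: "'h \<Rightarrow> ('g, 'g \<times> 'h) formal_map" where "uS \<xi> = dd \<xi> s - dst \<xi>"

lemma gval_dst: "gval (dst \<xi>)"
  by (simp add: dst_def gval_simps gval_fprod gval_J)

lemma gval_uS: "gval (uS \<xi>)"
  by (simp add: uS_def gval_simps gval_dst gval_dv s_gval)

lemma Pr_K_dst: "Pr (K \<zeta>) (dst \<xi>) = Pr (K \<xi>) (dd \<zeta> s)"
proof -
  have "Pr (K \<zeta>) (dst \<xi>) = (\<Sum>b\<in>B. rS b \<xi> \<odot> const \<langle>\<zeta>, b\<rangle>)"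
  proof -
    have "Pr (K \<zeta>) (J b) = (const \<langle>\<zeta>, b\<rangle> :: ('g, 'k) formal_map)" for b
      by (simp add: Pr_K J_def const_def fun_eq_iff pair_simps)
    then show ?thesis by (simp add: dst_def Pr_simps Pr_scale)
  qed
  also have "\<dots> = Pr (K \<xi>) (dd \<zeta> s)"
    unfolding Pr_commute[of "K \<xi>" "dd \<zeta> s"] Pr_dv restr_const rS_def Pr_commute[of "K \<xi>"]
    by (simp add: fmul_commute)
  finally show ?thesis .
qed

text \<open>The differential of an equivariant map is equivariant, and its transpose inherits this
  because the action of z moves from one argument of the pairing to the other.\<close>

lemma DL_uS: "z \<in> L \<Longrightarrow> DL z (uS \<xi>) + uS (coad G z \<xi>) = 0"
proof -
  assume z: "z \<in> L"
  have dd: "DL z (dd \<xi> s) = - dd (coad G z \<xi>) s" for \<xi>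
    by (simp add: DL_dd z s_eqv Dd_simps)
  have "DL z (dst \<xi>) + dst (coad G z \<xi>) = 0"
  proof (rule gval_eqI)
    show "gval (DL z (dst \<xi>) + dst (coad G z \<xi>))"
      by (simp add: DL_def gval_simps gval_dst gval_dv gval_Br gval_J)
    fix \<zeta>
    have "Pr (K \<zeta>) (DL z (dst \<xi>)) = Dk (vf z) (Pr (K \<zeta>) (dst \<xi>)) - Pr (DL z (K \<zeta>)) (dst \<xi>)"
      by (simp add: Dk_Pr_DL)
    also have "\<dots> = - Pr (K (coad G z \<xi>)) (dd \<zeta> s)"
      unfolding Pr_DL_K[OF gval_dst] Pr_K_dst Dk_Pr_DL dd
      by (simp add: Pr_DL_K gval_dv s_gval Pr_simps)
    finally show "Pr (K \<zeta>) (DL z (dst \<xi>) + dst (coad G z \<xi>)) = 0"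
      by (simp add: Pr_simps Pr_K_dst)
  qed
  then show ?thesis by (simp add: uS_def DL_simps dd algebra_simps neg_eq_iff_add_eq_0)
qed

lemma dv_cS: "dv sh B v (cS \<xi>) = (\<lambda>\<alpha>. coad G (fst (Dd v s \<alpha>)) \<xi>)"
  unfolding cS_def
  by (rule dv_map[of sd sh "\<lambda>x. coad G (fst x) \<xi>"]) (simp add: linearI vs_d vs_h coad_simps sd_simps)

text \<open>Equivariance of s replaces its derivative along the coadjoint field by -[z; s]; the
  Jacobi identity in \<gg> then exchanges the two coadjoint operators.\<close>

lemma dv_vf_cS:
  assumes "z \<in> L" shows "dv sh B (vf z) (cS \<xi>) + cS (coad G z \<xi>) = (\<lambda>\<alpha>. coad G z (cS \<xi> \<alpha>))"
proof
  fix \<alpha>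
  have "DL z s \<alpha> = 0" by (simp add: s_eqv assms)
  moreover have "Br (J z) s \<alpha> = ([z; fst (s \<alpha>)], 0)"
    unfolding J_def using s_gval 
    by (subst fprod_const_left) (simp_all add: br_simps zero_prod_def[symmetric] fst_br_fst gval_def)
  ultimately have *: "fst (Dd (vf z) s \<alpha>) = - [z; fst (s \<alpha>)]"
    by (simp add: DL_def prod_eq_iff eq_neg_iff_add_eq_0)
  have "[z; [x; y]] = [[z; x]; y] + [x; [z; y]]" for x y
  proof -
    have "br (z, 0) (br (x, 0) (y, 0)) = br (br (z, 0) (x, 0)) (y, 0) + br (x, 0) (br (z, 0) (y, 0))"
      by (rule br_jacobi)
    then show ?thesis by (simp add: fst_br_fst)
  qed
  then show "(dv sh B (vf z) (cS \<xi>) + cS (coad G z \<xi>)) \<alpha> = coad G z (cS \<xi> \<alpha>)"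
    by (intro h_eqI) (simp add: dv_cS[unfolded cS_def] * cS_def coad pair_simps lbr_simps)
qed

end

text \<open>Abstracts the graph of a linear map from the dual of \<gg> to \<gg> that depends
  formally on p. The dual component of \<open>e \<xi>\<close> is constant, so every derivative of e
  is \<gg>-valued.\<close>

locale dyn_section = red_qb G L M B
  for G :: "('k::{real_normed_field, euclidean_space},
               'g::ab_group_add, 'h::ab_group_add) quasi_bialgebra" (structure) and L M B +
  fixes e :: "'h \<Rightarrow> ('g, 'g \<times> 'h) formal_map"
  assumes e_add: "e (\<xi> + \<eta>) = e \<xi> + e \<eta>"
    and e_scale: "e (sh c \<xi>) \<alpha> = sd c (e \<xi> \<alpha>)"
    and e_snd: "snd (e \<xi> \<alpha>) = const \<xi> \<alpha>"
begin

lemma linfam_e: "linfam e" by (simp add: linfam_def e_add)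

lemma Dd_ext_e: "Dd v (ext e \<mu>) = ext (\<lambda>x. Dd v (e x)) \<mu> + ext e (dv sh B v \<mu>)"
  by (rule dv_ext) (simp_all add: linfam_e biadd_sd biadd_sh e_scale)

lemma gval_pd_e: "gval (pd b (e \<xi>))"
proof -
  have "snd (nsc n x) = nsc n (snd x)" for n and x :: "'g \<times> 'h"
    by (rule nsc_hom) simp_all
  then show ?thesis by (simp add: gval_def pd_def e_snd const_def)
qed

lemma gval_dv_e: "gval (Dd v (e \<xi>))"
  by (simp add: dv_def gval_simps gval_fprod gval_pd_e)

lemma snd_ext_e: "snd (ext e \<mu> \<alpha>) = \<mu> \<alpha>"
proof -
  have "snd (ext e \<mu> \<alpha>) = (\<Sum>(\<beta>,\<gamma>) | \<beta> + \<gamma> = \<alpha>. if \<gamma> = {#} then \<mu> \<beta> else 0)"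
    by (simp add: ext_def snd_sum e_snd split_def const_def)
  then show ?thesis by (subst (asm) sum_splits_swap) (simp add: sum_splits_delta1)
qed

lemma Pr_gval_e: "gval f \<Longrightarrow> Pr f (e \<zeta>) = Pr (K \<zeta>) f"
proof -
  assume f: "gval f"
  have "gval (e \<zeta> - K \<zeta>)" by (simp add: gval_def e_snd K_def const_def)
  from Pr_gval[OF f this] show ?thesis by (simp add: Pr_simps Pr_commute[of _ "K \<zeta>"])
qed

text \<open>\<open>V\<close> measures the failure of equivariance, and \<open>F\<close> that of the dynamical Yang-Baxter equation.\<close>

definition V :: "'g \<Rightarrow> 'h \<Rightarrow> ('g, 'g \<times> 'h) formal_map" where
  "V z \<xi> = DL z (e \<xi>) + e (coad G z \<xi>)"

definition A :: "'h \<Rightarrow> 'h \<Rightarrow> 'h \<Rightarrow> ('g, 'k) formal_map" where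
  "A \<xi> \<eta> \<zeta> = Pr (dd \<xi> (e \<eta>)) (e \<zeta>)"

definition T :: "'h \<Rightarrow> 'h \<Rightarrow> 'h \<Rightarrow> ('g, 'k) formal_map" where
  "T \<xi> \<eta> \<zeta> = Pr (Br (e \<xi>) (e \<eta>)) (e \<zeta>)"

definition F :: "'h \<Rightarrow> 'h \<Rightarrow> 'h \<Rightarrow> ('g, 'k) formal_map" where
  "F \<xi> \<eta> \<zeta> = A \<xi> \<eta> \<zeta> + A \<eta> \<zeta> \<xi> + A \<zeta> \<xi> \<eta> - T \<xi> \<eta> \<zeta>"

lemma T_rot: "T \<eta> \<zeta> \<xi> = T \<xi> \<eta> \<zeta>"
  by (simp add: T_def Pr_invariant Pr_commute[of _ "e \<xi>"])

end

locale gauge_section = gauge_field G L M B s + dyn_section G L M B e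
  for G :: "('k::{real_normed_field, euclidean_space},
               'g::ab_group_add, 'h::ab_group_add) quasi_bialgebra" (structure) and L M B s e
begin

text \<open>The velocity of \<open>e\<close> under the gauge flow generated by \<open>s\<close>.\<close>

definition e' :: "'h \<Rightarrow> ('g, 'g \<times> 'h) formal_map" where
  "e' \<xi> = Br s (e \<xi>) + ext e (cS \<xi>) + uS \<xi>"

text \<open>The bracket with s changes the dual component by -\<open>cS \<xi>\<close>, and the term
  \<open>ext e (cS \<xi>)\<close> compensates this exactly. The flow therefore stays among
  graphs.\<close>

lemma gval_aux: "gval (Br s (e \<xi>) + ext e (cS \<xi>))"
proof -
  have "snd (Br s (e \<xi>) \<alpha>) = - cS \<xi> \<alpha>" for \<alpha>
  proof -
    have "snd (Br s (e \<xi>) \<alpha>) = (\<Sum>(\<beta>,\<gamma>) | \<beta> + \<gamma> = \<alpha>. if \<gamma> = {#} then - cS \<xi> \<beta> else 0)"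
      using s_gval by (auto simp add: fprod_splits snd_sum e_snd split_def const_def snd_br_fst gval_def cS_def
         biadd_simps[OF biadd_coad] intro!: sum.cong)
    then show ?thesis by (subst (asm) sum_splits_swap) (simp add: sum_splits_delta1)
  qed
  then show ?thesis by (simp add: gval_def snd_ext_e)
qed

lemma gval_e': "gval (e' \<xi>)"
  unfolding e'_def by (rule gval_simps(1)[OF gval_aux gval_uS])

lemma Pr_uS: "Pr (uS \<eta>) (e \<zeta>) = Pr (dd \<eta> s) (e \<zeta>) - Pr (dd \<zeta> s) (e \<eta>)"
proof -
  have "Pr (dst \<eta>) (e \<zeta>) = Pr (dd \<zeta> s) (e \<eta>)"
    by (simp add: Pr_gval_e gval_dst gval_dv s_gval Pr_K_dst)
  then show ?thesis by (simp add: uS_def Pr_simps)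
qed

text \<open>The action of z is a derivation of the bracket and annihilates s, so the defect obeys
  the linear part of the law for e; the inhomogeneous term \<open>uS\<close> is equivariant by
  itself and contributes nothing.\<close>

lemma V_flow:
  assumes z: "z \<in> L"
  shows "DL z (e' \<xi>) + e' (coad G z \<xi>) = Br s (V z \<xi>) + ext (V z) (cS \<xi>)"
proof -
  have 1: "DL z (ext e (cS \<xi>)) = ext (\<lambda>x. DL z (e x)) (cS \<xi>) + ext e (dv sh B (vf z) (cS \<xi>))"
    by (simp add: DL_def Dd_ext_e fprod_ext_right[OF biadd_br] ext_fam)
  have 2: "ext (\<lambda>x. e (coad G z x)) (cS \<xi>) = ext e (\<lambda>\<alpha>. coad G z (cS \<xi> \<alpha>))"
    by (simp add: ext_def fun_eq_iff)
  have 3: "(\<lambda>\<alpha>. coad G z (cS \<xi> \<alpha>)) = dv sh B (vf z) (cS \<xi>) + cS (coad G z \<xi>)"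
    by (rule dv_vf_cS[OF z, symmetric])
  have "DL z (e' \<xi>) + e' (coad G z \<xi>) = Br s (V z \<xi>) + ext (V z) (cS \<xi>) + (DL z (uS \<xi>) + uS (coad G z \<xi>))"
    by (simp add: e'_def V_def[abs_def] DL_simps DL_Br s_eqv[OF z] Br_simps 1 ext_fam 2 3 ext_arg[OF linfam_e])
  then show ?thesis by (simp add: DL_uS[OF z])
qed

end

section \<open>The Bianchi identity\<close>

locale dyn_eqv = dyn_section G L M B e
  for G :: "('k::{real_normed_field, euclidean_space},
               'g::ab_group_add, 'h::ab_group_add) quasi_bialgebra" (structure) and L M B e +
  assumes e_iso: "Pr (e \<xi>) (e \<eta>) = 0" and e_eqv: "z \<in> L \<Longrightarrow> V z \<xi> = 0"
begin

lemma DL_e: "z \<in> L \<Longrightarrow> DL z (e \<xi>) = - e (coad G z \<xi>)"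
  using e_eqv[of z \<xi>] by (simp add: V_def eq_neg_iff_add_eq_0)

lemma F_eqv:
  assumes "z \<in> L"
  shows "Dk (vf z) (F \<xi> \<eta> \<zeta>) + F (coad G z \<xi>) \<eta> \<zeta> + F \<xi> (coad G z \<eta>) \<zeta> + F \<xi> \<eta> (coad G z \<zeta>) = 0"
  by (simp add: F_def A_def T_def Dk_simps Dk_Pr_DL DL_dd DL_Br DL_e assms Pr_simps Br_simps Dd_simps)

text \<open>Derivative of the isotropy relation in direction \<xi>.\<close>

lemma A_skew: "A \<xi> \<zeta> \<eta> = - A \<xi> \<eta> \<zeta>"
proof -
  have "dk \<xi> (Pr (e \<eta>) (e \<zeta>)) = 0" by (simp only: e_iso) (simp add: Dk_simps)
  then show ?thesis
    by (simp add: A_def Dk_Pr Pr_commute[of "e \<eta>" "dd \<xi> (e \<zeta>)"] eq_neg_iff_add_eq_0 add.commute)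
qed

lemma T_skew: "T \<eta> \<xi> \<zeta> = - T \<xi> \<eta> \<zeta>"
  unfolding T_def by (subst Br_skew) (simp add: Pr_simps)

lemma Pr_ext_e: "Pr (ext e \<mu>) (ext e \<nu>) = 0"
  by (simp add: fprod_ext_left[OF biadd_pr] fprod_ext_right[OF biadd_pr] e_iso)

text \<open>Equivariance trades the bracket with an element of L for a derivative along its
  coadjoint field; the remaining term, a section again, vanishes by isotropy.\<close>

lemma Pr_Br_J: "c \<in> B \<Longrightarrow> Pr (Br (J c) (e \<eta>)) (e \<zeta>) = - (\<Sum>b\<in>B. vf c b \<odot> Pr (pd b (e \<eta>)) (e \<zeta>))"
proof -
  assume c: "c \<in> B"
  have "Br (J c) (e \<eta>) = - e (coad G c \<eta>) - Dd (vf c) (e \<eta>)"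
    using DL_e[OF B_L[OF c], of \<eta>] by (simp add: DL_def algebra_simps)
  then show ?thesis by (simp add: Pr_simps e_iso Pr_dv)
qed

text \<open>With \<open>c\<close> the dual component of the bracket, \<open>C\<close> splits into
  the section \<open>ext e (c \<xi> \<eta>)\<close> and a \<gg>-valued remainder. Sections are
  isotropic and so is \<gg>, hence only cross terms survive when two brackets are paired.\<close>

definition C :: "'h \<Rightarrow> 'h \<Rightarrow> ('g, 'g \<times> 'h) formal_map" where "C \<xi> \<eta> = Br (e \<xi>) (e \<eta>)"
definition c :: "'h \<Rightarrow> 'h \<Rightarrow> ('g, 'h) formal_map" where "c \<xi> \<eta> = (\<lambda>\<alpha>. snd (C \<xi> \<eta> \<alpha>))"

lemma gval_C: "gval (C \<xi> \<eta> - ext e (c \<xi> \<eta>))"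
  by (simp add: gval_def snd_ext_e c_def)

lemma Pr_gval_C: "gval f \<Longrightarrow> Pr f (ext e (c \<xi> \<eta>)) = Pr f (C \<xi> \<eta>)"
  using Pr_gval[OF _ gval_C, of f \<xi> \<eta>] by (simp add: Pr_simps)

definition \<Theta> :: "'h \<Rightarrow> 'h \<Rightarrow> 'h \<Rightarrow> 'h \<Rightarrow> ('g, 'k) formal_map" where
  "\<Theta> \<xi> \<eta> \<zeta> \<mu> = Pr (Dd (restr G (c \<xi> \<eta>)) (e \<zeta>)) (e \<mu>)"

definition FF :: "'h \<Rightarrow> 'h \<Rightarrow> 'h \<Rightarrow> 'h \<Rightarrow> ('g, 'k) formal_map" where
  "FF \<xi> \<eta> \<zeta> \<mu> = ext (F \<zeta> \<mu>) (c \<xi> \<eta>) + ext (F \<xi> \<eta>) (c \<zeta> \<mu>)"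

text \<open>\<Theta> is a contraction of the Poisson tensor with first derivatives belonging to
  (\<xi>, \<eta>) and to (\<zeta>, \<mu>); exchanging the two pairs transposes the tensor.\<close>

lemma \<Theta>_skew: "\<Theta> \<xi> \<eta> \<zeta> \<mu> + \<Theta> \<zeta> \<mu> \<xi> \<eta> = 0"
proof -
  let ?k = "\<lambda>\<xi> \<eta> a. Pr (pd a (e \<xi>)) (e \<eta>)"
  \<comment> \<open>The component of \<open>c\<close> at b is read off by pairing with
    \<open>J b\<close>; invariance then brings \<open>J b\<close> into the bracket, where
    \<open>Pr_Br_J\<close> applies.\<close>
  have r: "restr G (c \<xi> \<eta>) b = - (\<Sum>a\<in>B. vf b a \<odot> ?k \<xi> \<eta> a)" if "b \<in> B" for \<xi> \<eta> b
  proof -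
    have "restr G (c \<xi> \<eta>) b = Pr (C \<xi> \<eta>) (J b)" by (simp add: Pr_J restr_def c_def)
    also have "\<dots> = Pr (Br (J b) (e \<xi>)) (e \<eta>)"
      unfolding C_def by (simp add: Pr_invariant Pr_commute[of _ "J b"])
    finally show ?thesis using Pr_Br_J[OF that] by simp
  qed
  have t: "\<Theta> \<xi> \<eta> \<zeta> \<mu> = - (\<Sum>b\<in>B. \<Sum>a\<in>B. vf b a \<odot> ?k \<xi> \<eta> a \<odot> ?k \<zeta> \<mu> b)" for \<xi> \<eta> \<zeta> \<mu>
    unfolding \<Theta>_def Pr_dv by (simp add: r fmul_simps sum_negf)
  have "\<Theta> \<zeta> \<mu> \<xi> \<eta> = - (\<Sum>a\<in>B. \<Sum>b\<in>B. vf b a \<odot> ?k \<zeta> \<mu> a \<odot> ?k \<xi> \<eta> b)"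
    unfolding t by (subst sum.swap) (rule refl)
  also have "\<dots> = - (\<Sum>a\<in>B. \<Sum>b\<in>B. - (vf a b \<odot> ?k \<xi> \<eta> b \<odot> ?k \<zeta> \<mu> a))"
  proof -
    have "vf b a \<odot> ?k \<zeta> \<mu> a \<odot> ?k \<xi> \<eta> b = - (vf a b \<odot> ?k \<xi> \<eta> b \<odot> ?k \<zeta> \<mu> a)" if "a \<in> B" "b \<in> B" for a b
      using vf_skew[OF that(2,1)] fmul_commute[of "?k \<zeta> \<mu> a" "?k \<xi> \<eta> b"] by (simp add: fmul_simps fmul_assoc)
    then show ?thesis by (intro arg_cong[where f = uminus] sum.cong) auto
  qed
  also have "\<dots> = - \<Theta> \<xi> \<eta> \<zeta> \<mu>" by (simp add: t sum_negf)
  finally show ?thesis by simp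
qed

definition N :: "'h \<Rightarrow> 'h \<Rightarrow> 'h \<Rightarrow> 'h \<Rightarrow> ('g, 'k) formal_map" where
  "N \<xi> \<eta> \<zeta> \<mu> = Pr (dd \<xi> (e \<eta>)) (C \<zeta> \<mu>)"

lemma N_skew: "N \<xi> \<eta> \<mu> \<zeta> = - N \<xi> \<eta> \<zeta> \<mu>"
  unfolding N_def C_def by (subst Br_skew) (simp add: Pr_simps)

text \<open>The definition of F is solved for T and the formal covector
  \<open>c \<xi> \<eta>\<close> is put in the last place. Where that covector is paired with a
  derivative of e, \<open>c\<close> may be replaced by \<open>C\<close>, giving N; where it is the
  direction of differentiation, it gives \<Theta>.\<close>

lemma ext_T: "ext (T \<zeta> \<mu>) (c \<xi> \<eta>) = N \<zeta> \<mu> \<xi> \<eta> - N \<mu> \<zeta> \<xi> \<eta> + \<Theta> \<xi> \<eta> \<zeta> \<mu> - ext (F \<zeta> \<mu>) (c \<xi> \<eta>)"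
proof -
  have T: "T \<zeta> \<mu> = (\<lambda>x. A \<zeta> \<mu> x - A \<mu> \<zeta> x + A x \<zeta> \<mu> - F \<zeta> \<mu> x)"
  proof
    fix x show "T \<zeta> \<mu> x = A \<zeta> \<mu> x - A \<mu> \<zeta> x + A x \<zeta> \<mu> - F \<zeta> \<mu> x"
      using A_skew[of \<mu> x \<zeta>] by (simp add: F_def)
  qed
  have 1: "ext (A x y) (c \<xi> \<eta>) = N x y \<xi> \<eta>" for x y
  proof -
    have "ext (A x y) (c \<xi> \<eta>) = Pr (dd x (e y)) (ext e (c \<xi> \<eta>))"
      by (simp add: fprod_ext_right[OF biadd_pr] A_def[abs_def])
    then show ?thesis by (simp add: Pr_gval_C gval_dv_e N_def)
  qed
  have 2: "ext (\<lambda>x. A x \<zeta> \<mu>) (c \<xi> \<eta>) = \<Theta> \<xi> \<eta> \<zeta> \<mu>"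
    unfolding A_def \<Theta>_def fprod_ext_left[OF biadd_pr, symmetric] ext_dv_restr[OF biadd_sd] ..
  show ?thesis unfolding T ext_fam 2 by (simp add: 1)
qed

text \<open>The first bracket is split into section and remainder; the remainder sees only the
  section part of the second bracket. Both cross terms are values of \<open>ext_T\<close>, and their
  \<Theta>-terms cancel by \<open>\<Theta>_skew\<close>.\<close>

lemma Pr_C_C: "Pr (C \<xi> \<eta>) (C \<zeta> \<mu>) = N \<zeta> \<mu> \<xi> \<eta> - N \<mu> \<zeta> \<xi> \<eta> + N \<xi> \<eta> \<zeta> \<mu> - N \<eta> \<xi> \<zeta> \<mu> - FF \<xi> \<eta> \<zeta> \<mu>"
proof -
  let ?g = "C \<xi> \<eta> - ext e (c \<xi> \<eta>)"
  have "Pr (C \<xi> \<eta>) (C \<zeta> \<mu>) = Pr (ext e (c \<xi> \<eta>)) (C \<zeta> \<mu>) + Pr ?g (C \<zeta> \<mu>)"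
    by (simp add: Pr_simps)
  also have "Pr ?g (C \<zeta> \<mu>) = Pr ?g (ext e (c \<zeta> \<mu>))"
    by (simp add: Pr_gval_C gval_C)
  also have "\<dots> = Pr (C \<xi> \<eta>) (ext e (c \<zeta> \<mu>))"
    by (simp add: Pr_simps Pr_ext_e)
  also have "\<dots> = ext (T \<xi> \<eta>) (c \<zeta> \<mu>)"
    by (simp add: fprod_ext_right[OF biadd_pr] T_def[abs_def] C_def)
  also have "Pr (ext e (c \<xi> \<eta>)) (C \<zeta> \<mu>) = ext (T \<zeta> \<mu>) (c \<xi> \<eta>)"
    by (subst Pr_commute) (simp add: fprod_ext_right[OF biadd_pr] T_def[abs_def] C_def)
  finally show ?thesis using \<Theta>_skew[of \<xi> \<eta> \<zeta> \<mu>]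
    by (simp add: ext_T FF_def fun_eq_iff algebra_simps)
qed

text \<open>The Jacobi identity of three sections, paired with a fourth; invariance moves the outer
  bracket onto the fourth section.\<close>

lemma C_jacobi: "Pr (C \<xi> \<eta>) (C \<zeta> \<mu>) + Pr (C \<eta> \<zeta>) (C \<xi> \<mu>) + Pr (C \<zeta> \<xi>) (C \<eta> \<mu>) = 0"
proof -
  let ?x = "e \<xi>" and ?y = "e \<eta>" and ?z = "e \<zeta>"
  have "Br (Br ?x ?y) ?z + Br (Br ?y ?z) ?x + Br (Br ?z ?x) ?y = 0"
    using Br_jacobi[of ?x ?y ?z] Br_skew[of "Br ?y ?z" ?x] Br_skew[of "Br ?z ?x" ?y] Br_skew[of ?z ?x]
    by (simp add: Br_simps)
  then have "Pr (Br (Br ?x ?y) ?z + Br (Br ?y ?z) ?x + Br (Br ?z ?x) ?y) (e \<mu>) = 0"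
    by (simp only: Pr_simps)
  then show ?thesis by (simp only: Pr_simps Pr_invariant[of "Br _ _"] C_def)
qed

lemma dk_T: "dk \<mu> (T \<xi> \<eta> \<zeta>) = N \<mu> \<xi> \<eta> \<zeta> + N \<mu> \<eta> \<zeta> \<xi> + N \<mu> \<zeta> \<xi> \<eta>"
proof -
  have "dk \<mu> (T \<xi> \<eta> \<zeta>) = Pr (Br (dd \<mu> (e \<xi>)) (e \<eta>)) (e \<zeta>) + Pr (Br (e \<xi>) (dd \<mu> (e \<eta>))) (e \<zeta>)
      + Pr (Br (e \<xi>) (e \<eta>)) (dd \<mu> (e \<zeta>))"
    by (simp add: T_def Dk_Pr Dd_Br Pr_simps)
  also have "Pr (Br (dd \<mu> (e \<xi>)) (e \<eta>)) (e \<zeta>) = N \<mu> \<xi> \<eta> \<zeta>"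
    by (simp add: Pr_invariant N_def C_def)
  also have "Pr (Br (e \<xi>) (dd \<mu> (e \<eta>))) (e \<zeta>) = N \<mu> \<eta> \<zeta> \<xi>"
    by (subst Pr_invariant, subst Pr_commute, subst Pr_invariant) (simp add: N_def C_def)
  also have "Pr (Br (e \<xi>) (e \<eta>)) (dd \<mu> (e \<zeta>)) = N \<mu> \<zeta> \<xi> \<eta>"
    by (subst Pr_commute) (simp add: N_def C_def)
  finally show ?thesis .
qed

definition H :: "'h \<Rightarrow> 'h \<Rightarrow> 'h \<Rightarrow> 'h \<Rightarrow> ('g, 'k) formal_map" where
  "H \<mu> \<xi> \<eta> \<zeta> = Pr (dd \<mu> (dd \<xi> (e \<eta>))) (e \<zeta>)"

lemma dk_A: "dk \<mu> (A \<xi> \<eta> \<zeta>) = H \<mu> \<xi> \<eta> \<zeta>"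
  by (simp add: A_def H_def Dk_Pr Pr_gval gval_dv_e)

lemma H_commute: "H \<xi> \<mu> \<eta> \<zeta> = H \<mu> \<xi> \<eta> \<zeta>"
  by (simp add: H_def dv_dir_commute[OF vs_d, of \<xi>])

lemma H_skew: "H \<mu> \<xi> \<zeta> \<eta> = - H \<mu> \<xi> \<eta> \<zeta>"
  by (simp add: dk_A[symmetric] A_skew[of \<xi> \<zeta>] Dk_simps)

text \<open>In the exterior derivative of F the second derivatives H cancel, being symmetric in the
  directions and skew in the sections. The N-terms are those of \<open>C_jacobi\<close> expanded by
  \<open>Pr_C_C\<close>, and the terms \<open>FF\<close> are what the expansion leaves over.\<close>

lemma bianchi:
  "dk \<xi> (F \<eta> \<zeta> \<mu>) - dk \<eta> (F \<xi> \<zeta> \<mu>) + dk \<zeta> (F \<xi> \<eta> \<mu>) - dk \<mu> (F \<xi> \<eta> \<zeta>) =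
   - (FF \<xi> \<eta> \<zeta> \<mu> + FF \<eta> \<zeta> \<xi> \<mu> + FF \<zeta> \<xi> \<eta> \<mu>)"
proof
  fix \<alpha>
  have dk_F: "dk x (F y z w) = H x y z w + H x z w y + H x w y z - (N x y z w + N x z w y + N x w y z)" for x y z w
    by (simp add: F_def Dk_simps dk_A dk_T)
  have H1: "H x y z w \<alpha> = H y x z w \<alpha>" for x y z w by (simp only: H_commute[of x y])
  have H2: "H x y z w \<alpha> = - H x y w z \<alpha>" for x y z w by (simp only: H_skew[of x y z w] uminus_apply)
  have N: "N x y z w \<alpha> = - N x y w z \<alpha>" for x y z w by (simp only: N_skew[of x y z w] uminus_apply)
  have CC: "Pr (C \<xi> \<eta>) (C \<zeta> \<mu>) \<alpha> + Pr (C \<eta> \<zeta>) (C \<xi> \<mu>) \<alpha> + Pr (C \<zeta> \<xi>) (C \<eta> \<mu>) \<alpha> = 0"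
    using fun_cong[OF C_jacobi[of \<xi> \<eta> \<zeta> \<mu>], of \<alpha>] by simp
  show "(dk \<xi> (F \<eta> \<zeta> \<mu>) - dk \<eta> (F \<xi> \<zeta> \<mu>) + dk \<zeta> (F \<xi> \<eta> \<mu>) - dk \<mu> (F \<xi> \<eta> \<zeta>)) \<alpha> =
   (- (FF \<xi> \<eta> \<zeta> \<mu> + FF \<eta> \<zeta> \<xi> \<mu> + FF \<zeta> \<xi> \<eta> \<mu>)) \<alpha>"
    using CC H1[of \<eta> \<xi>] H1[of \<zeta> \<xi>] H1[of \<mu> \<xi>] H1[of \<zeta> \<eta>] H1[of \<mu> \<eta>] H1[of \<mu> \<zeta>]
      H2[of _ _ \<xi> \<eta>] H2[of _ _ \<xi> \<zeta>] H2[of _ _ \<xi> \<mu>] H2[of _ _ \<eta> \<zeta>] H2[of _ _ \<eta> \<mu>] H2[of _ _ \<zeta> \<mu>]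
      N[of _ _ \<xi> \<eta>] N[of _ _ \<xi> \<zeta>] N[of _ _ \<xi> \<mu>] N[of _ _ \<eta> \<zeta>] N[of _ _ \<eta> \<mu>] N[of _ _ \<zeta> \<mu>]
    unfolding Pr_C_C dk_F plus_fun_apply minus_apply uminus_apply
    by (simp add: algebra_simps)
qed

end

section \<open>The evolution of F along the gauge flow\<close>

locale gauge_eqv = gauge_section G L M B s e + dyn_eqv G L M B e
  for G :: "('k::{real_normed_field, euclidean_space},
               'g::ab_group_add, 'h::ab_group_add) quasi_bialgebra" (structure) and L M B s e
begin

lemma dk_Pr_e: "gval f \<Longrightarrow> dk \<xi> (Pr f (e \<zeta>)) = Pr (dd \<xi> f) (e \<zeta>)"
  by (simp add: Dk_Pr Pr_gval gval_dv_e)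

text \<open>By \<open>Pr_uS\<close> the bilinear form of \<open>uS\<close> is the exterior
  derivative of the one-form given by s, so the cyclic sum is a second exterior derivative.\<close>

lemma uS_F: "Pr (dd \<xi> (uS \<eta>)) (e \<zeta>) + Pr (dd \<eta> (uS \<zeta>)) (e \<xi>) + Pr (dd \<zeta> (uS \<xi>)) (e \<eta>) = 0"
proof -
  have *: "Pr (dd \<xi> (uS \<eta>)) (e \<zeta>) = Pr (dd \<xi> (dd \<eta> s)) (e \<zeta>) - Pr (dd \<xi> (dd \<zeta> s)) (e \<eta>)" for \<xi> \<eta> \<zeta>
  proof -
    have "dk \<xi> (Pr (uS \<eta>) (e \<zeta>)) = dk \<xi> (Pr (dd \<eta> s) (e \<zeta>)) - dk \<xi> (Pr (dd \<zeta> s) (e \<eta>))"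
      by (simp add: Pr_uS Dk_simps)
    then show ?thesis by (simp add: dk_Pr_e gval_uS gval_dv s_gval)
  qed
  show ?thesis unfolding * dv_dir_commute[OF vs_d, of \<eta> \<xi>] dv_dir_commute[OF vs_d, of \<zeta> \<eta>]
     dv_dir_commute[OF vs_d, of \<zeta> \<xi>] by simp
qed

text \<open>Equivariance of s expresses the components of \<open>cS \<xi>\<close> by the Poisson
  tensor and the derivatives of s. The bracket with \<open>dst \<xi>\<close> produces the same
  tensor through \<open>Pr_Br_J\<close>, with transposed indices and the opposite sign.\<close>

lemma dst_F: "Pr (Br (dst \<xi>) (e \<eta>)) (e \<zeta>) = ext (\<lambda>x. A x \<eta> \<zeta>) (cS \<xi>)"
proof -
  let ?k = "\<lambda>b. Pr (pd b (e \<eta>)) (e \<zeta>)"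
  have r: "restr G (cS \<xi>) b = (\<Sum>a\<in>B. vf b a \<odot> rS a \<xi>)" if b: "b \<in> B" for b
  proof -
    have "restr G (cS \<xi>) b = - Pr (Br (J b) s) (K \<xi>)"
    proof
      fix \<alpha>
      have "Br (J b) s \<alpha> = ([b; fst (s \<alpha>)], 0)"
        unfolding J_def using s_gval 
        by (subst fprod_const_left) (simp_all add: br_simps zero_prod_def[symmetric] fst_br_fst gval_def)
      then show "restr G (cS \<xi>) b \<alpha> = (- Pr (Br (J b) s) (K \<xi>)) \<alpha>"
        unfolding Pr_commute[of _ "K \<xi>"] Pr_K
        by (simp add: restr_def cS_def coad) (subst lbr_skew, simp add: pair_simps)
    qed
    also have "\<dots> = Pr (Dd (vf b) s) (K \<xi>)"
      using s_eqv[OF B_L[OF b]] by (simp add: DL_def eq_neg_iff_add_eq_0[symmetric] Pr_simps add.commute)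
    also have "\<dots> = (\<Sum>a\<in>B. vf b a \<odot> rS a \<xi>)"
      unfolding rS_def Pr_commute[of "K \<xi>"] Pr_dv ..
    finally show ?thesis .
  qed
  have "ext (\<lambda>x. A x \<eta> \<zeta>) (cS \<xi>) = Pr (Dd (restr G (cS \<xi>)) (e \<eta>)) (e \<zeta>)"
    unfolding A_def fprod_ext_left[OF biadd_pr, symmetric] ext_dv_restr[OF biadd_sd] ..
  also have "\<dots> = (\<Sum>b\<in>B. \<Sum>a\<in>B. vf b a \<odot> rS a \<xi> \<odot> ?k b)"
    by (simp add: Pr_dv r fmul_simps)
  also have "\<dots> = (\<Sum>a\<in>B. \<Sum>b\<in>B. vf b a \<odot> rS a \<xi> \<odot> ?k b)"
    by (rule sum.swap)
  also have "\<dots> = (\<Sum>a\<in>B. \<Sum>b\<in>B. - (rS a \<xi> \<odot> (vf a b \<odot> ?k b)))"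
  proof (intro sum.cong refl)
    fix a b assume "a \<in> B" "b \<in> B"
    from vf_skew[OF this(2,1)] show "vf b a \<odot> rS a \<xi> \<odot> ?k b = - (rS a \<xi> \<odot> (vf a b \<odot> ?k b))"
      by (simp add: fmul_simps fmul_assoc fmul_left_commute[of "vf a b"])
  qed
  also have "\<dots> = Pr (Br (dst \<xi>) (e \<eta>)) (e \<zeta>)"
    by (simp add: dst_def Br_simps Pr_simps Br_scale Pr_scale Pr_Br_J fmul_simps sum_negf)
  finally show ?thesis by simp
qed

definition A' :: "'h \<Rightarrow> 'h \<Rightarrow> 'h \<Rightarrow> ('g, 'k) formal_map" where
  "A' \<xi> \<eta> \<zeta> = Pr (dd \<xi> (e' \<eta>)) (e \<zeta>) + Pr (dd \<xi> (e \<eta>)) (e' \<zeta>)"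

definition T' :: "'h \<Rightarrow> 'h \<Rightarrow> 'h \<Rightarrow> ('g, 'k) formal_map" where
  "T' \<xi> \<eta> \<zeta> = Pr (Br (e' \<xi>) (e \<eta>) + Br (e \<xi>) (e' \<eta>)) (e \<zeta>) + Pr (Br (e \<xi>) (e \<eta>)) (e' \<zeta>)"

text \<open>A derivative of e and the velocity are both \<gg>-valued and pair to zero. The bracket
  of s with the derivative of e is moved to the last argument, where modulo \<gg> it acts as
  -\<open>ext e (cS \<zeta>)\<close>.\<close>

lemma A'_eq: "A' \<xi> \<eta> \<zeta> = Pr (Br (dd \<xi> s) (e \<eta>)) (e \<zeta>) + ext (\<lambda>x. A \<xi> x \<zeta>) (cS \<eta>)
     + ext (\<lambda>x. A \<xi> \<eta> x) (cS \<zeta>) + Pr (dd \<xi> (uS \<eta>)) (e \<zeta>)"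
proof -
  have "Pr (dd \<xi> (e \<eta>)) (e' \<zeta>) = 0" by (simp add: Pr_gval gval_dv_e gval_e')
  moreover have "dd \<xi> (e' \<eta>) = Br (dd \<xi> s) (e \<eta>) + Br s (dd \<xi> (e \<eta>)) + ext (\<lambda>x. dd \<xi> (e x)) (cS \<eta>)
     + ext e (dv sh B (restr G (const \<xi>)) (cS \<eta>)) + dd \<xi> (uS \<eta>)"
    by (simp add: e'_def Dd_simps Dd_Br Dd_ext_e)
  moreover have "Pr (Br s (dd \<xi> (e \<eta>))) (e \<zeta>) = ext (\<lambda>x. A \<xi> \<eta> x) (cS \<zeta>)"
  proof -
    have "Pr (Br s (dd \<xi> (e \<eta>))) (e \<zeta>) = - Pr (dd \<xi> (e \<eta>)) (Br s (e \<zeta>))"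
      by (subst Br_skew) (simp add: Pr_simps Pr_invariant)
    also have "\<dots> = Pr (dd \<xi> (e \<eta>)) (ext e (cS \<zeta>))"
      using Pr_gval[OF gval_dv_e gval_aux] by (simp add: Pr_simps neg_eq_iff_add_eq_0)
    finally show ?thesis by (simp add: fprod_ext_right[OF biadd_pr] A_def[abs_def])
  qed
  moreover have "Pr (ext e \<nu>) (e \<zeta>) = 0" for \<nu>
    by (simp add: fprod_ext_left[OF biadd_pr] e_iso)
  moreover have "Pr (ext (\<lambda>x. dd \<xi> (e x)) (cS \<eta>)) (e \<zeta>) = ext (\<lambda>x. A \<xi> x \<zeta>) (cS \<eta>)"
    by (simp add: fprod_ext_left[OF biadd_pr] A_def)
  ultimately show ?thesis by (simp add: A'_def Pr_simps)
qed

lemma Pr_Br_derivation: "Pr (Br (Br s x) y) z + Pr (Br x (Br s y)) z + Pr (Br x y) (Br s z) = 0"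
proof -
  have "Pr (Br s (Br x y)) z = - Pr (Br x y) (Br s z)"
    by (subst Br_skew) (simp add: Pr_simps Pr_invariant[of "Br x y"])
  then show ?thesis using Br_jacobi[of s x y] by (simp add: Pr_simps)
qed

lemma T'_eq: "T' \<xi> \<eta> \<zeta> = ext (\<lambda>x. T x \<eta> \<zeta>) (cS \<xi>) + ext (\<lambda>x. T \<xi> x \<zeta>) (cS \<eta>) + ext (\<lambda>x. T \<xi> \<eta> x) (cS \<zeta>)
   + Pr (Br (uS \<xi>) (e \<eta>)) (e \<zeta>) + Pr (Br (uS \<eta>) (e \<zeta>)) (e \<xi>) + Pr (Br (uS \<zeta>) (e \<xi>)) (e \<eta>)"
proof -
  have 1: "Pr (Br (e \<xi>) (uS \<eta>)) (e \<zeta>) = Pr (Br (uS \<eta>) (e \<zeta>)) (e \<xi>)" by (rule Pr_Br_rot)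
  have 2: "Pr (Br (e \<xi>) (e \<eta>)) (uS \<zeta>) = Pr (Br (uS \<zeta>) (e \<xi>)) (e \<eta>)" by (rule Pr_Br_rot[symmetric])
  have 3: "ext (\<lambda>x. T x \<eta> \<zeta>) (cS \<xi>) = Pr (Br (ext e (cS \<xi>)) (e \<eta>)) (e \<zeta>)"
    "ext (\<lambda>x. T \<xi> x \<zeta>) (cS \<eta>) = Pr (Br (e \<xi>) (ext e (cS \<eta>))) (e \<zeta>)"
    "ext (\<lambda>x. T \<xi> \<eta> x) (cS \<zeta>) = Pr (Br (e \<xi>) (e \<eta>)) (ext e (cS \<zeta>))"
    unfolding T_def by (simp_all add: fprod_ext_left[OF biadd_pr] fprod_ext_right[OF biadd_pr]
      fprod_ext_left[OF biadd_br] fprod_ext_right[OF biadd_br])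
  show ?thesis using Pr_Br_derivation[of "e \<xi>" "e \<eta>" "e \<zeta>"]
    unfolding T'_def 3 e'_def Pr_simps Br_simps 1 2 by (simp add: algebra_simps)
qed

text \<open>The bracket with s is a derivation preserving the invariant trilinear form; the
  remaining inhomogeneous terms cancel by \<open>dst_F\<close> and \<open>uS_F\<close>. What is left
  is linear in F.\<close>

lemma F_flow: "A' \<xi> \<eta> \<zeta> + A' \<eta> \<zeta> \<xi> + A' \<zeta> \<xi> \<eta> - T' \<xi> \<eta> \<zeta> =
  ext (\<lambda>x. F x \<eta> \<zeta>) (cS \<xi>) + ext (\<lambda>x. F \<xi> x \<zeta>) (cS \<eta>) + ext (\<lambda>x. F \<xi> \<eta> x) (cS \<zeta>)"
proof -
  have *: "Pr (Br (dd x s) (e y)) (e z) = Pr (Br (uS x) (e y)) (e z) + ext (\<lambda>w. A w y z) (cS x)" for x y z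
    by (simp add: uS_def Br_simps Pr_simps dst_F)
  show ?thesis using uS_F[of \<xi> \<eta> \<zeta>]
    unfolding A'_eq T'_eq F_def ext_fam * by (simp add: algebra_simps)
qed

end

section \<open>Differentiable paths\<close>

text \<open>Finite dimension in the form used by the calculus: a numbered finite family with linear
  coordinate functionals that reproduce every vector.\<close>

definition fdim :: "('k::field \<Rightarrow> 'v::ab_group_add \<Rightarrow> 'v) \<Rightarrow> bool" where
  "fdim s \<longleftrightarrow> vector_space s \<and> (\<exists>n c w. (\<forall>i. Vector_Spaces.linear s (*) (c i)) \<and>
     (\<forall>x. x = (\<Sum>i<(n::nat). s (c i x) (w i))))"

lemma fdimE:
  assumes "fdim s"
  obtains n c w where "\<And>i. Vector_Spaces.linear s (*) (c i)" "\<And>x. x = (\<Sum>i<(n::nat). s (c i x) (w i))"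
  using assms unfolding fdim_def by blast

lemma fdimI:
  assumes "vector_space s" "finite E" "\<And>e. Vector_Spaces.linear s (*) (c e)" "\<And>x. x = (\<Sum>e\<in>E. s (c e x) (w e))"
  shows "fdim s"
proof -
  obtain h where h: "bij_betw h {..<card E} E"
    using ex_bij_betw_nat_finite[OF assms(2)] by (auto simp: atLeast0LessThan)
  have "x = (\<Sum>i<card E. s (c (h i) x) (w (h i)))" for x
    by (rule trans[OF assms(4)[of x] sum.reindex_bij_betw[OF h, of "\<lambda>e. s (c e x) (w e)", symmetric]])
  then show ?thesis unfolding fdim_def
    using assms(1,3) by (intro conjI exI[of _ "card E"] exI[of _ "\<lambda>i. c (h i)"] exI[of _ "\<lambda>i. w (h i)"]) blast+
qed

lemma fdim_mult: "fdim ((*) :: 'k::field \<Rightarrow> 'k \<Rightarrow> 'k)"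
  by (rule fdimI[of _ "{1}" "\<lambda>_ x. x" "\<lambda>x. x"]) (simp_all add: linearI vector_space_mult)

lemma fdim_eqI:
  assumes "fdim s" "\<And>u. Vector_Spaces.linear s (*) u \<Longrightarrow> u x = u y"
  shows "x = y"
proof -
  from assms(1) obtain n c w where c: "\<And>i. Vector_Spaces.linear s (*) (c i)" "\<And>x. x = (\<Sum>i<(n::nat). s (c i x) (w i))"
    by (rule fdimE) blast
  have "(\<Sum>i<n. s (c i x) (w i)) = (\<Sum>i<n. s (c i y) (w i))" by (simp only: assms(2)[OF c(1)])
  then show ?thesis by (rule trans[OF c(2) trans[OF _ c(2)[symmetric]]])
qed

text \<open>The vector types carry no topology, so a path is differentiated after composition with
  each linear functional into the normed field. The interval is [0,1], one-sided at the
  ends.\<close>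

definition wderiv :: "('k::{real_normed_field, euclidean_space} \<Rightarrow> 'v::ab_group_add \<Rightarrow> 'v) \<Rightarrow> (real \<Rightarrow> 'v) \<Rightarrow> (real \<Rightarrow> 'v) \<Rightarrow> bool" where
  "wderiv s f f' \<longleftrightarrow> (\<forall>u. Vector_Spaces.linear s (*) u \<longrightarrow>
     (\<forall>\<tau>\<in>{0..1}. ((\<lambda>\<tau>. u (f \<tau>)) has_vector_derivative u (f' \<tau>)) (at \<tau> within {0..1})))"

lemma wderivD:
  "wderiv s f f' \<Longrightarrow> Vector_Spaces.linear s (*) u \<Longrightarrow> \<tau> \<in> {0..1} \<Longrightarrow>
   ((\<lambda>\<tau>. u (f \<tau>)) has_vector_derivative u (f' \<tau>)) (at \<tau> within {0..1})"
  by (simp add: wderiv_def)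

lemma wderiv_mult_iff:
  "wderiv (*) f f' \<longleftrightarrow> (\<forall>\<tau>\<in>{0..1}. (f has_vector_derivative f' \<tau>) (at \<tau> within {0..1}))"
proof
  assume "wderiv (*) f f'"
  from wderivD[OF this, of "\<lambda>x. x"] show "\<forall>\<tau>\<in>{0..1}. (f has_vector_derivative f' \<tau>) (at \<tau> within {0..1})"
    by (simp add: linearI vector_space_mult)
next
  assume f: "\<forall>\<tau>\<in>{0..1}. (f has_vector_derivative f' \<tau>) (at \<tau> within {0..1})"
  show "wderiv (*) f f'" unfolding wderiv_def
  proof (intro allI impI ballI)
    fix u :: "'a \<Rightarrow> 'a" and \<tau> :: real assume u: "Vector_Spaces.linear (*) (*) u" and \<tau>: "\<tau> \<in> {0..1}"
    define a where "a = u 1"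
    have a: "u x = x * a" for x using linear_scl[OF u, of x 1] by (simp only: mult_1_right a_def)
    show "((\<lambda>\<tau>. u (f \<tau>)) has_vector_derivative u (f' \<tau>)) (at \<tau> within {0..1})"
      unfolding a by (rule has_vector_derivative_mult_left[OF f[rule_format, OF \<tau>]])
  qed
qed

lemma wderiv_const: "vector_space s \<Longrightarrow> wderiv s (\<lambda>\<tau>. x) (\<lambda>\<tau>. 0)"
  by (auto simp: wderiv_def linear_simps)

lemma wderiv_add: "wderiv s f f' \<Longrightarrow> wderiv s g g' \<Longrightarrow> wderiv s (\<lambda>\<tau>. f \<tau> + g \<tau>) (\<lambda>\<tau>. f' \<tau> + g' \<tau>)"
  by (auto simp: wderiv_def linear_add intro!: has_vector_derivative_add)

lemma wderiv_diff: "wderiv s f f' \<Longrightarrow> wderiv s g g' \<Longrightarrow> wderiv s (\<lambda>\<tau>. f \<tau> - g \<tau>) (\<lambda>\<tau>. f' \<tau> - g' \<tau>)"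
  by (auto simp: wderiv_def linear_simps intro!: has_vector_derivative_diff)

lemma wderiv_sum:
  "vector_space s \<Longrightarrow> (\<And>i. i \<in> A \<Longrightarrow> wderiv s (f i) (f' i)) \<Longrightarrow>
   wderiv s (\<lambda>\<tau>. \<Sum>i\<in>A. f i \<tau>) (\<lambda>\<tau>. \<Sum>i\<in>A. f' i \<tau>)"
  by (induction A rule: infinite_finite_induct) (auto intro: wderiv_const wderiv_add)

lemma linear_comp: "Vector_Spaces.linear s t T \<Longrightarrow> Vector_Spaces.linear t r u \<Longrightarrow> Vector_Spaces.linear s r (\<lambda>x. u (T x))"
  by (simp add: Vector_Spaces.linear_iff)

lemma wderiv_map:
  assumes "Vector_Spaces.linear s t T" "wderiv s f f'"
  shows "wderiv t (\<lambda>\<tau>. T (f \<tau>)) (\<lambda>\<tau>. T (f' \<tau>))"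
  using assms(2) linear_comp[OF assms(1)] unfolding wderiv_def by blast

text \<open>Coordinates in the first factor turn the bilinear map into a finite sum of products of
  scalar functions, to which the product rule applies.\<close>

lemma wderiv_bilinear:
  assumes fin: "fdim s1" and vs: "vector_space s3"
    and m1: "\<And>y. Vector_Spaces.linear s1 s3 (\<lambda>x. m x y)" and m2: "\<And>x. Vector_Spaces.linear s2 s3 (m x)"
    and f: "wderiv s1 f f'" and g: "wderiv s2 g g'"
  shows "wderiv s3 (\<lambda>\<tau>. m (f \<tau>) (g \<tau>)) (\<lambda>\<tau>. m (f' \<tau>) (g \<tau>) + m (f \<tau>) (g' \<tau>))"
  unfolding wderiv_def
proof (intro allI impI ballI)
  fix u and \<tau> :: real assume u: "Vector_Spaces.linear s3 (*) u" and \<tau>: "\<tau> \<in> {0..1}"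
  from fin obtain n c w where c: "\<And>i. Vector_Spaces.linear s1 (*) (c i)" "\<And>x. x = (\<Sum>i<(n::nat). s1 (c i x) (w i))"
    by (rule fdimE) blast
  have *: "u (m x y) = (\<Sum>i<n. c i x * u (m (w i) y))" for x y
  proof -
    have "u (m x y) = u (m (\<Sum>i<n. s1 (c i x) (w i)) y)" using c(2)[of x] by (rule arg_cong)
    then show ?thesis by (simp add: linear_sum'[OF m1] linear_sum'[OF u] linear_scl[OF m1] linear_scl[OF u])
  qed
  have "((\<lambda>\<tau>. \<Sum>i<n. c i (f \<tau>) * u (m (w i) (g \<tau>))) has_vector_derivative
        (\<Sum>i<n. c i (f \<tau>) * u (m (w i) (g' \<tau>)) + c i (f' \<tau>) * u (m (w i) (g \<tau>)))) (at \<tau> within {0..1})"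
    by (intro has_vector_derivative_sum has_vector_derivative_mult wderivD[OF f c(1) \<tau>] 
        wderivD[OF g linear_comp[OF m2 u] \<tau>])
  then show "((\<lambda>\<tau>. u (m (f \<tau>) (g \<tau>))) has_vector_derivative u (m (f' \<tau>) (g \<tau>) + m (f \<tau>) (g' \<tau>))) (at \<tau> within {0..1})"
    by (simp only: sum.distrib *[symmetric] linear_add[OF u] add.commute)
qed

definition fderiv :: "('k::{real_normed_field, euclidean_space} \<Rightarrow> 'v::ab_group_add \<Rightarrow> 'v) \<Rightarrow>
    (real \<Rightarrow> ('a, 'v) formal_map) \<Rightarrow> (real \<Rightarrow> ('a, 'v) formal_map) \<Rightarrow> bool" where
  "fderiv s f f' \<longleftrightarrow> (\<forall>\<alpha>. wderiv s (\<lambda>\<tau>. f \<tau> \<alpha>) (\<lambda>\<tau>. f' \<tau> \<alpha>))"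

lemma fderiv_const: "vector_space s \<Longrightarrow> fderiv s (\<lambda>\<tau>. x) (\<lambda>\<tau>. 0)"
  by (simp add: fderiv_def wderiv_const)

lemma fderiv_add: "fderiv s f f' \<Longrightarrow> fderiv s g g' \<Longrightarrow> fderiv s (\<lambda>\<tau>. f \<tau> + g \<tau>) (\<lambda>\<tau>. f' \<tau> + g' \<tau>)"
  by (simp add: fderiv_def wderiv_add)

lemma fderiv_diff: "fderiv s f f' \<Longrightarrow> fderiv s g g' \<Longrightarrow> fderiv s (\<lambda>\<tau>. f \<tau> - g \<tau>) (\<lambda>\<tau>. f' \<tau> - g' \<tau>)"
  by (simp add: fderiv_def wderiv_diff)

lemma fderiv_sum:
  "vector_space s \<Longrightarrow> (\<And>i. i \<in> A \<Longrightarrow> fderiv s (f i) (f' i)) \<Longrightarrow>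
   fderiv s (\<lambda>\<tau>. \<Sum>i\<in>A. f i \<tau>) (\<lambda>\<tau>. \<Sum>i\<in>A. f' i \<tau>)"
  by (simp add: fderiv_def sum_fun_apply wderiv_sum)

lemma fderiv_map:
  "Vector_Spaces.linear s t T \<Longrightarrow> fderiv s f f' \<Longrightarrow> fderiv t (\<lambda>\<tau> \<alpha>. T (f \<tau> \<alpha>)) (\<lambda>\<tau> \<alpha>. T (f' \<tau> \<alpha>))"
  unfolding fderiv_def by (intro allI wderiv_map[of s t T]) auto

lemma fderiv_fprod:
  assumes "fdim s1" "vector_space s3"
    "\<And>y. Vector_Spaces.linear s1 s3 (\<lambda>x. m x y)" "\<And>x. Vector_Spaces.linear s2 s3 (m x)"
    "fderiv s1 f f'" "fderiv s2 g g'"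
  shows "fderiv s3 (\<lambda>\<tau>. fprod m (f \<tau>) (g \<tau>)) (\<lambda>\<tau>. fprod m (f' \<tau>) (g \<tau>) + fprod m (f \<tau>) (g' \<tau>))"
proof -
  have "wderiv s3 (\<lambda>\<tau>. \<Sum>p\<in>{(\<beta>,\<gamma>). \<beta> + \<gamma> = \<alpha>}. m (f \<tau> (fst p)) (g \<tau> (snd p)))
     (\<lambda>\<tau>. \<Sum>p\<in>{(\<beta>,\<gamma>). \<beta> + \<gamma> = \<alpha>}. m (f' \<tau> (fst p)) (g \<tau> (snd p)) + m (f \<tau> (fst p)) (g' \<tau> (snd p)))" for \<alpha>
    using assms by (intro wderiv_sum wderiv_bilinear[of s1 s3 m s2]) (auto simp: fderiv_def)
  then show ?thesis by (simp add: fderiv_def fprod_splits split_def sum.distrib)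
qed

lemma fderiv_ext:
  assumes "vector_space s" "\<And>x. fderiv s (\<lambda>\<tau>. X \<tau> x) (\<lambda>\<tau>. X' \<tau> x)"
  shows "fderiv s (\<lambda>\<tau>. ext (X \<tau>) \<mu>) (\<lambda>\<tau>. ext (X' \<tau>) \<mu>)"
proof -
  have "wderiv s (\<lambda>\<tau>. \<Sum>p\<in>{(\<beta>,\<gamma>). \<beta> + \<gamma> = \<alpha>}. X \<tau> (\<mu> (fst p)) (snd p))
      (\<lambda>\<tau>. \<Sum>p\<in>{(\<beta>,\<gamma>). \<beta> + \<gamma> = \<alpha>}. X' \<tau> (\<mu> (fst p)) (snd p))" for \<alpha>
    using assms by (intro wderiv_sum) (auto simp: fderiv_def)
  then show ?thesis by (simp add: fderiv_def ext_def split_def)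
qed

lemma fderiv_ext_arg:
  assumes "vector_space t" "\<And>\<gamma>. Vector_Spaces.linear s t (\<lambda>x. X x \<gamma>)" "fderiv s \<mu> \<mu>'"
  shows "fderiv t (\<lambda>\<tau>. ext X (\<mu> \<tau>)) (\<lambda>\<tau>. ext X (\<mu>' \<tau>))"
proof -
  have "wderiv t (\<lambda>\<tau>. \<Sum>p\<in>{(\<beta>,\<gamma>). \<beta> + \<gamma> = \<alpha>}. X (\<mu> \<tau> (fst p)) (snd p))
      (\<lambda>\<tau>. \<Sum>p\<in>{(\<beta>,\<gamma>). \<beta> + \<gamma> = \<alpha>}. X (\<mu>' \<tau> (fst p)) (snd p))" for \<alpha>
    using assms by (intro wderiv_sum wderiv_map[of s t "\<lambda>x. X x _"]) (auto simp: fderiv_def)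
  then show ?thesis by (simp add: fderiv_def ext_def split_def)
qed

lemma linear_nsc: "vector_space s \<Longrightarrow> Vector_Spaces.linear s s (nsc n)"
  by (simp add: linearI nsc_plus biadd_simps(12)[OF biadd_scale])

lemma fderiv_pd: "vector_space s \<Longrightarrow> fderiv s f f' \<Longrightarrow> fderiv s (\<lambda>\<tau>. pd b (f \<tau>)) (\<lambda>\<tau>. pd b (f' \<tau>))"
  unfolding fderiv_def pd_def by (auto intro: wderiv_map[OF linear_nsc])

lemma linear_scale_left: "vector_space s \<Longrightarrow> Vector_Spaces.linear (*) s (\<lambda>c. s c x)"
  by (rule linearI) (simp_all add: vector_space_mult[folded module_iff_vector_space] module_iff_vector_space[symmetric]
      module.scale_left_distrib module.scale_scale del: module_iff_vector_space)

lemma linear_scale_right: "vector_space s \<Longrightarrow> Vector_Spaces.linear s s (s c)"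
  by (rule linearI) (simp_all add: module_iff_vector_space[symmetric]
      module.scale_right_distrib module.scale_scale mult.commute del: module_iff_vector_space)

lemma fderiv_dv:
  assumes "vector_space s" "fderiv s f f'"
  shows "fderiv s (\<lambda>\<tau>. dv s B v (f \<tau>)) (\<lambda>\<tau>. dv s B v (f' \<tau>))"
proof -
  have "fderiv s (\<lambda>\<tau>. fprod s (v b) (pd b (f \<tau>))) (\<lambda>\<tau>. fprod s (v b) (pd b (f' \<tau>)))" for b
    using fderiv_fprod[OF fdim_mult assms(1) linear_scale_left[OF assms(1)] linear_scale_right[OF assms(1)]
        fderiv_const[OF vector_space_mult] fderiv_pd[OF assms]]
    by (simp add: fprod_simps[OF biadd_scale[OF assms(1)]])
  then show ?thesis unfolding dv_def by (intro fderiv_sum assms)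
qed

lemma fderiv_const_eq:
  assumes "fdim s" "fderiv s f f'" "\<And>\<tau>. \<tau> \<in> {0..1} \<Longrightarrow> f' \<tau> \<alpha> = 0" "\<tau> \<in> {0..1}"
  shows "f \<tau> \<alpha> = f 0 \<alpha>"
proof (rule fdim_eqI[OF assms(1)])
  fix u assume u: "Vector_Spaces.linear s (*) u"
  have "((\<lambda>\<tau>. u (f \<tau> \<alpha>)) has_vector_derivative 0) (at x within {0..1})" if "x \<in> {0..1}" for x
    using assms(2) wderivD[OF _ u that, of "\<lambda>\<tau>. f \<tau> \<alpha>" "\<lambda>\<tau>. f' \<tau> \<alpha>"] assms(3)[OF that] linear_simps(1)[OF u]
    by (simp add: fderiv_def)
  from has_vector_derivative_zero_constant[OF _ this] obtain c where "\<And>x. x \<in> {0..1} \<Longrightarrow> u (f x \<alpha>) = c"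
    by (metis convex_real_interval(5))
  then show "u (f \<tau> \<alpha>) = u (f 0 \<alpha>)" using assms(4) by simp
qed

text \<open>Induction on the degree: once all coefficients of lower degree vanish along the path,
  the coefficient at \<alpha> has zero derivative and keeps its initial value. The index set allows
  the functions of a family, indexed here by covectors, to be coupled.\<close>

lemma nilpotent_ode:
  assumes "fdim s" "\<And>i. i \<in> I \<Longrightarrow> fderiv s (y i) (y' i)" "\<And>i. i \<in> I \<Longrightarrow> y i 0 = 0"
    and "\<And>i \<alpha> \<tau>. i \<in> I \<Longrightarrow> \<tau> \<in> {0..1} \<Longrightarrow>
      (\<And>j \<gamma>. j \<in> I \<Longrightarrow> size \<gamma> < size \<alpha> \<Longrightarrow> y j \<tau> \<gamma> = 0) \<Longrightarrow> y' i \<tau> \<alpha> = 0"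
    and "i \<in> I" "\<tau> \<in> {0..1}"
  shows "y i \<tau> = 0"
proof -
  have "\<forall>i\<in>I. \<forall>\<tau>\<in>{0..1}. y i \<tau> \<alpha> = 0" for \<alpha>
  proof (induction \<alpha> rule: measure_induct_rule[of size])
    case (less \<alpha>)
    show ?case
    proof (intro ballI)
      fix i \<tau> assume i: "i \<in> I" and \<tau>: "\<tau> \<in> {0..1::real}"
      have "y i \<tau> \<alpha> = y i 0 \<alpha>"
        by (rule fderiv_const_eq[OF assms(1) assms(2)[OF i] assms(4)[OF i] \<tau>]) (auto simp: less)
      then show "y i \<tau> \<alpha> = 0" by (simp add: assms(3)[OF i])
    qed
  qed
  then show ?thesis using assms(5,6) by (simp add: fun_eq_iff)
qed

text \<open>As \<mu> has no constant term, only coefficients of X of strictly lower degree reach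
  \<alpha>.\<close>

lemma ext_nilpotent:
  assumes "linfam X" "\<mu> {#} = 0" "\<And>x \<gamma>. size \<gamma> < size \<alpha> \<Longrightarrow> X x \<gamma> = 0"
  shows "ext X \<mu> \<alpha> = 0"
proof (rule ext_0)
  fix \<beta> \<gamma> assume "\<beta> + \<gamma> = \<alpha>"
  then show "X (\<mu> \<beta>) \<gamma> = 0"
    using assms(3)[of \<gamma>] by (cases "\<beta> = {#}") (auto simp: assms(2) linfam_simps(2)[OF assms(1)] nonempty_has_size[symmetric])
qed

lemma fprod_nilpotent:
  assumes "biadd m" "s {#} = 0" "\<And>\<gamma>. size \<gamma> < size \<alpha> \<Longrightarrow> f \<gamma> = 0"
  shows "fprod m s f \<alpha> = 0"
proof (rule fprod_0)
  fix \<beta> \<gamma> assume "\<beta> + \<gamma> = \<alpha>"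
  then show "m (s \<beta>) (f \<gamma>) = 0"
    using assms(3)[of \<gamma>] by (cases "\<beta> = {#}") (auto simp: assms(2) biadd_simps[OF assms(1)] nonempty_has_size[symmetric])
qed

context lie_qb
begin

lemma fdim_h: "fdim sh"
proof -
  obtain E :: "'g set" and D :: "'g \<Rightarrow> 'h" where E: "finite E"
    "\<And>x. x = (\<Sum>e\<in>E. sg \<langle>D e, x\<rangle> e)" "\<And>\<xi>. \<xi> = (\<Sum>e\<in>E. sh \<langle>\<xi>, e\<rangle> (D e))"
    by (rule dual_bases) blast
  show ?thesis by (rule fdimI[OF vs_h E(1) pair_linear_left E(3)])
qed

lemma fdim_d: "fdim sd"
proof -
  obtain E :: "'g set" and D :: "'g \<Rightarrow> 'h" where E: "finite E"
    "\<And>x. x = (\<Sum>e\<in>E. sg \<langle>D e, x\<rangle> e)" "\<And>\<xi>. \<xi> = (\<Sum>e\<in>E. sh \<langle>\<xi>, e\<rangle> (D e))"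
    by (rule dual_bases) blast
  define c where "c = (\<lambda>p u. if snd p then \<langle>D (fst p), fst u\<rangle> else \<langle>snd u, fst p\<rangle>)"
  define w where "w = (\<lambda>p. if snd p then (fst p, 0) else (0, D (fst p)))"
  show ?thesis
  proof (rule fdimI[OF vs_d])
    show "finite (E \<times> (UNIV :: bool set))" using E(1) by simp
    show "Vector_Spaces.linear sd (*) (c p)" for p
      by (cases p) (auto simp: c_def linearI vs_d vector_space_mult sd_simps pair_simps pair_scale)
    fix u
    have z: "sg a 0 = 0" "sh a 0 = 0" for a
      using vs_g vs_h by (simp_all add: module.scale_zero_right module_iff_vector_space)
    have "(\<Sum>p\<in>E \<times> UNIV. sd (c p u) (w p)) = (\<Sum>e\<in>E. \<Sum>b\<in>UNIV. sd (c (e,b) u) (w (e,b)))"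
      by (simp add: sum.cartesian_product)
    also have "\<dots> = (\<Sum>e\<in>E. sg \<langle>D e, fst u\<rangle> e, \<Sum>e\<in>E. sh \<langle>snd u, e\<rangle> (D e))"
      by (simp add: UNIV_bool c_def w_def prod_eq_iff fst_sum snd_sum sd_simps z)
    also have "\<dots> = u" using E(2)[of "fst u", symmetric] E(3)[of "snd u", symmetric] by (simp only: prod.collapse)
    finally show "u = (\<Sum>p\<in>E \<times> UNIV. sd (c p u) (w p))" by simp
  qed
qed

lemma linear_pair_bidual: "Vector_Spaces.linear sh (*) u \<Longrightarrow> \<exists>x. u = (\<lambda>\<xi>. \<langle>\<xi>, x\<rangle>)"
  using ex_bidual[of u] by (auto simp: fun_eq_iff eq_commute)

lemma linear_pair_functional: "Vector_Spaces.linear sg (*) u \<Longrightarrow> \<exists>\<xi>. u = pairing G \<xi>"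
  using ex_functional[of u] by (auto simp: fun_eq_iff eq_commute)

lemma pr_linear: "Vector_Spaces.linear sd (*) (\<lambda>x. pr x y)" "Vector_Spaces.linear sd (*) (pr x)"
  by (simp_all add: linearI vs_d vector_space_mult pr_scale biadd_simps[OF biadd_pr])

lemma fderiv_Pr:
  "fderiv sd f f' \<Longrightarrow> fderiv sd g g' \<Longrightarrow> fderiv (*) (\<lambda>\<tau>. Pr (f \<tau>) (g \<tau>)) (\<lambda>\<tau>. Pr (f' \<tau>) (g \<tau>) + Pr (f \<tau>) (g' \<tau>))"
  by (rule fderiv_fprod[OF fdim_d vector_space_mult pr_linear])

lemma fderiv_Br:
  "fderiv sd f f' \<Longrightarrow> fderiv sd g g' \<Longrightarrow> fderiv sd (\<lambda>\<tau>. Br (f \<tau>) (g \<tau>)) (\<lambda>\<tau>. Br (f' \<tau>) (g \<tau>) + Br (f \<tau>) (g' \<tau>))"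
  by (rule fderiv_fprod[OF fdim_d vs_d br_linear(2,1)])

end

section \<open>Preservation of solutions\<close>

text \<open>Assumes the gauge flow of an abstract path starting at a solution; the explicit path
  \<open>lp\<close> of gauge transforms is an instance.\<close>

locale gauge_path = gauge_field G L M B s
  for G :: "('k::{real_normed_field, euclidean_space},
               'g::ab_group_add, 'h::ab_group_add) quasi_bialgebra" (structure) and L M B s +
  fixes p :: "real \<Rightarrow> 'h \<Rightarrow> ('g, 'g \<times> 'h) formal_map"
  assumes s_0: "s {#} = 0"
    and p_section: "dyn_section G L M B (p \<tau>)"
    and p_flow: "fderiv sd (\<lambda>\<tau>. p \<tau> \<xi>) (\<lambda>\<tau>. gauge_section.e' G B s (p \<tau>) \<xi>)"
    and p_0: "dyn_eqv G L M B (p 0)" and p_0_F: "dyn_section.F G B (p 0) \<xi> \<eta> \<zeta> = 0"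
begin

interpretation p: gauge_section G L M B s "p \<tau>" for \<tau>
  by (intro gauge_section.intro gauge_field_axioms p_section)

interpretation p0: dyn_eqv G L M B "p 0" by (rule p_0)

lemma cS_0: "cS \<xi> {#} = 0"
  by (simp add: cS_def s_0 biadd_simps[OF biadd_coad])

lemma path_iso: "\<tau> \<in> {0..1} \<Longrightarrow> Pr (p \<tau> \<xi>) (p \<tau> \<eta>) = 0"
proof -
  define y where "y = (\<lambda>i \<tau>. Pr (p \<tau> (fst i)) (p \<tau> (snd i)))"
  define y' where "y' = (\<lambda>i \<tau>. Pr (p.e' \<tau> (fst i)) (p \<tau> (snd i)) + Pr (p \<tau> (fst i)) (p.e' \<tau> (snd i)))"
  assume "\<tau> \<in> {0..1}"
  have "y (\<xi>, \<eta>) \<tau> = 0"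
  proof (rule nilpotent_ode[OF fdim_mult, of UNIV y y'])
    show "fderiv (*) (y i) (y' i)" for i
      unfolding y_def y'_def by (rule fderiv_Pr[OF p_flow p_flow])
    show "y i 0 = 0" for i by (simp add: y_def p0.e_iso)
    show "y' i \<tau> \<alpha> = 0" if *: "\<And>j \<gamma>. j \<in> UNIV \<Longrightarrow> size \<gamma> < size \<alpha> \<Longrightarrow> y j \<tau> \<gamma> = 0" for i \<alpha> \<tau>
    proof -
      obtain \<xi> \<eta> where i: "i = (\<xi>, \<eta>)" by (cases i)
      \<comment> \<open>The bracket with s and the form of \<open>uS\<close> are both skew, so among
        the terms of the velocity only the extension along \<open>cS\<close> contributes.\<close>
      have 1: "Pr (Br s x) y + Pr x (Br s y) = 0" for x y
        by (subst Br_skew) (simp add: Pr_simps Pr_invariant)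
      have 2: "Pr (uS \<xi>) (p \<tau> \<eta>) + Pr (p \<tau> \<xi>) (uS \<eta>) = 0"
        unfolding Pr_commute[of "p \<tau> \<xi>"] p.Pr_uS by simp
      have "y' i \<tau> = ext (\<lambda>x. y (x, \<eta>) \<tau>) (cS \<xi>) + ext (\<lambda>x. y (\<xi>, x) \<tau>) (cS \<eta>)"
        using 1[of "p \<tau> \<xi>" "p \<tau> \<eta>"] 2
        by (simp add: y'_def y_def i p.e'_def Pr_simps fprod_ext_left[OF biadd_pr] fprod_ext_right[OF biadd_pr] algebra_simps)
      moreover have "ext (\<lambda>x. y (x, \<eta>) \<tau>) (cS \<xi>) \<alpha> = 0" "ext (\<lambda>x. y (\<xi>, x) \<tau>) (cS \<eta>) \<alpha> = 0"
      proof -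
        have "linfam (\<lambda>x. y (x, \<eta>) \<tau>)" "linfam (\<lambda>x. y (\<xi>, x) \<tau>)"
          by (simp_all add: y_def linfam_def p.e_add Pr_simps)
        then show "ext (\<lambda>x. y (x, \<eta>) \<tau>) (cS \<xi>) \<alpha> = 0" "ext (\<lambda>x. y (\<xi>, x) \<tau>) (cS \<eta>) \<alpha> = 0"
          by (simp_all add: ext_nilpotent cS_0 *)
      qed
      ultimately show ?thesis by simp
    qed
  qed (use \<open>\<tau> \<in> {0..1}\<close> in auto)
  then show ?thesis by (simp add: y_def)
qed

lemma path_V: "\<tau> \<in> {0..1} \<Longrightarrow> z \<in> L \<Longrightarrow> p.V \<tau> z \<xi> = 0"
proof -
  define y where "y = (\<lambda>\<xi> \<tau>. p.V \<tau> z \<xi>)"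
  define y' where "y' = (\<lambda>\<xi> \<tau>. DL z (p.e' \<tau> \<xi>) + p.e' \<tau> (coad G z \<xi>))"
  assume \<tau>: "\<tau> \<in> {0..1}" and z: "z \<in> L"
  have "y \<xi> \<tau> = 0"
  proof (rule nilpotent_ode[OF fdim_d, of UNIV y y'])
    show "fderiv sd (y i) (y' i)" for i
      unfolding y_def y'_def p.V_def DL_def
      using fderiv_Br[OF fderiv_const[OF vs_d] p_flow, of "J z" i]
      by (intro fderiv_add p_flow fderiv_dv vs_d) (simp add: Br_simps)
    show "y i 0 = 0" for i by (simp add: y_def p0.e_eqv z)
    show "y' i \<tau> \<alpha> = 0" if *: "\<And>j \<gamma>. j \<in> UNIV \<Longrightarrow> size \<gamma> < size \<alpha> \<Longrightarrow> y j \<tau> \<gamma> = 0" for i \<alpha> \<tau>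
    proof -
      have "y' i \<tau> = Br s (y i \<tau>) + ext (\<lambda>x. y x \<tau>) (cS i)"
        using p.V_flow[OF z, of \<tau> i] by (simp add: y'_def y_def)
      moreover have "ext (\<lambda>x. y x \<tau>) (cS i) \<alpha> = 0"
      proof (rule ext_nilpotent)
        show "linfam (\<lambda>x. y x \<tau>)" by (simp add: y_def linfam_def p.V_def p.e_add DL_simps coad_simps)
      qed (simp_all add: * cS_0)
      moreover have "Br s (y i \<tau>) \<alpha> = 0"
        by (rule fprod_nilpotent[where s = s, OF biadd_br s_0]) (simp add: *)
      ultimately show ?thesis by simp
    qed
  qed (use \<tau> in auto)
  then show ?thesis by (simp add: y_def)
qed

lemma path_eqv: "\<tau> \<in> {0..1} \<Longrightarrow> dyn_eqv G L M B (p \<tau>)"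
  by (intro dyn_eqv.intro p_section dyn_eqv_axioms.intro path_iso path_V)

lemma path_F: "\<tau> \<in> {0..1} \<Longrightarrow> p.F \<tau> \<xi> \<eta> \<zeta> = 0"
proof -
  define y where "y = (\<lambda>(\<xi>, \<eta>, \<zeta>) \<tau>. p.F \<tau> \<xi> \<eta> \<zeta>)"
  define y' where "y' = (\<lambda>(\<xi>, \<eta>, \<zeta>) \<tau>. (Pr (dd \<xi> (p.e' \<tau> \<eta>)) (p \<tau> \<zeta>) + Pr (dd \<xi> (p \<tau> \<eta>)) (p.e' \<tau> \<zeta>))
     + (Pr (dd \<eta> (p.e' \<tau> \<zeta>)) (p \<tau> \<xi>) + Pr (dd \<eta> (p \<tau> \<zeta>)) (p.e' \<tau> \<xi>))
     + (Pr (dd \<zeta> (p.e' \<tau> \<xi>)) (p \<tau> \<eta>) + Pr (dd \<zeta> (p \<tau> \<xi>)) (p.e' \<tau> \<eta>))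
     - (Pr (Br (p.e' \<tau> \<xi>) (p \<tau> \<eta>) + Br (p \<tau> \<xi>) (p.e' \<tau> \<eta>)) (p \<tau> \<zeta>) + Pr (Br (p \<tau> \<xi>) (p \<tau> \<eta>)) (p.e' \<tau> \<zeta>)))"
  assume \<tau>: "\<tau> \<in> {0..1}"
  have "y (\<xi>, \<eta>, \<zeta>) \<tau> = 0"
  proof (rule nilpotent_ode[OF fdim_mult, of UNIV y y'])
    show "fderiv (*) (y i) (y' i)" for i
      unfolding y_def y'_def p.F_def p.A_def p.T_def split_def
      by (intro fderiv_diff fderiv_add fderiv_Pr fderiv_Br fderiv_dv p_flow vs_d)
    show "y i 0 = 0" for i by (simp add: y_def p_0_F split_def)
    show "y' i \<tau> \<alpha> = 0" if \<tau>: "\<tau> \<in> {0..1}" and *: "\<And>j \<gamma>. j \<in> UNIV \<Longrightarrow> size \<gamma> < size \<alpha> \<Longrightarrow> y j \<tau> \<gamma> = 0" for i \<alpha> \<tau>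
    proof -
      \<comment> \<open>The evolution law of F is available only for isotropic equivariant sections,
        so the two preceding invariants are needed at the intermediate time \<tau>.\<close>
      interpret q: dyn_eqv G L M B "p \<tau>" by (rule path_eqv[OF \<tau>])
      interpret q: gauge_eqv G L M B s "p \<tau>" ..
      obtain \<xi> \<eta> \<zeta> where i: "i = (\<xi>, \<eta>, \<zeta>)" by (cases i)
      have "y' i \<tau> = ext (\<lambda>x. y (x, \<eta>, \<zeta>) \<tau>) (cS \<xi>) + ext (\<lambda>x. y (\<xi>, x, \<zeta>) \<tau>) (cS \<eta>) + ext (\<lambda>x. y (\<xi>, \<eta>, x) \<tau>) (cS \<zeta>)"
        using q.F_flow[of \<xi> \<eta> \<zeta>] by (simp add: y'_def y_def i q.A'_def q.T'_def)
      moreover have "linfam (\<lambda>x. y (x, \<eta>, \<zeta>) \<tau>)" "linfam (\<lambda>x. y (\<xi>, x, \<zeta>) \<tau>)" "linfam (\<lambda>x. y (\<xi>, \<eta>, x) \<tau>)"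
      proof -
        have dd: "dd (x + y) f = dd x f + dd y f" for x y f
          by (simp add: dv_def restr_const fprod_const_left br_simps biadd_simps[OF biadd_sd] pair_simps 
             sum.distrib[symmetric] fun_eq_iff sum_fun_apply)
        show "linfam (\<lambda>x. y (x, \<eta>, \<zeta>) \<tau>)" "linfam (\<lambda>x. y (\<xi>, x, \<zeta>) \<tau>)" "linfam (\<lambda>x. y (\<xi>, \<eta>, x) \<tau>)"
          by (simp_all add: linfam_def y_def p.F_def p.A_def p.T_def p.e_add Pr_simps Br_simps dd Dd_simps)
      qed
      then have "ext (\<lambda>x. y (x, \<eta>, \<zeta>) \<tau>) (cS \<xi>) \<alpha> = 0" "ext (\<lambda>x. y (\<xi>, x, \<zeta>) \<tau>) (cS \<eta>) \<alpha> = 0"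
        "ext (\<lambda>x. y (\<xi>, \<eta>, x) \<tau>) (cS \<zeta>) \<alpha> = 0"
        by (simp_all add: ext_nilpotent cS_0 *)
      ultimately show ?thesis by simp
    qed
  qed (use \<tau> in auto)
  then show ?thesis by (simp add: y_def)
qed

end

section \<open>Translation between maps l and sections of the double\<close>

context lie_qb
begin

definition sec :: "('g, 'h \<Rightarrow> 'g) formal_map \<Rightarrow> 'h \<Rightarrow> ('g, 'g \<times> 'h) formal_map" where
  "sec l \<xi> \<alpha> = (l \<alpha> \<xi>, const \<xi> \<alpha>)"

definition inj_g :: "('a, 'g) formal_map \<Rightarrow> ('a, 'g \<times> 'h) formal_map" where
  "inj_g f \<alpha> = (f \<alpha>, 0)"

lemma sec_eq: "sec l \<xi> = inj_g (\<lambda>\<alpha>. l \<alpha> \<xi>) + K \<xi>"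
  by (simp add: sec_def inj_g_def K_def const_def fun_eq_iff zero_prod_def)

lemma gval_inj_g: "gval (inj_g f)"
  by (simp add: gval_def inj_g_def)

lemma gval_eq_inj_g: "gval f \<Longrightarrow> f = inj_g (\<lambda>\<alpha>. fst (f \<alpha>))"
  by (simp add: gval_def inj_g_def fun_eq_iff prod_eq_iff)

lemma inj_g_eq_iff: "inj_g f = inj_g g \<longleftrightarrow> f = g"
  by (simp add: inj_g_def fun_eq_iff)

lemma inj_g_simps: "inj_g (f + g) = inj_g f + inj_g g" "inj_g (f - g) = inj_g f - inj_g g" "inj_g (- f) = - inj_g f"
  "inj_g 0 = 0"
  by (simp_all add: inj_g_def fun_eq_iff zero_prod_def)

lemma linear_inj_g: "Vector_Spaces.linear sg sd (\<lambda>x. (x, 0))"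
proof -
  have "sh c 0 = 0" for c using vs_h by (simp add: module.scale_zero_right module_iff_vector_space)
  then show ?thesis by (intro linearI vs_g vs_d) (simp_all add: prod_eq_iff sd_simps)
qed

lemma dv_inj_g: "dv sd B v (inj_g f) = inj_g (dv sg B v f)"
  unfolding inj_g_def by (rule dv_map[OF linear_inj_g])

lemma Br_inj_g: "Br (inj_g f) (inj_g g) = inj_g (fprod (lbr G) f g)"
proof
  fix \<alpha>
  have "(\<Sum>p\<in>A. (h p, 0)) = (\<Sum>p\<in>A. h p, 0 :: 'h)" for A and h :: "_ \<Rightarrow> 'g"
    by (simp add: prod_eq_iff fst_sum snd_sum)
  then show "Br (inj_g f) (inj_g g) \<alpha> = inj_g (fprod (lbr G) f g) \<alpha>"
    by (simp add: inj_g_def fprod_splits split_def fst_br_fst)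
qed

lemma J_inj_g: "J x = inj_g (const x)"
  by (simp add: J_def inj_g_def const_def fun_eq_iff zero_prod_def)

lemma Pr_K_inj_g: "Pr (K \<xi>) (inj_g f) = (\<lambda>\<alpha>. \<langle>\<xi>, f \<alpha>\<rangle>)"
  by (simp add: Pr_K inj_g_def)

lemma Pr_K_K: "Pr (K \<xi>) (K \<eta>) = 0"
  by (simp add: Pr_K) (simp add: K_def const_def fun_eq_iff pair_simps)

lemma phi_0: "phi G 0 \<eta> \<zeta> = 0" "phi G \<xi> 0 \<zeta> = 0" "phi G \<xi> \<eta> 0 = 0"
  using phi_trilinear(1)[of 0 0 \<eta> \<zeta>] phi_trilinear(2)[of \<xi> 0 0 \<zeta>] phi_trilinear(3)[of \<xi> \<eta> 0 0] by simp_all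

lemma Br_K: "Br f (K \<eta>) = (\<lambda>\<alpha>. br (f \<alpha>) (0, \<eta>))"
  unfolding K_def by (rule fprod_const_right) (simp add: br_simps)

lemma Pr_Br_inj_K_K: "Pr (Br (inj_g f) (K \<eta>)) (K \<zeta>) = (\<lambda>\<alpha>. \<langle>\<zeta>, cobr G (f \<alpha>) \<eta>\<rangle>)"
  unfolding Pr_commute[of _ "K \<zeta>"] Br_K Pr_K
proof
  fix \<alpha>
  have "\<langle>\<zeta>, fst (br (inj_g f \<alpha>) (0, \<eta>))\<rangle> = pr (br (inj_g f \<alpha>) (0, \<eta>)) (0, \<zeta>)"
    by (simp add: pr_def pair_simps)
  then show "\<langle>\<zeta>, fst (br (inj_g f \<alpha>) (0, \<eta>))\<rangle> = \<langle>\<zeta>, cobr G (f \<alpha>) \<eta>\<rangle>"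
    unfolding pr_br by (simp add: inj_g_def pair_simps lbr_simps biadd_simps[OF biadd_cobr] phi_0)
qed

lemma Pr_Br_K_K_K: "Pr (Br (K \<xi>) (K \<eta>)) (K \<zeta>) = const (phi G \<xi> \<eta> \<zeta>)"
  unfolding Pr_commute[of _ "K \<zeta>"] Br_K Pr_K
proof
  fix \<alpha>
  have "\<langle>\<zeta>, fst (br (K \<xi> \<alpha>) (0, \<eta>))\<rangle> = pr (br (K \<xi> \<alpha>) (0, \<eta>)) (0, \<zeta>)"
    by (simp add: pr_def pair_simps)
  then show "\<langle>\<zeta>, fst (br (K \<xi> \<alpha>) (0, \<eta>))\<rangle> = const (phi G \<xi> \<eta> \<zeta>) \<alpha>"
    unfolding pr_br 
    by (simp add: K_def const_def zero_prod_def[symmetric] pair_simps lbr_simps biadd_simps[OF biadd_cobr] phi_0)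
qed

text \<open>Each section is a \<gg>-part plus a constant covector. In the trilinear form, three
  \<gg>-parts give zero, two give the brackets, one gives the cobrackets, and none gives
  \<open>phi\<close>.\<close>

lemma Pr_Br_sec: "Pr (Br (sec l \<xi>) (sec l \<eta>)) (sec l \<zeta>) \<alpha> =
  cyc (\<lambda>\<xi> \<eta> \<zeta>. \<langle>\<zeta>, fprod (lbr G) (\<lambda>\<beta>. l \<beta> \<xi>) (\<lambda>\<beta>. l \<beta> \<eta>) \<alpha>\<rangle> + \<langle>\<zeta>, cobr G (l \<alpha> \<xi>) \<eta>\<rangle>) \<xi> \<eta> \<zeta>
  + const (phi G \<xi> \<eta> \<zeta>) \<alpha>"
proof -
  have 1: "Pr (Br (inj_g f) (inj_g g)) (K \<zeta>) = (\<lambda>\<alpha>. \<langle>\<zeta>, fprod (lbr G) f g \<alpha>\<rangle>)" for f g \<zeta>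
    by (simp add: Br_inj_g Pr_commute[of _ "K \<zeta>"] Pr_K_inj_g)
  have 2: "Pr (Br (K \<xi>) (inj_g f)) (inj_g g) = (\<lambda>\<alpha>. \<langle>\<xi>, fprod (lbr G) f g \<alpha>\<rangle>)" for f g \<xi>
    by (subst Pr_Br_rot) (rule 1)
  have 3: "Pr (Br (inj_g f) (K \<xi>)) (inj_g g) = (\<lambda>\<alpha>. \<langle>\<xi>, fprod (lbr G) g f \<alpha>\<rangle>)" for f g \<xi>
    by (subst Pr_Br_rot) (rule 2)
  have 4: "Pr (Br (K \<xi>) (inj_g f)) (K \<zeta>) = (\<lambda>\<alpha>. \<langle>\<xi>, cobr G (f \<alpha>) \<zeta>\<rangle>)" for f \<xi> \<zeta>
    by (subst Pr_Br_rot) (rule Pr_Br_inj_K_K)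
  have 5: "Pr (Br (K \<xi>) (K \<eta>)) (inj_g f) = (\<lambda>\<alpha>. \<langle>\<eta>, cobr G (f \<alpha>) \<xi>\<rangle>)" for f \<xi> \<eta>
    by (subst Pr_Br_rot) (rule 4)
  have 6: "Pr (Br (inj_g f) (inj_g g)) (inj_g h) = 0" for f g h
    by (simp add: Br_inj_g Pr_gval gval_inj_g)
  show ?thesis
    unfolding sec_eq Br_simps Pr_simps 
    by (simp add: 1 2 3 4 5 6 Pr_Br_inj_K_K Pr_Br_K_K_K cyc_def)
qed

lemma fpartial_pd: "fpartial G b f = pd b f"
  unfolding fpartial_def pd_def fun_eq_iff nsc_scale[OF vs_g] by simp

lemma fdiff_dv: "fdiff G B f v = dv sg B v f"
  by (simp add: fdiff_def dv_def fpartial_pd fun_eq_iff sum_fun_apply)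

end

context red_qb
begin

lemma sec_section_iff:
  "dyn_section G L M B (sec l) \<longleftrightarrow> (\<forall>\<alpha>. Vector_Spaces.linear sh sg (l \<alpha>))"
proof -
  have z: "const (\<xi> + \<eta>) \<alpha> = const \<xi> \<alpha> + const \<eta> \<alpha>" "const (sh c \<xi>) \<alpha> = sh c (const \<xi> \<alpha>)" 
    for c \<xi> \<eta> and \<alpha> :: "'g multiset"
    using vs_h by (simp_all add: const_def module.scale_zero_right module_iff_vector_space)
  have "dyn_section G L M B (sec l) \<longleftrightarrow> dyn_section_axioms G (sec l)"
    by (simp add: dyn_section_def red_qb_axioms)
  also have "\<dots> \<longleftrightarrow> (\<forall>\<alpha>. Vector_Spaces.linear sh sg (l \<alpha>))"
    by (auto simp: dyn_section_axioms_def sec_def fun_eq_iff Vector_Spaces.linear_iff vs_h vs_g prod_eq_iff sd_simps z)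
  finally show ?thesis .
qed

lemma Pr_sec_sec: "Pr (sec l \<xi>) (sec l \<eta>) = (\<lambda>\<alpha>. \<langle>\<xi>, l \<alpha> \<eta>\<rangle> + \<langle>\<eta>, l \<alpha> \<xi>\<rangle>)"
  unfolding sec_eq Pr_simps Pr_commute[of "inj_g _" "K _"] Pr_K_inj_g Pr_K_K
  by (simp add: Pr_gval gval_inj_g fun_eq_iff)

lemma V_sec:
  assumes "dyn_section G L M B (sec l)"
  shows "dyn_section.V G B (sec l) z \<xi> = inj_g (\<lambda>\<alpha>. fdiff G B (\<lambda>\<beta>. l \<beta> \<xi>) (vf z) \<alpha> + const (cobr G z \<xi>) \<alpha>
        + [z; l \<alpha> \<xi>] + l \<alpha> (coad G z \<xi>))"
proof -
  interpret dyn_section G L M B "sec l" by (rule assms)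
  have "DL z (inj_g f) = inj_g (\<lambda>\<alpha>. fdiff G B f (vf z) \<alpha> + [z; f \<alpha>])" for f
    by (simp add: DL_def dv_inj_g J_inj_g Br_inj_g inj_g_simps(1)[symmetric] fprod_const_left lbr_simps fdiff_dv)
       (simp add: inj_g_def fun_eq_iff)
  then show ?thesis
    by (simp add: V_def DL_simps sec_eq DL_K) (auto simp: inj_g_def K_def const_def fun_eq_iff)
qed

lemma F_sec:
  assumes "dyn_section G L M B (sec l)"
  shows "dyn_section.F G B (sec l) \<xi> \<eta> \<zeta> \<alpha> =
     cyc (\<lambda>\<xi> \<eta> \<zeta>. \<langle>\<zeta>, fdiff G B (\<lambda>\<beta>. l \<beta> \<eta>) (restr G (const \<xi>)) \<alpha>\<rangle>
                    - \<langle>\<zeta>, fprod (lbr G) (\<lambda>\<beta>. l \<beta> \<xi>) (\<lambda>\<beta>. l \<beta> \<eta>) \<alpha>\<rangle>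
                    - \<langle>\<zeta>, cobr G (l \<alpha> \<xi>) \<eta>\<rangle>) \<xi> \<eta> \<zeta> - const (phi G \<xi> \<eta> \<zeta>) \<alpha>"
proof -
  interpret dyn_section G L M B "sec l" by (rule assms)
  have "A \<xi> \<eta> \<zeta> = (\<lambda>\<alpha>. \<langle>\<zeta>, fdiff G B (\<lambda>\<beta>. l \<beta> \<eta>) (restr G (const \<xi>)) \<alpha>\<rangle>)" for \<xi> \<eta> \<zeta>
  proof -
    have "dd \<xi> (sec l \<eta>) = inj_g (dv sg B (restr G (const \<xi>)) (\<lambda>\<beta>. l \<beta> \<eta>))"
      unfolding sec_eq K_def by (simp add: Dd_simps dv_inj_g)
    then show ?thesis by (simp add: A_def Pr_gval_e gval_inj_g Pr_K_inj_g fdiff_dv)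
  qed
  then show ?thesis unfolding F_def T_def
    by (simp add: Pr_Br_sec cyc_def)
qed

text \<open>Skewness of l is isotropy of its graph, and the two equations are F = 0 and V = 0. These
  formulas presuppose linear coefficients; otherwise both sides are false.\<close>

lemma Dynl_iff:
  "l \<in> Dynl G L B \<longleftrightarrow> formal_on B l \<and> dyn_eqv G L M B (sec l) \<and> (\<forall>\<xi> \<eta> \<zeta>. dyn_section.F G B (sec l) \<xi> \<eta> \<zeta> = 0)"
proof (cases "\<forall>\<alpha>. Vector_Spaces.linear sh sg (l \<alpha>)")
  case False
  then have "\<not> dyn_section G L M B (sec l)" by (simp add: sec_section_iff)
  then show ?thesis using False by (auto simp: dyn_eqv_def Dynl_def skew_maps_def)
next
  case True
  then have s: "dyn_section G L M B (sec l)" by (simp add: sec_section_iff)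
  have 1: "(\<forall>\<alpha>. l \<alpha> \<in> skew_maps G) \<longleftrightarrow> (\<forall>\<xi> \<eta>. Pr (sec l \<xi>) (sec l \<eta>) = 0)"
    using True by (auto simp: Pr_sec_sec skew_maps_def fun_eq_iff eq_neg_iff_add_eq_0)
  have 2: "dyn_section.V G B (sec l) z \<xi> = 0 \<longleftrightarrow> (\<forall>\<alpha>. fdiff G B (\<lambda>\<beta>. l \<beta> \<xi>) (vf z) \<alpha> + const (cobr G z \<xi>) \<alpha>
        + [z; l \<alpha> \<xi>] + l \<alpha> (coad G z \<xi>) = 0)" for z \<xi>
    unfolding V_sec[OF s] inj_g_simps(4)[symmetric] inj_g_eq_iff by (simp add: fun_eq_iff)
  have 3: "dyn_section.F G B (sec l) \<xi> \<eta> \<zeta> = 0 \<longleftrightarrow> (\<forall>\<alpha>. cyc (\<lambda>\<xi> \<eta> \<zeta>. \<langle>\<zeta>, fdiff G B (\<lambda>\<beta>. l \<beta> \<eta>) (restr G (const \<xi>)) \<alpha>\<rangle>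
                    - \<langle>\<zeta>, fprod (lbr G) (\<lambda>\<beta>. l \<beta> \<xi>) (\<lambda>\<beta>. l \<beta> \<eta>) \<alpha>\<rangle>
                    - \<langle>\<zeta>, cobr G (l \<alpha> \<xi>) \<eta>\<rangle>) \<xi> \<eta> \<zeta> = const (phi G \<xi> \<eta> \<zeta>) \<alpha>)" for \<xi> \<eta> \<zeta>
    by (simp add: fun_eq_iff F_sec[OF s])
  show ?thesis unfolding Dynl_def dyn_eqv_def dyn_eqv_axioms_def mem_Collect_eq 1 2 3 using s by blast
qed

lemma gauge_maps_iff:
  "S \<in> gauge_maps G L B \<longleftrightarrow> formal_on B S \<and> S {#} = 0 \<and> gauge_field G L M B (inj_g S)"
proof -
  have "DL z (inj_g S) = inj_g (\<lambda>\<alpha>. fdiff G B S (vf z) \<alpha> + [z; S \<alpha>])" for z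
    by (simp add: DL_def dv_inj_g J_inj_g Br_inj_g inj_g_simps(1)[symmetric] fprod_const_left lbr_simps fdiff_dv)
       (simp add: inj_g_def fun_eq_iff)
  then have "DL z (inj_g S) = 0 \<longleftrightarrow> (\<forall>\<alpha>. fdiff G B S (vf z) \<alpha> = - [z; S \<alpha>])" for z
    by (simp add: inj_g_def fun_eq_iff zero_prod_def eq_neg_iff_add_eq_0)
  then show ?thesis
    by (auto simp: gauge_maps_def gauge_field_def gauge_field_axioms_def red_qb_axioms gval_inj_g)
qed

end

section \<open>The gauge flow\<close>

text \<open>These are the coefficients of the exponential series; that differentiation shifts their
  index yields the derivatives of \<open>E\<close> and \<open>R\<close>.\<close>

lemma wderiv_of_real_power:
  "wderiv (*) (\<lambda>\<tau>. of_real (\<tau> ^ Suc n / fact (Suc n))) (\<lambda>\<tau>. of_real (\<tau> ^ n / fact n) :: 'k::{real_normed_field, euclidean_space})"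
  unfolding wderiv_mult_iff
proof
  fix \<tau> :: real
  have "((\<lambda>\<tau>::real. \<tau> ^ Suc n / fact (Suc n)) has_real_derivative (\<tau> ^ n / fact n)) (at \<tau> within {0..1})"
  proof -
    have "real (Suc n) * \<tau> ^ n / fact (Suc n) = \<tau> ^ n / fact n"
      unfolding fact_Suc by (rule mult_divide_mult_cancel_left) simp
    then show ?thesis using DERIV_cdivide[OF DERIV_pow[of "Suc n" \<tau> "{0..1}"], of "fact (Suc n)"] by simp
  qed
  then have "((\<lambda>\<tau>::real. \<tau> ^ Suc n / fact (Suc n)) has_vector_derivative (\<tau> ^ n / fact n)) (at \<tau> within {0..1})"
    by (simp add: has_real_derivative_iff_has_vector_derivative)
  from bounded_linear.has_vector_derivative[OF bounded_linear_of_real this]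
  show "((\<lambda>\<tau>. of_real (\<tau> ^ Suc n / fact (Suc n))) has_vector_derivative (of_real (\<tau> ^ n / fact n) :: 'k)) (at \<tau> within {0..1})" .
qed

section \<open>Power series in ad S and the adjoint action along \<tau>S\<close>

locale gauge_map = red_qb G L M B
  for G :: "('k::{real_normed_field, euclidean_space},
               'g::ab_group_add, 'h::ab_group_add) quasi_bialgebra" (structure) and L M B +
  fixes S :: "('g, 'g) formal_map"
  assumes S: "S \<in> gauge_maps G L B"
begin

lemma S_0: "S {#} = 0" and S_formal: "formal_on B S" and S_field: "gauge_field G L M B (inj_g S)"
  using S by (simp_all add: gauge_maps_iff)

sublocale gauge_field G L M B "inj_g S" by (rule S_field)

abbreviation adS where "adS \<equiv> fprod (lbr G) S"
abbreviation ser where "ser c \<equiv> ad_series G c S"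

lemma sg_simps: "sg c (x + y) = sg c x + sg c y" "sg (a + b) x = sg a x + sg b x" "sg a (sg b x) = sg (a * b) x"
  "sg 1 x = x" "sg 0 x = 0" "sg c 0 = 0" "sg c (sum f A) = (\<Sum>i\<in>A. sg c (f i))" "sg c (x - y) = sg c x - sg c y"
proof -
  interpret vector_space sg by (rule vs_g)
  show "sg c (x + y) = sg c x + sg c y" "sg (a + b) x = sg a x + sg b x" "sg a (sg b x) = sg (a * b) x"
    "sg 1 x = x" "sg 0 x = 0" "sg c 0 = 0" "sg c (sum f A) = (\<Sum>i\<in>A. sg c (f i))" "sg c (x - y) = sg c x - sg c y"
    by (simp_all add: scale_right_distrib scale_left_distrib scale_sum_right scale_right_diff_distrib)
qed

lemma adS_pow_nil: "size \<alpha> < n \<Longrightarrow> (adS ^^ n) w \<alpha> = 0"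
proof (induction n arbitrary: \<alpha>)
  case (Suc n)
  have "adS ((adS ^^ n) w) \<alpha> = 0"
  proof (rule fprod_0)
    fix \<beta> \<gamma> assume "\<beta> + \<gamma> = \<alpha>"
    then show "[S \<beta>; (adS ^^ n) w \<gamma>] = 0"
      using Suc by (cases "\<beta> = {#}") (auto simp: S_0 lbr_simps nonempty_has_size)
  qed
  then show ?case by simp
qed simp

text \<open>Each application of ad S raises the degree, so any truncation order beyond the degree
  gives the same coefficient. Sums over splittings can then use one common order.\<close>

lemma ser_upto: "size \<alpha> \<le> N \<Longrightarrow> ser c w \<alpha> = (\<Sum>n\<le>N. sg (c n) ((adS ^^ n) w \<alpha>))"
  unfolding ad_series_def by (rule sum.mono_neutral_left) (auto simp: adS_pow_nil sg_simps)

lemma adS_pow_ext: "(adS ^^ n) (ext X \<mu>) = ext (\<lambda>x. (adS ^^ n) (X x)) \<mu>"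
  by (induction n) (simp_all add: fprod_ext_right[OF biadd_lbr])

lemma adS_pow_add: "(adS ^^ n) (v + w) = (adS ^^ n) v + (adS ^^ n) w"
  by (induction n) (simp_all only: funpow.simps o_apply id_apply fprod_simps[OF biadd_lbr])

lemma adS_pow_scale: "(adS ^^ n) (\<lambda>\<alpha>. sg k (w \<alpha>)) = (\<lambda>\<alpha>. sg k ((adS ^^ n) w \<alpha>))"
  by (induction n) (simp_all add: fprod_splits lbr_scale sg_simps split_def fun_eq_iff)

lemma ser_add: "ser c (v + w) = ser c v + ser c w"
  by (simp add: ad_series_def fun_eq_iff adS_pow_add sg_simps sum.distrib)

lemma ser_scale: "ser c (\<lambda>\<alpha>. sg k (w \<alpha>)) = (\<lambda>\<alpha>. sg k (ser c w \<alpha>))"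
  by (simp add: ad_series_def fun_eq_iff adS_pow_scale sg_simps mult.commute)

lemma ser_ext: "ser c (ext X \<mu>) = ext (\<lambda>x. ser c (X x)) \<mu>"
proof
  fix \<alpha>
  have "ser c (ext X \<mu>) \<alpha> = (\<Sum>n\<le>size \<alpha>. \<Sum>p\<in>{(\<beta>,\<gamma>). \<beta> + \<gamma> = \<alpha>}. sg (c n) ((adS ^^ n) (X (\<mu> (fst p))) (snd p)))"
    by (simp add: ad_series_def adS_pow_ext ext_def split_def sg_simps)
  also have "\<dots> = (\<Sum>p\<in>{(\<beta>,\<gamma>). \<beta> + \<gamma> = \<alpha>}. \<Sum>n\<le>size \<alpha>. sg (c n) ((adS ^^ n) (X (\<mu> (fst p))) (snd p)))"
    by (rule sum.swap)
  also have "\<dots> = (\<Sum>p\<in>{(\<beta>,\<gamma>). \<beta> + \<gamma> = \<alpha>}. ser c (X (\<mu> (fst p))) (snd p))"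
    by (rule sum.cong) (auto intro!: ser_upto[symmetric])
  finally show "ser c (ext X \<mu>) \<alpha> = ext (\<lambda>x. ser c (X x)) \<mu> \<alpha>" by (simp add: ext_def split_def)
qed

lemma ser_scalar: "ser c (fprod sg a w) = fprod sg a (ser c w)"
  by (simp add: fprod_ext[of sg] ser_ext ser_scale)

lemma ser_sum: "ser c (sum F A) = (\<Sum>i\<in>A. ser c (F i))"
proof -
  have "Modules.additive (ser c)" by (simp add: Modules.additive_def ser_add)
  then show ?thesis by (rule Modules.additive.sum)
qed

lemma ser_const_ext: "ser c w = ext (\<lambda>x. ser c (const x)) w"
proof -
  have "ext const w = w"
    by (rule HOL.ext, subst ext_def, subst sum_splits_swap) (simp add: const_def sum_splits_delta1)
  then show ?thesis using ser_ext[of c const w] by simp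
qed

lemma linfam_ser_const: "linfam (\<lambda>x. ser c (const x))"
proof -
  have "const (x + y) = (const x + const y :: ('g, 'g) formal_map)" for x y by (simp add: const_def fun_eq_iff)
  then show ?thesis by (simp add: linfam_def ser_add)
qed

text \<open>Multiplying the series by its variable shifts the coefficients; truncating one step
  later makes room for the shift.\<close>

lemma adS_ser: "adS (ser c w) = ser (\<lambda>n. case n of 0 \<Rightarrow> 0 | Suc m \<Rightarrow> c m) w"
  and ser_adS: "ser c (adS w) = ser (\<lambda>n. case n of 0 \<Rightarrow> 0 | Suc m \<Rightarrow> c m) w"
proof -
  have 1: "ser (\<lambda>n. case n of 0 \<Rightarrow> 0 | Suc m \<Rightarrow> c m) w \<alpha> = (\<Sum>n\<le>size \<alpha>. sg (c n) ((adS ^^ Suc n) w \<alpha>))" for \<alpha>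
    by (subst ser_upto[of _ "Suc (size \<alpha>)"]) (simp_all add: sum.atMost_Suc_shift sg_simps del: sum.atMost_Suc)
  show "ser c (adS w) = ser (\<lambda>n. case n of 0 \<Rightarrow> 0 | Suc m \<Rightarrow> c m) w"
    by (simp add: fun_eq_iff 1) (simp add: ad_series_def funpow_swap1)
  show "adS (ser c w) = ser (\<lambda>n. case n of 0 \<Rightarrow> 0 | Suc m \<Rightarrow> c m) w"
  proof
    fix \<alpha>
    have A: "adS f \<alpha> = (\<Sum>p\<in>{(\<beta>,\<gamma>). \<beta> + \<gamma> = \<alpha>}. [S (fst p); f (snd p)])" for f
      by (simp add: fprod_splits split_def)
    have "adS (ser c w) \<alpha> = (\<Sum>p\<in>{(\<beta>,\<gamma>). \<beta> + \<gamma> = \<alpha>}. [S (fst p); \<Sum>n\<le>size \<alpha>. sg (c n) ((adS ^^ n) w (snd p))])"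
      unfolding A by (rule sum.cong) (auto simp: ser_upto[symmetric])
    also have "\<dots> = (\<Sum>n\<le>size \<alpha>. sg (c n) ((adS ^^ Suc n) w \<alpha>))"
      by (simp add: lbr_simps lbr_scale A sg_simps) (rule sum.swap)
    finally show "adS (ser c w) \<alpha> = ser (\<lambda>n. case n of 0 \<Rightarrow> 0 | Suc m \<Rightarrow> c m) w \<alpha>" by (simp add: 1)
  qed
qed

lemma ser_scaled: "ad_series G c (\<lambda>\<beta>. sg k (S \<beta>)) w = ser (\<lambda>n. k ^ n * c n) w"
proof -
  have "(fprod (lbr G) (\<lambda>\<beta>. sg k (S \<beta>)) ^^ n) w = (\<lambda>\<alpha>. sg (k ^ n) ((adS ^^ n) w \<alpha>))" for n
    by (induction n) (simp_all add: fprod_splits lbr_scale sg_simps split_def fun_eq_iff)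
  then show ?thesis by (simp add: ad_series_def fun_eq_iff sg_simps mult.commute)
qed

lemma ser_delta: "ser (\<lambda>n. if n = 0 then 1 else 0) w = w"
proof
  fix \<alpha>
  have "ser (\<lambda>n. if n = 0 then 1 else 0) w \<alpha> = (\<Sum>n\<le>size \<alpha>. if n = 0 then w \<alpha> else 0)"
    unfolding ad_series_def by (intro sum.cong) (auto simp: sg_simps)
  then show "ser (\<lambda>n. if n = 0 then 1 else 0) w \<alpha> = w \<alpha>" by simp
qed

lemma ser_diff: "ser (\<lambda>n. c n - d n) w = ser c w - ser d w"
proof -
  interpret vector_space sg by (rule vs_g)
  show ?thesis by (simp add: ad_series_def fun_eq_iff scale_left_diff_distrib sum_subtractf)
qed

lemma fderiv_ser:
  assumes "\<And>n. wderiv (*) (\<lambda>\<tau>. c \<tau> n) (\<lambda>\<tau>. c' \<tau> n)"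
  shows "fderiv sg (\<lambda>\<tau>. ser (c \<tau>) w) (\<lambda>\<tau>. ser (c' \<tau>) w)"
  unfolding fderiv_def ad_series_def
  by (intro allI wderiv_sum vs_g wderiv_map[OF linear_scale_left[OF vs_g]] assms)

text \<open>With these coefficients \<open>E\<close> is exp(\<tau> ad S) and \<open>R\<close> is
  (exp(\<tau> ad S) - 1) / ad S, the integral of \<open>E\<close> from 0 to \<tau>. On the
  derivatives of S, \<open>R\<close> gives the right-translated differential of
  exp(\<tau>S).\<close>

definition ec :: "real \<Rightarrow> nat \<Rightarrow> 'k" where "ec \<tau> n = of_real (\<tau> ^ n / fact n)"

abbreviation E where "E \<tau> \<equiv> ser (ec \<tau>)"
abbreviation R where "R \<tau> \<equiv> ser (\<lambda>n. ec \<tau> (Suc n))"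

lemma fderiv_E: "fderiv sg (\<lambda>\<tau>. E \<tau> w) (\<lambda>\<tau>. adS (E \<tau> w))"
  unfolding adS_ser
proof (rule fderiv_ser)
  show "wderiv (*) (\<lambda>\<tau>. ec \<tau> n) (\<lambda>\<tau>. case n of 0 \<Rightarrow> 0 | Suc m \<Rightarrow> ec \<tau> m)" for n
  proof (cases n)
    case 0 then show ?thesis by (simp add: ec_def wderiv_const vector_space_mult)
  next
    case (Suc m)
    have "wderiv (*) (\<lambda>\<tau>. ec \<tau> (Suc m)) (\<lambda>\<tau>. ec \<tau> m)"
      unfolding ec_def by (rule wderiv_of_real_power)
    then show ?thesis by (simp add: Suc)
  qed
qed

lemma fderiv_R: "fderiv sg (\<lambda>\<tau>. R \<tau> w) (\<lambda>\<tau>. E \<tau> w)"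
  by (rule fderiv_ser) (unfold ec_def, rule wderiv_of_real_power)

lemma E_0: "E 0 w = w"
proof -
  have "ec 0 = (\<lambda>n. if n = 0 then 1 else 0)" by (auto simp: ec_def fun_eq_iff)
  then show ?thesis by (simp add: ser_delta)
qed

lemma R_0: "R 0 w = 0"
  by (simp add: ec_def ad_series_def fun_eq_iff sg_simps)

lemma adS_R: "adS (R \<tau> w) = E \<tau> w - w"
proof -
  have "(\<lambda>n. case n of 0 \<Rightarrow> 0 | Suc m \<Rightarrow> ec \<tau> (Suc m)) = (\<lambda>n. ec \<tau> n - (if n = 0 then 1 else 0))"
    by (auto simp: fun_eq_iff ec_def split: nat.splits)
  then show ?thesis by (simp add: adS_ser ser_diff ser_delta)
qed

lemma R_adS: "R \<tau> (adS w) = E \<tau> w - w"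
  by (simp add: ser_adS adS_ser[symmetric] adS_R)

abbreviation tS where "tS \<tau> \<equiv> (\<lambda>\<beta>. sg (of_real \<tau>) (S \<beta>))"

lemma Ad_tS: "Ad G (tS \<tau>) \<alpha> x = E \<tau> (const x) \<alpha>"
proof -
  have "(\<lambda>n. of_real \<tau> ^ n * (1 / fact n)) = ec \<tau>" by (simp add: ec_def fun_eq_iff)
  then show ?thesis by (simp add: Ad_def ser_scaled)
qed

lemma Ad_linear: "Vector_Spaces.linear sg sg (Ad G (tS \<tau>) \<alpha>)"
proof (rule linearI[OF vs_g vs_g])
  show "Ad G (tS \<tau>) \<alpha> (x + y) = Ad G (tS \<tau>) \<alpha> x + Ad G (tS \<tau>) \<alpha> y" for x y
    using linfam_simps(1)[OF linfam_ser_const] by (simp add: Ad_tS)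
  have "const (sg c x) = (\<lambda>\<alpha>. sg c (const x \<alpha>))" for c x by (simp add: const_def sg_simps fun_eq_iff)
  note c = this
  show "Ad G (tS \<tau>) \<alpha> (sg c x) = sg c (Ad G (tS \<tau>) \<alpha> x)" for c x
    unfolding Ad_tS c ser_scale ..
qed

definition cA :: "real \<Rightarrow> 'h \<Rightarrow> ('g, 'h) formal_map" where
  "cA \<tau> \<xi> = (\<lambda>\<alpha>. coAd G (tS \<tau>) \<alpha> \<xi>)"

lemma cA: "\<langle>cA \<tau> \<xi> \<alpha>, x\<rangle> = \<langle>\<xi>, E \<tau> (const x) \<alpha>\<rangle>"
  by (simp add: cA_def coAd_def transp[OF Ad_linear] Ad_tS)

lemma linfam_cA: "linfam (cA \<tau>)"
  by (auto simp: linfam_def fun_eq_iff cA pair_simps intro!: h_eqI)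

lemma cA_scale: "cA \<tau> (sh c \<xi>) \<gamma> = sh c (cA \<tau> \<xi> \<gamma>)"
  by (auto simp: cA pair_scale intro!: h_eqI)

lemma cA_0: "cA 0 \<xi> = const \<xi>"
proof
  fix \<alpha> show "cA 0 \<xi> \<alpha> = const \<xi> \<alpha>"
    by (rule h_eqI) (simp add: cA E_0, simp add: const_def pair_simps)
qed

text \<open>The transposition between \<open>cA\<close> and \<open>E\<close>, extended from constant
  vectors to formal maps by linearity.\<close>

lemma pair_cA: "fprod (pairing G) (cA \<tau> \<zeta>) w = (\<lambda>\<alpha>. \<langle>\<zeta>, E \<tau> w \<alpha>\<rangle>)"
proof
  fix \<alpha> show "fprod (pairing G) (cA \<tau> \<zeta>) w \<alpha> = \<langle>\<zeta>, E \<tau> w \<alpha>\<rangle>"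
    by (subst ser_const_ext, subst fprod_commute) (simp add: fprod_splits ext_def cA split_def pair_simps)
qed

lemma cS_S: "cS \<xi> = (\<lambda>\<alpha>. coad G (S \<alpha>) \<xi>)"
  by (simp add: cS_def inj_g_def)

lemma ext_cS_pair: "ext (\<lambda>x \<gamma>. \<langle>x, w \<gamma>\<rangle>) (cS \<xi>) = (\<lambda>\<alpha>. \<langle>\<xi>, adS w \<alpha>\<rangle>)"
  by (simp add: ext_def fun_eq_iff fprod_splits cS_S coad pair_simps split_def)

lemma fderiv_pair: "fderiv sg f f' \<Longrightarrow> fderiv (*) (\<lambda>\<tau> \<alpha>. \<langle>\<xi>, f \<tau> \<alpha>\<rangle>) (\<lambda>\<tau> \<alpha>. \<langle>\<xi>, f' \<tau> \<alpha>\<rangle>)"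
  by (rule fderiv_map[OF pair_linear_right])

lemma fderiv_hI:
  assumes "\<And>x. fderiv (*) (\<lambda>\<tau> \<alpha>. \<langle>f \<tau> \<alpha>, x\<rangle>) (\<lambda>\<tau> \<alpha>. \<langle>f' \<tau> \<alpha>, x\<rangle>)"
  shows "fderiv sh f f'"
  unfolding fderiv_def wderiv_def
proof (intro allI impI ballI)
  fix \<alpha> u and \<tau> :: real assume "Vector_Spaces.linear sh (*) u" and \<tau>: "\<tau> \<in> {0..1}"
  then obtain x where "u = (\<lambda>\<xi>. \<langle>\<xi>, x\<rangle>)" using linear_pair_bidual by blast
  then show "((\<lambda>\<tau>. u (f \<tau> \<alpha>)) has_vector_derivative u (f' \<tau> \<alpha>)) (at \<tau> within {0..1})"
    using assms[of x] \<tau> by (simp add: fderiv_def wderiv_mult_iff)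
qed

lemma fderiv_gI:
  assumes "\<And>\<xi>. fderiv (*) (\<lambda>\<tau> \<alpha>. \<langle>\<xi>, f \<tau> \<alpha>\<rangle>) (\<lambda>\<tau> \<alpha>. \<langle>\<xi>, f' \<tau> \<alpha>\<rangle>)"
  shows "fderiv sg f f'"
  unfolding fderiv_def wderiv_def
proof (intro allI impI ballI)
  fix \<alpha> u and \<tau> :: real assume "Vector_Spaces.linear sg (*) u" and \<tau>: "\<tau> \<in> {0..1}"
  then obtain \<xi> where "u = pairing G \<xi>" using linear_pair_functional by blast
  then show "((\<lambda>\<tau>. u (f \<tau> \<alpha>)) has_vector_derivative u (f' \<tau> \<alpha>)) (at \<tau> within {0..1})"
    using assms[of \<xi>] \<tau> by (simp add: fderiv_def wderiv_mult_iff)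
qed

text \<open>Transpose of \<open>fderiv_E\<close>: there ad S acts last, so its transpose
  \<open>cS\<close> acts first.\<close>

lemma fderiv_cA: "fderiv sh (\<lambda>\<tau>. cA \<tau> \<xi>) (\<lambda>\<tau>. ext (cA \<tau>) (cS \<xi>))"
proof (rule fderiv_hI)
  fix x
  have "\<langle>ext (cA \<tau>) (cS \<xi>) \<alpha>, x\<rangle> = \<langle>\<xi>, adS (E \<tau> (const x)) \<alpha>\<rangle>" for \<tau> \<alpha>
  proof -
    have "\<langle>ext (cA \<tau>) (cS \<xi>) \<alpha>, x\<rangle> = ext (\<lambda>y \<gamma>. \<langle>y, E \<tau> (const x) \<gamma>\<rangle>) (cS \<xi>) \<alpha>"
      by (simp add: ext_def pair_simps split_def cA)
    then show ?thesis by (simp add: ext_cS_pair)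
  qed
  then show "fderiv (*) (\<lambda>\<tau> \<alpha>. \<langle>cA \<tau> \<xi> \<alpha>, x\<rangle>) (\<lambda>\<tau> \<alpha>. \<langle>ext (cA \<tau>) (cS \<xi>) \<alpha>, x\<rangle>)"
    using fderiv_pair[OF fderiv_E, of \<xi> "const x"] by (simp add: cA)
qed

text \<open>The bilinear form of \<open>Ad l Ad\<^sup>*\<close>, taken at \<open>\<tau>S\<close>.\<close>

definition conj :: "('g, 'h \<Rightarrow> 'g) formal_map \<Rightarrow> real \<Rightarrow> 'h \<Rightarrow> 'h \<Rightarrow> ('g, 'k) formal_map" where
  "conj l \<tau> \<zeta> \<xi> = fprod (pairing G) (cA \<tau> \<zeta>) (fapply l (cA \<tau> \<xi>))"

lemma conj_eq: "conj l \<tau> \<zeta> \<xi> \<alpha> = \<langle>\<zeta>, fapply (Ad G (tS \<tau>)) (fapply l (cA \<tau> \<xi>)) \<alpha>\<rangle>"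
proof -
  have "fapply (Ad G (tS \<tau>)) w = E \<tau> w" for w
    unfolding fapply_ext Ad_tS by (rule ser_const_ext[symmetric])
  then show ?thesis by (simp add: conj_def pair_cA)
qed

text \<open>Both coadjoint factors evolve by \<open>fderiv_cA\<close>, and the middle factor l does
  not depend on \<tau>.\<close>

lemma conj_flow:
  assumes l: "\<And>\<gamma>. Vector_Spaces.linear sh sg (l \<gamma>)"
  shows "fderiv (*) (\<lambda>\<tau>. conj l \<tau> \<zeta> \<xi>)
    (\<lambda>\<tau>. ext (\<lambda>x. conj l \<tau> x \<xi>) (cS \<zeta>) + ext (\<lambda>x. conj l \<tau> \<zeta> x) (cS \<xi>))"
proof -
  have lf: "linfam (\<lambda>x \<alpha>. l \<alpha> x)" by (simp add: linfam_def fun_eq_iff linear_add[OF l])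
  have "fderiv sg (\<lambda>\<tau>. fapply l (cA \<tau> \<xi>)) (\<lambda>\<tau>. ext (\<lambda>x. fapply l (cA \<tau> x)) (cS \<xi>))"
    unfolding fapply_ext ext_ext[OF lf, symmetric]
    by (rule fderiv_ext_arg[OF vs_g l fderiv_cA])
  from fderiv_fprod[OF fdim_h vector_space_mult pair_linear_left pair_linear_right fderiv_cA this]
  show ?thesis unfolding conj_def
    by (simp add: fprod_ext_left[OF biadd_pair] fprod_ext_right[OF biadd_pair])
qed

lemma conj_0: "(\<And>\<gamma>. Vector_Spaces.linear sh sg (l \<gamma>)) \<Longrightarrow> conj l 0 \<zeta> \<xi> = (\<lambda>\<alpha>. \<langle>\<zeta>, l \<alpha> \<xi>\<rangle>)"
proof -
  assume l: "\<And>\<gamma>. Vector_Spaces.linear sh sg (l \<gamma>)"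
  have lf: "linfam (\<lambda>x \<alpha>. l \<alpha> x)" by (simp add: linfam_def fun_eq_iff linear_add[OF l])
  show ?thesis
    by (simp add: conj_def cA_0 fapply_ext ext_const[OF lf] fprod_const_left pair_simps)
qed

lemma conj_linear_right:
  assumes l: "\<And>\<gamma>. Vector_Spaces.linear sh sg (l \<gamma>)"
  shows "conj l \<tau> \<zeta> (\<xi> + \<eta>) = conj l \<tau> \<zeta> \<xi> + conj l \<tau> \<zeta> \<eta>"
    "conj l \<tau> \<zeta> (sh c \<xi>) \<alpha> = c * conj l \<tau> \<zeta> \<xi> \<alpha>"
proof -
  have lf: "linfam (\<lambda>x \<alpha>. l \<alpha> x)" by (simp add: linfam_def fun_eq_iff linear_add[OF l])
  show "conj l \<tau> \<zeta> (\<xi> + \<eta>) = conj l \<tau> \<zeta> \<xi> + conj l \<tau> \<zeta> \<eta>"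
    by (simp add: conj_def fapply_ext linfam_simps(1)[OF linfam_cA] ext_arg[OF lf] fprod_simps[OF biadd_pair])
  show "conj l \<tau> \<zeta> (sh c \<xi>) \<alpha> = c * conj l \<tau> \<zeta> \<xi> \<alpha>"
    by (simp add: conj_def fapply_ext fprod_splits ext_def cA_scale linear_scl[OF l] sg_simps[symmetric]
      pair_simps pair_scale sum_distrib_left split_def)
qed

lemma conj_linear_left:
  "conj l \<tau> (\<zeta> + \<eta>) \<xi> = conj l \<tau> \<zeta> \<xi> + conj l \<tau> \<eta> \<xi>" "conj l \<tau> (sh c \<zeta>) \<xi> \<alpha> = c * conj l \<tau> \<zeta> \<xi> \<alpha>"
  by (simp_all add: conj_def linfam_simps(1)[OF linfam_cA] fprod_simps[OF biadd_pair])
     (simp add: fprod_splits cA_scale pair_scale sum_distrib_left split_def)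

end

lemma fderiv_cong:
  assumes "fderiv s f f'" "\<And>\<tau>. \<tau> \<in> {0..1} \<Longrightarrow> f' \<tau> = g' \<tau>"
  shows "fderiv s f g'"
  using assms unfolding fderiv_def wderiv_def by metis

lemma formal_on_fprod:
  assumes "formal_on B f" "formal_on B g" "biadd m"
  shows "formal_on B (fprod m f g)"
  unfolding formal_on_def
proof (intro allI impI)
  fix \<alpha> assume \<alpha>: "\<not> set_mset \<alpha> \<subseteq> B"
  show "fprod m f g \<alpha> = 0"
  proof (rule fprod_0)
    fix \<beta> \<gamma> assume "\<beta> + \<gamma> = \<alpha>"
    then have "\<not> set_mset \<beta> \<subseteq> B \<or> \<not> set_mset \<gamma> \<subseteq> B" using \<alpha> by auto
    then show "m (f \<beta>) (g \<gamma>) = 0"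
      using assms(1,2) by (auto simp: formal_on_def biadd_simps[OF assms(3)])
  qed
qed

lemma formal_on_const: "formal_on B (const x)"
  by (simp add: formal_on_def const_def)

lemma formal_on_pd: "b \<in> B \<Longrightarrow> formal_on B f \<Longrightarrow> formal_on B (pd b f)"
  by (simp add: formal_on_def pd_def)

section \<open>The path of gauge transforms of a solution\<close>

locale gauge_dyn = gauge_map G L M B S
  for G :: "('k::{real_normed_field, euclidean_space},
               'g::ab_group_add, 'h::ab_group_add) quasi_bialgebra" (structure) and L M B S +
  fixes l :: "('g, 'h \<Rightarrow> 'g) formal_map"
  assumes l: "l \<in> Dynl G L B"
begin

lemma l_linear: "Vector_Spaces.linear sh sg (l \<gamma>)" and l_formal: "formal_on B l"
  using l by (simp_all add: Dynl_def skew_maps_def)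

text \<open>The derivative of exp(\<tau>S) in direction b, right-translated to the identity. Its
  components \<open>r\<close>, the components \<open>a\<close> of the moved covector and those,
  \<open>k\<close>, of the constant covector make up the bilinear form \<open>th\<close> of the
  twist at \<tau>S.\<close>

definition \<rho> :: "real \<Rightarrow> 'g \<Rightarrow> ('g, 'g) formal_map" where "\<rho> \<tau> b = R \<tau> (pd b S)"

definition a :: "real \<Rightarrow> 'g \<Rightarrow> 'h \<Rightarrow> ('g, 'k) formal_map" where "a \<tau> b \<xi> = restr G (cA \<tau> \<xi>) b"

definition r :: "real \<Rightarrow> 'g \<Rightarrow> 'h \<Rightarrow> ('g, 'k) formal_map" where "r \<tau> b \<xi> = (\<lambda>\<alpha>. \<langle>\<xi>, \<rho> \<tau> b \<alpha>\<rangle>)"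

definition k :: "'g \<Rightarrow> 'h \<Rightarrow> ('g, 'k) formal_map" where "k b \<xi> = const \<langle>\<xi>, b\<rangle>"

definition th :: "real \<Rightarrow> 'h \<Rightarrow> 'h \<Rightarrow> ('g, 'k) formal_map" where
  "th \<tau> \<zeta> \<xi> = (\<Sum>b\<in>B. a \<tau> b \<xi> \<odot> r \<tau> b \<zeta> - k b \<zeta> \<odot> r \<tau> b \<xi>)"

definition thetaP :: "real \<Rightarrow> ('g, 'h \<Rightarrow> 'g) formal_map" where
  "thetaP \<tau> \<alpha> \<xi> = (\<Sum>b\<in>B. fprod sg (a \<tau> b \<xi>) (\<rho> \<tau> b) \<alpha>) - (\<Sum>b\<in>B. sg \<langle>\<xi>, \<rho> \<tau> b \<alpha>\<rangle> b)"

definition cob :: "('g, 'h \<Rightarrow> 'g) formal_map" where "cob \<alpha> = cobr G (S \<alpha>)"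

text \<open>The group cocycle at \<tau>S, with the integration variable rescaled by \<tau>. The
  bound \<open>min 1 \<tau>\<close> keeps the interval inside [0,1], where the integrand is known to
  be continuous, so that linearity in the covectors holds for every real \<tau>, as
  \<open>gauge_path\<close> demands.\<close>

definition Pi :: "real \<Rightarrow> 'h \<Rightarrow> 'h \<Rightarrow> ('g, 'k) formal_map" where
  "Pi \<tau> \<zeta> \<xi> \<alpha> = integral {0..min 1 \<tau>} (\<lambda>\<sigma>. conj cob \<sigma> \<zeta> \<xi> \<alpha>)"

definition lp :: "real \<Rightarrow> ('g, 'h \<Rightarrow> 'g) formal_map" where
  "lp \<tau> \<alpha> \<xi> = fapply (Ad G (tS \<tau>)) (fapply l (cA \<tau> \<xi>)) \<alpha> + thetaP \<tau> \<alpha> \<xi> + bidual_vector G (\<lambda>\<zeta>. Pi \<tau> \<zeta> \<xi> \<alpha>)"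

lemma R_dv: "R \<tau> (dv sg B v S) = (\<Sum>b\<in>B. fprod sg (v b) (\<rho> \<tau> b))"
  by (simp add: dv_def ser_sum ser_scalar \<rho>_def)

lemma lp_1: "lp 1 = gauge_action G B l S"
proof -
  have tS: "tS 1 = S" by (simp add: sg_simps fun_eq_iff)
  have cA: "cA 1 \<xi> = (\<lambda>\<beta>. coAd G S \<beta> \<xi>)" for \<xi> by (simp add: cA_def sg_simps)
  have rd: "right_diff G B S v = R 1 (dv sg B v S)" for v
  proof -
    have "(\<lambda>n. 1 / fact (Suc n)) = (\<lambda>n. ec 1 (Suc n))" by (simp add: ec_def fun_eq_iff)
    then show ?thesis unfolding right_diff_def fdiff_dv by simp
  qed
  have 1: "thetaP 1 \<alpha> \<xi> = theta G B S \<alpha> \<xi>" for \<alpha> \<xi>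
  proof -
    have "right_diff G B S (\<lambda>b'. const (if b' = b then 1 else 0)) = \<rho> 1 b" if "b \<in> B" for b
    proof -
      have "dv sg B (\<lambda>b'. const (if b' = b then 1 else 0)) S = (\<Sum>c\<in>B. if c = b then pd c S else 0)"
        unfolding dv_def by (rule sum.cong) (auto simp: fprod_const_left sg_simps fun_eq_iff)
      then show ?thesis using that finite_B by (simp add: rd \<rho>_def)
    qed
    then show ?thesis
      by (simp add: theta_def right_diff_transp_def rd R_dv thetaP_def a_def cA sum_fun_apply)
  qed
  have 2: "(\<lambda>\<zeta>. Pi 1 \<zeta> \<xi> \<alpha>) = (\<lambda>\<zeta>. integral {0..1} (\<lambda>\<tau>::real. let \<tau>S = (\<lambda>\<beta>. scl G (of_real \<tau>) (S \<beta>))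
     in \<langle>\<zeta>, fapply (Ad G \<tau>S) (fprod (cobr G) S (\<lambda>\<beta>. coAd G \<tau>S \<beta> \<xi>)) \<alpha>\<rangle>))" for \<alpha> \<xi>
  proof -
    have "fapply cob w = fprod (cobr G) S w" for w by (simp add: fprod_def cob_def fun_eq_iff)
    then show ?thesis by (simp add: Pi_def conj_eq Let_def) (simp add: cA_def)
  qed
  show ?thesis
    by (simp add: fun_eq_iff lp_def gauge_action_def 1 group_cocycle_def 2 sg_simps cA)
qed

lemma cob_linear: "Vector_Spaces.linear sh sg (cob \<gamma>)"
  by (simp add: cob_def linearI vs_g vs_h cobr_simps)

lemma conj_cob_continuous: "continuous_on {0..1} (\<lambda>\<sigma>. conj cob \<sigma> \<zeta> \<xi> \<alpha>)"
  using conj_flow[where l = cob and \<zeta> = \<zeta> and \<xi> = \<xi>, OF cob_linear] unfolding fderiv_def wderiv_mult_iff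
  by (auto simp: continuous_on_eq_continuous_within intro: has_vector_derivative_continuous)

lemma conj_cob_integrable: "(\<lambda>\<sigma>. conj cob \<sigma> \<zeta> \<xi> \<alpha>) integrable_on {0..min 1 \<tau>}"
  by (intro integrable_continuous_interval continuous_on_subset[OF conj_cob_continuous]) auto

lemma Pi_linear:
  "Pi \<tau> (\<zeta> + \<eta>) \<xi> = Pi \<tau> \<zeta> \<xi> + Pi \<tau> \<eta> \<xi>" "Pi \<tau> (sh c \<zeta>) \<xi> \<alpha> = c * Pi \<tau> \<zeta> \<xi> \<alpha>"
  "Pi \<tau> \<zeta> (\<xi> + \<eta>) = Pi \<tau> \<zeta> \<xi> + Pi \<tau> \<zeta> \<eta>" "Pi \<tau> \<zeta> (sh c \<xi>) \<alpha> = c * Pi \<tau> \<zeta> \<xi> \<alpha>"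
  by (simp_all add: Pi_def fun_eq_iff conj_linear_left conj_linear_right[OF cob_linear]
      integral_add conj_cob_integrable)

lemma Pi_bidual: "\<langle>\<zeta>, bidual_vector G (\<lambda>\<zeta>. Pi \<tau> \<zeta> \<xi> \<alpha>)\<rangle> = Pi \<tau> \<zeta> \<xi> \<alpha>"
  by (rule bidual) (simp add: linearI vs_h vector_space_mult Pi_linear)

lemma Pi_0: "Pi 0 \<zeta> \<xi> = 0" "Pi 0 \<zeta> = (\<lambda>\<xi>. 0)"
  by (simp_all add: Pi_def fun_eq_iff)

lemma fderiv_Pi: "fderiv (*) (\<lambda>\<tau>. Pi \<tau> \<zeta> \<xi>) (\<lambda>\<tau>. conj cob \<tau> \<zeta> \<xi>)"
  unfolding fderiv_def wderiv_mult_iff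
proof (intro allI ballI)
  fix \<alpha> and \<tau> :: real assume \<tau>: "\<tau> \<in> {0..1}"
  show "((\<lambda>\<tau>. Pi \<tau> \<zeta> \<xi> \<alpha>) has_vector_derivative conj cob \<tau> \<zeta> \<xi> \<alpha>) (at \<tau> within {0..1})"
    by (rule has_vector_derivative_transform[OF \<tau> _ integral_has_vector_derivative[OF conj_cob_continuous \<tau>]])
       (auto simp: Pi_def min_absorb2)
qed

text \<open>\<open>conj cob\<close> is the \<tau>-derivative of \<open>Pi\<close>, so
  differentiating the two extension terms reproduces \<open>conj_flow\<close>. The difference of the
  two sides is therefore constant, and at 0 only the cobracket of S remains.\<close>

lemma Pi_flow:
  assumes "\<tau> \<in> {0..1}"
  shows "conj cob \<tau> \<zeta> \<xi> = ext (\<lambda>x. Pi \<tau> x \<xi>) (cS \<zeta>) + ext (\<lambda>x. Pi \<tau> \<zeta> x) (cS \<xi>) + (\<lambda>\<alpha>. \<langle>\<zeta>, cobr G (S \<alpha>) \<xi>\<rangle>)"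
proof -
  define f where "f = (\<lambda>\<tau>. conj cob \<tau> \<zeta> \<xi> - (ext (\<lambda>x. Pi \<tau> x \<xi>) (cS \<zeta>) + ext (\<lambda>x. Pi \<tau> \<zeta> x) (cS \<xi>)))"
  have "fderiv (*) f (\<lambda>\<tau>. (ext (\<lambda>x. conj cob \<tau> x \<xi>) (cS \<zeta>) + ext (\<lambda>x. conj cob \<tau> \<zeta> x) (cS \<xi>))
     - (ext (\<lambda>x. conj cob \<tau> x \<xi>) (cS \<zeta>) + ext (\<lambda>x. conj cob \<tau> \<zeta> x) (cS \<xi>)))"
    unfolding f_def
    by (intro fderiv_diff fderiv_add conj_flow cob_linear fderiv_ext vector_space_mult fderiv_Pi)
  then have "f \<tau> \<alpha> = f 0 \<alpha>" for \<alpha>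
    by (rule fderiv_const_eq[OF fdim_mult]) (simp_all add: assms[simplified])
  moreover have "f 0 = (\<lambda>\<alpha>. \<langle>\<zeta>, cobr G (S \<alpha>) \<xi>\<rangle>)"
    by (simp add: f_def Pi_0 conj_0[OF cob_linear]) (simp add: cob_def)
  ultimately have "f \<tau> = (\<lambda>\<alpha>. \<langle>\<zeta>, cobr G (S \<alpha>) \<xi>\<rangle>)" by (simp add: fun_eq_iff)
  then show ?thesis by (simp add: f_def diff_eq_eq add.commute)
qed

lemma pd_inj_g: "pd b (inj_g f) = inj_g (pd b f)"
  unfolding inj_g_def by (rule pd_hom[OF linear_additive[OF linear_inj_g]])

lemma rS_S: "rS b \<xi> = (\<lambda>\<alpha>. \<langle>\<xi>, pd b S \<alpha>\<rangle>)"
  by (simp add: rS_def pd_inj_g Pr_K_inj_g)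

lemma a_eq: "a \<tau> b \<xi> = (\<lambda>\<alpha>. \<langle>\<xi>, E \<tau> (const b) \<alpha>\<rangle>)"
  by (simp add: a_def restr_def cA)

lemma fderiv_a: "fderiv (*) (\<lambda>\<tau>. a \<tau> b \<xi>) (\<lambda>\<tau>. ext (a \<tau> b) (cS \<xi>))"
proof -
  have "ext (a \<tau> b) (cS \<xi>) = (\<lambda>\<alpha>. \<langle>\<xi>, adS (E \<tau> (const b)) \<alpha>\<rangle>)" for \<tau>
    using ext_cS_pair[of "E \<tau> (const b)" \<xi>] by (simp add: a_eq[abs_def])
  then show ?thesis using fderiv_pair[OF fderiv_E] by (simp add: a_eq)
qed

lemma fderiv_r: "fderiv (*) (\<lambda>\<tau>. r \<tau> b \<xi>) (\<lambda>\<tau>. rS b \<xi> + ext (r \<tau> b) (cS \<xi>))"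
proof -
  have "rS b \<xi> + ext (r \<tau> b) (cS \<xi>) = (\<lambda>\<alpha>. \<langle>\<xi>, E \<tau> (pd b S) \<alpha>\<rangle>)" for \<tau>
    using ext_cS_pair[of "\<rho> \<tau> b" \<xi>] adS_R[of \<tau> "pd b S"]
    by (simp add: r_def[abs_def] rS_S fun_eq_iff pair_simps \<rho>_def)
  then show ?thesis using fderiv_pair[OF fderiv_R] by (simp add: r_def \<rho>_def)
qed

lemma S_eqv: "z \<in> L \<Longrightarrow> dv sg B (vf z) S = (\<lambda>\<alpha>. [S \<alpha>; z])"
  using S unfolding gauge_maps_def fdiff_dv by (auto simp: fun_eq_iff lbr_skew[of z])

lemma pair_fprod_sg: "(\<lambda>\<alpha>. \<langle>\<xi>, fprod sg c w \<alpha>\<rangle>) = c \<odot> (\<lambda>\<alpha>. \<langle>\<xi>, w \<alpha>\<rangle>)"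
  by (simp add: fprod_splits fun_eq_iff pair_simps pair_scale split_def)

text \<open>exp(\<tau> ad S) b = b + R (ad S b), and by equivariance ad S b is the derivative of S
  along the coadjoint field of b. This expresses the moved covector by the right
  differential.\<close>

lemma a_k: "b \<in> B \<Longrightarrow> a \<tau> b \<xi> = k b \<xi> + (\<Sum>c\<in>B. vf b c \<odot> r \<tau> c \<xi>)"
proof -
  assume b: "b \<in> B"
  have "adS (const b) = dv sg B (vf b) S"
    by (simp add: S_eqv[OF B_L[OF b]] fprod_const_right lbr_simps)
  then have "E \<tau> (const b) = const b + (\<Sum>c\<in>B. fprod sg (vf b c) (\<rho> \<tau> c))"
    using R_adS[of \<tau> "const b"] by (simp add: R_dv diff_eq_eq add.commute)
  then have "a \<tau> b \<xi> = (\<lambda>\<alpha>. \<langle>\<xi>, const b \<alpha>\<rangle>) + (\<Sum>c\<in>B. (\<lambda>\<alpha>. \<langle>\<xi>, fprod sg (vf b c) (\<rho> \<tau> c) \<alpha>\<rangle>))"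
    by (simp add: a_eq fun_eq_iff pair_simps sum_fun_apply)
  moreover have "(\<lambda>\<alpha>. \<langle>\<xi>, const b \<alpha>\<rangle>) = k b \<xi>" by (simp add: k_def const_def fun_eq_iff pair_simps)
  ultimately show ?thesis by (simp add: pair_fprod_sg r_def)
qed

lemma ext_k: "b \<in> B \<Longrightarrow> ext (k b) (cS \<xi>) = (\<Sum>c\<in>B. vf b c \<odot> rS c \<xi>)"
proof -
  assume b: "b \<in> B"
  have "ext (k b) (cS \<xi>) = (\<lambda>\<alpha>. \<langle>\<xi>, [S \<alpha>; b]\<rangle>)"
  proof
    fix \<alpha>
    have "ext (k b) (cS \<xi>) \<alpha> = (\<Sum>(\<beta>,\<gamma>) | \<beta> + \<gamma> = \<alpha>. if \<gamma> = {#} then \<langle>cS \<xi> \<beta>, b\<rangle> else 0)"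
      by (simp add: ext_def k_def const_def)
    then show "ext (k b) (cS \<xi>) \<alpha> = \<langle>\<xi>, [S \<alpha>; b]\<rangle>"
      by (subst (asm) sum_splits_swap) (simp add: sum_splits_delta1 cS_S coad)
  qed
  also have "\<dots> = (\<lambda>\<alpha>. \<langle>\<xi>, dv sg B (vf b) S \<alpha>\<rangle>)" by (simp add: S_eqv B_L b)
  also have "\<dots> = (\<Sum>c\<in>B. (\<lambda>\<alpha>. \<langle>\<xi>, fprod sg (vf b c) (pd c S) \<alpha>\<rangle>))"
    by (simp add: dv_def fun_eq_iff sum_fun_apply pair_simps)
  finally show ?thesis by (simp add: pair_fprod_sg rS_S)
qed

definition u :: "'h \<Rightarrow> 'h \<Rightarrow> ('g, 'k) formal_map" where
  "u \<zeta> \<xi> = (\<Sum>b\<in>B. k b \<xi> \<odot> rS b \<zeta> - k b \<zeta> \<odot> rS b \<xi>)"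

text \<open>Differentiating \<open>r\<close> produces products of \<open>a\<close> with derivatives
  of S. By \<open>a_k\<close> they split into a term of \<open>u\<close> and a term containing the
  Poisson tensor; skew-symmetry of the tensor turns the latter into the missing extension of
  \<open>k\<close>.\<close>

lemma th_flow: "fderiv (*) (\<lambda>\<tau>. th \<tau> \<zeta> \<xi>) (\<lambda>\<tau>. ext (\<lambda>x. th \<tau> x \<xi>) (cS \<zeta>) + ext (\<lambda>x. th \<tau> \<zeta> x) (cS \<xi>) + u \<zeta> \<xi>)"
proof -
  have m: "fderiv (*) f f' \<Longrightarrow> fderiv (*) g g' \<Longrightarrow> fderiv (*) (\<lambda>\<tau>. f \<tau> \<odot> g \<tau>) (\<lambda>\<tau>. f' \<tau> \<odot> g \<tau> + f \<tau> \<odot> g' \<tau>)"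
    for f f' g g' :: "real \<Rightarrow> ('g, 'k) formal_map"
    by (rule fderiv_fprod[OF fdim_mult vector_space_mult linear_scale_left[OF vector_space_mult] linear_scale_right[OF vector_space_mult]])
  have "fderiv (*) (\<lambda>\<tau>. th \<tau> \<zeta> \<xi>) (\<lambda>\<tau>. \<Sum>b\<in>B. (ext (a \<tau> b) (cS \<xi>) \<odot> r \<tau> b \<zeta> + a \<tau> b \<xi> \<odot> (rS b \<zeta> + ext (r \<tau> b) (cS \<zeta>)))
      - (0 \<odot> r \<tau> b \<xi> + k b \<zeta> \<odot> (rS b \<xi> + ext (r \<tau> b) (cS \<xi>))))"
    unfolding th_def
    by (intro fderiv_sum fderiv_diff m fderiv_a fderiv_r fderiv_const vector_space_mult)
  moreover have "(\<Sum>b\<in>B. (ext (a \<tau> b) (cS \<xi>) \<odot> r \<tau> b \<zeta> + a \<tau> b \<xi> \<odot> (rS b \<zeta> + ext (r \<tau> b) (cS \<zeta>)))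
      - (0 \<odot> r \<tau> b \<xi> + k b \<zeta> \<odot> (rS b \<xi> + ext (r \<tau> b) (cS \<xi>)))) =
      ext (\<lambda>x. th \<tau> x \<xi>) (cS \<zeta>) + ext (\<lambda>x. th \<tau> \<zeta> x) (cS \<xi>) + u \<zeta> \<xi>" for \<tau>
  proof -
    have 1: "ext (\<lambda>x. th \<tau> x \<xi>) (cS \<zeta>) = (\<Sum>b\<in>B. a \<tau> b \<xi> \<odot> ext (r \<tau> b) (cS \<zeta>)) - (\<Sum>b\<in>B. ext (k b) (cS \<zeta>) \<odot> r \<tau> b \<xi>)"
      unfolding th_def ext_fam fprod_ext_left[OF biadd_mult, symmetric] fprod_ext_right[OF biadd_mult, symmetric] sum_subtractf ..
    have 2: "ext (\<lambda>x. th \<tau> \<zeta> x) (cS \<xi>) = (\<Sum>b\<in>B. ext (a \<tau> b) (cS \<xi>) \<odot> r \<tau> b \<zeta>) - (\<Sum>b\<in>B. k b \<zeta> \<odot> ext (r \<tau> b) (cS \<xi>))"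
      unfolding th_def ext_fam fprod_ext_left[OF biadd_mult, symmetric] fprod_ext_right[OF biadd_mult, symmetric] sum_subtractf ..
    have 3: "(\<Sum>b\<in>B. a \<tau> b \<xi> \<odot> rS b \<zeta>) = (\<Sum>b\<in>B. k b \<xi> \<odot> rS b \<zeta>) + (\<Sum>b\<in>B. \<Sum>c\<in>B. vf b c \<odot> r \<tau> c \<xi> \<odot> rS b \<zeta>)"
      by (simp add: a_k fmul_simps sum.distrib)
    have "(\<Sum>b\<in>B. \<Sum>c\<in>B. vf b c \<odot> r \<tau> c \<xi> \<odot> rS b \<zeta>) = (\<Sum>c\<in>B. \<Sum>b\<in>B. vf b c \<odot> r \<tau> c \<xi> \<odot> rS b \<zeta>)"
      by (rule sum.swap)
    also have "\<dots> = (\<Sum>c\<in>B. \<Sum>b\<in>B. - (vf c b \<odot> rS b \<zeta> \<odot> r \<tau> c \<xi>))"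
    proof (intro sum.cong refl)
      fix b c assume "b \<in> B" "c \<in> B"
      then show "vf b c \<odot> r \<tau> c \<xi> \<odot> rS b \<zeta> = - (vf c b \<odot> rS b \<zeta> \<odot> r \<tau> c \<xi>)"
        using fmul_commute[of "r \<tau> c \<xi>" "rS b \<zeta>"] by (subst vf_skew) (simp_all add: fmul_simps fmul_assoc)
    qed
    also have "\<dots> = - (\<Sum>c\<in>B. ext (k c) (cS \<zeta>) \<odot> r \<tau> c \<xi>)"
      by (simp add: ext_k fmul_simps sum_negf)
    finally have 4: "(\<Sum>b\<in>B. a \<tau> b \<xi> \<odot> rS b \<zeta>) = (\<Sum>b\<in>B. k b \<xi> \<odot> rS b \<zeta>) - (\<Sum>c\<in>B. ext (k c) (cS \<zeta>) \<odot> r \<tau> c \<xi>)"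
      by (simp add: 3)
    show ?thesis unfolding 1 2 u_def fmul_simps sum.distrib sum_subtractf 4 by (simp add: algebra_simps)
  qed
  ultimately show ?thesis by simp
qed

definition bl :: "real \<Rightarrow> 'h \<Rightarrow> 'h \<Rightarrow> ('g, 'k) formal_map" where "bl \<tau> \<zeta> \<xi> = (\<lambda>\<alpha>. \<langle>\<zeta>, lp \<tau> \<alpha> \<xi>\<rangle>)"

lemma bl_eq: "bl \<tau> \<zeta> \<xi> = conj l \<tau> \<zeta> \<xi> + th \<tau> \<zeta> \<xi> + Pi \<tau> \<zeta> \<xi>"
proof
  fix \<alpha>
  have "\<langle>\<zeta>, thetaP \<tau> \<alpha> \<xi>\<rangle> = th \<tau> \<zeta> \<xi> \<alpha>"
    using fun_cong[OF pair_fprod_sg, of \<zeta> _ _ \<alpha>]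
    by (simp add: thetaP_def th_def pair_simps pair_scale sum_fun_apply sum_subtractf k_def fprod_const_left r_def mult.commute)
  then show "bl \<tau> \<zeta> \<xi> \<alpha> = (conj l \<tau> \<zeta> \<xi> + th \<tau> \<zeta> \<xi> + Pi \<tau> \<zeta> \<xi>) \<alpha>"
    by (simp add: bl_def lp_def pair_simps conj_eq Pi_bidual)
qed

text \<open>The conjugated, twist and cocycle parts obey the same linear law; the twist adds the
  inhomogeneous term \<open>u\<close>, the cocycle the cobracket of S.\<close>

lemma bl_flow: "fderiv (*) (\<lambda>\<tau>. bl \<tau> \<zeta> \<xi>)
   (\<lambda>\<tau>. ext (\<lambda>x. bl \<tau> x \<xi>) (cS \<zeta>) + ext (\<lambda>x. bl \<tau> \<zeta> x) (cS \<xi>) + u \<zeta> \<xi> + (\<lambda>\<alpha>. \<langle>\<zeta>, cobr G (S \<alpha>) \<xi>\<rangle>))"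
proof (rule fderiv_cong)
  show "fderiv (*) (\<lambda>\<tau>. bl \<tau> \<zeta> \<xi>) (\<lambda>\<tau>. (ext (\<lambda>x. conj l \<tau> x \<xi>) (cS \<zeta>) + ext (\<lambda>x. conj l \<tau> \<zeta> x) (cS \<xi>))
     + (ext (\<lambda>x. th \<tau> x \<xi>) (cS \<zeta>) + ext (\<lambda>x. th \<tau> \<zeta> x) (cS \<xi>) + u \<zeta> \<xi>) + conj cob \<tau> \<zeta> \<xi>)"
    unfolding bl_eq by (intro fderiv_add conj_flow l_linear th_flow fderiv_Pi)
qed (simp add: Pi_flow bl_eq ext_fam algebra_simps)

lemma lp_linear: "Vector_Spaces.linear sh sg (lp \<tau> \<alpha>)"
proof (rule linearI[OF vs_h vs_g])
  have a: "a \<tau> b (\<xi> + \<eta>) = a \<tau> b \<xi> + a \<tau> b \<eta>" "r \<tau> b (\<xi> + \<eta>) = r \<tau> b \<xi> + r \<tau> b \<eta>"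
    "a \<tau> b (sh c \<xi>) = (\<lambda>\<alpha>. c * a \<tau> b \<xi> \<alpha>)" "r \<tau> b (sh c \<xi>) = (\<lambda>\<alpha>. c * r \<tau> b \<xi> \<alpha>)" for b c \<xi> \<eta>
    by (simp_all add: a_eq r_def fun_eq_iff pair_simps pair_scale)
  have m: "(\<lambda>\<alpha>. c * f \<alpha>) \<odot> g = (\<lambda>\<alpha>. c * (f \<odot> g) \<alpha>)" "f \<odot> (\<lambda>\<alpha>. c * g \<alpha>) = (\<lambda>\<alpha>. c * (f \<odot> g) \<alpha>)" for c f and g :: "('g, 'k) formal_map"
    by (simp_all add: fprod_splits fun_eq_iff sum_distrib_left split_def mult_ac)
  fix \<xi> \<eta> c
  have "bl \<tau> \<zeta> (\<xi> + \<eta>) = bl \<tau> \<zeta> \<xi> + bl \<tau> \<zeta> \<eta>" for \<zeta>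
    by (simp add: bl_eq conj_linear_right[OF l_linear] Pi_linear th_def a fmul_simps sum.distrib sum_subtractf)
  then show "lp \<tau> \<alpha> (\<xi> + \<eta>) = lp \<tau> \<alpha> \<xi> + lp \<tau> \<alpha> \<eta>"
    by (intro g_eqI) (simp add: bl_def pair_simps fun_eq_iff)
  have "bl \<tau> \<zeta> (sh c \<xi>) \<alpha> = c * bl \<tau> \<zeta> \<xi> \<alpha>" for \<zeta> \<alpha>
    by (simp add: bl_eq conj_linear_right[OF l_linear] Pi_linear th_def a m sum_fun_apply sum_distrib_left algebra_simps)
  then show "lp \<tau> \<alpha> (sh c \<xi>) = sg c (lp \<tau> \<alpha> \<xi>)"
    by (intro g_eqI) (simp add: bl_def pair_scale)
qed

lemma lp_0: "lp 0 = l"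
proof (intro HOL.ext g_eqI)
  fix \<alpha> \<xi> \<zeta>
  have "th 0 \<zeta> \<xi> = 0" by (simp add: th_def r_def \<rho>_def R_0 pair_simps zero_fun_def[symmetric] fmul_simps)
  then have "bl 0 \<zeta> \<xi> \<alpha> = \<langle>\<zeta>, l \<alpha> \<xi>\<rangle>" by (simp add: bl_eq conj_0[OF l_linear] Pi_0)
  then show "\<langle>\<zeta>, lp 0 \<alpha> \<xi>\<rangle> = \<langle>\<zeta>, l \<alpha> \<xi>\<rangle>" by (simp add: bl_def)
qed

lemma formal_ser: "formal_on B w \<Longrightarrow> formal_on B (ser c w)"
proof -
  assume w: "formal_on B w"
  have "formal_on B ((adS ^^ n) w)" for n
    by (induction n) (simp_all add: w formal_on_fprod S_formal biadd_lbr)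
  then show ?thesis by (simp add: formal_on_def ad_series_def sg_simps)
qed

lemma lp_formal: "formal_on B (lp \<tau>)"
proof -
  have cA: "formal_on B (cA \<tau> \<xi>)" for \<tau> \<xi>
    unfolding formal_on_def
  proof (intro allI impI h_eqI)
    fix \<alpha> x assume "\<not> set_mset \<alpha> \<subseteq> B"
    then have "E \<tau> (const x) \<alpha> = 0" using formal_ser[OF formal_on_const[of B x], of "ec \<tau>"] by (simp add: formal_on_def)
    then show "\<langle>cA \<tau> \<xi> \<alpha>, x\<rangle> = \<langle>0, x\<rangle>" by (simp add: cA pair_simps)
  qed
  have fa: "formal_on B (fapply l' (cA \<tau> \<xi>))" if "formal_on B l'" "\<And>\<gamma>. Vector_Spaces.linear sh sg (l' \<gamma>)" for l' \<xi> \<tau>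
    unfolding formal_on_def
  proof (intro allI impI, rule fprod_0)
    fix \<alpha> \<beta> \<gamma> assume "\<not> set_mset \<alpha> \<subseteq> B" "\<beta> + \<gamma> = \<alpha>"
    then have "\<not> set_mset \<beta> \<subseteq> B \<or> \<not> set_mset \<gamma> \<subseteq> B" by auto
    then show "l' \<beta> (cA \<tau> \<xi> \<gamma>) = 0"
      using that(1) cA[of \<tau> \<xi>] linear_simps(1)[OF that(2)] by (auto simp: formal_on_def)
  qed
  have cj: "formal_on B (conj l' \<tau> \<zeta> \<xi>)" if "formal_on B l'" "\<And>\<gamma>. Vector_Spaces.linear sh sg (l' \<gamma>)" for l' \<zeta> \<xi> \<tau>
    unfolding conj_def by (intro formal_on_fprod biadd_pair cA fa that)
  have "formal_on B cob" using S_formal 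
    by (auto simp: formal_on_def cob_def fun_eq_iff biadd_simps[OF biadd_cobr])
  then have P: "formal_on B (Pi \<tau> \<zeta> \<xi>)" for \<zeta> \<xi>
    using cj[OF _ cob_linear] by (simp add: formal_on_def Pi_def)
  have r: "formal_on B (r \<tau> b \<xi>)" if "b \<in> B" for b \<xi>
    using formal_ser[OF formal_on_pd[OF that S_formal]] by (simp add: formal_on_def r_def \<rho>_def pair_simps)
  have a: "formal_on B (a \<tau> b \<xi>)" for b \<xi>
    using cA[of \<tau> \<xi>] by (simp add: formal_on_def a_def restr_def pair_simps)
  have k: "formal_on B (k b \<xi>)" for b \<xi> by (simp add: k_def formal_on_const)
  have "formal_on B (a \<tau> b \<xi> \<odot> r \<tau> b \<zeta>)" "formal_on B (k b \<zeta> \<odot> r \<tau> b \<xi>)" if "b \<in> B" for b \<zeta> \<xi>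
    by (intro formal_on_fprod biadd_mult a k r that)+
  then have "formal_on B (th \<tau> \<zeta> \<xi>)" for \<zeta> \<xi>
    by (simp add: formal_on_def th_def sum_fun_apply)
  then have "formal_on B (bl \<tau> \<zeta> \<xi>)" for \<zeta> \<xi>
    using cj[OF l_formal l_linear] P by (simp add: formal_on_def bl_eq)
  then have "\<not> set_mset \<alpha> \<subseteq> B \<Longrightarrow> \<langle>\<zeta>, lp \<tau> \<alpha> \<xi>\<rangle> = \<langle>\<zeta>, 0\<rangle>" for \<alpha> \<zeta> \<xi>
    unfolding formal_on_def bl_def by (simp add: pair_simps)
  then have "\<not> set_mset \<alpha> \<subseteq> B \<Longrightarrow> lp \<tau> \<alpha> \<xi> = 0" for \<alpha> \<xi> by (rule g_eqI)
  then show ?thesis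
    by (simp add: formal_on_def fun_eq_iff)
qed

text \<open>Paired with \<open>K \<zeta>\<close>, the velocity \<open>e'\<close> splits as
  \<open>bl_flow\<close> does: the bracket with s gives the extension in \<zeta> and the cobracket,
  the extension along \<open>cS \<xi>\<close> gives the extension in \<xi>, and \<open>uS\<close>
  gives \<open>u\<close>.\<close>

lemma sec_flow: "fderiv sd (\<lambda>\<tau>. sec (lp \<tau>) \<xi>) (\<lambda>\<tau>. gauge_section.e' G B (inj_g S) (sec (lp \<tau>)) \<xi>)"
proof -
  have ds: "dyn_section G L M B (sec (lp \<tau>))" for \<tau> by (simp add: sec_section_iff lp_linear)
  interpret p: gauge_section G L M B "inj_g S" "sec (lp \<tau>)" for \<tau>
    by (intro gauge_section.intro S_field ds)
  define f' where "f' = (\<lambda>\<tau> \<alpha>. fst (p.e' \<tau> \<xi> \<alpha>))"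
  have f': "p.e' \<tau> \<xi> = inj_g (f' \<tau>)" for \<tau>
    unfolding f'_def by (rule gval_eq_inj_g[OF p.gval_e'])
  have "fderiv sg (\<lambda>\<tau> \<alpha>. lp \<tau> \<alpha> \<xi>) f'"
  proof (rule fderiv_gI)
    fix \<zeta>
    have Pe: "Pr (K \<zeta>) (sec (lp \<tau>) x) = bl \<tau> \<zeta> x" for x \<tau> \<zeta>
      by (simp add: sec_eq Pr_simps Pr_K_inj_g Pr_K_K bl_def)
    have "(\<lambda>\<alpha>. \<langle>\<zeta>, f' \<tau> \<alpha>\<rangle>) = ext (\<lambda>x. bl \<tau> x \<xi>) (cS \<zeta>) + ext (\<lambda>x. bl \<tau> \<zeta> x) (cS \<xi>) + u \<zeta> \<xi> + (\<lambda>\<alpha>. \<langle>\<zeta>, cobr G (S \<alpha>) \<xi>\<rangle>)" for \<tau>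
    proof -
      have "(\<lambda>\<alpha>. \<langle>\<zeta>, f' \<tau> \<alpha>\<rangle>) = Pr (K \<zeta>) (p.e' \<tau> \<xi>)" by (simp add: f' Pr_K_inj_g)
      also have "\<dots> = Pr (K \<zeta>) (Br (inj_g S) (sec (lp \<tau>) \<xi>)) + ext (\<lambda>x. bl \<tau> \<zeta> x) (cS \<xi>) + Pr (K \<zeta>) (uS \<xi>)"
        by (simp add: p.e'_def Pr_simps fprod_ext_right[OF biadd_pr] Pe)
      also have "Pr (K \<zeta>) (uS \<xi>) = u \<zeta> \<xi>"
      proof -
        have "Pr (K x) (dd y (inj_g S)) = (\<Sum>b\<in>B. k b y \<odot> rS b x)" for x y
          unfolding Pr_commute[of "K x"] Pr_dv rS_def restr_const k_def ..
        then show ?thesis by (simp add: uS_def Pr_simps Pr_K_dst u_def sum_subtractf)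
      qed
      also have "Pr (K \<zeta>) (Br (inj_g S) (sec (lp \<tau>) \<xi>)) = ext (\<lambda>x. bl \<tau> x \<xi>) (cS \<zeta>) + (\<lambda>\<alpha>. \<langle>\<zeta>, cobr G (S \<alpha>) \<xi>\<rangle>)"
      proof -
        have "Pr (K \<zeta>) (Br (inj_g S) (K \<xi>)) = (\<lambda>\<alpha>. \<langle>\<zeta>, cobr G (S \<alpha>) \<xi>\<rangle>)"
          by (subst Pr_commute) (rule Pr_Br_inj_K_K)
        moreover have "Pr (K \<zeta>) (Br (inj_g S) (inj_g (\<lambda>\<alpha>. lp \<tau> \<alpha> \<xi>))) = ext (\<lambda>x. bl \<tau> x \<xi>) (cS \<zeta>)"
          by (simp add: Br_inj_g Pr_K_inj_g ext_cS_pair bl_def)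
        ultimately show ?thesis by (simp add: sec_eq Br_simps Pr_simps)
      qed
      finally show ?thesis by (simp add: fun_eq_iff algebra_simps)
    qed
    then show "fderiv (*) (\<lambda>\<tau> \<alpha>. \<langle>\<zeta>, lp \<tau> \<alpha> \<xi>\<rangle>) (\<lambda>\<tau> \<alpha>. \<langle>\<zeta>, f' \<tau> \<alpha>\<rangle>)"
      using bl_flow[of \<zeta> \<xi>] by (simp add: bl_def)
  qed
  from fderiv_add[OF fderiv_map[OF linear_inj_g this] fderiv_const[OF vs_d, of "K \<xi>"]]
  show ?thesis unfolding sec_eq f' by (simp add: inj_g_def[abs_def])
qed

theorem gauge_action_Dynl: "gauge_action G B l S \<in> Dynl G L B"
proof -
  have "dyn_eqv G L M B (sec l)" and F: "dyn_section.F G B (sec l) \<xi> \<eta> \<zeta> = 0" for \<xi> \<eta> \<zeta>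
    using l by (simp_all add: Dynl_iff)
  moreover have "inj_g S {#} = 0" by (simp add: inj_g_def S_0 zero_prod_def)
  moreover have "dyn_section G L M B (sec (lp \<tau>))" for \<tau> by (simp add: sec_section_iff lp_linear)
  ultimately interpret gauge_path G L M B "inj_g S" "\<lambda>\<tau>. sec (lp \<tau>)"
    by (intro gauge_path.intro gauge_path_axioms.intro S_field sec_flow) (simp_all add: lp_0)
  show ?thesis unfolding lp_1[symmetric] Dynl_iff using lp_formal path_eqv[of 1] path_F[of 1] by simp
qed

end

section \<open>Equivariant Poincare lemmas\<close>

context red_qb
begin

interpretation g: vector_space sg by (rule vs_g)

definition pL :: "'g \<Rightarrow> 'g" where "pL x = (SOME a. a \<in> L \<and> x - a \<in> M)"

lemma pL: "pL x \<in> L" "x - pL x \<in> M"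
proof -
  obtain a b where "a \<in> L" "b \<in> M" "x = a + b" using L_plus_M[of x] by blast
  then have "a \<in> L \<and> x - a \<in> M" by simp
  then have "pL x \<in> L \<and> x - pL x \<in> M" unfolding pL_def by (rule someI)
  then show "pL x \<in> L" "x - pL x \<in> M" by simp_all
qed

lemma pL_unique: "a \<in> L \<Longrightarrow> x - a \<in> M \<Longrightarrow> pL x = a"
proof -
  assume a: "a \<in> L" "x - a \<in> M"
  have "(x - a) - (x - pL x) \<in> M" by (rule g.subspace_diff[OF M_subspace a(2) pL(2)])
  then have "pL x - a \<in> M" by simp
  moreover have "pL x - a \<in> L" by (rule g.subspace_diff[OF L_subspace pL(1) a(1)])
  ultimately have "pL x - a \<in> {0}" using L_Int_M by blast
  then show ?thesis by simp
qed

lemma pL_linear: "Vector_Spaces.linear sg sg pL"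
proof (rule linearI[OF vs_g vs_g])
  fix x y c
  have "(x - pL x) + (y - pL y) \<in> M" by (rule g.subspace_add[OF M_subspace pL(2) pL(2)])
  then show "pL (x + y) = pL x + pL y"
    by (intro pL_unique g.subspace_add[OF L_subspace] pL) (simp add: algebra_simps)
  have "sg c (x - pL x) \<in> M" by (rule g.subspace_scale[OF M_subspace pL(2)])
  then show "pL (sg c x) = sg c (pL x)"
    by (intro pL_unique g.subspace_scale[OF L_subspace] pL) (simp add: g.scale_right_diff_distrib)
qed

lemma pL_L: "x \<in> L \<Longrightarrow> pL x = x" and pL_M: "x \<in> M \<Longrightarrow> pL x = 0"
  using g.subspace_0[OF M_subspace] g.subspace_0[OF L_subspace] by (auto intro: pL_unique)

text \<open>Here reductivity enters: both summands are stable under L, so the projection is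
  equivariant, and with it the splitting of covectors used by the homotopy.\<close>

lemma pL_lbr: "z \<in> L \<Longrightarrow> pL [z; x] = [z; pL x]"
  using lbr_LM[OF _ pL(2), of z x] by (intro pL_unique lbr_LL pL(1)) (simp_all add: lbr_simps)

text \<open>\<open>P\<close> and \<open>Q\<close> are the projections of \<open>\<gg>\<^sup>*\<close> to \<open>\<mm>\<^sup>\<bottom>\<close> and \<open>\<ll>\<^sup>\<bottom>\<close>; \<open>bs\<close> is the basis of \<open>\<mm>\<^sup>\<bottom>\<close> dual to \<open>B\<close>.\<close>

definition P :: "'h \<Rightarrow> 'h" where "P \<xi> = transp G pL \<xi>"
definition Q :: "'h \<Rightarrow> 'h" where "Q \<xi> = \<xi> - P \<xi>"
definition bs :: "'g \<Rightarrow> 'h" where "bs b = functional G (\<lambda>x. rep (pL x) b)"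

lemma P: "\<langle>P \<xi>, x\<rangle> = \<langle>\<xi>, pL x\<rangle>"
  unfolding P_def by (rule transp[OF pL_linear])

lemma P_Q: "P \<xi> + Q \<xi> = \<xi>" by (simp add: Q_def)

lemma Q_L: "x \<in> L \<Longrightarrow> \<langle>Q \<xi>, x\<rangle> = 0"
  by (simp add: Q_def pair_simps P pL_L)

lemma P_simps: "P (\<xi> + \<eta>) = P \<xi> + P \<eta>" "P (sh c \<xi>) = sh c (P \<xi>)" "P (P \<xi>) = P \<xi>" "P (Q \<xi>) = 0"
  by (rule h_eqI, simp add: P pair_simps pair_scale pL_L pL Q_def)+

lemma Q_simps: "Q (\<xi> + \<eta>) = Q \<xi> + Q \<eta>" "Q (sh c \<xi>) = sh c (Q \<xi>)" "Q (P \<xi>) = 0" "Q (Q \<xi>) = Q \<xi>"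
  by (rule h_eqI, simp add: P pair_simps pair_scale pL_L pL Q_def algebra_simps)+

lemma P_coad: "z \<in> L \<Longrightarrow> P (coad G z \<xi>) = coad G z (P \<xi>)"
  by (rule h_eqI) (simp add: P coad pL_lbr)

lemma Q_coad: "z \<in> L \<Longrightarrow> Q (coad G z \<xi>) = coad G z (Q \<xi>)"
  by (simp add: Q_def P_coad biadd_simps[OF biadd_coad])

lemma bs: "\<langle>bs b, x\<rangle> = rep (pL x) b"
  unfolding bs_def
proof (rule functional, rule linearI[OF vs_g vector_space_mult])
  fix x y c
  show "rep (pL (x + y)) b = rep (pL x) b + rep (pL y) b"
    by (simp add: linear_add[OF pL_linear] rep_add pL)
  show "rep (pL (sg c x)) b = c * rep (pL x) b"
    by (simp add: linear_scl[OF pL_linear] g.representation_scale indep_B span_B pL)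
qed

lemma P_sum: "P \<xi> = (\<Sum>b\<in>B. sh \<langle>\<xi>, b\<rangle> (bs b))"
proof (rule h_eqI)
  fix x
  have "\<langle>\<xi>, pL x\<rangle> = \<langle>\<xi>, \<Sum>b\<in>B. sg (rep (pL x) b) b\<rangle>" by (simp add: sum_rep pL)
  then show "\<langle>P \<xi>, x\<rangle> = \<langle>\<Sum>b\<in>B. sh \<langle>\<xi>, b\<rangle> (bs b), x\<rangle>"
    by (simp add: P pair_simps pair_scale bs mult.commute)
qed

lemma P_bs: "P (bs b) = bs b"
  by (rule h_eqI) (simp add: P bs pL_L pL)

lemma coad_bs: "z \<in> L \<Longrightarrow> coad G z (bs b) = (\<Sum>c\<in>B. sh (rep [z; c] b) (bs c))"
proof -
  assume z: "z \<in> L"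
  have "coad G z (bs b) = P (coad G z (bs b))" by (simp add: P_coad z P_bs)
  also have "\<dots> = (\<Sum>c\<in>B. sh (rep [z; c] b) (bs c))"
    unfolding P_sum by (rule sum.cong) (simp_all add: coad bs pL_L lbr_LL z B_L)
  finally show ?thesis .
qed

lemma annihilator_M: "\<xi> \<in> annihilator G M \<longleftrightarrow> P \<xi> = \<xi>"
proof
  assume "\<xi> \<in> annihilator G M"
  then have "\<langle>\<xi>, x - pL x\<rangle> = 0" for x using pL(2) by (simp add: annihilator_def)
  then show "P \<xi> = \<xi>" by (intro h_eqI) (simp add: P pair_simps)
next
  assume P\<xi>: "P \<xi> = \<xi>"
  have "\<langle>\<xi>, x\<rangle> = 0" if "x \<in> M" for x
    using P[of \<xi> x] by (simp add: P\<xi> pL_M that pair_simps)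
  then show "\<xi> \<in> annihilator G M" by (simp add: annihilator_def)
qed

lemma annihilator_L: "\<xi> \<in> annihilator G L \<longleftrightarrow> Q \<xi> = \<xi>"
proof
  assume "\<xi> \<in> annihilator G L"
  then have "P \<xi> = 0" using pL(1) by (intro h_eqI) (simp add: P annihilator_def pair_simps)
  then show "Q \<xi> = \<xi>" by (simp add: Q_def)
next
  assume "Q \<xi> = \<xi>"
  then show "\<xi> \<in> annihilator G L" using Q_L[of _ \<xi>] by (simp add: annihilator_def)
qed

section \<open>Coordinates on the dual of L and the homotopy\<close>

abbreviation pp where "pp \<equiv> eval_at G B"

lemma pp: "b \<in> B \<Longrightarrow> pp b = (\<lambda>\<alpha>. if \<alpha> = {#b#} then 1 else 0)"
proof
  fix \<alpha> assume b: "b \<in> B"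
  have "pp b \<alpha> = (\<Sum>c\<in>B. if c = b then (if \<alpha> = {#c#} then 1 else 0) else 0)"
    unfolding eval_at_def by (rule sum.cong) (auto simp: rep_basis[OF b])
  then show "pp b \<alpha> = (if \<alpha> = {#b#} then 1 else 0)" using b finite_B by simp
qed

lemma pp_mult: "b \<in> B \<Longrightarrow> (pp b \<odot> f) \<alpha> = (if b \<in># \<alpha> then f (\<alpha> - {#b#}) else 0)"
proof -
  assume b: "b \<in> B"
  have "(pp b \<odot> f) \<alpha> = (\<Sum>p | (case p of (\<beta>,\<gamma>) \<Rightarrow> \<beta> + \<gamma> = \<alpha>). if p = ({#b#}, \<alpha> - {#b#}) then f (\<alpha> - {#b#}) else 0)"
    unfolding fprod_splits by (rule sum.cong) (auto simp: pp[OF b] split: if_splits)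
  also have "\<dots> = (if b \<in># \<alpha> then f (\<alpha> - {#b#}) else 0)"
    unfolding sum.delta[OF finite_splits] by auto
  finally show ?thesis .
qed

lemma vf_pp: "z \<in> L \<Longrightarrow> b \<in> B \<Longrightarrow> vf z b = (\<Sum>c\<in>B. const (rep [z; b] c) \<odot> pp c)"
  by (simp add: coad_field_def fun_eq_iff sum_fun_apply fprod_const_left)
     (simp add: eval_at_def[of _ _ "[z; b]"] pp, intro allI sum.cong, auto)

text \<open>The Koszul homotopy: contraction of a one-form on \<open>\<ll>\<^sup>*\<close> with the Euler vector field.\<close>

definition hop :: "('h \<Rightarrow> ('g, 'k) formal_map) \<Rightarrow> ('g, 'k) formal_map" where
  "hop X = (\<Sum>b\<in>B. pp b \<odot> X (bs b))"

definition lin :: "('h \<Rightarrow> ('g, 'k) formal_map) \<Rightarrow> bool" where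
  "lin X \<longleftrightarrow> linfam X \<and> (\<forall>c \<xi> \<alpha>. X (sh c \<xi>) \<alpha> = c * X \<xi> \<alpha>)"

lemma lin_sum: "lin X \<Longrightarrow> X (\<Sum>i\<in>A. sh (f i) (h i)) = (\<Sum>i\<in>A. const (f i) \<odot> X (h i))"
  by (simp add: lin_def linfam_sum fprod_const_left fun_eq_iff sum_fun_apply)

lemma hop_simps: "hop (\<lambda>x. X x + Y x) = hop X + hop Y" "hop (\<lambda>x. X x - Y x) = hop X - hop Y" "hop (\<lambda>x. - X x) = - hop X"
  by (simp_all add: hop_def fmul_simps sum.distrib sum_subtractf sum_negf)

lemma Dk_fmul: "Dk v (f \<odot> g) = Dk v f \<odot> g + f \<odot> Dk v g"
  by (rule dv_fprod) (simp_all add: biadd_mult)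

text \<open>Differentiating the coordinates of the Euler field gives back the one-form, evaluated on
  \<open>P \<xi>\<close> because only that part of \<xi> is seen as a direction on the dual of
  L.\<close>

lemma dk_hop: "lin X \<Longrightarrow> dk \<xi> (hop X) = X (P \<xi>) + hop (\<lambda>x. dk \<xi> (X x))"
proof -
  assume X: "lin X"
  have "dk \<xi> (hop X) = (\<Sum>b\<in>B. const \<langle>\<xi>, b\<rangle> \<odot> X (bs b)) + hop (\<lambda>x. dk \<xi> (X x))"
    unfolding hop_def Dk_simps Dk_fmul sum.distrib
    by (intro arg_cong2[where f = plus] sum.cong refl) (simp add: dk_eval_at B_L)
  then show ?thesis by (simp add: P_sum lin_sum[OF X])
qed

text \<open>The Euler field is invariant under linear fields: the changes of the coordinates
  \<open>pp b\<close> and of the covectors \<open>bs b\<close> are transposes of each other.\<close>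

lemma Dk_vf_hop:
  assumes X: "lin X" and z: "z \<in> L"
  shows "Dk (vf z) (hop X) = hop (\<lambda>x. Dk (vf z) (X x) + X (coad G z x))"
proof -
  have pp: "Dk (vf z) (pp b) = vf z b" if b: "b \<in> B" for b
  proof -
    have "Dk (vf z) (pp b) = (\<Sum>c\<in>B. if c = b then vf z c else 0)"
      unfolding dv_def by (rule sum.cong) (auto simp: pd_eval_at rep_basis b fprod_const_right)
    then show ?thesis using b finite_B by simp
  qed
  have "(\<Sum>b\<in>B. vf z b \<odot> X (bs b)) = (\<Sum>b\<in>B. \<Sum>c\<in>B. const (rep [z; b] c) \<odot> pp c \<odot> X (bs b))"
    by (simp add: vf_pp z fmul_simps)
  also have "\<dots> = (\<Sum>c\<in>B. \<Sum>b\<in>B. const (rep [z; b] c) \<odot> pp c \<odot> X (bs b))" by (rule sum.swap)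
  also have "\<dots> = hop (\<lambda>x. X (coad G z x))"
    unfolding hop_def
    by (intro sum.cong refl) (simp add: coad_bs[OF z] lin_sum[OF X] fmul_simps fmul_assoc fmul_left_commute[of "const _"])
  finally have 1: "(\<Sum>b\<in>B. vf z b \<odot> X (bs b)) = hop (\<lambda>x. X (coad G z x))" .
  have "Dk (vf z) (hop X) = (\<Sum>b\<in>B. vf z b \<odot> X (bs b)) + hop (\<lambda>x. Dk (vf z) (X x))"
    unfolding hop_def Dk_simps Dk_fmul sum.distrib
    by (intro arg_cong2[where f = plus] sum.cong refl) (simp add: pp)
  then show ?thesis by (simp add: 1 hop_simps)
qed

lemma dk_bs: "b \<in> B \<Longrightarrow> dk (bs b) f = pd b f"
proof -
  assume b: "b \<in> B"
  have "dk (bs b) f = (\<Sum>c\<in>B. if c = b then pd c f else 0)"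
    unfolding dv_def restr_const
    by (rule sum.cong) (auto simp: bs pL_L B_L rep_basis fprod_const_left)
  then show ?thesis using b finite_B by simp
qed

lemma dk_Q: "dk (Q \<xi>) f = 0" and dk_P: "dk (P \<xi>) f = dk \<xi> f"
proof -
  show "dk (Q \<xi>) f = 0" unfolding dv_def restr_const
    by (rule sum.neutral) (auto simp: Q_L B_L fprod_const_left)
  show "dk (P \<xi>) f = dk \<xi> f" unfolding dv_def restr_const
    by (rule sum.cong) (auto simp: P pL_L B_L)
qed

text \<open>Euler's identity: each b contributes its multiplicity in \<alpha>, and the
  multiplicities add up to the degree.\<close>

lemma hop_dk: "formal_on B f \<Longrightarrow> hop (\<lambda>x. dk x f) \<alpha> = of_nat (size \<alpha>) * f \<alpha>"
proof (cases "set_mset \<alpha> \<subseteq> B")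
  case True
  have "hop (\<lambda>x. dk x f) \<alpha> = (\<Sum>b\<in>B. of_nat (count \<alpha> b) * f \<alpha>)"
    unfolding hop_def sum_fun_apply
    by (rule sum.cong) (auto simp: pp_mult dk_bs pd_def nsc_mult not_in_iff)
  also have "\<dots> = of_nat (\<Sum>b\<in>B. count \<alpha> b) * f \<alpha>" by (simp add: sum_distrib_right)
  also have "(\<Sum>b\<in>B. count \<alpha> b) = size \<alpha>" unfolding size_multiset_overloaded_eq
    using True finite_B by (intro sum.mono_neutral_right) (auto simp: not_in_iff)
  finally show ?thesis .
next
  case False
  moreover assume "formal_on B f"
  moreover have "insert b (set_mset (\<alpha> - {#b#})) = set_mset \<alpha>" if "b \<in># \<alpha>" for b
    using insert_DiffM[OF that] by (metis set_mset_add_mset_insert)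
  ultimately show ?thesis
    by (auto simp: hop_def sum_fun_apply pp_mult dk_bs pd_def formal_on_def insert_DiffM intro!: sum.neutral)
qed

lemma hop_formal: "(\<And>x. formal_on B (X x)) \<Longrightarrow> formal_on B (hop X)"
proof -
  assume X: "\<And>x. formal_on B (X x)"
  have pp: "formal_on B (pp b)" if "b \<in> B" for b by (auto simp: formal_on_def pp that)
  then have "formal_on B (pp b \<odot> X (bs b))" if "b \<in> B" for b
    by (intro formal_on_fprod biadd_mult X pp that)
  then show ?thesis by (simp add: formal_on_def hop_def sum_fun_apply)
qed

lemma hop_homogeneous:
  assumes "\<And>x \<alpha>. size \<alpha> \<noteq> n \<Longrightarrow> X x \<alpha> = 0" and "size \<alpha> \<noteq> Suc n"
  shows "hop X \<alpha> = 0"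
  unfolding hop_def sum_fun_apply
proof (rule sum.neutral, rule ballI)
  fix b assume b: "b \<in> B"
  have "size (\<alpha> - {#b#}) \<noteq> n" if "b \<in># \<alpha>" using assms(2) that by (metis size_Suc_Diff1)
  then show "(pp b \<odot> X (bs b)) \<alpha> = 0" by (simp add: pp_mult b assms(1))
qed

lemma dk_lin: "lin X \<Longrightarrow> X (P \<xi> + Q \<xi>) = X (P \<xi>) + X (Q \<xi>)"
  by (simp add: lin_def linfam_def)

lemma dk_scale: "dk \<xi> (\<lambda>\<alpha>. c * f \<alpha>) = (\<lambda>\<alpha>. c * dk \<xi> f \<alpha>)"
  and Dk_scale: "Dk v (\<lambda>\<alpha>. c * f \<alpha>) = (\<lambda>\<alpha>. c * Dk v f \<alpha>)"
  by (rule dv_map[OF linear_scale_right[OF vector_space_mult]])+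

text \<open>On a form of degree n, Cartan's formula for the Euler field acts as n plus the number of
  arguments in the annihilator of M. This gives the weights 1/(n+2) and 1/(n+1) in T, according to
  where the argument left after contraction lies. On two arguments in the annihilator of L the
  factor is n: a closed form vanishes there for positive n, and for n = 0 this is the assumption
  \<open>base\<close>.\<close>

lemma Poincare2:
  fixes \<delta> :: "'h \<Rightarrow> 'h \<Rightarrow> ('g, 'k) formal_map"
  assumes lin: "\<And>\<eta>. lin (\<lambda>\<xi>. \<delta> \<xi> \<eta>)" and skew: "\<And>\<xi> \<eta>. \<delta> \<eta> \<xi> = - \<delta> \<xi> \<eta>"
    and closed: "\<And>\<xi> \<eta> \<zeta>. dk \<xi> (\<delta> \<eta> \<zeta>) + dk \<eta> (\<delta> \<zeta> \<xi>) + dk \<zeta> (\<delta> \<xi> \<eta>) = 0"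
    and hom: "\<And>\<xi> \<eta> \<alpha>. size \<alpha> \<noteq> n \<Longrightarrow> \<delta> \<xi> \<eta> \<alpha> = 0" and formal: "\<And>\<xi> \<eta>. formal_on B (\<delta> \<xi> \<eta>)"
    and base: "\<And>\<xi> \<eta>. n = 0 \<Longrightarrow> \<delta> (Q \<xi>) (Q \<eta>) = 0"
    and eqv: "\<And>z \<xi> \<eta>. z \<in> L \<Longrightarrow> Dk (vf z) (\<delta> \<xi> \<eta>) + \<delta> (coad G z \<xi>) \<eta> + \<delta> \<xi> (coad G z \<eta>) = 0"
  obtains T where "lin T" "\<And>\<eta>. formal_on B (T \<eta>)" "\<And>\<eta> \<alpha>. size \<alpha> \<noteq> Suc n \<Longrightarrow> T \<eta> \<alpha> = 0"
    "\<And>\<xi> \<eta>. dk \<xi> (T \<eta>) - dk \<eta> (T \<xi>) = \<delta> \<xi> \<eta>"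
    "\<And>z \<eta>. z \<in> L \<Longrightarrow> Dk (vf z) (T \<eta>) + T (coad G z \<eta>) = 0"
proof -
  define hd where "hd = (\<lambda>\<eta>. hop (\<lambda>x. \<delta> x \<eta>))"
  define T where "T = (\<lambda>\<eta> \<alpha>. 1 / of_nat (n + 2) * hd (P \<eta>) \<alpha> + 1 / of_nat (n + 1) * hd (Q \<eta>) \<alpha>)"
  have lin': "lin (\<delta> \<xi>)" for \<xi>
    using lin[of \<xi>] unfolding lin_def linfam_def skew[of \<xi>] by simp
  have hd_lin: "hd (\<xi> + \<eta>) = hd \<xi> + hd \<eta>" "hd (sh c \<xi>) = (\<lambda>\<alpha>. c * hd \<xi> \<alpha>)" for \<xi> \<eta> c
  proof -
    show "hd (\<xi> + \<eta>) = hd \<xi> + hd \<eta>"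
      using lin' by (simp add: hd_def lin_def linfam_def hop_simps)
    show "hd (sh c \<xi>) = (\<lambda>\<alpha>. c * hd \<xi> \<alpha>)"
      using lin' by (auto simp: hd_def lin_def hop_def fun_eq_iff sum_fun_apply pp_mult sum_distrib_left intro!: sum.cong)
  qed
  \<comment> \<open>Cartan's formula: closedness turns the differentiated contractions into the
    Euler derivative of \<delta>, which multiplies by n; the other two terms come from
    differentiating the Euler field.\<close>
  have N: "dk \<xi> (hd \<eta>) \<alpha> - dk \<eta> (hd \<xi>) \<alpha> = \<delta> (P \<xi>) \<eta> \<alpha> + \<delta> \<xi> (P \<eta>) \<alpha> + of_nat n * \<delta> \<xi> \<eta> \<alpha>" for \<xi> \<eta> \<alpha>
  proof -
    have "dk \<xi> (\<delta> x \<eta>) - dk \<eta> (\<delta> x \<xi>) = dk x (\<delta> \<xi> \<eta>)" for x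
      using closed[of x \<xi> \<eta>] by (simp add: skew[of x \<eta>] Dk_simps neg_eq_iff_add_eq_0 diff_eq_eq add_ac)
    then have "hop (\<lambda>x. dk \<xi> (\<delta> x \<eta>)) - hop (\<lambda>x. dk \<eta> (\<delta> x \<xi>)) = hop (\<lambda>x. dk x (\<delta> \<xi> \<eta>))"
      by (simp add: hop_simps[symmetric])
    then have "hop (\<lambda>x. dk \<xi> (\<delta> x \<eta>)) \<alpha> - hop (\<lambda>x. dk \<eta> (\<delta> x \<xi>)) \<alpha> = of_nat (size \<alpha>) * \<delta> \<xi> \<eta> \<alpha>"
      using hop_dk[OF formal, of \<xi> \<eta> \<alpha>] by (simp add: fun_eq_iff)
    moreover have "of_nat (size \<alpha>) * \<delta> \<xi> \<eta> \<alpha> = of_nat n * \<delta> \<xi> \<eta> \<alpha>" using hom[of \<alpha> \<xi> \<eta>] by (cases "size \<alpha> = n") auto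
    moreover have "\<delta> (P \<eta>) \<xi> \<alpha> = - \<delta> \<xi> (P \<eta>) \<alpha>" by (simp add: skew[of "P \<eta>" \<xi>])
    ultimately show ?thesis by (simp add: hd_def dk_hop lin)
  qed
  have nz: "(of_nat (n + 2) :: 'k) \<noteq> 0" "(of_nat (n + 1) :: 'k) \<noteq> 0"
    unfolding of_nat_eq_0_iff by simp_all
  have QQ: "\<delta> (Q \<xi>) (Q \<eta>) \<alpha> = 0" for \<xi> \<eta> \<alpha>
  proof (cases "n = 0")
    case True then show ?thesis using base by simp
  next
    case False
    have "\<delta> 0 x = 0" "\<delta> x 0 = 0" for x
      using lin[of x] lin'[of x] unfolding lin_def by (auto dest: linfam_simps(2))
    then show ?thesis using N[of "Q \<xi>" "Q \<eta>" \<alpha>] False by (simp add: dk_Q P_simps)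
  qed
  have PP: "dk \<xi> (hd (P \<eta>)) \<alpha> - dk \<eta> (hd (P \<xi>)) \<alpha> = of_nat (n + 2) * \<delta> (P \<xi>) (P \<eta>) \<alpha>" for \<xi> \<eta> \<alpha>
    using N[of "P \<xi>" "P \<eta>" \<alpha>] by (simp add: dk_P P_simps algebra_simps)
  have PQ: "dk \<xi> (hd (Q \<eta>)) \<alpha> = of_nat (n + 1) * \<delta> (P \<xi>) (Q \<eta>) \<alpha>" for \<xi> \<eta> \<alpha>
  proof -
    have "\<delta> x 0 = 0" for x using lin'[of x] unfolding lin_def by (auto dest: linfam_simps(2))
    then show ?thesis using N[of "P \<xi>" "Q \<eta>" \<alpha>] by (simp add: dk_P dk_Q P_simps algebra_simps)
  qed
  have dkT: "dk \<xi> (T \<eta>) \<alpha> = 1 / of_nat (n + 2) * dk \<xi> (hd (P \<eta>)) \<alpha> + 1 / of_nat (n + 1) * dk \<xi> (hd (Q \<eta>)) \<alpha>" for \<xi> \<eta> \<alpha>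
  proof -
    have "T \<eta> = (\<lambda>\<alpha>. 1 / of_nat (n + 2) * hd (P \<eta>) \<alpha>) + (\<lambda>\<alpha>. 1 / of_nat (n + 1) * hd (Q \<eta>) \<alpha>)"
      by (simp add: T_def fun_eq_iff)
    then show ?thesis by (simp only: Dk_simps dk_scale plus_fun_apply)
  qed
  show ?thesis
  proof (rule that[of T])
    show "lin T" unfolding lin_def linfam_def
      by (simp add: T_def P_simps Q_simps hd_lin fun_eq_iff algebra_simps add_divide_distrib)
    show "formal_on B (T \<eta>)" for \<eta>
      using hop_formal[of "\<lambda>x. \<delta> x _", OF formal] by (simp add: T_def formal_on_def hd_def)
    show "T \<eta> \<alpha> = 0" if "size \<alpha> \<noteq> Suc n" for \<eta> \<alpha>
      using hop_homogeneous[OF hom that] by (simp add: T_def hd_def)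
    show "dk \<xi> (T \<eta>) - dk \<eta> (T \<xi>) = \<delta> \<xi> \<eta>" for \<xi> \<eta>
    proof
      fix \<alpha>
      have "dk \<xi> (T \<eta>) \<alpha> - dk \<eta> (T \<xi>) \<alpha> = 1 / of_nat (n + 2) * (dk \<xi> (hd (P \<eta>)) \<alpha> - dk \<eta> (hd (P \<xi>)) \<alpha>)
          + 1 / of_nat (n + 1) * dk \<xi> (hd (Q \<eta>)) \<alpha> - 1 / of_nat (n + 1) * dk \<eta> (hd (Q \<xi>)) \<alpha>"
        unfolding dkT by (simp add: algebra_simps)
      also have "\<dots> = \<delta> (P \<xi>) (P \<eta>) \<alpha> + \<delta> (P \<xi>) (Q \<eta>) \<alpha> - \<delta> (P \<eta>) (Q \<xi>) \<alpha>"
        unfolding PP PQ using nz by (simp del: of_nat_add)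
      also have "\<dots> = \<delta> (P \<xi> + Q \<xi>) (P \<eta> + Q \<eta>) \<alpha>"
        unfolding dk_lin[OF lin] dk_lin[OF lin'] using skew[of "P \<eta>" "Q \<xi>"] by (simp add: QQ)
      finally show "(dk \<xi> (T \<eta>) - dk \<eta> (T \<xi>)) \<alpha> = \<delta> \<xi> \<eta> \<alpha>" by (simp add: P_Q)
    qed
    show "Dk (vf z) (T \<eta>) + T (coad G z \<eta>) = 0" if z: "z \<in> L" for z \<eta>
    proof -
      have hd: "Dk (vf z) (hd \<eta>) = - hd (coad G z \<eta>)" for \<eta>
      proof -
        have "Dk (vf z) (\<delta> x \<eta>) + \<delta> (coad G z x) \<eta> = - \<delta> x (coad G z \<eta>)" for x
          using eqv[OF z, of x \<eta>] by (simp only: eq_neg_iff_add_eq_0)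
        then show ?thesis by (simp add: hd_def Dk_vf_hop[OF lin z] hop_simps)
      qed
      have "T \<eta> = (\<lambda>\<alpha>. 1 / of_nat (n + 2) * hd (P \<eta>) \<alpha>) + (\<lambda>\<alpha>. 1 / of_nat (n + 1) * hd (Q \<eta>) \<alpha>)"
        by (simp add: T_def fun_eq_iff)
      then have "Dk (vf z) (T \<eta>) = - T (coad G z \<eta>)"
        by (simp only: Dk_simps Dk_scale hd P_coad[OF z] Q_coad[OF z] T_def fun_eq_iff) simp
      then show ?thesis by simp
    qed
  qed
qed

text \<open>Same mechanism with three arguments. Contraction uses up one argument in the annihilator
  of M, so a remaining pair with i arguments there is divided by n + i + 1; these are the constants
  c1, c2, c3 for i = 0, 1, 2.\<close>

lemma Poincare3:
  fixes F :: "'h \<Rightarrow> 'h \<Rightarrow> 'h \<Rightarrow> ('g, 'k) formal_map"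
  assumes lin: "\<And>\<eta> \<zeta>. lin (\<lambda>\<xi>. F \<xi> \<eta> \<zeta>)" and skew: "\<And>\<xi> \<eta> \<zeta>. F \<eta> \<xi> \<zeta> = - F \<xi> \<eta> \<zeta>"
    and rot: "\<And>\<xi> \<eta> \<zeta>. F \<eta> \<zeta> \<xi> = F \<xi> \<eta> \<zeta>"
    and closed: "\<And>\<xi> \<eta> \<zeta> \<mu>. dk \<xi> (F \<eta> \<zeta> \<mu>) - dk \<eta> (F \<xi> \<zeta> \<mu>) + dk \<zeta> (F \<xi> \<eta> \<mu>) - dk \<mu> (F \<xi> \<eta> \<zeta>) = 0"
    and hom: "\<And>\<xi> \<eta> \<zeta> \<alpha>. size \<alpha> \<noteq> n \<Longrightarrow> F \<xi> \<eta> \<zeta> \<alpha> = 0" and formal: "\<And>\<xi> \<eta> \<zeta>. formal_on B (F \<xi> \<eta> \<zeta>)"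
    and base: "\<And>\<xi> \<eta> \<zeta>. n = 0 \<Longrightarrow> F (Q \<xi>) (Q \<eta>) (Q \<zeta>) = 0"
    and eqv: "\<And>z \<xi> \<eta> \<zeta>. z \<in> L \<Longrightarrow> Dk (vf z) (F \<xi> \<eta> \<zeta>) + F (coad G z \<xi>) \<eta> \<zeta> + F \<xi> (coad G z \<eta>) \<zeta> + F \<xi> \<eta> (coad G z \<zeta>) = 0"
  obtains W where "\<And>\<eta>. lin (W \<eta>)" "\<And>\<xi> \<eta>. W \<eta> \<xi> = - W \<xi> \<eta>" "\<And>\<xi> \<eta>. formal_on B (W \<xi> \<eta>)" "\<And>\<xi> \<eta> \<alpha>. size \<alpha> \<noteq> Suc n \<Longrightarrow> W \<xi> \<eta> \<alpha> = 0"
    "\<And>\<xi> \<eta> \<zeta>. dk \<xi> (W \<eta> \<zeta>) + dk \<eta> (W \<zeta> \<xi>) + dk \<zeta> (W \<xi> \<eta>) = F \<xi> \<eta> \<zeta>"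
    "\<And>z \<xi> \<eta>. z \<in> L \<Longrightarrow> Dk (vf z) (W \<xi> \<eta>) + W (coad G z \<xi>) \<eta> + W \<xi> (coad G z \<eta>) = 0"
proof -
  define hd where "hd = (\<lambda>\<eta> \<zeta>. hop (\<lambda>x. F x \<eta> \<zeta>))"
  define c1 c2 c3 :: 'k where "c1 = 1 / of_nat (n + 1)" and "c2 = 1 / of_nat (n + 2)" and "c3 = 1 / of_nat (n + 3)"
  define W where "W = (\<lambda>\<eta> \<zeta> \<alpha>. c3 * hd (P \<eta>) (P \<zeta>) \<alpha> + c2 * hd (P \<eta>) (Q \<zeta>) \<alpha> + c2 * hd (Q \<eta>) (P \<zeta>) \<alpha> + c1 * hd (Q \<eta>) (Q \<zeta>) \<alpha>)"
  have lin2: "lin (\<lambda>\<eta>. F \<xi> \<eta> \<zeta>)" for \<xi> \<zeta>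
  proof -
    have "(\<lambda>\<eta>. F \<xi> \<eta> \<zeta>) = (\<lambda>\<eta>. F \<eta> \<zeta> \<xi>)" by (rule HOL.ext) (rule rot[symmetric])
    then show ?thesis using lin[of \<zeta> \<xi>] by (simp only:)
  qed
  have lin3: "lin (\<lambda>\<zeta>. F \<xi> \<eta> \<zeta>)" for \<xi> \<eta>
  proof -
    have "(\<lambda>\<zeta>. F \<xi> \<eta> \<zeta>) = (\<lambda>\<zeta>. F \<zeta> \<xi> \<eta>)" by (rule HOL.ext) (rule rot)
    then show ?thesis using lin[of \<xi> \<eta>] by (simp only:)
  qed
  have F0: "F 0 x y = 0" "F x 0 y = 0" "F x y 0 = 0" for x y
    using lin[of x y] lin2[of x y] lin3[of x y] unfolding lin_def by (auto dest: linfam_simps(2))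
  have hd_lin: "lin (hd \<eta>)" for \<eta>
  proof -
    have "hd \<eta> (\<xi> + \<zeta>) = hd \<eta> \<xi> + hd \<eta> \<zeta>" for \<xi> \<zeta>
      using lin3 by (simp add: hd_def lin_def linfam_def hop_simps)
    moreover have "hd \<eta> (sh c \<xi>) \<alpha> = c * hd \<eta> \<xi> \<alpha>" for c \<xi> \<alpha>
      using lin3 by (auto simp: hd_def lin_def hop_def sum_fun_apply pp_mult sum_distrib_left intro!: sum.cong)
    ultimately show ?thesis by (simp add: lin_def linfam_def)
  qed
  have hd_skew: "hd \<zeta> \<eta> = - hd \<eta> \<zeta>" for \<eta> \<zeta>
  proof -
    have "F x \<zeta> \<eta> = - F x \<eta> \<zeta>" for x using skew[of \<zeta> \<eta> x] rot[of \<zeta> \<eta> x] rot[of \<eta> \<zeta> x] by simp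
    then show ?thesis by (simp add: hd_def hop_simps)
  qed
  have N: "dk \<xi> (hd \<eta> \<zeta>) \<alpha> + dk \<eta> (hd \<zeta> \<xi>) \<alpha> + dk \<zeta> (hd \<xi> \<eta>) \<alpha> = F (P \<xi>) \<eta> \<zeta> \<alpha> + F \<xi> (P \<eta>) \<zeta> \<alpha> + F \<xi> \<eta> (P \<zeta>) \<alpha> + of_nat n * F \<xi> \<eta> \<zeta> \<alpha>" for \<xi> \<eta> \<zeta> \<alpha>
  proof -
    have "dk \<xi> (F x \<eta> \<zeta>) + dk \<eta> (F x \<zeta> \<xi>) + dk \<zeta> (F x \<xi> \<eta>) = dk x (F \<xi> \<eta> \<zeta>)" for x
    proof -
      have *: "F x \<zeta> \<xi> = - F x \<xi> \<zeta>" using skew[of \<zeta> \<xi> x] rot[of \<zeta> \<xi> x] rot[of \<xi> \<zeta> x] by simp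
      show ?thesis using closed[of x \<xi> \<eta> \<zeta>] unfolding * Dk_simps by (simp add: fun_eq_iff algebra_simps)
    qed
    then have "hop (\<lambda>x. dk \<xi> (F x \<eta> \<zeta>)) + hop (\<lambda>x. dk \<eta> (F x \<zeta> \<xi>)) + hop (\<lambda>x. dk \<zeta> (F x \<xi> \<eta>)) = hop (\<lambda>x. dk x (F \<xi> \<eta> \<zeta>))"
      by (simp add: hop_simps[symmetric])
    then have "hop (\<lambda>x. dk \<xi> (F x \<eta> \<zeta>)) \<alpha> + hop (\<lambda>x. dk \<eta> (F x \<zeta> \<xi>)) \<alpha> + hop (\<lambda>x. dk \<zeta> (F x \<xi> \<eta>)) \<alpha> = of_nat (size \<alpha>) * F \<xi> \<eta> \<zeta> \<alpha>"
      using hop_dk[OF formal, of \<xi> \<eta> \<zeta> \<alpha>] by (simp add: fun_eq_iff)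
    moreover have "of_nat (size \<alpha>) * F \<xi> \<eta> \<zeta> \<alpha> = of_nat n * F \<xi> \<eta> \<zeta> \<alpha>" using hom[of \<alpha> \<xi> \<eta> \<zeta>] by (cases "size \<alpha> = n") auto
    moreover have "F (P \<eta>) \<zeta> \<xi> = F \<xi> (P \<eta>) \<zeta>" "F (P \<zeta>) \<xi> \<eta> = F \<xi> \<eta> (P \<zeta>)" by (simp_all only: rot[of "P \<eta>" \<zeta> \<xi>] rot[of \<xi> \<eta> "P \<zeta>"])
    ultimately show ?thesis by (simp add: hd_def dk_hop lin add_ac)
  qed
  have nz: "c1 * of_nat (n + 1) = 1" "c2 * of_nat (n + 2) = 1" "c3 * of_nat (n + 3) = 1"
  proof -
    have "(of_nat (n + 1) :: 'k) \<noteq> 0" "(of_nat (n + 2) :: 'k) \<noteq> 0" "(of_nat (n + 3) :: 'k) \<noteq> 0"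
      unfolding of_nat_eq_0_iff by simp_all
    then show "c1 * of_nat (n + 1) = 1" "c2 * of_nat (n + 2) = 1" "c3 * of_nat (n + 3) = 1"
      unfolding c1_def c2_def c3_def by (simp_all del: of_nat_add)
  qed
  have QQQ: "F (Q \<xi>) (Q \<eta>) (Q \<zeta>) \<alpha> = 0" for \<xi> \<eta> \<zeta> \<alpha>
  proof (cases "n = 0")
    case True then show ?thesis using base by simp
  next
    case False
    then show ?thesis using N[of "Q \<xi>" "Q \<eta>" "Q \<zeta>" \<alpha>] by (simp add: dk_Q P_simps F0)
  qed
  have PPP: "dk \<xi> (hd (P \<eta>) (P \<zeta>)) \<alpha> + dk \<eta> (hd (P \<zeta>) (P \<xi>)) \<alpha> + dk \<zeta> (hd (P \<xi>) (P \<eta>)) \<alpha> = of_nat (n + 3) * F (P \<xi>) (P \<eta>) (P \<zeta>) \<alpha>" for \<xi> \<eta> \<zeta> \<alpha>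
    using N[of "P \<xi>" "P \<eta>" "P \<zeta>" \<alpha>] by (simp add: dk_P P_simps algebra_simps)
  have PPQ: "dk \<xi> (hd (P \<eta>) (Q \<zeta>)) \<alpha> + dk \<eta> (hd (Q \<zeta>) (P \<xi>)) \<alpha> = of_nat (n + 2) * F (P \<xi>) (P \<eta>) (Q \<zeta>) \<alpha>" for \<xi> \<eta> \<zeta> \<alpha>
    using N[of "P \<xi>" "P \<eta>" "Q \<zeta>" \<alpha>] by (simp add: dk_P dk_Q P_simps F0 algebra_simps)
  have PQQ: "dk \<xi> (hd (Q \<eta>) (Q \<zeta>)) \<alpha> = of_nat (n + 1) * F (P \<xi>) (Q \<eta>) (Q \<zeta>) \<alpha>" for \<xi> \<eta> \<zeta> \<alpha>
    using N[of "P \<xi>" "Q \<eta>" "Q \<zeta>" \<alpha>] by (simp add: dk_P dk_Q P_simps F0 algebra_simps)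
  have W_eq: "W \<eta> \<zeta> = (\<lambda>\<alpha>. c3 * hd (P \<eta>) (P \<zeta>) \<alpha>) + (\<lambda>\<alpha>. c2 * hd (P \<eta>) (Q \<zeta>) \<alpha>) + (\<lambda>\<alpha>. c2 * hd (Q \<eta>) (P \<zeta>) \<alpha>) + (\<lambda>\<alpha>. c1 * hd (Q \<eta>) (Q \<zeta>) \<alpha>)" for \<eta> \<zeta>
    by (simp add: W_def fun_eq_iff)
  have dkW: "dk \<xi> (W \<eta> \<zeta>) \<alpha> = c3 * dk \<xi> (hd (P \<eta>) (P \<zeta>)) \<alpha> + c2 * dk \<xi> (hd (P \<eta>) (Q \<zeta>)) \<alpha> + c2 * dk \<xi> (hd (Q \<eta>) (P \<zeta>)) \<alpha> + c1 * dk \<xi> (hd (Q \<eta>) (Q \<zeta>)) \<alpha>" for \<xi> \<eta> \<zeta> \<alpha>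
    unfolding W_eq by (simp only: Dk_simps dk_scale plus_fun_apply)
  show ?thesis
  proof (rule that[of W])
    show "lin (W \<eta>)" for \<eta>
      using hd_lin unfolding lin_def linfam_def
      by (simp add: W_def P_simps Q_simps fun_eq_iff algebra_simps)
    show "W \<eta> \<xi> = - W \<xi> \<eta>" for \<xi> \<eta>
      using hd_skew[of "P \<xi>"] hd_skew[of "Q \<xi>"] by (simp add: W_def fun_eq_iff)
    show "formal_on B (W \<xi> \<eta>)" for \<xi> \<eta>
      using hop_formal[of "\<lambda>x. F x _ _", OF formal] by (simp add: W_def formal_on_def hd_def)
    show "W \<xi> \<eta> \<alpha> = 0" if "size \<alpha> \<noteq> Suc n" for \<xi> \<eta> \<alpha>
      using hop_homogeneous[OF hom that] by (simp add: W_def hd_def)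
    show "dk \<xi> (W \<eta> \<zeta>) + dk \<eta> (W \<zeta> \<xi>) + dk \<zeta> (W \<xi> \<eta>) = F \<xi> \<eta> \<zeta>" for \<xi> \<eta> \<zeta>
    proof
      fix \<alpha>
      have "dk \<xi> (W \<eta> \<zeta>) \<alpha> + dk \<eta> (W \<zeta> \<xi>) \<alpha> + dk \<zeta> (W \<xi> \<eta>) \<alpha> =
         c3 * (dk \<xi> (hd (P \<eta>) (P \<zeta>)) \<alpha> + dk \<eta> (hd (P \<zeta>) (P \<xi>)) \<alpha> + dk \<zeta> (hd (P \<xi>) (P \<eta>)) \<alpha>)
         + c2 * (dk \<xi> (hd (P \<eta>) (Q \<zeta>)) \<alpha> + dk \<eta> (hd (Q \<zeta>) (P \<xi>)) \<alpha>)
         + c2 * (dk \<eta> (hd (P \<zeta>) (Q \<xi>)) \<alpha> + dk \<zeta> (hd (Q \<xi>) (P \<eta>)) \<alpha>)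
         + c2 * (dk \<zeta> (hd (P \<xi>) (Q \<eta>)) \<alpha> + dk \<xi> (hd (Q \<eta>) (P \<zeta>)) \<alpha>)
         + c1 * dk \<xi> (hd (Q \<eta>) (Q \<zeta>)) \<alpha> + c1 * dk \<eta> (hd (Q \<zeta>) (Q \<xi>)) \<alpha> + c1 * dk \<zeta> (hd (Q \<xi>) (Q \<eta>)) \<alpha>"
        unfolding dkW by (simp add: algebra_simps)
      also have "\<dots> = F (P \<xi>) (P \<eta>) (P \<zeta>) \<alpha> + F (P \<xi>) (P \<eta>) (Q \<zeta>) \<alpha> + F (P \<eta>) (P \<zeta>) (Q \<xi>) \<alpha> + F (P \<zeta>) (P \<xi>) (Q \<eta>) \<alpha>
         + F (P \<xi>) (Q \<eta>) (Q \<zeta>) \<alpha> + F (P \<eta>) (Q \<zeta>) (Q \<xi>) \<alpha> + F (P \<zeta>) (Q \<xi>) (Q \<eta>) \<alpha>"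
        unfolding PPP PPQ PQQ mult.assoc[symmetric] nz by simp
      also have "\<dots> = F (P \<xi> + Q \<xi>) (P \<eta> + Q \<eta>) (P \<zeta> + Q \<zeta>) \<alpha>"
        unfolding dk_lin[OF lin] dk_lin[OF lin2] dk_lin[OF lin3] 
        using rot[of "P \<eta>" "P \<zeta>" "Q \<xi>"] rot[of "P \<xi>" "Q \<eta>" "P \<zeta>"]
          rot[of "P \<eta>" "Q \<zeta>" "Q \<xi>"] rot[of "Q \<xi>" "Q \<eta>" "P \<zeta>"]
        by (simp add: QQQ)
      finally show "(dk \<xi> (W \<eta> \<zeta>) + dk \<eta> (W \<zeta> \<xi>) + dk \<zeta> (W \<xi> \<eta>)) \<alpha> = F \<xi> \<eta> \<zeta> \<alpha>" by (simp add: P_Q)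
    qed
    show "Dk (vf z) (W \<xi> \<eta>) + W (coad G z \<xi>) \<eta> + W \<xi> (coad G z \<eta>) = 0" if z: "z \<in> L" for z \<xi> \<eta>
    proof -
      have hd: "Dk (vf z) (hd \<xi> \<eta>) = - hd (coad G z \<xi>) \<eta> - hd \<xi> (coad G z \<eta>)" for \<xi> \<eta>
      proof -
        have "Dk (vf z) (F x \<xi> \<eta>) + F (coad G z x) \<xi> \<eta> = - F x (coad G z \<xi>) \<eta> - F x \<xi> (coad G z \<eta>)" for x
          using eqv[OF z, of x \<xi> \<eta>] by (simp add: eq_diff_eq eq_neg_iff_add_eq_0 add_ac)
        then show ?thesis by (simp add: hd_def Dk_vf_hop[OF lin z] hop_simps)
      qed
      show ?thesis
        by (simp only: W_eq Dk_simps Dk_scale hd P_coad[OF z] Q_coad[OF z]) (simp add: fun_eq_iff algebra_simps)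
    qed
  qed
qed

end

section \<open>Gauge equivalence\<close>

lemma fprod_empty: "fprod m f g {#} = m (f {#}) (g {#})"
  by (simp add: fprod_def)

text \<open>A constant field lowers the degree by one while a linear field, treated next, preserves
  it. This decides which coefficients an equation at \<alpha> can see.\<close>

lemma dv_dir_cong:
  assumes "biadd s" "\<And>\<gamma>. size \<gamma> = Suc (size \<alpha>) \<Longrightarrow> f \<gamma> = g \<gamma>" "\<And>b. b \<in> B \<Longrightarrow> \<exists>c. v b = const c"
  shows "dv s B v f \<alpha> = dv s B v g \<alpha>"
  unfolding dv_def sum_fun_apply
proof (rule sum.cong)
  fix b assume "b \<in> B"
  then obtain c where "v b = const c" using assms(3) by blast
  then show "fprod s (v b) (pd b f) \<alpha> = fprod s (v b) (pd b g) \<alpha>"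
    by (simp add: fprod_const_left biadd_simps[OF assms(1)] pd_def assms(2))
qed simp

lemma dv_linear_field_cong:
  assumes "biadd s" "\<And>\<gamma>. size \<gamma> = size \<alpha> \<Longrightarrow> f \<gamma> = g \<gamma>" "\<And>b \<beta>. b \<in> B \<Longrightarrow> size \<beta> \<noteq> 1 \<Longrightarrow> v b \<beta> = 0"
  shows "dv s B v f \<alpha> = dv s B v g \<alpha>"
  unfolding dv_def sum_fun_apply
proof (rule sum.cong)
  fix b assume b: "b \<in> B"
  show "fprod s (v b) (pd b f) \<alpha> = fprod s (v b) (pd b g) \<alpha>"
  proof (rule fprod_cong)
    fix \<beta> \<gamma> assume "\<beta> + \<gamma> = \<alpha>"
    then have "size \<alpha> = size \<beta> + size \<gamma>" by auto
    then show "s (v b \<beta>) (pd b f \<gamma>) = s (v b \<beta>) (pd b g \<gamma>)"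
      using assms(3)[OF b, of \<beta>] by (cases "size \<beta> = 1") (auto simp: biadd_simps[OF assms(1)] pd_def assms(2))
  qed
qed simp

context red_qb
begin

interpretation g: vector_space sg by (rule vs_g)

lemma vf_size: "size \<beta> \<noteq> 1 \<Longrightarrow> vf z b \<beta> = 0"
  by (auto simp: coad_field_def eval_at_def intro!: sum.neutral)

lemma Dk_vf_cong: "(\<And>\<gamma>. size \<gamma> = size \<alpha> \<Longrightarrow> f \<gamma> = g \<gamma>) \<Longrightarrow> Dk (vf z) f \<alpha> = Dk (vf z) g \<alpha>"
  by (rule dv_linear_field_cong[OF biadd_mult]) (simp_all add: vf_size)

lemma dk_cong: "(\<And>\<gamma>. size \<gamma> = Suc (size \<alpha>) \<Longrightarrow> f \<gamma> = g \<gamma>) \<Longrightarrow> dk \<xi> f \<alpha> = dk \<xi> g \<alpha>"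
  by (rule dv_dir_cong[OF biadd_mult]) (auto simp: restr_const)

text \<open>Scalar form of l, in which the leading terms of differences of solutions become
  two-forms for the Poincare lemma.\<close>

definition bf :: "('g, 'h \<Rightarrow> 'g) formal_map \<Rightarrow> 'h \<Rightarrow> 'h \<Rightarrow> ('g, 'k) formal_map" where
  "bf l \<xi> \<zeta> = (\<lambda>\<alpha>. \<langle>\<zeta>, l \<alpha> \<xi>\<rangle>)"

lemma dv_pair: "(\<lambda>\<alpha>. \<langle>\<zeta>, dv sg B v f \<alpha>\<rangle>) = Dk v (\<lambda>\<alpha>. \<langle>\<zeta>, f \<alpha>\<rangle>)"
  by (rule dv_map[OF pair_linear_right, symmetric])

lemma A_sec:
  assumes "dyn_section G L M B (sec l)"
  shows "dyn_section.A G B (sec l) \<xi> \<eta> \<zeta> = dk \<xi> (bf l \<eta> \<zeta>)"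
proof -
  interpret dyn_section G L M B "sec l" by (rule assms)
  have "dd \<xi> (sec l \<eta>) = inj_g (dv sg B (restr G (const \<xi>)) (\<lambda>\<beta>. l \<beta> \<eta>))"
    unfolding sec_eq K_def by (simp add: Dd_simps dv_inj_g)
  then show ?thesis by (simp add: A_def Pr_gval_e gval_inj_g Pr_K_inj_g dv_pair bf_def)
qed

lemma T_sec_cong:
  assumes "dyn_section G L M B (sec l)" "dyn_section G L M B (sec l')"
    "\<And>\<gamma>. size \<gamma> \<le> size \<alpha> \<Longrightarrow> l \<gamma> = l' \<gamma>"
  shows "dyn_section.T G (sec l) \<xi> \<eta> \<zeta> \<alpha> = dyn_section.T G (sec l') \<xi> \<eta> \<zeta> \<alpha>"
proof -
  have s: "sec l x \<gamma> = sec l' x \<gamma>" if "size \<gamma> \<le> size \<alpha>" for x \<gamma> using assms(3)[OF that] by (simp add: sec_def)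
  have b: "Br (sec l x) (sec l y) \<gamma> = Br (sec l' x) (sec l' y) \<gamma>" if "size \<gamma> \<le> size \<alpha>" for x y \<gamma>
    using that by (intro fprod_cong) (auto simp: s)
  show ?thesis
    unfolding dyn_section.T_def[OF assms(1)] dyn_section.T_def[OF assms(2)]
    by (rule fprod_cong) (auto simp: s b)
qed

text \<open>Compatibility enters through the vanishing of the cobracket on L: it makes the constant
  covectors \<open>K \<zeta>\<close> equivariant, so pairing with them keeps the equivariance of the
  section.\<close>

lemma bf_eqv:
  assumes "dyn_eqv G L M B (sec l)" "z \<in> L"
  shows "Dk (vf z) (bf l \<xi> \<zeta>) + bf l (coad G z \<xi>) \<zeta> + bf l \<xi> (coad G z \<zeta>) = 0"
proof -
  interpret dyn_eqv G L M B "sec l" by (rule assms(1))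
  have b: "bf l \<xi> \<zeta> = Pr (K \<zeta>) (sec l \<xi>)" for \<xi> \<zeta>
    by (simp add: sec_eq Pr_simps Pr_K_inj_g Pr_K_K bf_def)
  have "DL z (K \<zeta>) = - K (coad G z \<zeta>)"
    by (simp add: DL_K cobr_L assms(2)) (simp add: K_def const_def fun_eq_iff zero_prod_def)
  then show ?thesis by (simp add: b Dk_Pr_DL DL_e assms(2) Pr_simps)
qed

lemma bf_skew:
  assumes "dyn_eqv G L M B (sec l)" shows "bf l \<zeta> \<xi> = - bf l \<xi> \<zeta>"
  using dyn_eqv.e_iso[OF assms, of \<xi> \<zeta>] by (simp add: Pr_sec_sec bf_def fun_eq_iff eq_neg_iff_add_eq_0)

lemma ad_pow_cong:
  assumes "\<And>\<gamma>. size \<gamma> \<le> n \<Longrightarrow> S' \<gamma> = S \<gamma>" "\<And>\<gamma>. size \<gamma> \<le> n \<Longrightarrow> w' \<gamma> = w \<gamma>" "size \<alpha> \<le> n"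
  shows "(fprod (lbr G) S' ^^ k) w' \<alpha> = (fprod (lbr G) S ^^ k) w \<alpha>"
  using assms(3)
proof (induction k arbitrary: \<alpha>)
  case (Suc k)
  have "fprod (lbr G) S' ((fprod (lbr G) S' ^^ k) w') \<alpha> = fprod (lbr G) S ((fprod (lbr G) S ^^ k) w) \<alpha>"
    using Suc.prems by (intro fprod_cong) (auto simp: assms(1) Suc.IH)
  then show ?case by simp
qed (simp add: assms(2))

text \<open>S has no constant term, so one bracket with it raises the degree, and agreement of w and
  w' strictly below n suffices.\<close>

lemma ad_pow_cong':
  assumes "\<And>\<gamma>. size \<gamma> \<le> n \<Longrightarrow> S' \<gamma> = S \<gamma>" "\<And>\<gamma>. size \<gamma> < n \<Longrightarrow> w' \<gamma> = w \<gamma>" "S {#} = 0" "size \<alpha> \<le> n"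
  shows "(fprod (lbr G) S' ^^ Suc k) w' \<alpha> = (fprod (lbr G) S ^^ Suc k) w \<alpha>"
proof -
  have 1: "fprod (lbr G) S' w' \<gamma> = fprod (lbr G) S w \<gamma>" if g: "size \<gamma> \<le> n" for \<gamma>
  proof (rule fprod_cong)
    fix \<beta> \<delta> assume bd: "\<beta> + \<delta> = \<gamma>"
    show "[S' \<beta>; w' \<delta>] = [S \<beta>; w \<delta>]"
    proof (cases "\<beta> = {#}")
      case True then show ?thesis using assms(1)[of "{#}"] assms(3) by (simp add: lbr_simps)
    next
      case False
      then have "0 < size \<beta>" by (simp add: nonempty_has_size[symmetric])
      then have "size \<delta> < n" "size \<beta> \<le> n" using bd g by auto
      then show ?thesis by (simp add: assms(1,2))
    qed
  qed
  have "(fprod (lbr G) S' ^^ k) (fprod (lbr G) S' w') \<alpha> = (fprod (lbr G) S ^^ k) (fprod (lbr G) S w) \<alpha>"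
    by (rule ad_pow_cong[OF assms(1) 1 assms(4)])
  then show ?thesis by (simp add: funpow_swap1)
qed

text \<open>Only the zeroth term of the series sees w in degree n.\<close>

lemma ad_series_cong:
  assumes "\<And>\<gamma>. size \<gamma> \<le> n \<Longrightarrow> S' \<gamma> = S \<gamma>" "\<And>\<gamma>. size \<gamma> < n \<Longrightarrow> w' \<gamma> = w \<gamma>" "S {#} = 0" "size \<alpha> \<le> n"
  shows "ad_series G c S' w' \<alpha> = ad_series G c S w \<alpha> + sg (c 0) (w' \<alpha> - w \<alpha>)"
proof -
  have split: "(\<Sum>k\<le>m. h k) = h 0 + (\<Sum>k<m. h (Suc k))" for m and h :: "nat \<Rightarrow> 'g"
    by (induction m) (simp_all add: add.assoc)
  have "(fprod (lbr G) S' ^^ Suc k) w' \<alpha> = (fprod (lbr G) S ^^ Suc k) w \<alpha>" for k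
    by (rule ad_pow_cong'[where n = n and S = S and S' = S' and w = w and w' = w', OF assms])
  then show ?thesis unfolding ad_series_def split by (simp add: g.scale_right_diff_distrib)
qed

lemma ad_series_linear: "Vector_Spaces.linear sg sg (\<lambda>x. ad_series G c S (const x) \<alpha>)"
proof -
  have 1: "(fprod (lbr G) S ^^ n) (const (x + y)) = (fprod (lbr G) S ^^ n) (const x) + (fprod (lbr G) S ^^ n) (const y)" for n x y
  proof (induction n)
    case 0 show ?case by (simp add: const_def fun_eq_iff)
  next
    case (Suc n) then show ?case by (simp only: funpow.simps o_apply fprod_simps[OF biadd_lbr])
  qed
  have 2: "(fprod (lbr G) S ^^ n) (const (sg a x)) = (\<lambda>\<alpha>. sg a ((fprod (lbr G) S ^^ n) (const x) \<alpha>))" for n x a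
    by (induction n) (simp_all add: const_def fprod_splits lbr_scale g.scale_sum_right split_def fun_eq_iff)
  show ?thesis
    by (rule linearI[OF vs_g vs_g])
       (simp_all add: ad_series_def 1 2 g.scale_right_distrib sum.distrib g.scale_sum_right mult.commute)
qed

lemma coAd_pair: "\<langle>coAd G S \<alpha> \<xi>, x\<rangle> = \<langle>\<xi>, Ad G S \<alpha> x\<rangle>"
  unfolding coAd_def by (rule transp) (unfold Ad_def, rule ad_series_linear)

lemma coAd_empty: "coAd G S {#} \<xi> = \<xi>"
  by (rule h_eqI) (simp add: coAd_pair Ad_def ad_series_def const_def)

lemma Ad_cong:
  assumes "\<And>\<gamma>. size \<gamma> \<le> size \<alpha> \<Longrightarrow> S' \<gamma> = S \<gamma>"
  shows "Ad G S' \<alpha> x = Ad G S \<alpha> x"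
  unfolding Ad_def ad_series_def
  by (intro sum.cong arg_cong2[where f = sg] refl ad_pow_cong[where n = "size \<alpha>"]) (simp_all add: assms)

lemma coAd_cong:
  assumes "\<And>\<gamma>. size \<gamma> \<le> size \<alpha> \<Longrightarrow> S' \<gamma> = S \<gamma>"
  shows "coAd G S' \<alpha> \<xi> = coAd G S \<alpha> \<xi>"
  by (rule h_eqI) (simp add: coAd_pair Ad_cong[OF assms])

text \<open>T begins in degree n + 1, so up to degree n the brackets with S and T are unaffected.
  Only the differential of T enters, uncorrected by the series and paired with the constant term of
  the field.\<close>

lemma right_diff_perturb:
  assumes S: "S {#} = 0" and T: "\<And>\<gamma>. size \<gamma> \<le> n \<Longrightarrow> T \<gamma> = 0" and \<alpha>: "size \<alpha> \<le> n"
    and v: "\<And>b \<gamma>. b \<in> B \<Longrightarrow> size \<gamma> \<le> n \<Longrightarrow> v' b \<gamma> = v b \<gamma>" and v0: "\<And>b. b \<in> B \<Longrightarrow> v b {#} = v0 b"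
  shows "right_diff G B (S + T) v' \<alpha> = right_diff G B S v \<alpha> + (\<Sum>b\<in>B. sg (v0 b) (pd b T \<alpha>))"
proof -
  have pdT: "pd b T \<gamma> = 0" if "size \<gamma> < n" for b \<gamma> using that by (simp add: pd_def T)
  have *: "dv sg B v' (S + T) \<gamma> = dv sg B v S \<gamma> + (\<Sum>b\<in>B. sg (v0 b) (pd b T \<gamma>))" if g: "size \<gamma> \<le> n" for \<gamma>
  proof -
    have "fprod sg (v' b) (pd b S) \<gamma> = fprod sg (v b) (pd b S) \<gamma>" if "b \<in> B" for b
      using g by (intro fprod_cong) (auto simp: v that)
    moreover have "fprod sg (v' b) (pd b T) \<gamma> = sg (v0 b) (pd b T \<gamma>)" if b: "b \<in> B" for b
    proof -
      have "fprod sg (v' b) (pd b T) \<gamma> = fprod sg (const (v0 b)) (pd b T) \<gamma>"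
      proof (rule fprod_cong)
        fix \<beta> \<delta> assume bd: "\<beta> + \<delta> = \<gamma>"
        show "sg (v' b \<beta>) (pd b T \<delta>) = sg (const (v0 b) \<beta>) (pd b T \<delta>)"
        proof (cases "\<beta> = {#}")
          case True then show ?thesis using v[OF b, of "{#}"] v0[OF b] by (simp add: const_def)
        next
          case False
          then have "0 < size \<beta>" by (simp add: nonempty_has_size[symmetric])
          then have "size \<delta> < n" using bd g by auto
          then show ?thesis by (simp add: pdT)
        qed
      qed
      then show ?thesis by (simp add: fprod_const_left)
    qed
    ultimately show ?thesis
      by (simp add: dv_def sum_fun_apply pd_simps fprod_simps[OF biadd_sg] sum.distrib)
  qed
  have "dv sg B v' (S + T) \<gamma> = dv sg B v S \<gamma>" if "size \<gamma> < n" for \<gamma>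
    using *[of \<gamma>] that by (simp add: pdT)
  then have "right_diff G B (S + T) v' \<alpha> = right_diff G B S v \<alpha> +
      sg (1 / fact (Suc 0)) (dv sg B v' (S + T) \<alpha> - dv sg B v S \<alpha>)"
    unfolding right_diff_def fdiff_dv by (intro ad_series_cong[where n = n]) (simp_all add: T S \<alpha>)
  then show ?thesis by (simp add: *[OF \<alpha>])
qed

text \<open>The adjoint and cocycle parts contain T undifferentiated and do not change up to degree
  n; the twist contains its differential. To leading order the action is thus a translation, by an
  exterior derivative according to \<open>pair_perturb\<close>.\<close>

lemma gauge_action_perturb:
  assumes S: "S {#} = 0" and T: "\<And>\<gamma>. size \<gamma> \<le> n \<Longrightarrow> T \<gamma> = 0" and \<alpha>: "size \<alpha> \<le> n"
  shows "gauge_action G B l (S + T) \<alpha> \<xi> = gauge_action G B l S \<alpha> \<xi>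
     + ((\<Sum>b\<in>B. sg \<langle>\<xi>, b\<rangle> (pd b T \<alpha>)) - (\<Sum>b\<in>B. sg \<langle>\<xi>, pd b T \<alpha>\<rangle> b))"
proof -
  have ST: "(S + T) \<gamma> = S \<gamma>" if "size \<gamma> \<le> n" for \<gamma> using T[OF that] by simp
  have Ad: "Ad G (\<lambda>\<beta>. sg k ((S + T) \<beta>)) \<beta> x = Ad G (\<lambda>\<beta>. sg k (S \<beta>)) \<beta> x"
    and coAd: "coAd G (\<lambda>\<beta>. sg k ((S + T) \<beta>)) \<beta> \<xi> = coAd G (\<lambda>\<beta>. sg k (S \<beta>)) \<beta> \<xi>"
    if "size \<beta> \<le> n" for k \<beta> x \<xi>
    using that ST by (auto intro!: Ad_cong coAd_cong arg_cong[where f = "sg k"] dest: order_trans[OF _ that])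
  have Ad1: "Ad G (S + T) \<beta> x = Ad G S \<beta> x" and coAd1: "coAd G (S + T) \<beta> \<xi> = coAd G S \<beta> \<xi>"
    if "size \<beta> \<le> n" for \<beta> x \<xi>
    using Ad[OF that, of 1 x] coAd[OF that, of 1 \<xi>] by (simp_all add: plus_fun_def)
  have size: "size \<beta> \<le> n" "size \<gamma> \<le> n" if "\<beta> + \<gamma> = \<delta>" "size \<delta> \<le> n" for \<beta> \<gamma> \<delta> :: "'g multiset"
    using that by auto
  have 1: "fapply (Ad G (S + T)) (fapply l (\<lambda>\<beta>. coAd G (S + T) \<beta> \<xi>)) \<alpha> = fapply (Ad G S) (fapply l (\<lambda>\<beta>. coAd G S \<beta> \<xi>)) \<alpha>"
  proof -
    have "fapply l (\<lambda>\<beta>. coAd G (S + T) \<beta> \<xi>) \<gamma> = fapply l (\<lambda>\<beta>. coAd G S \<beta> \<xi>) \<gamma>" if "size \<gamma> \<le> n" for \<gamma>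
      by (rule fprod_cong) (simp add: coAd1 size[OF _ that])
    then show ?thesis by (intro fprod_cong) (simp add: Ad1 size[OF _ \<alpha>])
  qed
  have 2: "fapply (Ad G (\<lambda>\<beta>. sg k ((S + T) \<beta>))) (fprod (cobr G) (S + T) (\<lambda>\<beta>. coAd G (\<lambda>\<beta>. sg k ((S + T) \<beta>)) \<beta> \<xi>)) \<alpha>
      = fapply (Ad G (\<lambda>\<beta>. sg k (S \<beta>))) (fprod (cobr G) S (\<lambda>\<beta>. coAd G (\<lambda>\<beta>. sg k (S \<beta>)) \<beta> \<xi>)) \<alpha>" for k
  proof -
    have "fprod (cobr G) (S + T) (\<lambda>\<beta>. coAd G (\<lambda>\<beta>. sg k ((S + T) \<beta>)) \<beta> \<xi>) \<gamma> = fprod (cobr G) S (\<lambda>\<beta>. coAd G (\<lambda>\<beta>. sg k (S \<beta>)) \<beta> \<xi>) \<gamma>"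
      if "size \<gamma> \<le> n" for \<gamma>
      by (rule fprod_cong) (simp only: coAd ST size[OF _ that])
    then show ?thesis by (intro fprod_cong) (simp only: Ad size[OF _ \<alpha>])
  qed
  have 3: "right_diff G B (S + T) (restr G (\<lambda>\<beta>. coAd G (S + T) \<beta> \<xi>)) \<alpha> =
       right_diff G B S (restr G (\<lambda>\<beta>. coAd G S \<beta> \<xi>)) \<alpha> + (\<Sum>b\<in>B. sg \<langle>\<xi>, b\<rangle> (pd b T \<alpha>))"
    by (rule right_diff_perturb[where n = n and S = S and T = T, OF S T \<alpha>]) (simp_all add: restr_def coAd1 coAd_empty)
  have 4: "right_diff G B (S + T) (\<lambda>b'. const (if b' = b then 1 else 0)) \<alpha> =
      right_diff G B S (\<lambda>b'. const (if b' = b then 1 else 0)) \<alpha> + pd b T \<alpha>" if "b \<in> B" for b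
  proof -
    have "right_diff G B (S + T) (\<lambda>b'. const (if b' = b then 1 else 0)) \<alpha> =
      right_diff G B S (\<lambda>b'. const (if b' = b then 1 else 0)) \<alpha> + (\<Sum>b'\<in>B. sg (if b' = b then 1 else 0) (pd b' T \<alpha>))"
      by (rule right_diff_perturb[where n = n and S = S and T = T, OF S T \<alpha>]) (simp_all add: const_def)
    also have "(\<Sum>b'\<in>B. sg (if b' = b then 1 else 0) (pd b' T \<alpha>)) = (\<Sum>b'\<in>B. if b' = b then pd b' T \<alpha> else 0)"
      by (rule sum.cong) auto
    finally show ?thesis using that finite_B by (simp add: plus_fun_def)
  qed
  have 5: "theta G B (S + T) \<alpha> \<xi> = theta G B S \<alpha> \<xi> + ((\<Sum>b\<in>B. sg \<langle>\<xi>, b\<rangle> (pd b T \<alpha>)) - (\<Sum>b\<in>B. sg \<langle>\<xi>, pd b T \<alpha>\<rangle> b))"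
    unfolding theta_def 3 right_diff_transp_def
    by (simp add: 4 pair_simps g.scale_left_distrib sum.distrib algebra_simps)
  have 6: "group_cocycle G (S + T) \<alpha> \<xi> = group_cocycle G S \<alpha> \<xi>"
    unfolding group_cocycle_def Let_def 2 ..
  show ?thesis unfolding gauge_action_def 1 5 6 by (simp add: algebra_simps)
qed

lemma gauge_action_zero:
  assumes "\<And>\<gamma>. Vector_Spaces.linear sh sg (l \<gamma>)" shows "gauge_action G B l 0 {#} \<xi> = l {#} \<xi>"
proof -
  have b: "bidual_vector G (\<lambda>\<zeta>. 0) = 0"
    by (rule g_eqI) (simp add: bidual linearI vs_h vector_space_mult pair_simps)
  have "fprod (cobr G) 0 w = 0" for w :: "('g, 'h) formal_map" by (rule fprod_simps[OF biadd_cobr])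
  moreover have "fapply (Ad G S) 0 {#} = 0" for S :: "('g, 'g) formal_map"
    by (simp add: fprod_empty Ad_def ad_series_def const_def)
  ultimately have 1: "group_cocycle G 0 {#} \<xi> = 0"
    by (simp add: group_cocycle_def Let_def pair_simps b)
  have "right_diff G B 0 v {#} = 0" for v
    by (simp add: right_diff_def ad_series_def fdiff_dv dv_simps[OF biadd_sg])
  then have 2: "theta G B 0 {#} \<xi> = 0" by (simp add: theta_def right_diff_transp_def pair_simps)
  show ?thesis
    by (simp add: gauge_action_def 1 2 fprod_empty coAd_empty) (simp add: Ad_def ad_series_def const_def)
qed

text \<open>In degree 0 all of S is a perturbation of the trivial gauge map, and both terms of the
  perturbation contain a covector restricted to L, which vanishes here.\<close>

lemma gauge_action_mm:
  assumes "l \<in> Dynl G L B" "S {#} = 0"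
  shows "\<langle>Q \<eta>, gauge_action G B l S {#} (Q \<xi>)\<rangle> = \<langle>Q \<eta>, l {#} (Q \<xi>)\<rangle>"
proof -
  have l: "\<And>\<gamma>. Vector_Spaces.linear sh sg (l \<gamma>)" using assms(1) by (simp add: Dynl_def skew_maps_def)
  have "gauge_action G B l (0 + S) {#} (Q \<xi>) = l {#} (Q \<xi>) + (0 - (\<Sum>b\<in>B. sg \<langle>Q \<xi>, pd b S {#}\<rangle> b))"
    by (subst gauge_action_perturb[of _ 0]) (simp_all add: assms(2) gauge_action_zero[OF l] Q_L B_L)
  then show ?thesis by (simp add: pair_simps pair_scale Q_L B_L)
qed

lemma pair_perturb:
  "\<langle>\<zeta>, (\<Sum>b\<in>B. sg \<langle>\<xi>, b\<rangle> (pd b T \<alpha>)) - (\<Sum>b\<in>B. sg \<langle>\<xi>, pd b T \<alpha>\<rangle> b)\<rangle> =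
    dk \<xi> (\<lambda>\<alpha>. \<langle>\<zeta>, T \<alpha>\<rangle>) \<alpha> - dk \<zeta> (\<lambda>\<alpha>. \<langle>\<xi>, T \<alpha>\<rangle>) \<alpha>"
proof -
  have "pd b (\<lambda>\<alpha>. \<langle>\<zeta>, T \<alpha>\<rangle>) = (\<lambda>\<alpha>. \<langle>\<zeta>, pd b T \<alpha>\<rangle>)" for b \<zeta>
    by (rule pd_hom[OF linear_additive[OF pair_linear_right]])
  then show ?thesis
    by (simp add: dv_def sum_fun_apply restr_const fprod_const_left pair_simps pair_scale mult.commute)
qed

lemma lin_vector:
  assumes "lin T" obtains t :: "('g, 'g) formal_map" where "\<And>\<eta> \<alpha>. \<langle>\<eta>, t \<alpha>\<rangle> = T \<eta> \<alpha>"
proof -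
  have "\<exists>x. \<forall>\<eta>. \<langle>\<eta>, x\<rangle> = T \<eta> \<alpha>" for \<alpha>
    using assms by (intro ex_bidual) (auto simp: linearI vs_h vector_space_mult lin_def linfam_def)
  then show ?thesis using that by metis
qed

text \<open>The degree n part of the difference between l' and the current transform is a closed
  equivariant two-form. Its primitive has degree n + 1; added to S, it corrects degree n and leaves
  the lower degrees alone.\<close>

lemma gauge_step:
  assumes l: "l \<in> Dynl G L B" and l': "l' \<in> Dynl G L B" and S: "S \<in> gauge_maps G L B"
    and agree: "\<And>\<alpha>. size \<alpha> < n \<Longrightarrow> gauge_action G B l S \<alpha> = l' \<alpha>"
    and mm: "\<And>\<xi> \<eta>. \<langle>Q \<eta>, l {#} (Q \<xi>)\<rangle> = \<langle>Q \<eta>, l' {#} (Q \<xi>)\<rangle>"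
  obtains S' where "S' \<in> gauge_maps G L B" "\<And>\<alpha>. size \<alpha> < Suc n \<Longrightarrow> gauge_action G B l S' \<alpha> = l' \<alpha>"
    "\<And>\<alpha>. size \<alpha> \<le> n \<Longrightarrow> S' \<alpha> = S \<alpha>"
proof -
  define m where "m = gauge_action G B l S"
  interpret gm: gauge_dyn G L M B S l using l S by unfold_locales
  have m: "m \<in> Dynl G L B" unfolding m_def by (rule gm.gauge_action_Dynl)
  have E: "dyn_eqv G L M B (sec m)" "dyn_eqv G L M B (sec l')" using m l' by (simp_all add: Dynl_iff)
  then have D: "dyn_section G L M B (sec m)" "dyn_section G L M B (sec l')" by (simp_all add: dyn_eqv_def)
  define \<delta> where "\<delta> = (\<lambda>\<xi> \<zeta> \<alpha>. if size \<alpha> = n then bf l' \<xi> \<zeta> \<alpha> - bf m \<xi> \<zeta> \<alpha> else 0)"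
  have lins: "Vector_Spaces.linear sh sg (m \<gamma>)" "Vector_Spaces.linear sh sg (l' \<gamma>)" for \<gamma>
    using m l' by (simp_all add: Dynl_def skew_maps_def)
  obtain T where T: "lin T" "\<And>\<eta>. formal_on B (T \<eta>)" "\<And>\<eta> \<alpha>. size \<alpha> \<noteq> Suc n \<Longrightarrow> T \<eta> \<alpha> = 0"
    "\<And>\<xi> \<eta>. dk \<xi> (T \<eta>) - dk \<eta> (T \<xi>) = \<delta> \<xi> \<eta>"
    "\<And>z \<eta>. z \<in> L \<Longrightarrow> Dk (vf z) (T \<eta>) + T (coad G z \<eta>) = 0"
  proof (rule Poincare2[of \<delta> n])
    show "lin (\<lambda>\<xi>. \<delta> \<xi> \<eta>)" for \<eta>
      unfolding lin_def linfam_def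
      by (simp add: \<delta>_def bf_def fun_eq_iff linear_add[OF lins(1)] linear_add[OF lins(2)] 
         linear_scl[OF lins(1)] linear_scl[OF lins(2)] pair_simps pair_scale algebra_simps)
    show "\<delta> \<eta> \<xi> = - \<delta> \<xi> \<eta>" for \<xi> \<eta>
      unfolding \<delta>_def bf_skew[OF E(1), of \<eta>] bf_skew[OF E(2), of \<eta>] by (auto simp: fun_eq_iff)
    show "dk \<xi> (\<delta> \<eta> \<zeta>) + dk \<eta> (\<delta> \<zeta> \<xi>) + dk \<zeta> (\<delta> \<xi> \<eta>) = 0" for \<xi> \<eta> \<zeta>
    proof
      fix \<alpha>
      show "(dk \<xi> (\<delta> \<eta> \<zeta>) + dk \<eta> (\<delta> \<zeta> \<xi>) + dk \<zeta> (\<delta> \<xi> \<eta>)) \<alpha> = 0 \<alpha>"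
      proof (cases "n = Suc (size \<alpha>)")
        case True
        have d: "dk x (\<delta> y z) \<alpha> = dk x (bf l' y z) \<alpha> - dk x (bf m y z) \<alpha>" for x y z
        proof -
          have "dk x (\<delta> y z) \<alpha> = dk x (bf l' y z - bf m y z) \<alpha>"
            by (rule dk_cong) (simp add: \<delta>_def True)
          then show ?thesis by (simp add: Dk_simps)
        qed
        have F: "dyn_section.F G B (sec m) \<xi> \<eta> \<zeta> = 0" "dyn_section.F G B (sec l') \<xi> \<eta> \<zeta> = 0"
          using m l' by (simp_all add: Dynl_iff)
        \<comment> \<open>The quadratic term at \<alpha> involves only degrees below n, where m and
          l' already agree.\<close>
        have "dyn_section.T G (sec m) \<xi> \<eta> \<zeta> \<alpha> = dyn_section.T G (sec l') \<xi> \<eta> \<zeta> \<alpha>"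
          by (rule T_sec_cong[OF D]) (simp add: m_def agree True)
        then show ?thesis 
          using fun_cong[OF F(1), of \<alpha>] fun_cong[OF F(2), of \<alpha>]
          unfolding dyn_section.F_def[OF D(1)] dyn_section.F_def[OF D(2)] A_sec[OF D(1)] A_sec[OF D(2)]
          by (simp add: d algebra_simps)
      next
        case False
        have "dk x (\<delta> y z) \<alpha> = dk x 0 \<alpha>" for x y z by (rule dk_cong) (use False in \<open>simp add: \<delta>_def\<close>)
        then show ?thesis by (simp add: Dk_simps)
      qed
    qed
    show "size \<alpha> \<noteq> n \<Longrightarrow> \<delta> \<xi> \<eta> \<alpha> = 0" for \<xi> \<eta> \<alpha> by (simp add: \<delta>_def)
    show "formal_on B (\<delta> \<xi> \<eta>)" for \<xi> \<eta>
      using m l' by (simp add: formal_on_def \<delta>_def bf_def Dynl_def pair_simps)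
    \<comment> \<open>The degree 0 obstruction is the difference of the components in
      \<open>\<And>\<^sup>2\<mm>\<close>; it vanishes by \<open>mm\<close>, since S does not move
      that component.\<close>
    show "\<delta> (Q \<xi>) (Q \<eta>) = 0" if "n = 0" for \<xi> \<eta>
      using gauge_action_mm[of l S, OF l gm.S_0] mm by (simp add: \<delta>_def bf_def m_def fun_eq_iff that)
    show "Dk (vf z) (\<delta> \<xi> \<eta>) + \<delta> (coad G z \<xi>) \<eta> + \<delta> \<xi> (coad G z \<eta>) = 0" if z: "z \<in> L" for z \<xi> \<eta>
    proof
      fix \<alpha>
      show "(Dk (vf z) (\<delta> \<xi> \<eta>) + \<delta> (coad G z \<xi>) \<eta> + \<delta> \<xi> (coad G z \<eta>)) \<alpha> = 0 \<alpha>"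
      proof (cases "size \<alpha> = n")
        case True
        have "Dk (vf z) (\<delta> \<xi> \<eta>) \<alpha> = Dk (vf z) (bf l' \<xi> \<eta> - bf m \<xi> \<eta>) \<alpha>"
          by (rule Dk_vf_cong) (simp add: \<delta>_def True)
        then have "(Dk (vf z) (\<delta> \<xi> \<eta>) + \<delta> (coad G z \<xi>) \<eta> + \<delta> \<xi> (coad G z \<eta>)) \<alpha> =
          (Dk (vf z) (bf l' \<xi> \<eta>) + bf l' (coad G z \<xi>) \<eta> + bf l' \<xi> (coad G z \<eta>)) \<alpha>
          - (Dk (vf z) (bf m \<xi> \<eta>) + bf m (coad G z \<xi>) \<eta> + bf m \<xi> (coad G z \<eta>)) \<alpha>"
          by (simp add: Dk_simps) (simp add: \<delta>_def True)
        then show ?thesis by (simp only: bf_eqv[OF E(1) z] bf_eqv[OF E(2) z]) simp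
      next
        case False
        have "Dk (vf z) (\<delta> \<xi> \<eta>) \<alpha> = Dk (vf z) 0 \<alpha>" by (rule Dk_vf_cong) (use False in \<open>simp add: \<delta>_def\<close>)
        then show ?thesis using False by (simp add: Dk_simps) (simp add: \<delta>_def)
      qed
    qed
  qed blast
  obtain t where t: "\<And>\<eta> \<alpha>. \<langle>\<eta>, t \<alpha>\<rangle> = T \<eta> \<alpha>" using lin_vector[OF T(1)] by blast
  have t0: "t \<alpha> = 0" if "size \<alpha> \<noteq> Suc n" for \<alpha>
    by (rule g_eqI) (simp add: t T(3)[OF that] pair_simps)
  have tf: "formal_on B t"
    unfolding formal_on_def
  proof (intro allI impI g_eqI)
    fix \<alpha> \<eta> assume "\<not> set_mset \<alpha> \<subseteq> B"
    then show "\<langle>\<eta>, t \<alpha>\<rangle> = \<langle>\<eta>, 0\<rangle>" using T(2)[of \<eta>] by (simp add: formal_on_def t pair_simps)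
  qed
  have te: "fdiff G B t (vf z) \<alpha> = - [z; t \<alpha>]" if z: "z \<in> L" for z \<alpha>
  proof (rule g_eqI)
    fix \<eta>
    have "\<langle>\<eta>, dv sg B (vf z) t \<alpha>\<rangle> = Dk (vf z) (T \<eta>) \<alpha>"
      using fun_cong[OF dv_pair[of \<eta> "vf z" t], of \<alpha>] by (simp add: t)
    then show "\<langle>\<eta>, fdiff G B t (vf z) \<alpha>\<rangle> = \<langle>\<eta>, - [z; t \<alpha>]\<rangle>"
      using fun_cong[OF T(5)[OF z, of \<eta>], of \<alpha>]
      by (simp add: fdiff_dv pair_simps t[symmetric] coad[symmetric] eq_neg_iff_add_eq_0)
  qed
  show ?thesis
  proof (rule that[of "S + t"])
    show "S + t \<in> gauge_maps G L B"
      using S tf t0[of "{#}"] te 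
      by (auto simp: gauge_maps_def formal_on_def fdiff_dv dv_simps[OF biadd_sg] lbr_simps)
    show "(S + t) \<alpha> = S \<alpha>" if "size \<alpha> \<le> n" for \<alpha> using t0[of \<alpha>] that by simp
    show "gauge_action G B l (S + t) \<alpha> = l' \<alpha>" if a: "size \<alpha> < Suc n" for \<alpha>
    proof (rule HOL.ext, rule g_eqI)
      fix \<xi> \<zeta>
      have "gauge_action G B l (S + t) \<alpha> \<xi> = m \<alpha> \<xi>
         + ((\<Sum>b\<in>B. sg \<langle>\<xi>, b\<rangle> (pd b t \<alpha>)) - (\<Sum>b\<in>B. sg \<langle>\<xi>, pd b t \<alpha>\<rangle> b))"
        unfolding m_def by (rule gauge_action_perturb[where n = n]) (use a t0 gm.S_0 in auto)
      then have "\<langle>\<zeta>, gauge_action G B l (S + t) \<alpha> \<xi>\<rangle> = bf m \<xi> \<zeta> \<alpha> + (dk \<xi> (T \<zeta>) - dk \<zeta> (T \<xi>)) \<alpha>"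
        unfolding pair_simps(2) by (simp only: pair_perturb t bf_def pair_simps(2)) simp
      also have "\<dots> = bf l' \<xi> \<zeta> \<alpha>"
        unfolding T(4) using agree[of \<alpha>] a by (cases "size \<alpha> = n") (auto simp: \<delta>_def bf_def m_def)
      finally show "\<langle>\<zeta>, gauge_action G B l (S + t) \<alpha> \<xi>\<rangle> = \<langle>\<zeta>, l' \<alpha> \<xi>\<rangle>" by (simp add: bf_def)
    qed
  qed
qed

text \<open>The corrections stabilise: the coefficient at \<alpha> no longer changes from stage
  \<open>size \<alpha>\<close> on, so the limit is read off along the diagonal.\<close>

theorem gauge_equivalent:
  assumes l: "l \<in> Dynl G L B" and l': "l' \<in> Dynl G L B"
    and mm: "\<And>\<xi> \<eta>. \<langle>Q \<eta>, l {#} (Q \<xi>)\<rangle> = \<langle>Q \<eta>, l' {#} (Q \<xi>)\<rangle>"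
  obtains S where "S \<in> gauge_maps G L B" "gauge_action G B l S = l'"
proof -
  define R where "R = (\<lambda>n S. S \<in> gauge_maps G L B \<and> (\<forall>\<alpha>. size \<alpha> < n \<longrightarrow> gauge_action G B l S \<alpha> = l' \<alpha>))"
  have "\<exists>f. \<forall>n. R n (f n) \<and> (\<forall>\<alpha>. size \<alpha> \<le> n \<longrightarrow> f (Suc n) \<alpha> = f n \<alpha>)"
  proof (rule dependent_nat_choice)
    have "0 \<in> gauge_maps G L B"
      by (simp add: gauge_maps_def formal_on_def fdiff_dv dv_simps[OF biadd_sg] lbr_simps)
    then show "\<exists>x. R 0 x" by (auto simp: R_def)
    fix S n assume "R n S"
    then show "\<exists>y. R (Suc n) y \<and> (\<forall>\<alpha>. size \<alpha> \<le> n \<longrightarrow> y \<alpha> = S \<alpha>)"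
      unfolding R_def by (metis gauge_step[OF l l' _ _ mm])
  qed
  then obtain f where f: "\<And>n. f n \<in> gauge_maps G L B" "\<And>n \<alpha>. size \<alpha> < n \<Longrightarrow> gauge_action G B l (f n) \<alpha> = l' \<alpha>"
    "\<And>n \<alpha>. size \<alpha> \<le> n \<Longrightarrow> f (Suc n) \<alpha> = f n \<alpha>" by (auto simp: R_def)
  define S where "S = (\<lambda>\<alpha>. f (size \<alpha>) \<alpha>)"
  have fS: "f n \<alpha> = S \<alpha>" if "size \<alpha> \<le> n" for n \<alpha>
    using that by (induction n rule: dec_induct) (simp_all add: S_def f(3))
  have fm: "formal_on B (f n)" "f n {#} = 0" "z \<in> L \<Longrightarrow> fdiff G B (f n) (vf z) \<alpha> = - [z; f n \<alpha>]" for n z \<alpha>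
    using f(1)[of n] by (simp_all add: gauge_maps_def)
  show ?thesis
  proof (rule that[of S])
    have "fdiff G B S (vf z) \<alpha> = - [z; S \<alpha>]" if z: "z \<in> L" for z \<alpha>
    proof -
      have "fdiff G B S (vf z) \<alpha> = fdiff G B (f (size \<alpha>)) (vf z) \<alpha>"
        unfolding fdiff_dv by (rule dv_linear_field_cong[OF biadd_sg]) (auto simp: fS vf_size)
      then show ?thesis by (simp add: fm(3)[OF z] S_def)
    qed
    moreover have "formal_on B S" using fm(1) by (simp add: formal_on_def S_def)
    ultimately show "S \<in> gauge_maps G L B" using fm(2)[of 0] by (simp add: gauge_maps_def S_def)
    show "gauge_action G B l S = l'"
    proof (intro HOL.ext)
      fix \<alpha> :: "'g multiset" and \<xi>
      \<comment> \<open>One degree beyond \<alpha>, because the action at \<alpha> contains a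
        derivative of S.\<close>
      let ?n = "Suc (size \<alpha>)"
      have "gauge_action G B l (f ?n + (S - f ?n)) \<alpha> \<xi> = gauge_action G B l (f ?n) \<alpha> \<xi>
         + ((\<Sum>b\<in>B. sg \<langle>\<xi>, b\<rangle> (pd b (S - f ?n) \<alpha>)) - (\<Sum>b\<in>B. sg \<langle>\<xi>, pd b (S - f ?n) \<alpha>\<rangle> b))"
        by (rule gauge_action_perturb[where n = ?n]) (simp_all add: fm(2) fS)
      moreover have "pd b (S - f ?n) \<alpha> = 0" for b by (simp add: pd_def fS)
      ultimately show "gauge_action G B l S \<alpha> \<xi> = l' \<alpha> \<xi>" by (simp add: f(2) pair_simps)
    qed
  qed
qed

end

section \<open>Existence of solutions\<close>

lemma formal_on_dv:
  assumes "formal_on B f" "\<And>b. b \<in> B \<Longrightarrow> formal_on B (v b)" "biadd s"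
  shows "formal_on B (dv s B v f)"
proof -
  have "formal_on B (fprod s (v b) (pd b f))" if "b \<in> B" for b
    by (intro formal_on_fprod formal_on_pd assms that)
  then show ?thesis by (simp add: formal_on_def dv_def sum_fun_apply)
qed

context red_qb
begin

interpretation g: vector_space sg by (rule vs_g)

lemma dyn_eqv_bf_iff:
  assumes D: "dyn_section G L M B (sec l)"
  shows "dyn_eqv G L M B (sec l) \<longleftrightarrow> (\<forall>\<xi> \<zeta>. bf l \<zeta> \<xi> = - bf l \<xi> \<zeta>) \<and>
    (\<forall>z\<in>L. \<forall>\<xi> \<zeta>. Dk (vf z) (bf l \<xi> \<zeta>) + bf l (coad G z \<xi>) \<zeta> + bf l \<xi> (coad G z \<zeta>) = 0)"
proof (intro iffI conjI ballI allI)
  assume r: "(\<forall>\<xi> \<zeta>. bf l \<zeta> \<xi> = - bf l \<xi> \<zeta>) \<and>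
    (\<forall>z\<in>L. \<forall>\<xi> \<zeta>. Dk (vf z) (bf l \<xi> \<zeta>) + bf l (coad G z \<xi>) \<zeta> + bf l \<xi> (coad G z \<zeta>) = 0)"
  interpret dyn_section G L M B "sec l" by (rule D)
  have b: "bf l \<xi> \<zeta> = Pr (K \<zeta>) (sec l \<xi>)" for \<xi> \<zeta>
    by (simp add: sec_eq Pr_simps Pr_K_inj_g Pr_K_K bf_def)
  show "dyn_eqv G L M B (sec l)"
  proof (intro dyn_eqv.intro D dyn_eqv_axioms.intro)
    show "Pr (sec l \<xi>) (sec l \<eta>) = 0" for \<xi> \<eta>
    proof -
      have "bf l \<eta> \<xi> + bf l \<xi> \<eta> = 0" using r unfolding eq_neg_iff_add_eq_0 by blast
      then show ?thesis by (simp add: Pr_sec_sec bf_def fun_eq_iff)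
    qed
    show "V z \<xi> = 0" if z: "z \<in> L" for z \<xi>
    proof (rule gval_eqI)
      show "gval (V z \<xi>)" by (simp add: V_sec[OF D] gval_inj_g)
      fix \<zeta>
      have "DL z (K \<zeta>) = - K (coad G z \<zeta>)"
        by (simp add: DL_K cobr_L z) (simp add: K_def const_def fun_eq_iff zero_prod_def)
      then have "Pr (K \<zeta>) (V z \<xi>) = Dk (vf z) (bf l \<xi> \<zeta>) + bf l (coad G z \<xi>) \<zeta> + bf l \<xi> (coad G z \<zeta>)"
        by (simp add: V_def Pr_simps b Dk_Pr_DL)
      also have "\<dots> = 0" using r z by blast
      finally show "Pr (K \<zeta>) (V z \<xi>) = 0" .
    qed
  qed
qed (rule bf_skew bf_eqv; assumption)+

lemma F_bf:
  assumes "dyn_section G L M B (sec l)"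
  shows "dyn_section.F G B (sec l) \<xi> \<eta> \<zeta> = dk \<xi> (bf l \<eta> \<zeta>) + dk \<eta> (bf l \<zeta> \<xi>) + dk \<zeta> (bf l \<xi> \<eta>)
    - dyn_section.T G (sec l) \<xi> \<eta> \<zeta>"
  by (simp add: dyn_section.F_def[OF assms] A_sec[OF assms])

text \<open>Covectors annihilating L give no direction of differentiation, so only the trilinear
  term of F is left; at the origin it is the twisted phi. This is the degree 0 obstruction to
  existence.\<close>

lemma F_Q:
  assumes D: "dyn_section G L M B (sec l)"
  shows "dyn_section.F G B (sec l) (Q \<xi>) (Q \<eta>) (Q \<zeta>) {#} = - twisted_phi G (l {#}) (Q \<xi>) (Q \<eta>) (Q \<zeta>)"
proof -
  have "dyn_section.T G (sec l) (Q \<xi>) (Q \<eta>) (Q \<zeta>) {#} = twisted_phi G (l {#}) (Q \<xi>) (Q \<eta>) (Q \<zeta>)"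
    unfolding dyn_section.T_def[OF D] Pr_Br_sec
    by (simp add: twisted_phi_def fprod_empty const_def cyc_def pair_simps)
  then show ?thesis by (simp add: F_bf[OF D] dk_Q)
qed

text \<open>Normalization means that the value at 0 equals its own
  \<open>\<And>\<^sup>2\<mm>\<close> component. In this form it can be combined with the gauge
  invariance of that component.\<close>

lemma normalized_iff:
  assumes l: "Vector_Spaces.linear sh sg (l {#})"
  shows "normalized G L M l \<longleftrightarrow> (\<forall>\<xi> \<zeta>. \<langle>\<zeta>, l {#} \<xi>\<rangle> = \<langle>Q \<zeta>, l {#} (Q \<xi>)\<rangle>)"
proof
  assume n: "normalized G L M l"
  show "\<forall>\<xi> \<zeta>. \<langle>\<zeta>, l {#} \<xi>\<rangle> = \<langle>Q \<zeta>, l {#} (Q \<xi>)\<rangle>"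
  proof (intro allI)
    fix \<xi> \<zeta>
    have "P \<xi> \<in> annihilator G M" "Q \<xi> \<in> annihilator G L" by (simp_all add: annihilator_M annihilator_L P_simps Q_simps)
    with n have 1: "l {#} (P \<xi>) = 0" "l {#} (Q \<xi>) \<in> M" by (auto simp: normalized_def)
    have "l {#} \<xi> = l {#} (P \<xi> + Q \<xi>)" by (simp add: P_Q)
    also have "\<dots> = l {#} (Q \<xi>)" by (simp add: linear_add[OF l] 1)
    finally have "\<langle>\<zeta>, l {#} \<xi>\<rangle> = \<langle>P \<zeta>, l {#} (Q \<xi>)\<rangle> + \<langle>Q \<zeta>, l {#} (Q \<xi>)\<rangle>" by (simp add: pair_simps(1)[symmetric] P_Q)
    then show "\<langle>\<zeta>, l {#} \<xi>\<rangle> = \<langle>Q \<zeta>, l {#} (Q \<xi>)\<rangle>" by (simp add: P pL_M 1 pair_simps)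
  qed
next
  assume r: "\<forall>\<xi> \<zeta>. \<langle>\<zeta>, l {#} \<xi>\<rangle> = \<langle>Q \<zeta>, l {#} (Q \<xi>)\<rangle>"
  show "normalized G L M l" unfolding normalized_def
  proof (intro conjI ballI)
    fix \<xi> assume "\<xi> \<in> annihilator G M"
    then have "Q \<xi> = 0" by (simp add: annihilator_M Q_def)
    show "l {#} \<xi> = 0"
    proof (rule g_eqI)
      fix \<zeta>
      have "\<langle>\<zeta>, l {#} \<xi>\<rangle> = \<langle>Q \<zeta>, l {#} (Q \<xi>)\<rangle>" by (rule r[rule_format])
      then show "\<langle>\<zeta>, l {#} \<xi>\<rangle> = \<langle>\<zeta>, 0\<rangle>" by (simp add: \<open>Q \<xi> = 0\<close> linear_simps(1)[OF l] pair_simps)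
    qed
  next
    fix \<xi>
    have "\<langle>\<zeta>, pL (l {#} \<xi>)\<rangle> = \<langle>\<zeta>, 0\<rangle>" for \<zeta>
    proof -
      have "\<langle>\<zeta>, pL (l {#} \<xi>)\<rangle> = \<langle>Q (P \<zeta>), l {#} (Q \<xi>)\<rangle>" unfolding P[symmetric] by (rule r[rule_format])
      then show ?thesis by (simp add: Q_simps pair_simps)
    qed
    then have "pL (l {#} \<xi>) = 0" by (rule g_eqI)
    then show "l {#} \<xi> \<in> M" using pL(2)[of "l {#} \<xi>"] by simp
  qed
qed

lemma Dk_vf_empty: "Dk (vf z) f {#} = 0"
  by (simp add: dv_def sum_fun_apply fprod_empty vf_size)

lemma dk_0: "(\<And>\<gamma>. size \<gamma> = Suc (size \<alpha>) \<Longrightarrow> f \<gamma> = 0) \<Longrightarrow> dk \<xi> f \<alpha> = 0"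
  using dk_cong[of \<alpha> f 0 \<xi>] by (simp add: Dk_simps)

lemma Dk_vf_0: "(\<And>\<gamma>. size \<gamma> = size \<alpha> \<Longrightarrow> f \<gamma> = 0) \<Longrightarrow> Dk (vf z) f \<alpha> = 0"
  using Dk_vf_cong[of \<alpha> f 0 z] by (simp add: Dk_simps)

lemma lin_gauge_map:
  assumes T: "lin T" "\<And>\<eta>. formal_on B (T \<eta>)" "\<And>\<eta>. T \<eta> {#} = 0"
    "\<And>z \<eta>. z \<in> L \<Longrightarrow> Dk (vf z) (T \<eta>) + T (coad G z \<eta>) = 0"
    and t: "\<And>\<eta> \<alpha>. \<langle>\<eta>, t \<alpha>\<rangle> = T \<eta> \<alpha>"
  shows "t \<in> gauge_maps G L B"
  unfolding gauge_maps_def mem_Collect_eq formal_on_def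
proof (intro conjI ballI allI impI g_eqI)
  show "\<langle>\<eta>, t \<alpha>\<rangle> = \<langle>\<eta>, 0\<rangle>" if "\<not> set_mset \<alpha> \<subseteq> B" for \<alpha> \<eta>
    using T(2)[of \<eta>] that by (simp add: formal_on_def t pair_simps)
  show "\<langle>\<eta>, t {#}\<rangle> = \<langle>\<eta>, 0\<rangle>" for \<eta> by (simp add: t T(3) pair_simps)
  fix z \<alpha> \<eta> assume z: "z \<in> L"
  have "\<langle>\<eta>, dv sg B (vf z) t \<alpha>\<rangle> = Dk (vf z) (T \<eta>) \<alpha>"
    using fun_cong[OF dv_pair[of \<eta> "vf z" t], of \<alpha>] by (simp add: t)
  then show "\<langle>\<eta>, fdiff G B t (vf z) \<alpha>\<rangle> = \<langle>\<eta>, - [z; t \<alpha>]\<rangle>"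
    using fun_cong[OF T(4)[OF z, of \<eta>], of \<alpha>]
    by (simp add: fdiff_dv pair_simps t[symmetric] coad[symmetric] eq_neg_iff_add_eq_0)
qed

text \<open>What has to be removed from the value at 0 is a constant two-form without component in
  \<open>\<And>\<^sup>2\<mm>\<close>. Being constant it is closed, and its equivariant primitive is
  linear in p.\<close>

lemma ex_normalized:
  assumes l: "l \<in> Dynl G L B"
  obtains S where "S \<in> gauge_maps G L B" "normalized G L M (gauge_action G B l S)"
proof -
  have lin_l: "Vector_Spaces.linear sh sg (l \<gamma>)" for \<gamma> using l by (simp add: Dynl_def skew_maps_def)
  have E: "dyn_eqv G L M B (sec l)" using l by (simp add: Dynl_iff)
  define \<delta> where "\<delta> = (\<lambda>\<xi> \<zeta> (\<alpha> :: 'g multiset). if size \<alpha> = 0 then bf l (Q \<xi>) (Q \<zeta>) {#} - bf l \<xi> \<zeta> {#} else 0)"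
  obtain T where T: "lin T" "\<And>\<eta>. formal_on B (T \<eta>)" "\<And>\<eta> \<alpha>. size \<alpha> \<noteq> Suc 0 \<Longrightarrow> T \<eta> \<alpha> = 0"
    "\<And>\<xi> \<eta>. dk \<xi> (T \<eta>) - dk \<eta> (T \<xi>) = \<delta> \<xi> \<eta>"
    "\<And>z \<eta>. z \<in> L \<Longrightarrow> Dk (vf z) (T \<eta>) + T (coad G z \<eta>) = 0"
  proof (rule Poincare2[of \<delta> 0])
    show "lin (\<lambda>\<xi>. \<delta> \<xi> \<eta>)" for \<eta>
      unfolding lin_def linfam_def
      by (simp add: \<delta>_def bf_def fun_eq_iff linear_add[OF lin_l] linear_scl[OF lin_l] Q_simps pair_simps pair_scale algebra_simps)
    show "\<delta> \<eta> \<xi> = - \<delta> \<xi> \<eta>" for \<xi> \<eta>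
      unfolding \<delta>_def bf_skew[OF E, of \<eta>] bf_skew[OF E, of "Q \<eta>"] by (auto simp: fun_eq_iff)
    have "dk \<xi> (\<delta> \<eta> \<zeta>) = 0" for \<xi> \<eta> \<zeta> by (rule HOL.ext, unfold zero_fun_apply, rule dk_0) (auto simp: \<delta>_def)
    then show "dk \<xi> (\<delta> \<eta> \<zeta>) + dk \<eta> (\<delta> \<zeta> \<xi>) + dk \<zeta> (\<delta> \<xi> \<eta>) = 0" for \<xi> \<eta> \<zeta> by simp
    show "size \<alpha> \<noteq> 0 \<Longrightarrow> \<delta> \<xi> \<eta> \<alpha> = 0" for \<xi> \<eta> \<alpha> by (simp add: \<delta>_def)
    show "formal_on B (\<delta> \<xi> \<eta>)" for \<xi> \<eta> by (simp add: formal_on_def \<delta>_def)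
    show "\<delta> (Q \<xi>) (Q \<eta>) = 0" for \<xi> \<eta> by (simp add: \<delta>_def Q_simps fun_eq_iff)
    show "Dk (vf z) (\<delta> \<xi> \<eta>) + \<delta> (coad G z \<xi>) \<eta> + \<delta> \<xi> (coad G z \<eta>) = 0" if z: "z \<in> L" for z \<xi> \<eta>
    proof
      fix \<alpha>
      have "bf l (coad G z x) y {#} + bf l x (coad G z y) {#} = 0" for x y
        using fun_cong[OF bf_eqv[OF E z, of x y], of "{#}"] by (simp add: Dk_vf_empty)
      then have b: "bf l (coad G z x) y {#} = - bf l x (coad G z y) {#}" for x y by (simp add: eq_neg_iff_add_eq_0)
      have "Dk (vf z) (\<delta> \<xi> \<eta>) \<alpha> = 0"
      proof (cases "\<alpha> = {#}")
        case False
        then show ?thesis by (intro Dk_vf_0) (auto simp: \<delta>_def)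
      qed (simp add: Dk_vf_empty)
      then show "(Dk (vf z) (\<delta> \<xi> \<eta>) + \<delta> (coad G z \<xi>) \<eta> + \<delta> \<xi> (coad G z \<eta>)) \<alpha> = 0 \<alpha>"
        by simp (simp add: \<delta>_def Q_coad z b)
    qed
  qed blast
  obtain t where t: "\<And>\<eta> \<alpha>. \<langle>\<eta>, t \<alpha>\<rangle> = T \<eta> \<alpha>" using lin_vector[OF T(1)] by blast
  have tg: "t \<in> gauge_maps G L B" by (rule lin_gauge_map[OF T(1,2) _ T(5) t]) (simp_all add: T(3))
  then interpret gauge_dyn G L M B t l using l by unfold_locales
  have m: "gauge_action G B l t \<in> Dynl G L B" by (rule gauge_action_Dynl)
  have "\<langle>\<zeta>, gauge_action G B l t {#} \<xi>\<rangle> = \<langle>Q \<zeta>, l {#} (Q \<xi>)\<rangle>" for \<xi> \<zeta>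
  proof -
    have "gauge_action G B l (0 + t) {#} \<xi> = gauge_action G B l 0 {#} \<xi>
         + ((\<Sum>b\<in>B. sg \<langle>\<xi>, b\<rangle> (pd b t {#})) - (\<Sum>b\<in>B. sg \<langle>\<xi>, pd b t {#}\<rangle> b))"
      by (rule gauge_action_perturb[where n = 0]) (simp_all add: S_0)
    then have "\<langle>\<zeta>, gauge_action G B l t {#} \<xi>\<rangle> = bf l \<xi> \<zeta> {#} + (dk \<xi> (T \<zeta>) - dk \<zeta> (T \<xi>)) {#}"
      by (simp only: pair_simps(2) pair_perturb t bf_def gauge_action_zero[OF lin_l] add_0_left) simp
    then show ?thesis unfolding T(4) by (simp add: \<delta>_def bf_def)
  qed
  moreover have "Vector_Spaces.linear sh sg (gauge_action G B l t {#})"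
    using m by (simp add: Dynl_def skew_maps_def)
  ultimately have "normalized G L M (gauge_action G B l t)"
    by (simp add: normalized_iff Q_simps)
  then show ?thesis using that tg by blast
qed

end

context dyn_eqv
begin

lemma F_skew: "F \<eta> \<xi> \<zeta> = - F \<xi> \<eta> \<zeta>"
  unfolding F_def T_skew[of \<eta> \<xi>] A_skew[of \<xi> \<zeta> \<eta>] A_skew[of \<zeta> \<eta> \<xi>] A_skew[of \<eta> \<xi> \<zeta>]
  by (simp add: algebra_simps)

lemma F_rot: "F \<eta> \<zeta> \<xi> = F \<xi> \<eta> \<zeta>"
  by (simp add: F_def T_rot[of \<eta> \<zeta> \<xi>] algebra_simps)

end

context dyn_section
begin

lemma F_lin: "lin (\<lambda>\<xi>. F \<xi> \<eta> \<zeta>)"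
proof -
  have dd: "dd (x + y) f = dd x f + dd y f" "dd (sh c x) f = (\<lambda>\<gamma>. sd c (dd x f \<gamma>))" for x y f c
    by (simp_all add: linear_sum'[OF linear_scale_right[OF vs_d]] dv_def restr_const fprod_const_left br_simps biadd_simps[OF biadd_sd] pair_simps pair_scale
             sum.distrib[symmetric] fun_eq_iff sum_fun_apply module.scale_scale[OF vs_d[folded module_iff_vector_space]])
  have e: "e (sh c x) = (\<lambda>\<gamma>. sd c (e x \<gamma>))" for c x by (simp add: fun_eq_iff e_scale)
  have Prs: "Pr (\<lambda>\<gamma>. sd c (f \<gamma>)) g = (\<lambda>\<alpha>. c * Pr f g \<alpha>)" "Pr f (\<lambda>\<gamma>. sd c (g \<gamma>)) = (\<lambda>\<alpha>. c * Pr f g \<alpha>)" for c f g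
    by (simp_all add: fprod_splits pr_scale sum_distrib_left split_def fun_eq_iff)
  have Brs: "Br (\<lambda>\<gamma>. sd c (f \<gamma>)) g = (\<lambda>\<alpha>. sd c (Br f g \<alpha>))" for c f g
    by (simp add: fprod_splits br_scale split_def fun_eq_iff linear_sum'[OF linear_scale_right[OF vs_d]])
  have dds: "dd x (\<lambda>\<gamma>. sd c (f \<gamma>)) = (\<lambda>\<gamma>. sd c (dd x f \<gamma>))" for x c f
    by (rule dv_map[OF linear_scale_right[OF vs_d]])
  show ?thesis
    unfolding lin_def linfam_def
    by (simp add: F_def A_def T_def e_add Pr_simps Br_simps Dd_simps dd)
       (simp add: e dd Prs Brs dds algebra_simps)
qed

end

context red_qb
begin

text \<open>The degree n part of -F is an equivariant three-form, closed by the Bianchi identity.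
  Adding its primitive, of degree n + 1, to l cancels that part, because the quadratic terms of F in
  degree n see l only up to degree n.\<close>

lemma Dynl_step:
  assumes E: "dyn_eqv G L M B (sec l)" and f: "formal_on B l"
    and F: "\<And>\<xi> \<eta> \<zeta> \<alpha>. size \<alpha> < n \<Longrightarrow> dyn_section.F G B (sec l) \<xi> \<eta> \<zeta> \<alpha> = 0"
    and base: "\<And>\<xi> \<eta> \<zeta>. twisted_phi G (l {#}) (Q \<xi>) (Q \<eta>) (Q \<zeta>) = 0"
  obtains l' where "dyn_eqv G L M B (sec l')" "formal_on B l'"
    "\<And>\<xi> \<eta> \<zeta> \<alpha>. size \<alpha> < Suc n \<Longrightarrow> dyn_section.F G B (sec l') \<xi> \<eta> \<zeta> \<alpha> = 0"
    "\<And>\<alpha>. size \<alpha> \<le> n \<Longrightarrow> l' \<alpha> = l \<alpha>"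
proof -
  interpret e: dyn_eqv G L M B "sec l" by (rule E)
  have D: "dyn_section G L M B (sec l)" using E by (simp add: dyn_eqv_def)
  define \<Phi> where "\<Phi> = (\<lambda>\<xi> \<eta> \<zeta> \<alpha>. if size \<alpha> = n then - e.F \<xi> \<eta> \<zeta> \<alpha> else 0)"
  obtain W where W: "\<And>\<eta>. lin (W \<eta>)" "\<And>\<xi> \<eta>. W \<eta> \<xi> = - W \<xi> \<eta>" "\<And>\<xi> \<eta>. formal_on B (W \<xi> \<eta>)"
    "\<And>\<xi> \<eta> \<alpha>. size \<alpha> \<noteq> Suc n \<Longrightarrow> W \<xi> \<eta> \<alpha> = 0"
    "\<And>\<xi> \<eta> \<zeta>. dk \<xi> (W \<eta> \<zeta>) + dk \<eta> (W \<zeta> \<xi>) + dk \<zeta> (W \<xi> \<eta>) = \<Phi> \<xi> \<eta> \<zeta>"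
    "\<And>z \<xi> \<eta>. z \<in> L \<Longrightarrow> Dk (vf z) (W \<xi> \<eta>) + W (coad G z \<xi>) \<eta> + W \<xi> (coad G z \<eta>) = 0"
  proof (rule Poincare3[of \<Phi> n])
    show "lin (\<lambda>\<xi>. \<Phi> \<xi> \<eta> \<zeta>)" for \<eta> \<zeta>
      using e.F_lin[of \<eta> \<zeta>] by (simp add: lin_def linfam_def \<Phi>_def fun_eq_iff)
    show "\<Phi> \<eta> \<xi> \<zeta> = - \<Phi> \<xi> \<eta> \<zeta>" for \<xi> \<eta> \<zeta> unfolding \<Phi>_def e.F_skew[of \<eta> \<xi>] by (simp add: fun_eq_iff)
    show "\<Phi> \<eta> \<zeta> \<xi> = \<Phi> \<xi> \<eta> \<zeta>" for \<xi> \<eta> \<zeta> unfolding \<Phi>_def e.F_rot[of \<eta> \<zeta> \<xi>] ..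
    show "dk \<xi> (\<Phi> \<eta> \<zeta> \<mu>) - dk \<eta> (\<Phi> \<xi> \<zeta> \<mu>) + dk \<zeta> (\<Phi> \<xi> \<eta> \<mu>) - dk \<mu> (\<Phi> \<xi> \<eta> \<zeta>) = 0" for \<xi> \<eta> \<zeta> \<mu>
    proof
      fix \<alpha>
      show "(dk \<xi> (\<Phi> \<eta> \<zeta> \<mu>) - dk \<eta> (\<Phi> \<xi> \<zeta> \<mu>) + dk \<zeta> (\<Phi> \<xi> \<eta> \<mu>) - dk \<mu> (\<Phi> \<xi> \<eta> \<zeta>)) \<alpha> = 0 \<alpha>"
      proof (cases "n = Suc (size \<alpha>)")
        case True
        have d: "dk x (\<Phi> y z w) \<alpha> = - dk x (e.F y z w) \<alpha>" for x y z w
        proof -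
          have "dk x (\<Phi> y z w) \<alpha> = dk x (- e.F y z w) \<alpha>" by (rule dk_cong) (simp add: \<Phi>_def True)
          then show ?thesis by (simp add: Dk_simps)
        qed
        \<comment> \<open>The right-hand side of the Bianchi identity at \<alpha> contains F only in
          degrees below n, where it already vanishes.\<close>
        have "e.FF x y z w \<alpha> = 0" for x y z w
        proof -
          have "ext (e.F a b) m \<alpha> = 0" for a b and m :: "('g, 'h) formal_map"
            by (rule ext_0) (use True in \<open>auto intro!: F\<close>)
          then show ?thesis by (simp add: e.FF_def)
        qed
        then show ?thesis using fun_cong[OF e.bianchi[of \<xi> \<eta> \<zeta> \<mu>], of \<alpha>] by (simp add: d algebra_simps)
      next
        case False
        then have "dk x (\<Phi> y z w) \<alpha> = 0" for x y z w by (intro dk_0) (auto simp: \<Phi>_def)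
        then show ?thesis by simp
      qed
    qed
    show "size \<alpha> \<noteq> n \<Longrightarrow> \<Phi> \<xi> \<eta> \<zeta> \<alpha> = 0" for \<xi> \<eta> \<zeta> \<alpha> by (simp add: \<Phi>_def)
    show "formal_on B (\<Phi> \<xi> \<eta> \<zeta>)" for \<xi> \<eta> \<zeta>
    proof -
      have s: "formal_on B (sec l x)" for x using f by (auto simp: formal_on_def sec_def const_def zero_prod_def)
      have d: "formal_on B (dd x (sec l y))" for x y
        by (intro formal_on_dv s biadd_sd) (simp add: restr_const formal_on_const)
      have A: "formal_on B (e.A x y z)" "formal_on B (e.T x y z)" for x y z
        unfolding e.A_def e.T_def by (intro formal_on_fprod s d biadd_pr biadd_br)+
      then have "formal_on B (e.F \<xi> \<eta> \<zeta>)" by (simp add: formal_on_def e.F_def)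
      then show ?thesis by (simp add: formal_on_def \<Phi>_def)
    qed
    \<comment> \<open>By \<open>F_Q\<close> the obstruction in degree 0 is the twisted phi on the
      annihilator of L.\<close>
    show "\<Phi> (Q \<xi>) (Q \<eta>) (Q \<zeta>) = 0" if "n = 0" for \<xi> \<eta> \<zeta>
      by (simp add: \<Phi>_def that fun_eq_iff F_Q[OF D] base)
    show "Dk (vf z) (\<Phi> \<xi> \<eta> \<zeta>) + \<Phi> (coad G z \<xi>) \<eta> \<zeta> + \<Phi> \<xi> (coad G z \<eta>) \<zeta> + \<Phi> \<xi> \<eta> (coad G z \<zeta>) = 0"
      if z: "z \<in> L" for z \<xi> \<eta> \<zeta>
    proof
      fix \<alpha>
      show "(Dk (vf z) (\<Phi> \<xi> \<eta> \<zeta>) + \<Phi> (coad G z \<xi>) \<eta> \<zeta> + \<Phi> \<xi> (coad G z \<eta>) \<zeta> + \<Phi> \<xi> \<eta> (coad G z \<zeta>)) \<alpha> = 0 \<alpha>"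
      proof (cases "size \<alpha> = n")
        case True
        have "Dk (vf z) (\<Phi> \<xi> \<eta> \<zeta>) \<alpha> = Dk (vf z) (- e.F \<xi> \<eta> \<zeta>) \<alpha>"
          by (rule Dk_vf_cong) (simp add: \<Phi>_def True)
        then have "(Dk (vf z) (\<Phi> \<xi> \<eta> \<zeta>) + \<Phi> (coad G z \<xi>) \<eta> \<zeta> + \<Phi> \<xi> (coad G z \<eta>) \<zeta> + \<Phi> \<xi> \<eta> (coad G z \<zeta>)) \<alpha> =
          - (Dk (vf z) (e.F \<xi> \<eta> \<zeta>) + e.F (coad G z \<xi>) \<eta> \<zeta> + e.F \<xi> (coad G z \<eta>) \<zeta> + e.F \<xi> \<eta> (coad G z \<zeta>)) \<alpha>"
          by (simp add: Dk_simps) (simp add: \<Phi>_def True)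
        then show ?thesis by (simp only: e.F_eqv[OF z]) simp
      next
        case False
        then have "Dk (vf z) (\<Phi> \<xi> \<eta> \<zeta>) \<alpha> = 0" by (intro Dk_vf_0) (auto simp: \<Phi>_def)
        then show ?thesis using False by simp (simp add: \<Phi>_def)
      qed
    qed
  qed blast
  have "\<exists>k. \<forall>\<zeta> \<alpha>. \<langle>\<zeta>, k \<alpha>\<rangle> = W \<eta> \<zeta> \<alpha>" for \<eta> using lin_vector[OF W(1)[of \<eta>]] by metis
  then obtain k where k: "\<And>\<eta> \<zeta> \<alpha>. \<langle>\<zeta>, k \<eta> \<alpha>\<rangle> = W \<eta> \<zeta> \<alpha>" by metis
  have W_left: "W (\<xi> + \<eta>) \<zeta> = W \<xi> \<zeta> + W \<eta> \<zeta>" "W (sh c \<xi>) \<zeta> \<alpha> = c * W \<xi> \<zeta> \<alpha>" for \<xi> \<eta> \<zeta> c \<alpha>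
    using W(1)[of \<zeta>] unfolding W(2)[of _ \<zeta>] by (simp_all add: lin_def linfam_def)
  define l' where "l' = (\<lambda>\<alpha> \<eta>. l \<alpha> \<eta> + k \<eta> \<alpha>)"
  have k0: "k \<eta> \<alpha> = 0" if "size \<alpha> \<noteq> Suc n" for \<eta> \<alpha>
    by (rule g_eqI) (simp add: k W(4)[OF that] pair_simps)
  have bf': "bf l' \<xi> \<eta> = bf l \<xi> \<eta> + W \<xi> \<eta>" for \<xi> \<eta>
    by (simp add: bf_def l'_def fun_eq_iff pair_simps k)
  have agree: "l' \<alpha> = l \<alpha>" if "size \<alpha> \<le> n" for \<alpha>
    using that by (simp add: l'_def k0)
  have lin_l: "Vector_Spaces.linear sh sg (l \<gamma>)" for \<gamma> using D by (simp add: sec_section_iff)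
  have D': "dyn_section G L M B (sec l')"
    unfolding sec_section_iff
  proof (intro allI linearI[OF vs_h vs_g] g_eqI)
    fix \<alpha> \<xi> \<eta> \<zeta> c
    show "\<langle>\<zeta>, l' \<alpha> (\<xi> + \<eta>)\<rangle> = \<langle>\<zeta>, l' \<alpha> \<xi> + l' \<alpha> \<eta>\<rangle>"
      by (simp add: l'_def pair_simps k W_left linear_add[OF lin_l])
    show "\<langle>\<zeta>, l' \<alpha> (sh c \<xi>)\<rangle> = \<langle>\<zeta>, sg c (l' \<alpha> \<xi>)\<rangle>"
      by (simp add: l'_def pair_simps pair_scale k W_left linear_scl[OF lin_l] algebra_simps)
  qed
  show ?thesis
  proof (rule that[of l'])
    show "dyn_eqv G L M B (sec l')" unfolding dyn_eqv_bf_iff[OF D']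
    proof (intro conjI allI ballI)
      show "bf l' \<zeta> \<xi> = - bf l' \<xi> \<zeta>" for \<xi> \<zeta>
        unfolding bf' bf_skew[OF E, of \<zeta>] W(2)[of \<zeta>] by simp
      fix z \<xi> \<zeta> assume z: "z \<in> L"
      have "Dk (vf z) (bf l' \<xi> \<zeta>) + bf l' (coad G z \<xi>) \<zeta> + bf l' \<xi> (coad G z \<zeta>) =
        (Dk (vf z) (bf l \<xi> \<zeta>) + bf l (coad G z \<xi>) \<zeta> + bf l \<xi> (coad G z \<zeta>)) +
        (Dk (vf z) (W \<xi> \<zeta>) + W (coad G z \<xi>) \<zeta> + W \<xi> (coad G z \<zeta>))"
        by (simp add: bf' Dk_simps add_ac)
      then show "Dk (vf z) (bf l' \<xi> \<zeta>) + bf l' (coad G z \<xi>) \<zeta> + bf l' \<xi> (coad G z \<zeta>) = 0"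
        by (simp only: bf_eqv[OF E z] W(6)[OF z]) simp
    qed
    show "formal_on B l'" unfolding formal_on_def
    proof (intro allI impI HOL.ext g_eqI)
      fix \<alpha> \<xi> \<zeta> assume "\<not> set_mset \<alpha> \<subseteq> B"
      then show "\<langle>\<zeta>, l' \<alpha> \<xi>\<rangle> = \<langle>\<zeta>, 0 \<xi>\<rangle>"
        using f W(3)[of \<xi> \<zeta>] by (simp add: formal_on_def l'_def pair_simps k)
    qed
    show "size \<alpha> \<le> n \<Longrightarrow> l' \<alpha> = l \<alpha>" for \<alpha> by (rule agree)
    show "dyn_section.F G B (sec l') \<xi> \<eta> \<zeta> \<alpha> = 0" if a: "size \<alpha> < Suc n" for \<xi> \<eta> \<zeta> \<alpha>
    proof -
      have "dyn_section.T G (sec l') \<xi> \<eta> \<zeta> \<alpha> = dyn_section.T G (sec l) \<xi> \<eta> \<zeta> \<alpha>"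
        by (rule T_sec_cong[OF D' D]) (use a agree in auto)
      then have "dyn_section.F G B (sec l') \<xi> \<eta> \<zeta> \<alpha> = e.F \<xi> \<eta> \<zeta> \<alpha> + (dk \<xi> (W \<eta> \<zeta>) + dk \<eta> (W \<zeta> \<xi>) + dk \<zeta> (W \<xi> \<eta>)) \<alpha>"
        unfolding F_bf[OF D'] F_bf[OF D] by (simp add: bf' Dk_simps)
      then show ?thesis unfolding W(5) using F[of \<alpha> \<xi> \<eta> \<zeta>] a by (cases "size \<alpha> = n") (auto simp: \<Phi>_def)
    qed
  qed
qed

text \<open>The construction starts from the constant map t, which is skew and invariant; stage 0
  requires nothing of F. Later stages leave lower coefficients, in particular the value at 0,
  unchanged, so they have a diagonal limit.\<close>

theorem ex_Dynl:
  assumes t: "t \<in> reduced_moduli G L M"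
  obtains l where "l \<in> Dynl G L B" "l {#} = t"
proof -
  have t_lin: "Vector_Spaces.linear sh sg t" and t_skew: "\<langle>\<xi>, t \<eta>\<rangle> = - \<langle>\<eta>, t \<xi>\<rangle>"
    and t_inv: "z \<in> L \<Longrightarrow> [z; t \<xi>] + t (coad G z \<xi>) = 0" for \<xi> \<eta> z
    using t unfolding reduced_moduli_def invariant_bivectors_def skew_maps_def by blast+
  have tw: "twisted_phi G t (Q \<xi>) (Q \<eta>) (Q \<zeta>) = 0" for \<xi> \<eta> \<zeta>
    using t by (simp add: reduced_moduli_def annihilator_L Q_simps)
  define R where "R = (\<lambda>n l. dyn_eqv G L M B (sec l) \<and> formal_on B l \<and> l {#} = t \<and>
    (\<forall>\<xi> \<eta> \<zeta> \<alpha>. size \<alpha> < n \<longrightarrow> dyn_section.F G B (sec l) \<xi> \<eta> \<zeta> \<alpha> = 0))"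
  have "\<exists>f. \<forall>n. R n (f n) \<and> (\<forall>\<alpha>. size \<alpha> \<le> n \<longrightarrow> f (Suc n) \<alpha> = f n \<alpha>)"
  proof (rule dependent_nat_choice)
    have z: "Vector_Spaces.linear sh sg 0" by (rule linearI[OF vs_h vs_g])
      (simp_all add: module.scale_zero_right[OF vs_g[folded module_iff_vector_space]])
    have D: "dyn_section G L M B (sec (const t))"
      using t_lin z by (simp add: sec_section_iff const_def)
    have b: "bf (const t) \<xi> \<zeta> = const \<langle>\<zeta>, t \<xi>\<rangle>" for \<xi> \<zeta>
      by (auto simp: bf_def const_def fun_eq_iff pair_simps)
    have "dyn_eqv G L M B (sec (const t))" unfolding dyn_eqv_bf_iff[OF D] b
    proof (intro conjI allI ballI)
      show "const \<langle>\<xi>, t \<zeta>\<rangle> = - const \<langle>\<zeta>, t \<xi>\<rangle>" for \<xi> \<zeta>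
        using t_skew[of \<xi> \<zeta>] by (simp add: const_def fun_eq_iff)
      fix z \<xi> \<zeta> assume z: "z \<in> L"
      have "\<langle>\<zeta>, [z; t \<xi>] + t (coad G z \<xi>)\<rangle> = 0" by (simp add: t_inv[OF z] pair_simps)
      then show "Dk (vf z) (const \<langle>\<zeta>, t \<xi>\<rangle>) + const \<langle>\<zeta>, t (coad G z \<xi>)\<rangle> + const \<langle>coad G z \<zeta>, t \<xi>\<rangle> = 0"
        by (simp add: Dk_simps) (simp add: const_def fun_eq_iff coad pair_simps add.commute)
    qed
    then have "R 0 (const t)" by (simp add: R_def formal_on_const) (simp add: const_def)
    then show "\<exists>x. R 0 x" by blast
    fix l n assume "R n l"
    then have *: "dyn_eqv G L M B (sec l)" "formal_on B l" "l {#} = t"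
      "\<And>\<xi> \<eta> \<zeta> \<alpha>. size \<alpha> < n \<Longrightarrow> dyn_section.F G B (sec l) \<xi> \<eta> \<zeta> \<alpha> = 0"
      by (auto simp: R_def)
    from Dynl_step[OF *(1,2,4), of n] tw *(3) obtain l' where "dyn_eqv G L M B (sec l')" "formal_on B l'"
      "\<And>\<xi> \<eta> \<zeta> \<alpha>. size \<alpha> < Suc n \<Longrightarrow> dyn_section.F G B (sec l') \<xi> \<eta> \<zeta> \<alpha> = 0"
      "\<And>\<alpha>. size \<alpha> \<le> n \<Longrightarrow> l' \<alpha> = l \<alpha>" by metis
    then show "\<exists>y. R (Suc n) y \<and> (\<forall>\<alpha>. size \<alpha> \<le> n \<longrightarrow> y \<alpha> = l \<alpha>)"
      using *(3) by (intro exI[of _ l']) (auto simp: R_def)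
  qed
  then obtain f where "\<forall>n. R n (f n) \<and> (\<forall>\<alpha>. size \<alpha> \<le> n \<longrightarrow> f (Suc n) \<alpha> = f n \<alpha>)" by blast
  then have f: "\<And>n. dyn_eqv G L M B (sec (f n))" "\<And>n. formal_on B (f n)" "\<And>n. f n {#} = t"
    "\<And>n \<xi> \<eta> \<zeta> \<alpha>. size \<alpha> < n \<Longrightarrow> dyn_section.F G B (sec (f n)) \<xi> \<eta> \<zeta> \<alpha> = 0"
    "\<And>n \<alpha>. size \<alpha> \<le> n \<Longrightarrow> f (Suc n) \<alpha> = f n \<alpha>"
    unfolding R_def by blast+
  define l where "l = (\<lambda>\<alpha>. f (size \<alpha>) \<alpha>)"
  have fl: "f n \<alpha> = l \<alpha>" if "size \<alpha> \<le> n" for n \<alpha>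
    using that by (induction n rule: dec_induct) (simp_all add: l_def f(5))
  have Df: "dyn_section G L M B (sec (f n))" for n using f(1)[of n] by (simp add: dyn_eqv_def)
  have D: "dyn_section G L M B (sec l)" using Df by (simp add: sec_section_iff l_def)
  have bl: "bf l \<xi> \<zeta> \<gamma> = bf (f n) \<xi> \<zeta> \<gamma>" if "size \<gamma> \<le> n" for n \<xi> \<zeta> \<gamma> by (simp add: bf_def fl[OF that])
  show ?thesis
  proof (rule that[of l])
    show "l {#} = t" by (simp add: l_def f(3))
    show "l \<in> Dynl G L B" unfolding Dynl_iff dyn_eqv_bf_iff[OF D]
    proof (intro conjI allI ballI)
      show "formal_on B l" using f(2) by (simp add: formal_on_def l_def)
      show "bf l \<zeta> \<xi> = - bf l \<xi> \<zeta>" for \<xi> \<zeta>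
      proof
        fix \<alpha> show "bf l \<zeta> \<xi> \<alpha> = (- bf l \<xi> \<zeta>) \<alpha>"
          using fun_cong[OF bf_skew[OF f(1)[of "size \<alpha>"], of \<zeta> \<xi>], of \<alpha>] by (simp add: bl[of _ "size \<alpha>"])
      qed
      show "Dk (vf z) (bf l \<xi> \<zeta>) + bf l (coad G z \<xi>) \<zeta> + bf l \<xi> (coad G z \<zeta>) = 0" if z: "z \<in> L" for z \<xi> \<zeta>
      proof
        fix \<alpha>
        have "Dk (vf z) (bf l \<xi> \<zeta>) \<alpha> = Dk (vf z) (bf (f (size \<alpha>)) \<xi> \<zeta>) \<alpha>" by (rule Dk_vf_cong) (simp add: bl)
        then show "(Dk (vf z) (bf l \<xi> \<zeta>) + bf l (coad G z \<xi>) \<zeta> + bf l \<xi> (coad G z \<zeta>)) \<alpha> = 0 \<alpha>"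
          using fun_cong[OF bf_eqv[OF f(1)[of "size \<alpha>"] z, of \<xi> \<zeta>], of \<alpha>] by (simp add: bl[of _ "size \<alpha>"])
      qed
      show "dyn_section.F G B (sec l) \<xi> \<eta> \<zeta> = 0" for \<xi> \<eta> \<zeta>
      proof
        fix \<alpha> :: "'g multiset"
        \<comment> \<open>F at \<alpha> contains first derivatives of l, hence coefficients of one
          degree more.\<close>
        let ?n = "Suc (size \<alpha>)"
        have d: "dk x (bf l y z) \<alpha> = dk x (bf (f ?n) y z) \<alpha>" for x y z by (rule dk_cong) (simp add: bl)
        have "dyn_section.T G (sec l) \<xi> \<eta> \<zeta> \<alpha> = dyn_section.T G (sec (f ?n)) \<xi> \<eta> \<zeta> \<alpha>"
          by (rule T_sec_cong[OF D Df]) (simp add: fl)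
        then have "dyn_section.F G B (sec l) \<xi> \<eta> \<zeta> \<alpha> = dyn_section.F G B (sec (f ?n)) \<xi> \<eta> \<zeta> \<alpha>"
          unfolding F_bf[OF D] F_bf[OF Df] by (simp add: d)
        then show "dyn_section.F G B (sec l) \<xi> \<eta> \<zeta> \<alpha> = 0 \<alpha>" by (simp add: f(4))
      qed
    qed
  qed
qed

section \<open>The moduli space\<close>

abbreviation gauge_rel where
  "gauge_rel \<equiv> {(l, l'). l \<in> Dynl G L B \<and> (\<exists>S\<in>gauge_maps G L B. l' = gauge_action G B l S)}"

text \<open>The component in \<open>\<And>\<^sup>2\<mm>\<close> of the value at 0.\<close>

definition mm :: "('g, 'h \<Rightarrow> 'g) formal_map \<Rightarrow> 'h \<Rightarrow> 'h \<Rightarrow> 'k" where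
  "mm l \<zeta> \<xi> = \<langle>Q \<zeta>, l {#} (Q \<xi>)\<rangle>"

lemma Dynl_linear: "l \<in> Dynl G L B \<Longrightarrow> Vector_Spaces.linear sh sg (l \<alpha>)"
  by (simp add: Dynl_def skew_maps_def)

text \<open>Invariance of \<open>mm\<close> gives one inclusion and \<open>gauge_equivalent\<close>
  the other. The classes are thus the level sets of \<open>mm\<close>, and the quotient is handled
  in that form from here on.\<close>

lemma gauge_class:
  assumes l: "l \<in> Dynl G L B"
  shows "gauge_rel `` {l} = {l' \<in> Dynl G L B. mm l' = mm l}"
proof (intro set_eqI iffI)
  fix l' assume "l' \<in> gauge_rel `` {l}"
  then obtain S where S: "S \<in> gauge_maps G L B" and l': "l' = gauge_action G B l S" by auto
  interpret gauge_dyn G L M B S l using S l by unfold_locales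
  have "mm l' = mm l" by (simp add: mm_def l' fun_eq_iff gauge_action_mm[of l S, OF l S_0])
  then show "l' \<in> {l' \<in> Dynl G L B. mm l' = mm l}" using gauge_action_Dynl by (simp add: l')
next
  fix l' assume "l' \<in> {l' \<in> Dynl G L B. mm l' = mm l}"
  then have l': "l' \<in> Dynl G L B" and "mm l' = mm l" by simp_all
  then have "\<langle>Q \<eta>, l {#} (Q \<xi>)\<rangle> = \<langle>Q \<eta>, l' {#} (Q \<xi>)\<rangle>" for \<xi> \<eta> by (simp add: mm_def fun_eq_iff)
  from gauge_equivalent[OF l l' this] obtain S where "S \<in> gauge_maps G L B" "gauge_action G B l S = l'" .
  then show "l' \<in> gauge_rel `` {l}" using l by auto
qed

lemma moduli_iff: "C \<in> moduli G L B \<longleftrightarrow> (\<exists>l\<in>Dynl G L B. C = {l' \<in> Dynl G L B. mm l' = mm l})"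
  unfolding moduli_def quotient_def using gauge_class by auto

lemma normalized_eqI:
  assumes "l \<in> Dynl G L B" "l' \<in> Dynl G L B" "normalized G L M l" "normalized G L M l'" "mm l = mm l'"
  shows "l {#} = l' {#}"
proof (intro HOL.ext g_eqI)
  fix \<xi> \<zeta>
  have "\<langle>\<zeta>, l {#} \<xi>\<rangle> = mm l \<zeta> \<xi>" "\<langle>\<zeta>, l' {#} \<xi>\<rangle> = mm l' \<zeta> \<xi>"
    using assms(3,4) unfolding normalized_iff[OF Dynl_linear[OF assms(1)]] normalized_iff[OF Dynl_linear[OF assms(2)]] mm_def by blast+
  then show "\<langle>\<zeta>, l {#} \<xi>\<rangle> = \<langle>\<zeta>, l' {#} \<xi>\<rangle>" by (simp add: assms(5))
qed

text \<open>Existence comes from \<open>ex_normalized\<close>. For uniqueness, a normalized value at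
  0 is determined by \<open>mm\<close>, which is constant on the class.\<close>

lemma moduli_normalized:
  assumes C: "C \<in> moduli G L B"
  obtains l where "l \<in> C" "l \<in> Dynl G L B" "normalized G L M l" "base_value G L M C = l {#}"
    "C = {l' \<in> Dynl G L B. mm l' = mm l}" "\<exists>!t. \<exists>l\<in>C. normalized G L M l \<and> t = l {#}"
proof -
  obtain l0 where l0: "l0 \<in> Dynl G L B" and C: "C = {l' \<in> Dynl G L B. mm l' = mm l0}"
    using C by (auto simp: moduli_iff)
  obtain S where S: "S \<in> gauge_maps G L B" and n: "normalized G L M (gauge_action G B l0 S)"
    using ex_normalized[OF l0] by blast
  define l where "l = gauge_action G B l0 S"
  have l: "l \<in> Dynl G L B" "mm l = mm l0" "normalized G L M l"
    using gauge_class[OF l0] S l0 n by (auto simp: l_def)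
  have u: "l' {#} = l {#}" if "l' \<in> C" "normalized G L M l'" for l'
    using that l by (intro normalized_eqI) (simp_all add: C)
  have lC: "l \<in> C" using l by (simp add: C)
  show ?thesis
  proof (rule that[of l])
    show "l \<in> C" by (rule lC)
    have ex: "\<exists>l'\<in>C. normalized G L M l' \<and> l {#} = l' {#}" using lC l(3) by blast
    have un: "t = l {#}" if "\<exists>l\<in>C. normalized G L M l \<and> t = l {#}" for t using that u by blast
    show "base_value G L M C = l {#}" unfolding base_value_def
      by (rule the_equality) (fact ex, fact un)
    show "C = {l' \<in> Dynl G L B. mm l' = mm l}" by (simp add: C l)
    show "\<exists>!t. \<exists>l\<in>C. normalized G L M l \<and> t = l {#}"
      by (rule ex1I) (fact ex, fact un)
  qed (rule l)+
qed

text \<open>The conditions on the value at 0 are the two equations at p = 0: the coadjoint field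
  vanishes there, which leaves invariance, and on the annihilator of L the derivative terms drop
  out, which leaves the twisted phi.\<close>

lemma normalized_reduced:
  assumes l: "l \<in> Dynl G L B" and n: "normalized G L M l"
  shows "l {#} \<in> reduced_moduli G L M"
proof -
  have E: "dyn_eqv G L M B (sec l)" and F: "dyn_section.F G B (sec l) \<xi> \<eta> \<zeta> = 0" for \<xi> \<eta> \<zeta>
    using l by (simp_all add: Dynl_iff)
  have inv: "[z; l {#} \<xi>] + l {#} (coad G z \<xi>) = 0" if z: "z \<in> L" for z \<xi>
  proof (rule g_eqI)
    fix \<zeta> show "\<langle>\<zeta>, [z; l {#} \<xi>] + l {#} (coad G z \<xi>)\<rangle> = \<langle>\<zeta>, 0\<rangle>"
      using fun_cong[OF bf_eqv[OF E z, of \<xi> \<zeta>], of "{#}"]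
      by (simp add: Dk_vf_empty bf_def coad pair_simps add.commute)
  qed
  have tw: "twisted_phi G (l {#}) (Q \<xi>) (Q \<eta>) (Q \<zeta>) = 0" for \<xi> \<eta> \<zeta>
    using F_Q[of l \<xi> \<eta> \<zeta>] E by (simp add: dyn_eqv_def F)
  have "twisted_phi G (l {#}) \<xi> \<eta> \<zeta> = 0"
    if "\<xi> \<in> annihilator G L" "\<eta> \<in> annihilator G L" "\<zeta> \<in> annihilator G L" for \<xi> \<eta> \<zeta>
    using that tw[of \<xi> \<eta> \<zeta>] by (simp only: annihilator_L)
  then show ?thesis
    using l n inv by (simp add: reduced_moduli_def invariant_bivectors_def normalized_def Dynl_def)
qed

text \<open>Injective because the base value determines \<open>mm\<close> and hence the class;
  surjective because a solution with value t at 0 is already normalized, by the conditions on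
  t.\<close>

lemma bij_base_value: "bij_betw (base_value G L M) (moduli G L B) (reduced_moduli G L M)"
proof (rule bij_betw_imageI)
  show "inj_on (base_value G L M) (moduli G L B)"
  proof (rule inj_onI)
    fix C C' assume C: "C \<in> moduli G L B" "C' \<in> moduli G L B" and eq: "base_value G L M C = base_value G L M C'"
    obtain l where l: "base_value G L M C = l {#}" "C = {l' \<in> Dynl G L B. mm l' = mm l}"
      by (rule moduli_normalized[OF C(1)]) (rule that; assumption)
    obtain l' where l': "base_value G L M C' = l' {#}" "C' = {l'' \<in> Dynl G L B. mm l'' = mm l'}"
      by (rule moduli_normalized[OF C(2)]) (rule that; assumption)
    have "mm l = mm l'" using eq l(1) l'(1) by (simp add: mm_def fun_eq_iff)
    then show "C = C'" by (simp add: l(2) l'(2))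
  qed
  show "base_value G L M ` moduli G L B = reduced_moduli G L M"
  proof (intro set_eqI iffI)
    fix t assume "t \<in> base_value G L M ` moduli G L B"
    then obtain C where C: "C \<in> moduli G L B" and t: "t = base_value G L M C" by blast
    show "t \<in> reduced_moduli G L M"
      by (rule moduli_normalized[OF C]) (simp only: t normalized_reduced)
  next
    fix t assume t: "t \<in> reduced_moduli G L M"
    obtain l where l: "l \<in> Dynl G L B" "l {#} = t" using ex_Dynl[OF t] by blast
    have n: "normalized G L M l"
      using t by (simp add: normalized_def l reduced_moduli_def invariant_bivectors_def)
    let ?C = "{l' \<in> Dynl G L B. mm l' = mm l}"
    have C: "?C \<in> moduli G L B" using l by (auto simp: moduli_iff)
    obtain l1 where l1: "l1 \<in> ?C" "normalized G L M l1" "base_value G L M ?C = l1 {#}"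
      by (rule moduli_normalized[OF C]) (rule that; assumption)
    have "l1 {#} = l {#}" using l1 l n by (intro normalized_eqI) auto
    then have "t = base_value G L M ?C" unfolding l1(3) l(2) by (rule sym)
    then show "t \<in> base_value G L M ` moduli G L B" using C by (rule image_eqI)
  qed
qed

end

theorem corollary6p7:
  fixes G :: "('k::{real_normed_field, euclidean_space},
               'g::ab_group_add, 'h::ab_group_add) quasi_bialgebra"
    and L M B :: "'g set"
  assumes "lie_quasi_bialgebra G"
    and "reductive_decomposition G L M"
    and "compatible G L M"
    and "basis_of G L B"
  shows "(\<forall>C\<in>moduli G L B. \<exists>!t. \<exists>l\<in>C. normalized G L M l \<and> t = l {#}) \<and>
         bij_betw (base_value G L M) (moduli G L B) (reduced_moduli G L M)"
proof -
  interpret red_qb G L M B using assms by unfold_locales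
  show ?thesis
  proof (intro conjI ballI bij_base_value)
    fix C assume C: "C \<in> moduli G L B"
    show "\<exists>!t. \<exists>l\<in>C. normalized G L M l \<and> t = l {#}" by (rule moduli_normalized[OF C])
  qed
qed

end
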